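(* Let $V$ be one of the spaces $L^p$ (for some $p\in[1,\infty]$), $B^\infty$ or $BV$. The integral difference equation $$X(t)+\sum_{k=1}^\infty A_kX(t-\tau_k)+\int_0^{\tau_*}N(s)X(t-s)\,ds=0\quad (t>0),\qquad X(t)=X_0(t)\quad(-\tau_*\le t\le 0)$$ is exponentially stable (in the state space $V([-\tau_*,0],\mathbb{R}^n)$) if and only if there exists $\nu_0>0$ such that all solutions $z\in\mathbb{C}$ of the characteristic equation $$\det\Big(I+\sum_{k=1}^\infty A_ke^{-\tau_kz}+\int_0^{\tau_*}N(s)e^{-sz}\,ds\Big)=0$$ satisfy $\mathrm{Re}(z)<-\nu_0$. Moreover, in that case, for all $0<\nu<\nu_0$ there exists $C\ge 1$ such that for all $X_0\in V([-\tau_*,0],\mathbb{R}^n)$, the solution $X$ satisfies, for all $t\ge 0$, $$\|X_t\|_V\le Ce^{-\nu t}\|X_0\|_V.$$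
   Context: Data: $n\ge 1$ is an integer, $\tau_*>0$; $(A_k)_{k\ge1}$ is a sequence of real $n\times n$ matrices with $\sum_{k\ge1}|A_k|<\infty$; $(\tau_k)_{k\ge1}$ is a strictly increasing sequence in $(0,\tau_*]$; $N\in L^1((0,\tau_* ),\mathbb{R}^{n\times n})$. $I$ is the $n\times n$ identity matrix and $|\cdot|$ is a matrix norm. Spaces: for $C\subset\mathbb{R}$ with nonempty interior, $V(C,\mathbb{R}^n)$ is one of the Banach spaces: (1) $L^p(C,\mathbb{R}^n)$, $p\in[1,\infty]$; (2) $B^\infty(C,\mathbb{R}^n)$, the Borel measurable bounded functions (defined pointwise everywhere) with the sup norm; (3) $BV(C,\mathbb{R}^n)$, the functions of bounded variation, with norm the sum of the total variation and the sup norm. Elements of $L^p$ and of $BV$ are identified when equal almost everywhere (the $BV$ norm being the infimum over representatives); elements of $B^\infty$ are not identified. Partial trajectory: $X_t(s):=X(t+s)$ for $s\in[-\tau_*,0]$, and $\|X_t\|_V$ is its norm in $V([-\tau_*,0],\mathbb{R}^n)$. Solution: given $X_0\in V([-\tau_*,0],\mathbb{R}^n)$, a function $X$ on $[-\tau_*,\infty)$ is a solution if $X_t\in V([-\tau_*,0],\mathbb{R}^n)$ for all $t\ge0$ and the equation together with the initial condition holds for all $t\ge-\tau_*$ when $V=B^\infty$, and for almost every $t$ when $V=BV$ or $V=L^p$. For each $X_0$ there is exactly one solution. Exponential stability: the equation is exponentially stable if there exist $\nu>0$ and $C\ge1$ such that for all $X_0\in V([-\tau_*,0],\mathbb{R}^n)$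 the solution satisfies $\|X_t\|_V\le Ce^{-\nu t}\|X_0\|_V$ for all $t\ge0$. *)

theory Defs
  imports "HOL-Analysis.Analysis" "HOL-Probability.Essential_Supremum"
begin

text \<open>The choice of the space $V$: the exponent of \<open>Lp\<close> ranges over $[1,\infty]$.\<close>

datatype state_space = Lp ereal | B_inf | BV

definition valid_state_space :: "state_space \<Rightarrow> bool" where
  "valid_state_space V \<longleftrightarrow> (case V of Lp p \<Rightarrow> 1 \<le> p | B_inf \<Rightarrow> True | BV \<Rightarrow> True)"

definition in_Lp :: "ereal \<Rightarrow> real set \<Rightarrow> (real \<Rightarrow> real ^ 'n) \<Rightarrow> bool" where
  "in_Lp p C f \<longleftrightarrow> f \<in> borel_measurable (lebesgue_on C) \<and>
     (if p = \<infinity> then esssup (lebesgue_on C) (\<lambda>x. ereal (norm (f x))) < \<infinity>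
      else integrable (lebesgue_on C) (\<lambda>x. norm (f x) powr real_of_ereal p))"

definition norm_Lp :: "ereal \<Rightarrow> real set \<Rightarrow> (real \<Rightarrow> real ^ 'n) \<Rightarrow> real" where
  "norm_Lp p C f =
     (if p = \<infinity> then real_of_ereal (esssup (lebesgue_on C) (\<lambda>x. ereal (norm (f x))))
      else (LINT x|lebesgue_on C. norm (f x) powr real_of_ereal p) powr (1 / real_of_ereal p))"

definition sup_norm :: "real set \<Rightarrow> (real \<Rightarrow> real ^ 'n) \<Rightarrow> real" where
  "sup_norm C f = (SUP x\<in>C. norm (f x))"

definition in_B_inf :: "real set \<Rightarrow> (real \<Rightarrow> real ^ 'n) \<Rightarrow> bool" where
  "in_B_inf C f \<longleftrightarrow> f \<in> borel_measurable (restrict_space borel C) \<and> bounded (f ` C)"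

definition variation_sums :: "real set \<Rightarrow> (real \<Rightarrow> real ^ 'n) \<Rightarrow> real set" where
  "variation_sums C f =
     {\<Sum>i<m. norm (f (t (Suc i)) - f (t i)) | (m :: nat) (t :: nat \<Rightarrow> real).
        (\<forall>i\<le>m. t i \<in> C) \<and> (\<forall>i<m. t i \<le> t (Suc i))}"

definition bounded_variation_on :: "real set \<Rightarrow> (real \<Rightarrow> real ^ 'n) \<Rightarrow> bool" where
  "bounded_variation_on C f \<longleftrightarrow> bdd_above (variation_sums C f)"

definition total_variation :: "real set \<Rightarrow> (real \<Rightarrow> real ^ 'n) \<Rightarrow> real" where
  "total_variation C f = Sup (variation_sums C f)"

text \<open>Elements of $BV$ are classes modulo equality almost everywhere, so a function belongs to
  the space as soon as its class contains a function of bounded variation.\<close>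

definition bv_representatives :: "real set \<Rightarrow> (real \<Rightarrow> real ^ 'n) \<Rightarrow> (real \<Rightarrow> real ^ 'n) set" where
  "bv_representatives C f =
     {g. bounded_variation_on C g \<and> (AE x in lebesgue_on C. g x = f x)}"

definition in_BV :: "real set \<Rightarrow> (real \<Rightarrow> real ^ 'n) \<Rightarrow> bool" where
  "in_BV C f \<longleftrightarrow> bv_representatives C f \<noteq> {}"

definition norm_BV :: "real set \<Rightarrow> (real \<Rightarrow> real ^ 'n) \<Rightarrow> real" where
  "norm_BV C f = (INF g\<in>bv_representatives C f. total_variation C g + sup_norm C g)"

fun in_V :: "state_space \<Rightarrow> real set \<Rightarrow> (real \<Rightarrow> real ^ 'n) \<Rightarrow> bool" where
  "in_V (Lp p) C f = in_Lp p C f"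
| "in_V B_inf C f = in_B_inf C f"
| "in_V BV C f = in_BV C f"

fun norm_V :: "state_space \<Rightarrow> real set \<Rightarrow> (real \<Rightarrow> real ^ 'n) \<Rightarrow> real" where
  "norm_V (Lp p) C f = norm_Lp p C f"
| "norm_V B_inf C f = sup_norm C f"
| "norm_V BV C f = norm_BV C f"

definition partial_trajectory :: "(real \<Rightarrow> real ^ 'n) \<Rightarrow> real \<Rightarrow> real \<Rightarrow> real ^ 'n" where
  "partial_trajectory X t = (\<lambda>s. X (t + s))"

text \<open>Sequences indexed by $k \ge 1$ are re-indexed from \<open>0\<close>.  If all partial trajectories
  of \<open>X\<close> lie in $V$, the series and the integral below converge absolutely for almost every
  \<open>t > 0\<close> (for every \<open>t > 0\<close> in the case of $B^\infty$), so the default values of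
  divergent series and integrals play no role.\<close>

definition equation_at ::
  "real \<Rightarrow> (nat \<Rightarrow> real ^ 'n ^ 'n) \<Rightarrow> (nat \<Rightarrow> real) \<Rightarrow> (real \<Rightarrow> real ^ 'n ^ 'n) \<Rightarrow>
   (real \<Rightarrow> real ^ 'n) \<Rightarrow> (real \<Rightarrow> real ^ 'n) \<Rightarrow> real \<Rightarrow> bool" where
  "equation_at \<tau>max A \<tau> N X0 X t \<longleftrightarrow>
     (0 < t \<longrightarrow> X t + (\<Sum>k. A k *v X (t - \<tau> k))
                 + (LINT s:{0<..<\<tau>max}|lebesgue. N s *v X (t - s)) = 0) \<and>
     (- \<tau>max \<le> t \<and> t \<le> 0 \<longrightarrow> X t = X0 t)"

text \<open>Only the values of \<open>X\<close> on $[-\tau_*,\infty)$ and of \<open>X0\<close> on $[-\tau_*,0]$ matter.\<close>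

definition is_solution ::
  "state_space \<Rightarrow> real \<Rightarrow> (nat \<Rightarrow> real ^ 'n ^ 'n) \<Rightarrow> (nat \<Rightarrow> real) \<Rightarrow> (real \<Rightarrow> real ^ 'n ^ 'n) \<Rightarrow>
   (real \<Rightarrow> real ^ 'n) \<Rightarrow> (real \<Rightarrow> real ^ 'n) \<Rightarrow> bool" where
  "is_solution V \<tau>max A \<tau> N X0 X \<longleftrightarrow>
     (\<forall>t\<ge>0. in_V V {-\<tau>max..0} (partial_trajectory X t)) \<and>
     (if V = B_inf then \<forall>t\<ge>-\<tau>max. equation_at \<tau>max A \<tau> N X0 X t
      else AE t in lebesgue_on {-\<tau>max..}. equation_at \<tau>max A \<tau> N X0 X t)"

definition decay_estimate ::
  "state_space \<Rightarrow> real \<Rightarrow> (nat \<Rightarrow> real ^ 'n ^ 'n) \<Rightarrow> (nat \<Rightarrow> real) \<Rightarrow> (real \<Rightarrow> real ^ 'n ^ 'n) \<Rightarrow>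
   real \<Rightarrow> real \<Rightarrow> bool" where
  "decay_estimate V \<tau>max A \<tau> N \<nu> C \<longleftrightarrow>
     (\<forall>X0 X. in_V V {-\<tau>max..0} X0 \<longrightarrow> is_solution V \<tau>max A \<tau> N X0 X \<longrightarrow>
        (\<forall>t\<ge>0. norm_V V {-\<tau>max..0} (partial_trajectory X t)
                 \<le> C * exp (- \<nu> * t) * norm_V V {-\<tau>max..0} X0))"

definition exponentially_stable ::
  "state_space \<Rightarrow> real \<Rightarrow> (nat \<Rightarrow> real ^ 'n ^ 'n) \<Rightarrow> (nat \<Rightarrow> real) \<Rightarrow> (real \<Rightarrow> real ^ 'n ^ 'n) \<Rightarrow> bool"
  where
  "exponentially_stable V \<tau>max A \<tau> N \<longleftrightarrow> (\<exists>\<nu>>0. \<exists>C\<ge>1. decay_estimate V \<tau>max A \<tau> N \<nu> C)"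

definition cscale :: "complex \<Rightarrow> real ^ 'n ^ 'n \<Rightarrow> complex ^ 'n ^ 'n" where
  "cscale c M = (\<chi> i j. c * complex_of_real (M $ i $ j))"

definition char_matrix ::
  "real \<Rightarrow> (nat \<Rightarrow> real ^ 'n ^ 'n) \<Rightarrow> (nat \<Rightarrow> real) \<Rightarrow> (real \<Rightarrow> real ^ 'n ^ 'n) \<Rightarrow> complex \<Rightarrow>
   complex ^ 'n ^ 'n" where
  "char_matrix \<tau>max A \<tau> N z =
     mat 1 + (\<Sum>k. cscale (exp (- of_real (\<tau> k) * z)) (A k))
           + (LINT s:{0<..<\<tau>max}|lebesgue. cscale (exp (- of_real s * z)) (N s))"

end

theory Submission
  imports Defs "HOL-Probability.Probability" "HOL-Complex_Analysis.Complex_Analysis"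
    "HOL-Analysis.Kronecker_Approximation_Theorem"
begin

text \<open>
  The characteristic matrix is $I + \hat\mu(z)$, where $\mu$ is the matrix of finite signed measures
  $\sum_k A_k \delta_{\tau_k} + N(s)\,ds$ on $(0,\tau_*]$ and $\hat\mu$ is its Laplace transform; the
  equation itself reads $X + \mu * X = 0$.  Stability therefore amounts to inverting $I + \hat\mu$
  within an algebra of measures with an exponential weight.

  \<^bold>\<open>From the zeros to decay.\<close>  Suppose that $d(z) = \det(I + \hat\mu(z))$ has no zero with
  $\mathrm{Re}(z) \ge -\nu_0$, and let $\nu < \nu_0$.  A Wiener-Pitt type theorem (\<open>LS_inverse_det\<close>)
  shows that $1/d$ is again the transform of a measure on $[0,\infty)$ that integrates
  $e^{\nu t}$.  There are two points.  First, $|d|$ is bounded below on $\mathrm{Re}(z) \ge -\nu$: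
  vertical translates of $d$ form a normal family, so if $d$ came close to $0$ along a sequence, a
  limit of translates would have a zero, and by Hurwitz' theorem so would $d$
  (\<open>half_plane_lower_bound\<close>).  Secondly, the lower bound is turned into a bound on measures.
  Up to a small error $\mu$ is a finite sum of point masses plus a measure whose transform is
  $O(1/(1+|z|^2))$.  The almost periodic determinant $D$ of the finite sum inherits the lower bound
  (\<open>discrete_part_lower_bound\<close>).  The powers of $1/D$ have a countable set of exponents, all in the
  semigroup generated by finitely many delays, and their coefficients are controlled by a mean value
  argument (\<open>LS_discrete\<close>); the remaining part has an integrable transform and is inverted by a
  contour integral (\<open>LS_inverse_Laplace\<close>).  Because the constants obtained for the $j$-th power grow
  only like $(1+j)\delta^{-j}$ (\<open>LS_inverse_power\<close>), a Neumann series absorbs the small error.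
  Cramer's rule then gives a matrix $\kappa$ of measures with $\kappa + \kappa * \mu = \delta_0 I$
  (\<open>resolvent_exists\<close>).

  Convolving the equation with $\kappa$ expresses a solution at positive times through its initial
  data alone: $X = \kappa * F$, where $F$ vanishes outside $(0,\tau_*]$ and is, up to sign, the convolution of
  $\mu$ with $X_0$ there.  As $\kappa$ integrates $e^{\nu t}$, this gives exponential decay at rate $\nu$
  in each of the spaces: $|X|$ is dominated by a convolution of $|X_0|$ with a
  positive measure, which settles $L^p$ (Jensen's inequality) and $B^\infty$; for $BV$ the formula itself
  provides a representative whose variation is estimated.

  \<^bold>\<open>From decay to the zeros.\<close>  If $(I + \hat\mu(z))v = 0$ with $v \ne 0$, then
  $\mathrm{Re}(e^{zt}v)$ is a solution lying in all the spaces, and sampled at the periods of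
  $e^{i\,\mathrm{Im}(z)t}$ it is multiplied by the powers of a fixed number.  A decay rate $\nu$ hence forces
  $\mathrm{Re}(z) \le -\nu$ (\<open>decay_rate_bounds_zeros\<close>).
\<close>

section \<open>Weighted measures as laws of a delay and a weight\<close>

text \<open>The abbreviations \<open>eexp\<close> and \<open>lap\<close> are the two test functions that matter below: the exponential weight and the Laplace kernel.\<close>

abbreviation borel_fun :: "('a::topological_space => 'b::topological_space) set" where
  "borel_fun \<equiv> borel_measurable borel"

abbreviation enorm :: "'a::real_normed_vector => ennreal" where
  "enorm x \<equiv> ennreal (norm x)"

abbreviation eexp :: "real => real => ennreal" where
  "eexp \<nu> \<equiv> (\<lambda>t. ennreal (exp (\<nu> * t)))"

abbreviation lap :: "complex => real => complex" where
  "lap z \<equiv> (\<lambda>t. exp (- (z * of_real t)))"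

text \<open>A complex measure on the line is encoded by a probability measure on pairs (time, weight): its value
  on $\varphi$ is the expectation of weight times $\varphi$(time).  The predicate \<open>law\<close> is closed
  under convolution and superposition, so that algebra with measures becomes algebra with
  random variables, and Fubini's theorem for probability measures suffices.
  The functional \<open>absint\<close> integrates against the total mass of the weights; since opposite weights may cancel, it
  only dominates the total variation of the measure that is represented.\<close>

definition absint :: "(real \<times> complex) measure => (real => ennreal) => ennreal" where
  "absint M \<phi> = (\<integral>\<^sup>+x. enorm (snd x) * \<phi> (fst x) \<partial>M)"

definition pairing :: "(real \<times> complex) measure => (real => complex) => complex" where
  "pairing M \<phi> = (\<integral>x. snd x * \<phi> (fst x) \<partial>M)"

definition law :: "real set => (real \<times> complex) measure => bool" where
  "law S M \<longleftrightarrow> prob_space M \<and> sets M = sets borel \<and> S \<in> sets borel \<and> (AE x in M. fst x \<in> S)"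

lemma meas_snd_fst [measurable]:
  "(%x. fst x) \<in> borel_measurable (borel :: (real \<times> complex) measure)"
  "(%x. snd x) \<in> borel_measurable (borel :: (real \<times> complex) measure)"
  by (rule borel_measurable_continuous_onI, intro continuous_intros)+

lemma law_meas: "law S M ==> f \<in> borel_fun ==> f \<in> borel_measurable M"
  unfolding law_def using measurable_cong_sets by blast

lemma pairing_integrable:
  assumes "law S M" "\<phi> \<in> borel_fun" "absint M (%t. enorm (\<phi> t)) < \<infinity>"
  shows "integrable M (%x. snd x * \<phi> (fst x))"
proof -
  have m: "(%x. snd x * \<phi> (fst x)) \<in> borel_measurable M"
    by (rule law_meas[OF assms(1)]) (use assms(2) in measurable)
  show ?thesis
    by (rule integrableI_bounded[OF m])
      (use assms(3) in \<open>simp add: absint_def norm_mult ennreal_mult'\<close>)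
qed

lemma norm_pairing_le:
  assumes "law S M" "\<phi> \<in> borel_fun"
  shows "enorm (pairing M \<phi>) \<le> absint M (%t. enorm (\<phi> t))"
proof (cases "integrable M (%x. snd x * \<phi> (fst x))")
  case True
  then show ?thesis unfolding pairing_def absint_def
    using integral_norm_bound_ennreal[OF True] by (simp add: norm_mult ennreal_mult')
next
  case False
  then show ?thesis by (simp add: pairing_def not_integrable_integral_eq)
qed

lemma law_from_rv:
  fixes T :: "'a => real" and W :: "'a => complex"
  assumes "prob_space M" and T: "T \<in> borel_measurable M" and W: "W \<in> borel_measurable M"
    and S: "S \<in> sets borel" "AE x in M. T x \<in> S"
  obtains L where "law S L"
    "\<And>\<phi>. \<phi> \<in> borel_fun ==> absint L \<phi> = (\<integral>\<^sup>+x. enorm (W x) * \<phi> (T x) \<partial>M)"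
    "\<And>\<phi>. \<phi> \<in> borel_fun ==> pairing L \<phi> = (\<integral>x. W x * \<phi> (T x) \<partial>M)"
proof
  interpret prob_space M by fact
  have TW[measurable]: "(%x. (T x, W x)) \<in> M \<rightarrow>\<^sub>M borel" using T W by (rule borel_measurable_Pair)
  let ?L = "distr M borel (%x. (T x, W x))"
  have "AE x in ?L. fst x \<in> S"
    using S by (subst AE_distr_iff) (auto intro!: measurable_sets)
  then show "law S ?L"
    unfolding law_def using S by (auto intro: prob_space_distr)
  show "absint ?L \<phi> = (\<integral>\<^sup>+x. enorm (W x) * \<phi> (T x) \<partial>M)" 
    if [measurable]: "\<phi> \<in> borel_fun" for \<phi>
    unfolding absint_def by (subst nn_integral_distr) auto
  show "pairing ?L \<phi> = (\<integral>x. W x * \<phi> (T x) \<partial>M)" if [measurable]: "\<phi> \<in> borel_fun" for \<phi>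
    unfolding pairing_def by (subst integral_distr) auto
qed

text \<open>Convolution: delays add and weights multiply for an independent pair.\<close>

lemma law_prod:
  assumes M1: "law S1 M1" and M2: "law S2 M2" and S: "S \<in> sets borel" "\<And>s t. s \<in> S1 ==> t \<in> S2 ==> s + t \<in> S"
  obtains L where "law S L"
    "\<And>\<phi>. \<phi> \<in> borel_fun ==> absint L \<phi> = absint M1 (%s. absint M2 (%t. \<phi> (s + t)))"
    "\<And>\<phi>. \<phi> \<in> borel_fun ==> absint L (%t. enorm (\<phi> t)) < \<infinity> ==>
       pairing L \<phi> = pairing M1 (%s. pairing M2 (%t. \<phi> (s + t)))"
proof -
  interpret M1: prob_space M1 using M1 by (simp add: law_def)
  interpret M2: prob_space M2 using M2 by (simp add: law_def)
  interpret P: pair_prob_space M1 M2 ..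
  have s[measurable_cong]: "sets M1 = sets borel" "sets M2 = sets borel" using M1 M2 by (auto simp: law_def)
  have AE2: "AE y in M2. fst y \<in> S2" and AE1: "AE y in M1. fst y \<in> S1" and [measurable]: "S2 \<in> sets borel" "S1 \<in> sets borel"
    using M1 M2 by (auto simp: law_def)
  have "AE x in M1 \<Otimes>\<^sub>M M2. fst (fst x) \<in> S1"
    by (rule P.AE_pair_measure) (use AE1 in auto)
  moreover have "AE x in M1 \<Otimes>\<^sub>M M2. fst (snd x) \<in> S2"
    by (rule P.AE_pair_measure) (use AE2 in auto)
  ultimately have AEs: "AE x in M1 \<Otimes>\<^sub>M M2. fst (fst x) + fst (snd x) \<in> S"
    by eventually_elim (use S in auto)
  obtain L where L: "law S L"
    "\<And>\<phi>. \<phi> \<in> borel_fun ==> absint L \<phi> = 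
      (\<integral>\<^sup>+x. enorm (snd (fst x) * snd (snd x)) * \<phi> (fst (fst x) + fst (snd x)) \<partial>(M1 \<Otimes>\<^sub>M M2))"
    "\<And>\<phi>. \<phi> \<in> borel_fun ==> pairing L \<phi> = 
      (\<integral>x. snd (fst x) * snd (snd x) * \<phi> (fst (fst x) + fst (snd x)) \<partial>(M1 \<Otimes>\<^sub>M M2))"
    by (rule law_from_rv[OF P.prob_space_axioms _ _ S(1) AEs, where W = "%x. snd (fst x) * snd (snd x)"]) measurable
  have a: "absint L \<phi> = absint M1 (%s. absint M2 (%t. \<phi> (s + t)))" if [measurable]: "\<phi> \<in> borel_fun" for \<phi>
  proof -
    have m1: "(%x. enorm (snd (fst x) * snd (snd x)) * \<phi> (fst (fst x) + fst (snd x))) \<in> borel_measurable (M1 \<Otimes>\<^sub>M M2)"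
      by measurable
    have m2: "(%y. enorm (snd y) * \<phi> (s + fst y)) \<in> borel_measurable M2" for s
      by measurable
    have "enorm (snd x) * (\<integral>\<^sup>+y. enorm (snd y) * \<phi> (fst x + fst y) \<partial>M2)
       = (\<integral>\<^sup>+y. enorm (snd x * snd y) * \<phi> (fst x + fst y) \<partial>M2)" for x :: "real \<times> complex"
      by (subst nn_integral_cmult[OF m2, symmetric]) (simp add: norm_mult ennreal_mult' mult.assoc)
    then show ?thesis
      unfolding L(2)[OF that] absint_def[of M1] absint_def[of M2] M2.nn_integral_fst[OF m1, symmetric] by simp
  qed
  show thesis
  proof (rule that[OF L(1) a])
    fix \<phi> :: "real => complex" assume m[measurable]: "\<phi> \<in> borel_fun" and fin: "absint L (%t. enorm (\<phi> t)) < \<infinity>"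
    have i: "integrable (M1 \<Otimes>\<^sub>M M2) (%x. snd (fst x) * snd (snd x) * \<phi> (fst (fst x) + fst (snd x)))"
      using fin by (intro integrableI_bounded) (auto simp: L(2) norm_mult ennreal_mult')
    have "pairing L \<phi> = (\<integral>x. \<integral>y. snd x * snd y * \<phi> (fst x + fst y) \<partial>M2 \<partial>M1)"
      unfolding L(3)[OF m] using P.integral_fst'[OF i] by simp
    also have "\<dots> = pairing M1 (%s. pairing M2 (%t. \<phi> (s + t)))"
      unfolding pairing_def by (simp add: mult.assoc)
    finally show "pairing L \<phi> = pairing M1 (%s. pairing M2 (%t. \<phi> (s + t)))" .
  qed auto
qed

text \<open>A countable sum of measures is encoded by drawing an index from a geometric distribution and, independently, one
  sample from each of the laws; the selected weight is divided by the probability of its index.\<close>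

lemma law_mixture:
  fixes M :: "nat => (real \<times> complex) measure"
  assumes M: "\<And>i. law S (M i)"
  obtains L where "law S L"
    "\<And>\<phi>. \<phi> \<in> borel_fun ==> absint L \<phi> = (\<Sum>i. absint (M i) \<phi>)"
    "\<And>\<phi>. \<phi> \<in> borel_fun ==> (\<Sum>i. absint (M i) (%t. enorm (\<phi> t))) < \<infinity> ==>
       (%i. pairing (M i) \<phi>) sums pairing L \<phi>"
proof -
  define p :: "nat => real" where "p = pmf (geometric_pmf (1/2))"
  have p: "p i > 0" for i by (simp add: p_def)
  define Q where "Q = measure_pmf (geometric_pmf (1/2))"
  define R where "R = PiM UNIV M"
  have pM: "prob_space (M i)" for i using M by (auto simp: law_def)
  interpret Q: prob_space Q unfolding Q_def by unfold_locales
  interpret R: prob_space R unfolding R_def by (rule prob_space_PiM) (rule pM)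
  interpret P: pair_prob_space Q R ..
  have [measurable_cong]: "sets Q = sets (count_space UNIV)" by (simp add: Q_def)
  have s[measurable_cong]: "sets (M i) = sets borel" for i using M by (auto simp: law_def)
  have c: "(%\<omega>. \<omega> i) \<in> R \<rightarrow>\<^sub>M borel" for i
    using measurable_component_singleton[of i UNIV M] by (simp add: R_def cong: measurable_cong_sets)
  have e[measurable]: "(%x. snd x (fst x)) \<in> Q \<Otimes>\<^sub>M R \<rightarrow>\<^sub>M borel"
  proof -
    have "(%x. (%i x. snd x i) (fst x) x) \<in> Q \<Otimes>\<^sub>M R \<rightarrow>\<^sub>M borel"
      by (rule measurable_compose_countable) (use c in measurable)
    then show ?thesis by simp
  qed
  have pmeas[measurable]: "(%x. complex_of_real (p (fst x))) \<in> Q \<Otimes>\<^sub>M R \<rightarrow>\<^sub>M borel" 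
    by measurable
  have marg: "distr R (M i) (%\<omega>. \<omega> i) = M i" for i
    unfolding R_def by (rule distr_PiM_component) (auto intro: pM)
  have cM: "(%\<omega>. \<omega> i) \<in> R \<rightarrow>\<^sub>M M i" for i using c by (simp cong: measurable_cong_sets)
  have nn: "(\<integral>\<^sup>+\<omega>. f (\<omega> i) \<partial>R) = (\<integral>\<^sup>+x. f x \<partial>M i)" if "f \<in> borel_fun" for f i
  proof -
    have "(\<integral>\<^sup>+x. f x \<partial>M i) = (\<integral>\<^sup>+x. f x \<partial>distr R (M i) (%\<omega>. \<omega> i))" by (simp add: marg)
    also have "\<dots> = (\<integral>\<^sup>+\<omega>. f (\<omega> i) \<partial>R)"
      by (rule nn_integral_distr[OF cM]) (use that in measurable)
    finally show ?thesis by simp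
  qed
  have ic: "(\<integral>\<omega>. f (\<omega> i) \<partial>R) = (\<integral>x. f x \<partial>M i)" if "f \<in> borel_fun" for f :: "_ => complex" and i
  proof -
    have "(\<integral>x. f x \<partial>M i) = (\<integral>x. f x \<partial>distr R (M i) (%\<omega>. \<omega> i))" by (simp add: marg)
    also have "\<dots> = (\<integral>\<omega>. f (\<omega> i) \<partial>R)"
      by (rule integral_distr[OF cM]) (use that in measurable)
    finally show ?thesis by simp
  qed
  have S: "S \<in> sets borel" using M by (auto simp: law_def)
  have AEs: "AE x in Q \<Otimes>\<^sub>M R. fst (snd x (fst x)) \<in> S"
  proof (rule P.AE_pair_measure)
    show "{x \<in> space (Q \<Otimes>\<^sub>M R). fst (snd x (fst x)) \<in> S} \<in> sets (Q \<Otimes>\<^sub>M R)"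
      using S by measurable
    have "AE \<omega> in R. fst (\<omega> i) \<in> S" for i
    proof -
      have "AE x in distr R (M i) (%\<omega>. \<omega> i). fst x \<in> S" unfolding marg using M[of i] by (simp add: law_def)
      then show ?thesis by (subst (asm) AE_distr_iff[OF cM]) (use S in measurable)
    qed
    then show "AE x in Q. AE y in R. fst (snd (x, y) (fst (x, y))) \<in> S" by simp
  qed
  obtain L where L: "law S L"
    "\<And>\<phi>. \<phi> \<in> borel_fun ==> absint L \<phi> = 
      (\<integral>\<^sup>+x. enorm (snd (snd x (fst x)) / p (fst x)) * \<phi> (fst (snd x (fst x))) \<partial>(Q \<Otimes>\<^sub>M R))"
    "\<And>\<phi>. \<phi> \<in> borel_fun ==> pairing L \<phi> = 
      (\<integral>x. snd (snd x (fst x)) / p (fst x) * \<phi> (fst (snd x (fst x))) \<partial>(Q \<Otimes>\<^sub>M R))"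
    by (rule law_from_rv[OF P.prob_space_axioms _ _ S AEs, where W = "%x. snd (snd x (fst x)) / p (fst x)"]) measurable
  have a: "absint L \<phi> = (\<Sum>i. absint (M i) \<phi>)" if [measurable]: "\<phi> \<in> borel_fun" for \<phi>
  proof -
    have "absint L \<phi> = (\<integral>\<^sup>+i. \<integral>\<^sup>+\<omega>. enorm (snd (\<omega> i) / p i) * \<phi> (fst (\<omega> i)) \<partial>R \<partial>Q)"
    proof -
      have m1: "(%x. enorm (snd (snd x (fst x)) / p (fst x)) * \<phi> (fst (snd x (fst x)))) \<in> borel_measurable (Q \<Otimes>\<^sub>M R)"
        by measurable
      show ?thesis unfolding L(2)[OF that] R.nn_integral_fst[OF m1, symmetric] by simp
    qed
    also have "\<dots> = (\<integral>\<^sup>+i. \<integral>\<^sup>+x. enorm (snd x / p i) * \<phi> (fst x) \<partial>M i \<partial>Q)"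
      by (intro nn_integral_cong nn) measurable
    also have "\<dots> = (\<integral>\<^sup>+i. ennreal (1 / p i) * absint (M i) \<phi> \<partial>Q)"
      unfolding absint_def using p
      by (intro nn_integral_cong) (subst nn_integral_cmult[symmetric], measurable, 
        simp add: norm_divide ennreal_mult'[symmetric] mult.assoc[symmetric] less_imp_le)
    also have "\<dots> = (\<integral>\<^sup>+i. absint (M i) \<phi> \<partial>count_space UNIV)"
      unfolding Q_def nn_integral_measure_pmf p_def[symmetric] using p
      by (intro nn_integral_cong) (simp add: mult.assoc[symmetric] ennreal_mult'[symmetric] less_imp_le less_imp_neq[symmetric])
    finally show ?thesis by (simp add: nn_integral_count_space_nat)
  qed
  show thesis
  proof (rule that[OF L(1) a])
    fix \<phi> :: "real => complex" assume m[measurable]: "\<phi> \<in> borel_fun" 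
      and fin: "(\<Sum>i. absint (M i) (%t. enorm (\<phi> t))) < \<infinity>"
    have fin': "absint L (%t. enorm (\<phi> t)) < \<infinity>" using fin by (simp add: a)
    have i: "integrable (Q \<Otimes>\<^sub>M R) (%x. snd (snd x (fst x)) / p (fst x) * \<phi> (fst (snd x (fst x))))"
      using fin' by (intro integrableI_bounded) (auto simp: L(2) norm_mult ennreal_mult' simp del: times_divide_eq_left)
    have eq: "(\<integral>\<omega>. snd (\<omega> i) / p i * \<phi> (fst (\<omega> i)) \<partial>R) = pairing (M i) \<phi> / p i" for i
      unfolding pairing_def by (subst ic) (auto simp flip: integral_divide_zero intro!: Bochner_Integration.integral_cong)
    have "integrable Q (%i. \<integral>\<omega>. snd (\<omega> i) / p i * \<phi> (fst (\<omega> i)) \<partial>R)"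
      using P.integrable_fst'[OF i] by simp
    then have iQ: "integrable Q (%i. pairing (M i) \<phi> / p i)" unfolding eq .
    have "pairing L \<phi> = (\<integral>i. \<integral>\<omega>. snd (\<omega> i) / p i * \<phi> (fst (\<omega> i)) \<partial>R \<partial>Q)"
      unfolding L(3)[OF m] using P.integral_fst'[OF i] by simp
    also have "\<dots> = (\<integral>i. pairing (M i) \<phi> / p i \<partial>Q)" unfolding eq ..
    also have "\<dots> = (\<integral>i. p i *\<^sub>R (pairing (M i) \<phi> / p i) \<partial>count_space UNIV)"
      unfolding Q_def measure_pmf_eq_density p_def by (subst integral_density) auto
    also have "\<dots> = (\<integral>i. pairing (M i) \<phi> \<partial>count_space UNIV)"
      using p by (intro Bochner_Integration.integral_cong) (auto simp: scaleR_conv_of_real less_imp_neq[symmetric])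
    finally have 1: "pairing L \<phi> = (\<integral>i. pairing (M i) \<phi> \<partial>count_space UNIV)" .
    have "integrable (count_space UNIV) (%i. p i *\<^sub>R (pairing (M i) \<phi> / p i))"
      using iQ unfolding Q_def measure_pmf_eq_density p_def by (subst (asm) integrable_density) auto
    then have "integrable (count_space UNIV) (%i. pairing (M i) \<phi>)"
      by (rule Bochner_Integration.integrable_cong[THEN iffD1, rotated 2]) 
        (use p in \<open>auto simp: scaleR_conv_of_real less_imp_neq[symmetric]\<close>)
    from sums_integral_count_space_nat[OF this] 1
    show "(%i. pairing (M i) \<phi>) sums pairing L \<phi>" by simp
  qed auto
qed

lemma law_dirac:
  assumes "lam \<in> S" "S \<in> sets borel"
  obtains L where "law S L"
    "\<And>\<phi>. \<phi> \<in> borel_fun ==> absint L \<phi> = enorm c * \<phi> lam"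
    "\<And>\<phi>. \<phi> \<in> borel_fun ==> pairing L \<phi> = c * \<phi> lam"
proof -
  interpret prob_space "return borel (0::real)" by (rule prob_space_return) simp
  obtain L where L: "law S L" 
    "\<And>\<phi>. \<phi> \<in> borel_fun ==> absint L \<phi> = (\<integral>\<^sup>+x. enorm c * \<phi> lam \<partial>return borel (0::real))"
    "\<And>\<phi>. \<phi> \<in> borel_fun ==> pairing L \<phi> = (\<integral>x. c * \<phi> lam \<partial>return borel (0::real))"
    by (rule law_from_rv[of "return borel (0::real)" "%_. lam" "%_. c" S])
      (use assms in \<open>auto intro: prob_space_return\<close>)
  show thesis using that[of L] L prob_space by (simp add: emeasure_space_1[simplified])
qed

lemma law_density:
  fixes h :: "real => complex"
  assumes h[measurable]: "h \<in> borel_fun" and S: "S \<in> sets borel" "S \<noteq> {}"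
    and h0: "\<And>t. t \<notin> S ==> h t = 0"
  obtains L where "law S L"
    "\<And>\<phi>. \<phi> \<in> borel_fun ==> absint L \<phi> = (\<integral>\<^sup>+t. enorm (h t) * \<phi> t \<partial>lborel)"
    "\<And>\<phi>. \<phi> \<in> borel_fun ==> pairing L \<phi> = (\<integral>t. h t * \<phi> t \<partial>lborel)"
proof -
  obtain s0 where s0: "s0 \<in> S" using S by auto
  define q where "q = std_normal_density"
  have q: "q t > 0" for t unfolding q_def by (rule normal_density_pos) simp
  have [measurable]: "q \<in> borel_fun" by (simp add: q_def)
  let ?M = "density lborel q"
  have P: "prob_space ?M" using prob_space_normal_density[of 1 0] by (simp add: q_def)
  have [measurable]: "S \<in> sets borel" by fact
  obtain L where L: "law S L" 
    "\<And>\<phi>. \<phi> \<in> borel_fun ==> absint L \<phi> = (\<integral>\<^sup>+x. enorm (h x / q x) * \<phi> (if x \<in> S then x else s0) \<partial>?M)"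
    "\<And>\<phi>. \<phi> \<in> borel_fun ==> pairing L \<phi> = (\<integral>x. h x / q x * \<phi> (if x \<in> S then x else s0) \<partial>?M)"
    by (rule law_from_rv[OF P, of "%t. if t \<in> S then t else s0" "%x. h x / q x" S])
       (use S s0 in auto)
  have eqf: "h x / q x * \<phi> (if x \<in> S then x else s0) = h x / q x * \<phi> x" for \<phi> :: "real => complex" and x
    using h0[of x] by auto
  have eqn: "enorm (h x / q x) * \<phi> (if x \<in> S then x else s0) = enorm (h x / q x) * \<phi> x" for \<phi> :: "real => ennreal" and x
    using h0[of x] by auto
  show thesis
  proof (rule that[OF L(1)])
    fix \<phi> :: "real => ennreal" assume [measurable]: "\<phi> \<in> borel_fun"
    show "absint L \<phi> = (\<integral>\<^sup>+t. enorm (h t) * \<phi> t \<partial>lborel)"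
      unfolding L(2)[OF \<open>\<phi> \<in> _\<close>] eqn using q
      by (subst nn_integral_density) (auto simp: norm_divide mult.assoc[symmetric] ennreal_mult'[symmetric] less_imp_le less_imp_neq[symmetric])
  next
    fix \<phi> :: "real => complex" assume [measurable]: "\<phi> \<in> borel_fun"
    have "q x *\<^sub>R (h x / q x * \<phi> x) = h x * \<phi> x" for x
      using q[of x] by (simp add: scaleR_conv_of_real)
    then show "pairing L \<phi> = (\<integral>t. h t * \<phi> t \<partial>lborel)"
      unfolding L(3)[OF \<open>\<phi> \<in> _\<close>] eqf using q
      by (subst integral_density) (auto simp: less_imp_le)
  qed
qed

section \<open>Laplace-Stieltjes transforms with exponential weight\<close>

text \<open>The class of functions that are Laplace transforms, on the half-plane $\mathrm{Re}(z) \ge -\nu$, of a measure carried by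
  \<open>S\<close> with weighted mass $\int e^{\nu t}\,d|\mu|(t) \le B$.  For a fixed weight it is a normed algebra
  with norm bound \<open>B\<close>, and the lemmas below are the rules for calculating with that bound.\<close>

definition LS :: "real set => real => real => (complex => complex) => bool" where
  "LS S \<nu> B f \<longleftrightarrow> (\<exists>M. law S M \<and> 0 \<le> B \<and> absint M (eexp \<nu>) \<le> ennreal B \<and>
     (\<forall>z. - \<nu> \<le> Re z --> f z = pairing M (lap z)))"

lemma LS_nonneg: "LS S \<nu> B f ==> 0 \<le> B"
  by (auto simp: LS_def)

lemma absint_mono:
  assumes "law S M" "\<And>t. t \<in> S ==> \<phi> t \<le> \<psi> t"
  shows "absint M \<phi> \<le> absint M \<psi>"
  unfolding absint_def
  by (rule nn_integral_mono_AE) (use assms(1) in \<open>auto simp: law_def intro!: mult_left_mono assms(2) elim!: eventually_mono\<close>)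

lemma exp_meas [measurable]: "(lap z) \<in> borel_fun"
  "(%t. ennreal (exp (x * t))) \<in> borel_fun" for x :: real
  by measurable

lemma neg_mult_le: "- \<nu> \<le> x ==> 0 \<le> t ==> - (x * t) \<le> \<nu> * (t::real)"
  using mult_right_mono[of "-x" \<nu> t] by simp

lemma absint_exp_le:
  assumes "law S M" "S \<subseteq> {0..}" "- \<nu> \<le> Re z"
  shows "absint M (%t. enorm (exp (- (z * complex_of_real t)))) \<le> absint M (eexp \<nu>)"
  by (rule absint_mono[OF assms(1)]) (use assms(2,3) in \<open>auto intro!: ennreal_leI neg_mult_le\<close>)

lemma LS_bound:
  assumes f: "LS S \<nu> B f" and S: "S \<subseteq> {0..}" and z: "- \<nu> \<le> Re z"
  shows "norm (f z) \<le> B"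
proof -
  obtain M where M: "law S M" "0 \<le> B" "absint M (eexp \<nu>) \<le> ennreal B"
     "f z = pairing M (lap z)" using f z by (auto simp: LS_def)
  have "enorm (f z) \<le> ennreal B"
    unfolding M(4)
    by (rule order_trans[OF norm_pairing_le[OF M(1)] order_trans[OF absint_exp_le[OF M(1) S z] M(3)]]) measurable
  then show ?thesis using M(2) by simp
qed

lemma LS_mono:
  assumes f: "LS S \<nu> B f" and S: "S \<subseteq> S'" "S' \<in> sets borel" "S \<subseteq> {0..}" and "\<nu>' \<le> \<nu>" "B \<le> B'"
    and eq: "\<And>z. - \<nu>' \<le> Re z ==> g z = f z"
  shows "LS S' \<nu>' B' g"
proof -
  obtain M where M: "law S M" "0 \<le> B" "absint M (eexp \<nu>) \<le> ennreal B"
     "\<forall>z. - \<nu> \<le> Re z --> f z = pairing M (lap z)" using f by (auto simp: LS_def)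
  have "law S' M" using M(1) S(1,2) unfolding law_def by (auto elim!: eventually_mono)
  moreover have "absint M (%t. ennreal (exp (\<nu>' * t))) \<le> absint M (eexp \<nu>)"
    by (rule absint_mono[OF M(1)]) (use assms in \<open>auto intro!: ennreal_leI mult_right_mono\<close>)
  ultimately show ?thesis unfolding LS_def using M assms
    by (intro exI[of _ M]) (auto intro: order_trans ennreal_leI)
qed

lemma LS_cong: "LS S \<nu> B f ==> (\<And>z. - \<nu> \<le> Re z ==> g z = f z) ==> LS S \<nu> B g"
  by (auto simp: LS_def)

lemma LS_le: "LS S \<nu> B f ==> B \<le> B' ==> LS S \<nu> B' f"
  unfolding LS_def by (meson ennreal_leI order_trans)

lemma LS_exp:
  assumes "lam \<in> S" "S \<in> sets borel"
  shows "LS S \<nu> (norm c * exp (\<nu> * lam)) (%z. c * exp (- (z * of_real lam)))"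
proof -
  obtain L where L: "law S L"
    "\<And>\<phi>. \<phi> \<in> borel_fun ==> absint L \<phi> = enorm c * \<phi> lam"
    "\<And>\<phi>. \<phi> \<in> borel_fun ==> pairing L \<phi> = c * \<phi> lam" using law_dirac[OF assms] by metis
  show ?thesis unfolding LS_def using L(1)
    by (intro exI[of _ L]) (auto simp: L(2)[OF exp_meas(2)] L(3)[OF exp_meas(1)] ennreal_mult')
qed

lemma LS_const: "0 \<in> S ==> S \<in> sets borel ==> LS S \<nu> (norm c) (%z. c)"
  using LS_exp[of 0 S \<nu> c] by simp

lemma LS_zero: "S \<noteq> {} ==> S \<in> sets borel ==> LS S \<nu> 0 (%z. 0)"
  using LS_exp[of _ S \<nu> 0] by auto

lemma LS_mult:
  assumes f: "LS S \<nu> B f" and g: "LS S \<nu> B' g" and S: "S \<in> sets borel" "S \<subseteq> {0..}" "\<And>s t. s \<in> S ==> t \<in> S ==> s + t \<in> S"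
  shows "LS S \<nu> (B * B') (%z. f z * g z)"
proof -
  obtain M where M: "law S M" "0 \<le> B" "absint M (eexp \<nu>) \<le> ennreal B"
     "\<And>z. - \<nu> \<le> Re z ==> f z = pairing M (lap z)" using f by (auto simp: LS_def)
  obtain M' where M': "law S M'" "0 \<le> B'" "absint M' (eexp \<nu>) \<le> ennreal B'"
     "\<And>z. - \<nu> \<le> Re z ==> g z = pairing M' (lap z)" using g by (auto simp: LS_def)
  obtain L where L: "law S L"
    "\<And>\<phi>. \<phi> \<in> borel_fun ==> absint L \<phi> = absint M (%s. absint M' (%t. \<phi> (s + t)))"
    "\<And>\<phi>. \<phi> \<in> borel_fun ==> absint L (%t. enorm (\<phi> t)) < \<infinity> ==>
       pairing L \<phi> = pairing M (%s. pairing M' (%t. \<phi> (s + t)))"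
    using law_prod[OF M(1) M'(1) S(1) S(3)] by metis
  have ac: "absint M' (%t. c * \<phi> t) = c * absint M' \<phi>" "absint M (%t. \<phi> t * c) = absint M \<phi> * c"
    if "\<phi> \<in> borel_fun" for c \<phi>
    unfolding absint_def using that
    by (subst nn_integral_cmult[symmetric], auto intro!: law_meas[OF M'(1)] nn_integral_cong simp: ac_simps)
       (subst nn_integral_cmult[symmetric], auto intro!: law_meas[OF M(1)] nn_integral_cong simp: ac_simps)
  have b: "absint L (eexp \<nu>) = absint M (eexp \<nu>) * absint M' (eexp \<nu>)"
    by (simp add: L(2) ring_distribs exp_add ennreal_mult' ac)
  then have b': "absint L (eexp \<nu>) \<le> ennreal (B * B')"
    using mult_mono[OF M(3) M'(3)] by (simp add: ennreal_mult' M(2) M'(2))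
  have "f z * g z = pairing L (lap z)" if z: "- \<nu> \<le> Re z" for z
  proof -
    have "absint L (%t. enorm (exp (- (z * complex_of_real t)))) < \<infinity>"
      using order_trans[OF absint_exp_le[OF L(1) S(2) z] b'] by (simp add: order.strict_trans1)
    then have "pairing L (lap z) = pairing M (%s. pairing M' (%t. exp (- (z * complex_of_real (s + t)))))"
      by (intro L(3)) measurable
    also have "\<dots> = pairing M (%s. exp (- (z * complex_of_real s)) * g z)"
      unfolding M'(4)[OF z] pairing_def
      by (simp add: exp_add[symmetric] algebra_simps flip: integral_mult_right_zero)
    also have "\<dots> = f z * g z"
      unfolding M(4)[OF z] pairing_def
      by (subst integral_mult_left_zero[symmetric]) (simp add: algebra_simps)
    finally show ?thesis by simp
  qed
  then show ?thesis unfolding LS_def using L(1) b' M(2) M'(2) by (intro exI[of _ L]) auto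
qed

text \<open>Completeness of the algebra: absolutely convergent series of transforms are transforms.\<close>

lemma LS_suminf:
  assumes f: "\<And>i::nat. LS S \<nu> (B i) (f i)" and S: "S \<subseteq> {0..}" and B: "summable B"
  shows "LS S \<nu> (\<Sum>i. B i) (%z. \<Sum>i. f i z)"
proof -
  define ok where "ok i M \<longleftrightarrow> law S M \<and> 0 \<le> B i \<and> absint M (eexp \<nu>) \<le> ennreal (B i) \<and> 
     (\<forall>z. - \<nu> \<le> Re z --> f i z = pairing M (lap z))" for i M
  have "\<forall>i. \<exists>M. ok i M"
    using f unfolding LS_def ok_def by simp
  from choice[OF this] obtain M where ok: "\<And>i. ok i (M i)" by auto
  have M: "\<And>i. law S (M i)" "\<And>i. 0 \<le> B i" "\<And>i. absint (M i) (eexp \<nu>) \<le> ennreal (B i)"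
    "\<And>i z. - \<nu> \<le> Re z ==> f i z = pairing (M i) (lap z)"
    using ok by (simp_all add: ok_def)
  obtain L where L: "law S L"
    "\<And>\<phi>. \<phi> \<in> borel_fun ==> absint L \<phi> = (\<Sum>i. absint (M i) \<phi>)"
    "\<And>\<phi>. \<phi> \<in> borel_fun ==> (\<Sum>i. absint (M i) (%t. enorm (\<phi> t))) < \<infinity> ==>
       (%i. pairing (M i) \<phi>) sums pairing L \<phi>"
    by (rule law_mixture[where M = M, OF M(1)]) (rule that, assumption, blast, blast)
  have b: "absint L (eexp \<nu>) \<le> ennreal (\<Sum>i. B i)"
  proof -
    have "(\<Sum>i. absint (M i) (eexp \<nu>)) \<le> (\<Sum>i. ennreal (B i))"
      by (rule suminf_le[OF M(3)]) auto
    also have "\<dots> = ennreal (\<Sum>i. B i)" by (rule suminf_ennreal2[OF M(2) B])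
    finally show ?thesis unfolding L(2)[OF exp_meas(2)] .
  qed
  have "(\<Sum>i. f i z) = pairing L (lap z)" if z: "- \<nu> \<le> Re z" for z
  proof -
    have mm: "(%t. enorm (exp (- (z * complex_of_real t)))) \<in> borel_fun" by measurable
    have "absint L (%t. enorm (exp (- (z * complex_of_real t)))) < \<infinity>"
      using order_trans[OF absint_exp_le[OF L(1) S z] b] by (simp add: order.strict_trans1)
    then have "(%i. pairing (M i) (lap z)) sums pairing L (lap z)"
      by (intro L(3)) (rule exp_meas(1), simp only: L(2)[OF mm])
    then show ?thesis unfolding M(4)[OF z] by (simp only: sums_iff)
  qed
  then show ?thesis unfolding LS_def using L(1) b M(2) B by (intro exI[of _ L]) (auto intro: suminf_nonneg)
qed

lemma LS_add:
  assumes f: "LS S \<nu> B f" and g: "LS S \<nu> B' g" and S: "S \<subseteq> {0..}"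
  shows "LS S \<nu> (B + B') (%z. f z + g z)"
proof -
  obtain M where "law S M" using f by (auto simp: LS_def)
  then have "S \<in> sets borel" "S \<noteq> {}" 
    unfolding law_def using prob_space.AE_False[of M] by auto
  then have z: "LS S \<nu> 0 (%z. 0)" by (rule LS_zero[rotated])
  define F where "F i = (if i = 0 then f else if i = 1 then g else (%z. 0))" for i :: nat
  define b where "b i = (if i = 0 then B else if i = 1 then B' else 0)" for i :: nat
  have s: "(%i. if i = 0 then x else if i = 1 then y else 0) sums (x + y)" for x y :: "'a :: real_normed_vector"
    using sums_finite[of "{0, 1::nat}" "%i. if i = 0 then x else if i = 1 then y else 0"] by simp
  have "LS S \<nu> (\<Sum>i. b i) (%z. \<Sum>i. F i z)"
    by (rule LS_suminf[OF _ S]) (use f g z s in \<open>auto simp: F_def b_def sums_iff\<close>)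
  moreover have "(\<Sum>i. b i) = B + B'" using s[of B B'] by (simp add: b_def sums_iff)
  moreover have "(\<Sum>i. F i z) = f z + g z" for z
    using s[of "f z" "g z"] by (simp add: F_def sums_iff if_distrib[of "%f. f z"] cong: if_cong)
  ultimately show ?thesis by simp
qed

text \<open>Products of transforms remain in the class with the same carrier as soon as the carrier is closed under addition and contains $0$.\<close>

locale delay_semigroup =
  fixes S :: "real set"
  assumes S_borel: "S \<in> sets borel" and S_0: "0 \<in> S" and S_nonneg: "S \<subseteq> {0..}" 
    and S_add: "\<And>s t. s \<in> S ==> t \<in> S ==> s + t \<in> S"
begin

lemma LS_cmult: "LS S \<nu> B f ==> LS S \<nu> (norm c * B) (%z. c * f z)"
  by (rule LS_mult[OF LS_const[OF S_0 S_borel] _ S_borel S_nonneg S_add])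

lemma LS_uminus: "LS S \<nu> B f ==> LS S \<nu> B (%z. - f z)"
  using LS_cmult[of \<nu> B f "-1"] by simp

lemma LS_diff: "LS S \<nu> B f ==> LS S \<nu> B' g ==> LS S \<nu> (B + B') (%z. f z - g z)"
  using LS_add[OF _ LS_uminus S_nonneg] by simp

lemma LS_sum:
  assumes "finite I" "\<And>i. i \<in> I ==> LS S \<nu> (B i) (f i)"
  shows "LS S \<nu> (\<Sum>i\<in>I. B i) (%z. \<Sum>i\<in>I. f i z)"
  using assms by (induction I rule: finite_induct) (use S_0 in \<open>auto intro!: LS_zero S_borel LS_add S_nonneg\<close>)

lemma LS_prod:
  assumes "finite I" "\<And>i. i \<in> I ==> LS S \<nu> (B i) (f i)"
  shows "LS S \<nu> (\<Prod>i\<in>I. B i) (%z. \<Prod>i\<in>I. f i z)"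
  using assms 
proof (induction I rule: finite_induct)
  case empty
  show ?case using LS_const[OF S_0 S_borel, of \<nu> 1] by simp
qed (auto intro!: LS_mult S_borel S_nonneg S_add)

lemma LS_power: "LS S \<nu> B f ==> LS S \<nu> (B ^ n) (%z. f z ^ n)"
  using LS_prod[of "{..<n}" \<nu> "%_. B" "%_. f"] by simp

lemma LS_prod_diff:
  fixes B \<epsilon> :: real
  assumes "finite I" "\<And>i. i \<in> I ==> LS S \<nu> B (f i)" "\<And>i. i \<in> I ==> LS S \<nu> B (g i)"
    "\<And>i. i \<in> I ==> LS S \<nu> \<epsilon> (%z. f i z - g i z)" "1 \<le> B" "0 \<le> \<epsilon>"
  shows "LS S \<nu> (card I * B ^ card I * \<epsilon>) (%z. (\<Prod>i\<in>I. f i z) - (\<Prod>i\<in>I. g i z))"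
  using assms
proof (induction I rule: finite_induct)
  case empty
  show ?case using LS_zero[OF _ S_borel] S_0 by auto
next
  case (insert x I)
  have 1: "LS S \<nu> (\<epsilon> * B ^ card I) (%z. (f x z - g x z) * (\<Prod>i\<in>I. f i z))"
    using LS_prod[of I \<nu> "%_. B" f] insert by (intro LS_mult S_borel S_nonneg S_add) auto
  have 2: "LS S \<nu> (B * (card I * B ^ card I * \<epsilon>)) (%z. g x z * ((\<Prod>i\<in>I. f i z) - (\<Prod>i\<in>I. g i z)))"
    using insert by (intro LS_mult S_borel S_nonneg S_add) auto
  have "\<epsilon> * B ^ card I \<le> \<epsilon> * B ^ Suc (card I)"
    using insert.prems by (intro mult_left_mono power_increasing) auto
  then have le: "\<epsilon> * B ^ card I + B * (card I * B ^ card I * \<epsilon>) \<le> card (insert x I) * B ^ card (insert x I) * \<epsilon>"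
    using insert.hyps by (simp add: algebra_simps)
  have eq: "(\<Prod>i\<in>insert x I. f i z) - (\<Prod>i\<in>insert x I. g i z) = 
    (f x z - g x z) * (\<Prod>i\<in>I. f i z) + g x z * ((\<Prod>i\<in>I. f i z) - (\<Prod>i\<in>I. g i z))" for z
    using insert.hyps by (simp add: algebra_simps)
  show ?case unfolding eq by (rule LS_le[OF LS_add[OF 1 2 S_nonneg] le])
qed

lemma LS_det:
  fixes f :: "'n::finite => 'n => complex => complex"
  assumes "\<And>i j. LS S \<nu> B (f i j)"
  shows "LS S \<nu> (fact CARD('n) * B ^ CARD('n)) (%z. det (\<chi> i j. f i j z))"
proof -
  let ?P = "{p. p permutes (UNIV :: 'n set)}"
  have n1: "\<bar>real_of_int (sign p)\<bar> = 1" for p :: "'n => 'n" by (simp add: sign_def)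
  have "LS S \<nu> (\<Sum>p\<in>?P. norm (of_int (sign p) :: complex) * (\<Prod>i\<in>(UNIV::'n set). B)) (%z. \<Sum>p\<in>?P. of_int (sign p) * (\<Prod>i\<in>UNIV. f i (p i) z))"
    by (intro LS_sum LS_cmult LS_prod assms) auto
  moreover have "(\<Sum>p\<in>?P. norm (of_int (sign p) :: complex) * (\<Prod>i\<in>(UNIV::'n set). B)) = fact CARD('n) * B ^ CARD('n)"
    by (simp add: n1 card_permutations)
  ultimately show ?thesis by (simp add: det_def)
qed

text \<open>The determinant is locally Lipschitz in the entries, with respect to the norm of the algebra: change one factor at a time in the Leibniz formula.\<close>

lemma LS_det_diff:
  fixes B \<epsilon> :: real and f :: "'n::finite => 'n => complex => complex"
  assumes f: "\<And>i j. LS S \<nu> B (f i j)" "\<And>i j. LS S \<nu> B (g i j)"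
    "\<And>i j. LS S \<nu> \<epsilon> (%z. f i j z - g i j z)" "1 \<le> B"
  shows "LS S \<nu> (fact CARD('n) * (CARD('n) * B ^ CARD('n) * \<epsilon>)) (%z. det (\<chi> i j. f i j z) - det (\<chi> i j. g i j z))"
proof -
  let ?P = "{p. p permutes (UNIV :: 'n set)}"
  have n1: "\<bar>real_of_int (sign p)\<bar> = 1" for p :: "'n => 'n" by (simp add: sign_def)
  have e: "0 \<le> \<epsilon>" using f(3) LS_nonneg by blast
  have "LS S \<nu> (\<Sum>p\<in>?P. norm (of_int (sign p) :: complex) * (CARD('n) * B ^ CARD('n) * \<epsilon>)) 
    (%z. \<Sum>p\<in>?P. of_int (sign p) * ((\<Prod>i\<in>UNIV. f i (p i) z) - (\<Prod>i\<in>UNIV. g i (p i) z)))"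
    by (intro LS_sum LS_cmult LS_prod_diff f e) auto
  moreover have "(\<Sum>p\<in>?P. norm (of_int (sign p) :: complex) * (CARD('n) * B ^ CARD('n) * \<epsilon>)) = fact CARD('n) * (CARD('n) * B ^ CARD('n) * \<epsilon>)"
    by (simp add: n1 card_permutations)
  ultimately show ?thesis by (simp add: det_def sum_subtractf right_diff_distrib)
qed

end

lemma LS_density:
  fixes h :: "real => complex"
  assumes h[measurable]: "h \<in> borel_fun" and S: "S \<in> sets borel" "S \<noteq> {}"
    and h0: "\<And>t. t \<notin> S ==> h t = 0" and "0 \<le> B"
    and B: "(\<integral>\<^sup>+t. ennreal (norm (h t) * exp (\<nu> * t)) \<partial>lborel) \<le> ennreal B"
  shows "LS S \<nu> B (%z. \<integral>t. h t * exp (- (z * of_real t)) \<partial>lborel)"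
proof -
  obtain L where L: "law S L"
    "\<And>\<phi>. \<phi> \<in> borel_fun ==> absint L \<phi> = (\<integral>\<^sup>+t. enorm (h t) * \<phi> t \<partial>lborel)"
    "\<And>\<phi>. \<phi> \<in> borel_fun ==> pairing L \<phi> = (\<integral>t. h t * \<phi> t \<partial>lborel)"
    using law_density[OF h S h0] by metis
  show ?thesis unfolding LS_def using L(1) B \<open>0 \<le> B\<close>
    by (intro exI[of _ L]) (auto simp: L(2)[OF exp_meas(2)] L(3)[OF exp_meas(1)] ennreal_mult')
qed

lemma LS_holomorphic:
  assumes f: "LS S \<nu> B f" and S: "S \<subseteq> {0..}"
  shows "f holomorphic_on {z. - \<nu> < Re z}"
proof -
  obtain M where M: "law S M" "0 \<le> B" "absint M (eexp \<nu>) \<le> ennreal B"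
     "\<And>z. - \<nu> \<le> Re z ==> f z = pairing M (lap z)" using f by (auto simp: LS_def)
  have mm: "g \<in> borel_fun ==> g \<in> borel_measurable M" for g :: "_ => complex" by (rule law_meas[OF M(1)])
  have AES: "AE x in M. fst x \<ge> 0" using M(1) S by (auto simp: law_def elim!: eventually_mono)
  have fin: "absint M (eexp \<nu>) < \<infinity>" using M(3) by (simp add: order.strict_trans1)
  have int0: "integrable M (%x. norm (snd x) * exp (\<nu> * fst x))"
    using fin by (intro integrableI_nonneg) (auto intro!: law_meas[OF M(1)] simp: absint_def ennreal_mult')
  show ?thesis
  proof (rule holomorphic_onI)
    fix z0 assume "z0 \<in> {z. - \<nu> < Re z}"
    then have z0: "- \<nu> < Re z0" by simp
    define r where "r = Re z0 + \<nu>"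
    define a where "a k x = snd x * exp (- (z0 * of_real (fst x))) * ((- of_real (fst x)) ^ k /\<^sub>R fact k)" for k and x :: "real \<times> complex"
    have "f holomorphic_on ball z0 r"
    proof (rule power_series_holomorphic)
      fix w assume w: "w \<in> ball z0 r"
      have rw: "- \<nu> \<le> Re w" using w complex_Re_le_cmod[of "z0 - w"] by (simp add: dist_norm r_def)
      have pt: "(%k. a k x * (w - z0) ^ k) sums (snd x * exp (- (w * of_real (fst x))))" for x
      proof -
        have "(%k. snd x * exp (- (z0 * of_real (fst x))) * ((- (w - z0) * of_real (fst x)) ^ k /\<^sub>R fact k)) sums 
          (snd x * exp (- (z0 * of_real (fst x))) * exp (- (w - z0) * of_real (fst x)))"
          by (intro sums_mult exp_converges)
        moreover have "snd x * exp (- (z0 * of_real (fst x))) * ((- (w - z0) * of_real (fst x)) ^ k /\<^sub>R fact k) = a k x * (w - z0) ^ k" for k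
        proof -
          have "(- (w - z0) * of_real (fst x)) ^ k = (- of_real (fst x)) ^ k * (w - z0) ^ k"
            by (subst power_mult_distrib[symmetric]) (simp add: algebra_simps)
          then show ?thesis by (simp add: a_def scaleR_conv_of_real mult_ac)
        qed
        moreover have "exp (- (z0 * of_real (fst x))) * exp (- (w - z0) * of_real (fst x)) = exp (- (w * of_real (fst x)))"
          by (subst exp_add[symmetric]) (simp add: algebra_simps)
        ultimately show ?thesis by (simp add: mult.assoc)
      qed
      have dom: "(\<Sum>k<n. norm (a k x * (w - z0) ^ k)) \<le> norm (snd x) * exp (\<nu> * fst x)" if "fst x \<ge> 0" for n x
      proof -
        let ?s = "norm (w - z0) * fst x"
        have n: "norm (a k x * (w - z0) ^ k) = norm (snd x) * exp (- (Re z0 * fst x)) * (?s ^ k / fact k)" for k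
          using that unfolding a_def norm_mult norm_power norm_scaleR norm_minus_cancel norm_of_real norm_exp_eq_Re power_mult_distrib
          by (simp add: field_simps)
        have "(\<Sum>k<n. ?s ^ k / fact k) \<le> exp ?s"
          using sum_le_suminf[OF summable_exp_generic[of ?s], of "{..<n}"] that by (simp add: exp_def divide_inverse mult.commute)
        then have "(\<Sum>k<n. norm (a k x * (w - z0) ^ k)) \<le> norm (snd x) * exp (- (Re z0 * fst x)) * exp ?s"
          unfolding n sum_distrib_left[symmetric] by (intro mult_left_mono) auto
        also have "\<dots> \<le> norm (snd x) * exp (\<nu> * fst x)"
        proof -
          have "?s \<le> r * fst x" using w that by (intro mult_right_mono) (auto simp: dist_norm norm_minus_commute)
          then show ?thesis by (auto simp: r_def algebra_simps intro!: mult_left_mono simp flip: exp_add)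
        qed
        finally show ?thesis .
      qed
      have int: "integrable M (%x. a k x * (w - z0) ^ k)" for k
      proof (rule Bochner_Integration.integrable_bound[OF int0])
        show "(%x. a k x * (w - z0) ^ k) \<in> borel_measurable M" unfolding a_def by (rule mm) measurable
        show "AE x in M. norm (a k x * (w - z0) ^ k) \<le> norm (norm (snd x) * exp (\<nu> * fst x))"
          using AES
        proof eventually_elim
          case (elim x)
          have "norm (a k x * (w - z0) ^ k) \<le> (\<Sum>k<Suc k. norm (a k x * (w - z0) ^ k))"
            by (rule member_le_sum) auto
          also have "\<dots> \<le> norm (snd x) * exp (\<nu> * fst x)" by (rule dom[OF elim])
          finally show ?case by simp
        qed
      qed
      have "(%k. \<integral>x. a k x * (w - z0) ^ k \<partial>M) sums (\<integral>x. (\<Sum>k. a k x * (w - z0) ^ k) \<partial>M)"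
      proof (rule sums_integral[OF int])
        show "AE x in M. summable (%k. norm (a k x * (w - z0) ^ k))"
          using AES by eventually_elim (rule summableI_nonneg_bounded[OF _ dom], auto)
        show "summable (%k. \<integral>x. norm (a k x * (w - z0) ^ k) \<partial>M)"
        proof (rule summableI_nonneg_bounded)
          fix n
          have "(\<Sum>k<n. \<integral>x. norm (a k x * (w - z0) ^ k) \<partial>M) = (\<integral>x. (\<Sum>k<n. norm (a k x * (w - z0) ^ k)) \<partial>M)"
            using int by (subst Bochner_Integration.integral_sum) auto
          also have "\<dots> \<le> (\<integral>x. norm (snd x) * exp (\<nu> * fst x) \<partial>M)"
            using AES dom int int0 by (intro integral_mono_AE) (auto elim!: eventually_mono)
          finally show "(\<Sum>k<n. \<integral>x. norm (a k x * (w - z0) ^ k) \<partial>M) \<le> (\<integral>x. norm (snd x) * exp (\<nu> * fst x) \<partial>M)" .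
        qed auto
      qed
      then show "(%k. (\<integral>x. a k x \<partial>M) * (w - z0) ^ k) sums f w"
        using M(4)[OF rw] pt by (simp add: pairing_def sums_iff)
    qed
    then show "f field_differentiable at z0 within {z. - \<nu> < Re z}"
      using z0 by (intro holomorphic_on_imp_differentiable_at[THEN field_differentiable_at_within, of f "ball z0 r"]) (auto simp: r_def)
  qed
qed

text \<open>A measure without mass at $0$ has small weighted mass once the weight decays fast enough, by dominated convergence.\<close>

lemma LS_decay:
  assumes f: "LS S \<nu> B f" and S: "S \<subseteq> {0<..}" "S \<in> sets borel" and "0 < \<epsilon>"
  shows "\<exists>\<sigma>0. \<forall>\<sigma>\<ge>\<sigma>0. LS S (- \<sigma>) \<epsilon> f"
proof -
  obtain M where M: "law S M" "0 \<le> B" "absint M (eexp \<nu>) \<le> ennreal B"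
     "\<And>z. - \<nu> \<le> Re z ==> f z = pairing M (lap z)" using f by (auto simp: LS_def)
  have AES: "AE x in M. fst x > 0" using M(1) S by (auto simp: law_def elim!: eventually_mono)
  have fin: "absint M (eexp \<nu>) < \<infinity>" using M(3) by (simp add: order.strict_trans1)
  have int0: "integrable M (%x. norm (snd x) * exp (\<nu> * fst x))"
    using fin by (intro integrableI_nonneg) (auto intro!: law_meas[OF M(1)] simp: absint_def ennreal_mult')
  have "((%\<sigma>. \<integral>x. norm (snd x) * exp (- \<sigma> * fst x) \<partial>M) \<longlongrightarrow> (\<integral>x. 0 \<partial>M)) at_top"
  proof (rule integral_dominated_convergence_at_top[where w = "%x. norm (snd x) * exp (\<nu> * fst x)"])
    show "\<forall>\<^sub>F \<sigma> in at_top. AE x in M. norm (norm (snd x) * exp (- \<sigma> * fst x)) \<le> norm (snd x) * exp (\<nu> * fst x)"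
      using eventually_ge_at_top[of "-\<nu>"]
    proof eventually_elim
      case (elim \<sigma>)
      show ?case using AES by eventually_elim (use elim in \<open>auto intro!: mult_left_mono neg_mult_le\<close>)
    qed
    show "AE x in M. ((%\<sigma>. norm (snd x) * exp (- \<sigma> * fst x)) \<longlongrightarrow> 0) at_top"
      using AES
    proof eventually_elim
      case (elim x)
      have "((%\<sigma>. exp (- \<sigma> * fst x)) \<longlongrightarrow> 0) at_top"
        using elim by real_asymp
      then show ?case by (rule tendsto_mult_right_zero)
    qed
  qed (auto intro!: law_meas[OF M(1)] int0)
  then have "\<forall>\<^sub>F \<sigma> in at_top. (\<integral>x. norm (snd x) * exp (- \<sigma> * fst x) \<partial>M) < \<epsilon>"
    using \<open>0 < \<epsilon>\<close> by (simp add: order_tendstoD)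
  with eventually_ge_at_top[of "-\<nu>"] have "\<forall>\<^sub>F \<sigma> in at_top. LS S (- \<sigma>) \<epsilon> f"
  proof eventually_elim
    case (elim \<sigma>)
    have i: "integrable M (%x. norm (snd x) * exp (- \<sigma> * fst x))"
    proof (rule Bochner_Integration.integrable_bound[OF int0])
      show "AE x in M. norm (norm (snd x) * exp (- \<sigma> * fst x)) \<le> norm (norm (snd x) * exp (\<nu> * fst x))"
      using AES by eventually_elim (use elim in \<open>auto intro!: mult_left_mono neg_mult_le\<close>)
    qed (auto intro!: law_meas[OF M(1)])
    have "absint M (%t. ennreal (exp (- \<sigma> * t))) = ennreal (\<integral>x. norm (snd x) * exp (- \<sigma> * fst x) \<partial>M)"
      unfolding absint_def by (subst nn_integral_eq_integral[OF i, symmetric]) (auto simp: ennreal_mult')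
    also have "\<dots> \<le> ennreal \<epsilon>" using elim(2) by (intro ennreal_leI) simp
    finally show ?case unfolding LS_def using M(1,4) elim(1) \<open>0 < \<epsilon>\<close> by (intro exI[of _ M]) auto
  qed
  then show ?thesis by (simp add: eventually_at_top_linorder)
qed

section \<open>Recovering a measure from its transform\<close>

lemma (in pair_sigma_finite) integrable_pair_product_bound:
  fixes F :: "'a \<times> 'b => 'c :: {banach, second_countable_topology}"
  assumes F[measurable]: "F \<in> borel_measurable (M1 \<Otimes>\<^sub>M M2)"
    and u: "integrable M1 u" and v: "integrable M2 v"
    and le: "\<And>x y. norm (F (x, y)) \<le> u x * v y" and nn: "\<And>x. 0 \<le> u x" "\<And>y. 0 \<le> v y"
  shows "integrable (M1 \<Otimes>\<^sub>M M2) F"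
proof (rule integrableI_bounded[OF F])
  have [measurable]: "u \<in> borel_measurable M1" "v \<in> borel_measurable M2" using u v by auto
  have "(\<integral>\<^sup>+x. enorm (F x) \<partial>(M1 \<Otimes>\<^sub>M M2)) = (\<integral>\<^sup>+x. \<integral>\<^sup>+y. enorm (F (x, y)) \<partial>M2 \<partial>M1)"
    by (rule M2.nn_integral_fst[symmetric]) measurable
  also have "\<dots> \<le> (\<integral>\<^sup>+x. \<integral>\<^sup>+y. ennreal (u x) * ennreal (v y) \<partial>M2 \<partial>M1)"
    using le nn by (intro nn_integral_mono) (auto simp flip: ennreal_mult intro!: ennreal_leI)
  also have "\<dots> = (\<integral>\<^sup>+x. ennreal (u x) \<partial>M1) * (\<integral>\<^sup>+y. ennreal (v y) \<partial>M2)"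
    by (simp add: nn_integral_cmult nn_integral_multc)
  also have "\<dots> < \<infinity>"
    using nn_integral_eq_integral[OF u] nn_integral_eq_integral[OF v] nn by (simp add: ennreal_mult_less_top)
  finally show "(\<integral>\<^sup>+x. enorm (F x) \<partial>(M1 \<Otimes>\<^sub>M M2)) < \<infinity>" .
qed

lemma vertical_contour_integral:
  assumes R: "0 < R" and g: "continuous_on {z. Re z = \<alpha> \<and> \<bar>Im z\<bar> \<le> R} g"
  shows "contour_integral (linepath (Complex \<alpha> (- R)) (Complex \<alpha> R)) g = 
     \<i> * (\<integral>y. indicat_real {- R..R} y *\<^sub>R g (Complex \<alpha> y) \<partial>lborel)"
proof -
  have c: "continuous_on {- R..R} (%y. g (Complex \<alpha> y))"
    by (intro continuous_on_compose2[OF g]) (auto intro!: continuous_intros simp: Complex_eq)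
  have i: "set_integrable lborel {- R..R} (%y. g (Complex \<alpha> y))"
    by (rule borel_integrable_compact[OF _ c, unfolded set_integrable_def[symmetric]]) auto
  have "((%y. g (Complex \<alpha> y)) has_integral (LINT y:{- R..R}|lborel. g (Complex \<alpha> y))) (cbox (- R) R)"
    using set_borel_integral_eq_integral[OF i] by (simp add: has_integral_iff)
  from has_integral_affinity'[OF this, of "2 * R" "- R"] R
  have "((%x. g (Complex \<alpha> (2 * R * x - R))) has_integral (1 / (2 * R)) *\<^sub>R (LINT y:{- R..R}|lborel. g (Complex \<alpha> y))) {0..1}"
    by (simp add: divide_simps)
  then have "((%x. g (Complex \<alpha> (2 * R * x - R)) * (Complex \<alpha> R - Complex \<alpha> (- R))) has_integral 
     ((1 / (2 * R)) *\<^sub>R (LINT y:{- R..R}|lborel. g (Complex \<alpha> y))) * (Complex \<alpha> R - Complex \<alpha> (- R))) {0..1}"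
    by (rule has_integral_mult_left)
  also have "((1 / (2 * R)) *\<^sub>R (LINT y:{- R..R}|lborel. g (Complex \<alpha> y))) * (Complex \<alpha> R - Complex \<alpha> (- R)) = \<i> * (LINT y:{- R..R}|lborel. g (Complex \<alpha> y))"
    using R by (simp add: Complex_eq scaleR_conv_of_real field_simps)
  finally have "((%x. g (Complex \<alpha> (2 * R * x - R)) * (Complex \<alpha> R - Complex \<alpha> (- R))) has_integral 
      \<i> * (LINT y:{- R..R}|lborel. g (Complex \<alpha> y))) {0..1}" .
  moreover have "linepath (Complex \<alpha> (- R)) (Complex \<alpha> R) x = Complex \<alpha> (2 * R * x - R)" for x
    by (simp add: linepath_def complex_eq_iff algebra_simps)
  ultimately have "(g has_contour_integral \<i> * (LINT y:{- R..R}|lborel. g (Complex \<alpha> y))) (linepath (Complex \<alpha> (- R)) (Complex \<alpha> R))"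
    by (simp add: has_contour_integral_linepath)
  then show ?thesis by (simp add: contour_integral_unique set_lebesgue_integral_def)
qed

lemma contour_integral_bound_linepath_continuous:
  assumes "continuous_on (closed_segment a b) g" "\<And>z. z \<in> closed_segment a b ==> norm (g z) \<le> H"
  shows "norm (contour_integral (linepath a b) g) \<le> H * norm (b - a)"
proof (rule contour_integral_bound_linepath)
  show "g contour_integrable_on linepath a b" by (rule contour_integrable_continuous_linepath) fact
  show "0 \<le> H" using assms(2)[of a] norm_ge_zero[of "g a"] by (simp del: norm_ge_zero)
qed (rule assms)

text \<open>A contour integral over a rectangle equals that over its two vertical sides up to the horizontal ones, which are negligible for a function that is small at great height.\<close>

lemma rectangle_vertical_sides:
  assumes "\<alpha> \<le> \<beta>" "0 \<le> R"
    and cont: "continuous_on (path_image (rectpath (Complex \<alpha> (- R)) (Complex \<beta> R))) g"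
    and I: "(g has_contour_integral I) (rectpath (Complex \<alpha> (- R)) (Complex \<beta> R))"
    and H: "\<And>z. \<bar>Im z\<bar> = R ==> \<alpha> \<le> Re z ==> Re z \<le> \<beta> ==> norm (g z) \<le> H"
  shows "norm (contour_integral (linepath (Complex \<beta> (- R)) (Complex \<beta> R)) g - 
     contour_integral (linepath (Complex \<alpha> (- R)) (Complex \<alpha> R)) g - I) \<le> 2 * H * (\<beta> - \<alpha>)"
proof -
  let ?a = "Complex \<alpha> (- R)" and ?b = "Complex \<beta> (- R)" and ?c = "Complex \<beta> R" and ?d = "Complex \<alpha> R"
  have pi: "path_image (rectpath ?a ?c) = {z. Re z \<in> {\<alpha>, \<beta>} \<and> Im z \<in> {- R..R}} \<union> {z. Im z \<in> {- R, R} \<and> Re z \<in> {\<alpha>..\<beta>}}"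
    using assms by (subst path_image_rectpath) auto
  have sub: "closed_segment ?a ?b \<subseteq> path_image (rectpath ?a ?c)" "closed_segment ?b ?c \<subseteq> path_image (rectpath ?a ?c)"
      "closed_segment ?c ?d \<subseteq> path_image (rectpath ?a ?c)" "closed_segment ?d ?a \<subseteq> path_image (rectpath ?a ?c)"
    unfolding pi using assms by (auto simp: closed_segment_same_Re closed_segment_same_Im closed_segment_eq_real_ivl split: if_splits)
  note ci = contour_integrable_continuous_linepath[OF continuous_on_subset[OF cont]]
  have "I = contour_integral (rectpath ?a ?c) g" using I by (simp add: contour_integral_unique)
  also have "\<dots> = contour_integral (linepath ?a ?b) g + contour_integral (linepath ?b ?c) g + contour_integral (linepath ?c ?d) g + contour_integral (linepath ?d ?a) g"
    unfolding rectpath_def Let_def using ci[OF sub(1)] ci[OF sub(2)] ci[OF sub(3)] ci[OF sub(4)]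
    by (simp add: contour_integrable_joinI)
  finally have eq: "contour_integral (linepath ?b ?c) g - contour_integral (linepath ?a ?d) g - I = 
     - contour_integral (linepath ?a ?b) g - contour_integral (linepath ?c ?d) g"
    using contour_integral_reverse_linepath[OF continuous_on_subset[OF cont sub(4)]] by simp
  have 1: "norm (contour_integral (linepath ?a ?b) g) \<le> H * norm (?b - ?a)"
    by (rule contour_integral_bound_linepath_continuous[OF continuous_on_subset[OF cont sub(1)]])
      (use assms in \<open>auto intro!: H simp: closed_segment_same_Im closed_segment_eq_real_ivl split: if_splits\<close>)
  have 2: "norm (contour_integral (linepath ?c ?d) g) \<le> H * norm (?d - ?c)"
    by (rule contour_integral_bound_linepath_continuous[OF continuous_on_subset[OF cont sub(3)]])
      (use assms in \<open>auto intro!: H simp: closed_segment_same_Im closed_segment_eq_real_ivl split: if_splits\<close>)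
  have n: "norm (?b - ?a) = \<beta> - \<alpha>" "norm (?d - ?c) = \<beta> - \<alpha>" using assms by (auto simp: cmod_def)
  have "norm (- contour_integral (linepath ?a ?b) g - contour_integral (linepath ?c ?d) g) \<le> 
     norm (contour_integral (linepath ?a ?b) g) + norm (contour_integral (linepath ?c ?d) g)"
    by (metis norm_minus_cancel norm_triangle_ineq4)
  also have "\<dots> \<le> 2 * H * (\<beta> - \<alpha>)" using 1 2 unfolding n by simp
  finally show ?thesis unfolding eq .
qed

lemma open_right_half_plane: "open {z. x < Re z}"
  by (intro open_Collect_less continuous_intros)

lemma convex_right_half_plane: "convex {z. x < Re z}"
  using convex_halfspace_gt[of x "1::complex"] by (simp add: inner_complex_def)

lemma integrable_Lorentz: "integrable lborel (%y::real. 1 / (1 + y\<^sup>2))"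
  and integral_Lorentz: "(\<integral>y. 1 / (1 + y\<^sup>2) \<partial>(lborel :: real measure)) = pi"
  using integrable_inverse_1_plus_square LBINT_inverse_1_plus_square
  by (simp_all add: set_integrable_def interval_lebesgue_integral_def set_lebesgue_integral_def einterval_def inverse_eq_divide)

text \<open>Cauchy's integral formula for a half-plane: apply the formula to large rectangles.  The quadratic decay makes the sides other than the
  one on the line $\mathrm{Re} = \alpha$ disappear in the limit.\<close>

lemma half_plane_Cauchy:
  fixes f :: "complex => complex"
  assumes f: "f holomorphic_on {z. \<alpha>' < Re z}" and b: "\<And>z. \<alpha>' < Re z ==> norm (f z) \<le> b / (1 + (norm z)\<^sup>2)"
    and \<alpha>: "\<alpha>' < \<alpha>" and z: "\<alpha> < Re z"
  shows "(\<integral>y. f (Complex \<alpha> y) / (z - Complex \<alpha> y) \<partial>lborel) = 2 * pi * f z"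
proof -
  let ?g = "%w. f w / (w - z)"
  have b0: "0 \<le> b" 
  proof -
    have "0 \<le> norm (f z)" by simp
    also have "\<dots> \<le> b / (1 + (norm z)\<^sup>2)" using b \<alpha> z by simp
    finally have "0 \<le> b / (1 + (norm z)\<^sup>2)" .
    moreover have "0 < 1 + (norm z)\<^sup>2" by (simp add: add_pos_nonneg)
    ultimately show ?thesis by (simp add: zero_le_divide_iff)
  qed
  define V where "V R \<beta> = contour_integral (linepath (Complex \<beta> (- R)) (Complex \<beta> R)) ?g" for R \<beta>
  have hol: "?g holomorphic_on {w. \<alpha>' < Re w} - {z}"
    by (intro holomorphic_intros holomorphic_on_subset[OF f]) auto
  note cont = holomorphic_on_imp_continuous_on[OF hol]
  have gb: "norm (?g w) \<le> b / (1 + R\<^sup>2) / (R - norm z)" if "R \<le> norm w" "norm z < R" "\<alpha>' < Re w" for w R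
  proof -
    have "norm (f w) \<le> b / (1 + R\<^sup>2)"
      by (rule order_trans[OF b[OF that(3)]]) (use that b0 norm_ge_zero[of z] in \<open>intro divide_left_mono add_left_mono power_mono mult_pos_pos add_pos_nonneg; linarith?\<close>, auto)
    moreover have "R - norm z \<le> norm (w - z)" using that norm_triangle_ineq2[of w z] by linarith
    ultimately show ?thesis using that b0 unfolding norm_divide by (intro frac_le) (auto intro!: divide_nonneg_nonneg)
  qed
  have bound: "norm (- V R \<alpha> - 2 * pi * \<i> * f z) \<le> 2 * (b / (1 + R\<^sup>2) / (R - norm z)) * (R - \<alpha>) + b / (1 + R\<^sup>2) / (R - norm z) * (2 * R)"
    if R: "norm z < R" "\<bar>\<alpha>\<bar> < R" for R
  proof -
    have R0: "0 < R" using R by (meson le_less_trans norm_ge_zero)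
    have zb: "z \<in> box (Complex \<alpha> (- R)) (Complex R R)"
      using z R abs_Re_le_cmod[of z] abs_Im_le_cmod[of z] by (auto simp: in_box_complex_iff abs_le_iff)
    have "path_image (rectpath (Complex \<alpha> (- R)) (Complex R R)) \<inter> box (Complex \<alpha> (- R)) (Complex R R) = {}"
      using R R0 by (intro path_image_rectpath_inter_box) auto
    then have piz: "z \<notin> path_image (rectpath (Complex \<alpha> (- R)) (Complex R R))" using zb by blast
    have "path_image (rectpath (Complex \<alpha> (- R)) (Complex R R)) \<subseteq> cbox (Complex \<alpha> (- R)) (Complex R R)"
      using R R0 by (intro path_image_rectpath_subset_cbox) auto
    then have pi: "path_image (rectpath (Complex \<alpha> (- R)) (Complex R R)) \<subseteq> {w. \<alpha>' < Re w} - {z}"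
      using piz \<alpha> by (auto simp: in_cbox_complex_iff)
    have "(?g has_contour_integral (2 * pi * \<i> * winding_number (rectpath (Complex \<alpha> (- R)) (Complex R R)) z * f z)) (rectpath (Complex \<alpha> (- R)) (Complex R R))"
      using z \<alpha> pi by (intro Cauchy_integral_formula_convex_simple[OF convex_right_half_plane f]) (auto simp: interior_open open_right_half_plane)
    then have I: "(?g has_contour_integral (2 * pi * \<i> * f z)) (rectpath (Complex \<alpha> (- R)) (Complex R R))"
      using winding_number_rectpath[OF zb] by simp
    have "norm (V R R - V R \<alpha> - 2 * pi * \<i> * f z) \<le> 2 * (b / (1 + R\<^sup>2) / (R - norm z)) * (R - \<alpha>)"
      unfolding V_def
      by (rule rectangle_vertical_sides[OF _ _ continuous_on_subset[OF cont pi] I])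
        (use R R0 \<alpha> in \<open>simp, simp, intro gb, metis abs_Im_le_cmod, simp_all\<close>)
    moreover have "norm (V R R) \<le> b / (1 + R\<^sup>2) / (R - norm z) * norm (Complex R R - Complex R (- R))"
      unfolding V_def
    proof (rule contour_integral_bound_linepath_continuous)
      show "continuous_on (closed_segment (Complex R (- R)) (Complex R R)) ?g"
        by (rule continuous_on_subset[OF cont]) (use R \<alpha> abs_Re_le_cmod[of z] in \<open>auto simp: closed_segment_same_Re\<close>)
      show "norm (?g w) \<le> b / (1 + R\<^sup>2) / (R - norm z)" if "w \<in> closed_segment (Complex R (- R)) (Complex R R)" for w
        using that R R0 \<alpha> abs_Re_le_cmod[of w] by (intro gb) (auto simp: closed_segment_same_Re)
    qed
    moreover have "norm (Complex R R - Complex R (- R)) = 2 * R" using R0 by (simp add: cmod_def real_sqrt_mult)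
    ultimately show ?thesis 
      using norm_triangle_ineq4[of "V R R - V R \<alpha> - 2 * pi * \<i> * f z" "V R R"] by simp
  qed
  have lim: "((%R. 2 * (b / (1 + R\<^sup>2) / (R - norm z)) * (R - \<alpha>) + b / (1 + R\<^sup>2) / (R - norm z) * (2 * R)) \<longlongrightarrow> 0) at_top"
    by real_asymp
  have "((%R. - V R \<alpha> - 2 * pi * \<i> * f z) \<longlongrightarrow> 0) at_top"
  proof (rule Lim_null_comparison[OF _ lim])
    show "\<forall>\<^sub>F R in at_top. norm (- V R \<alpha> - 2 * pi * \<i> * f z) \<le> 
        2 * (b / (1 + R\<^sup>2) / (R - norm z)) * (R - \<alpha>) + b / (1 + R\<^sup>2) / (R - norm z) * (2 * R)"
      using eventually_gt_at_top[of "norm z"] eventually_gt_at_top[of "\<bar>\<alpha>\<bar>"] by eventually_elim (rule bound)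
  qed
  then have "((%R. - (- V R \<alpha> - 2 * pi * \<i> * f z) - 2 * pi * \<i> * f z) \<longlongrightarrow> - 0 - 2 * pi * \<i> * f z) at_top"
    by (intro tendsto_intros)
  then have V1: "((%R. V R \<alpha>) \<longlongrightarrow> - (2 * pi * \<i> * f z)) at_top" by simp
  let ?h = "%y. f (Complex \<alpha> y) / (z - Complex \<alpha> y)"
  have cl: "continuous_on UNIV (%y. ?h y)"
    by (intro continuous_intros continuous_on_compose2[OF holomorphic_on_imp_continuous_on[OF f]])
      (use \<alpha> z in \<open>auto simp: Complex_eq complex_eq_iff intro!: continuous_intros\<close>)
  have hb: "norm (?h y) \<le> b / (Re z - \<alpha>) * (1 / (1 + y\<^sup>2))" for y
  proof -
    have "norm (f (Complex \<alpha> y)) \<le> b / (1 + y\<^sup>2)"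
    proof -
      have "norm (f (Complex \<alpha> y)) \<le> b / (1 + (norm (Complex \<alpha> y))\<^sup>2)" using \<alpha> by (intro b) simp
      also have "\<dots> \<le> b / (1 + y\<^sup>2)" using b0 by (intro divide_left_mono mult_pos_pos add_pos_nonneg) (auto simp: cmod_power2)
      finally show ?thesis .
    qed
    moreover have "Re z - \<alpha> \<le> norm (z - Complex \<alpha> y)" using complex_Re_le_cmod[of "z - Complex \<alpha> y"] by simp
    ultimately have "norm (f (Complex \<alpha> y)) / norm (z - Complex \<alpha> y) \<le> b / (1 + y\<^sup>2) / (Re z - \<alpha>)" using z by (intro frac_le) (use b0 in auto)
    then show ?thesis by (simp add: norm_divide mult.commute)
  qed
  have "((%R. \<integral>y. indicat_real {- R..R} y *\<^sub>R ?h y \<partial>lborel) \<longlongrightarrow> (\<integral>y. ?h y \<partial>lborel)) at_top"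
  proof (rule integral_dominated_convergence_at_top)
    show "integrable lborel (%y. b / (Re z - \<alpha>) * (1 / (1 + y\<^sup>2)))"
      using integrable_Lorentz by (rule integrable_mult_right)
    show "AE y in lborel. ((%R. indicat_real {- R..R} y *\<^sub>R ?h y) \<longlongrightarrow> ?h y) at_top"
    proof (rule AE_I2)
      fix y :: real
      have "\<forall>\<^sub>F R in at_top. indicat_real {- R..R} y *\<^sub>R ?h y = ?h y"
        using eventually_ge_at_top[of "\<bar>y\<bar>"] by eventually_elim (simp add: indicator_def abs_le_iff)
      then show "((%R. indicat_real {- R..R} y *\<^sub>R ?h y) \<longlongrightarrow> ?h y) at_top"
        by (rule tendsto_eventually)
    qed
    show "\<forall>\<^sub>F R in at_top. AE y in lborel. norm (indicat_real {- R..R} y *\<^sub>R ?h y) \<le> b / (Re z - \<alpha>) * (1 / (1 + y\<^sup>2))"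
      using hb order_trans[OF norm_ge_zero hb] by (intro always_eventually allI AE_I2) (auto simp: indicator_def)
    show "?h \<in> borel_measurable lborel" using cl by (simp add: borel_measurable_continuous_onI)
    then show "(%y. indicat_real {- R..R} y *\<^sub>R ?h y) \<in> borel_measurable lborel" for R by measurable
  qed
  then have "((%R. - (\<i> * (\<integral>y. indicat_real {- R..R} y *\<^sub>R ?h y \<partial>lborel))) \<longlongrightarrow> - (\<i> * (\<integral>y. ?h y \<partial>lborel))) at_top"
    by (intro tendsto_intros)
  moreover have "\<forall>\<^sub>F R in at_top. - (\<i> * (\<integral>y. indicat_real {- R..R} y *\<^sub>R ?h y \<partial>lborel)) = V R \<alpha>"
    using eventually_gt_at_top[of 0]
  proof eventually_elim
    case (elim R)
    have "V R \<alpha> = \<i> * (\<integral>y. indicat_real {- R..R} y *\<^sub>R ?g (Complex \<alpha> y) \<partial>lborel)"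
      unfolding V_def by (rule vertical_contour_integral[OF elim continuous_on_subset[OF cont]]) (use z \<alpha> in auto)
    also have "(%y. indicat_real {- R..R} y *\<^sub>R ?g (Complex \<alpha> y)) = (%y. - (indicat_real {- R..R} y *\<^sub>R ?h y))"
      by (rule ext) (metis minus_diff_eq minus_divide_right scaleR_minus_right)
    finally show ?case by simp
  qed
  ultimately have "((%R. V R \<alpha>) \<longlongrightarrow> - (\<i> * (\<integral>y. ?h y \<partial>lborel))) at_top"
    by (rule Lim_transform_eventually)
  from tendsto_unique[OF _ this V1] show ?thesis by simp
qed

lemma nn_integral_exp_half_line:
  fixes c :: real
  assumes "0 < c"
  shows "(\<integral>\<^sup>+t. ennreal (indicat_real {0..} t * exp (- (c * t))) \<partial>lborel) = ennreal (1 / c)"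
proof -
  have "((%t. - exp (- (c * t)) / c) \<longlongrightarrow> 0) at_top" using assms by real_asymp
  then have "(\<integral>\<^sup>+t. ennreal (exp (- (c * t))) * indicator {0..} t \<partial>lborel) = ennreal (0 - (- exp (- (c * 0)) / c))"
    using assms by (intro nn_integral_FTC_atLeast) (auto intro!: derivative_eq_intros)
  then show ?thesis by (simp add: ennreal_mult' ennreal_indicator mult.commute)
qed

lemma integrable_exp_half_line: "0 < c ==> integrable lborel (%t. indicat_real {0..} t * exp (- (c * t)))"
  by (rule integrableI_nonneg) (auto simp: nn_integral_exp_half_line)

lemma integral_cexp_half_line:
  fixes c :: complex
  assumes "0 < Re c"
  shows "(\<integral>t. indicat_real {0..} t *\<^sub>R exp (- (c * of_real t)) \<partial>lborel) = 1 / c"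
proof -
  have c: "c \<noteq> 0" using assms by auto
  have i: "integrable lborel (%t. indicat_real {0..} t *\<^sub>R exp (- (c * of_real t)))"
    by (rule Bochner_Integration.integrable_bound[OF integrable_exp_half_line[OF assms]]) auto
  have i': "set_integrable lborel (einterval 0 \<infinity>) (%t. exp (- (c * of_real t)))"
    unfolding set_integrable_def
    by (rule Bochner_Integration.integrable_bound[OF integrable_exp_half_line[OF assms]]) (auto simp: indicator_def einterval_iff zero_ereal_def)
  have l: "((%x. - exp (- (c * of_real x)) / c) \<longlongrightarrow> 0) at_top"
  proof (rule Lim_null_comparison)
    show "((%x. exp (- (Re c * x)) / norm c) \<longlongrightarrow> 0) at_top" using assms c by real_asymp
  qed (auto simp: norm_divide)
  have "(LBINT t=0..\<infinity>. exp (- (c * of_real t))) = 0 - (- (1 / c))"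
  proof (rule interval_integral_FTC_integrable[where F = "%t. - exp (- (c * of_real t)) / c", OF _ _ _ i'])
    show "((%t. - exp (- (c * of_real t)) / c) has_vector_derivative exp (- (c * of_real x))) (at x)" for x
      using c by (auto intro!: derivative_eq_intros has_vector_derivative_real_field)
    show "(((%t. - exp (- (c * of_real t)) / c) \<circ> real_of_ereal) \<longlongrightarrow> - (1 / c)) (at_right 0)"
    proof -
      have "((%t. - exp (- (c * complex_of_real t)) / c) \<longlongrightarrow> - exp (- (c * of_real 0)) / c) (at_right 0)"
        using c by (intro tendsto_intros)
      then show ?thesis by (simp add: zero_ereal_def ereal_tendsto_simps)
    qed
    show "(((%t. - exp (- (c * of_real t)) / c) \<circ> real_of_ereal) \<longlongrightarrow> 0) (at_left \<infinity>)"
      using l by (simp add: ereal_tendsto_simps)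
  qed (auto intro!: continuous_intros)
  moreover have "(LBINT t=0..\<infinity>. exp (- (c * of_real t))) = (\<integral>t. indicat_real {0..} t *\<^sub>R exp (- (c * of_real t)) \<partial>lborel)"
    unfolding interval_lebesgue_integral_def set_lebesgue_integral_def
    using AE_lborel_singleton[of "0::real"]
    by (auto intro!: integral_cong_AE simp: indicator_def einterval_iff zero_ereal_def elim!: eventually_mono)
  ultimately show ?thesis by simp
qed

text \<open>The density is the inverse Laplace integral of \<open>f\<close> along the line $\mathrm{Re} = -\mu$ for a $\mu$ strictly between the two weights.  Along that line
  \<open>f\<close> is integrable, so the density is $O(e^{-\mu t})$ and is integrable against $e^{\nu t}$; Cauchy's formula identifies its transform.\<close>

lemma LS_inverse_Laplace:
  fixes f :: "complex => complex"
  assumes f: "f holomorphic_on {z. - \<nu>' < Re z}" and b: "\<And>z. - \<nu>' < Re z ==> norm (f z) \<le> b / (1 + (norm z)\<^sup>2)"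
    and \<nu>: "\<nu> < \<nu>'" and b0: "0 \<le> b"
  shows "LS {0..} \<nu> (b / (\<nu>' - \<nu>)) f"
proof -
  define \<mu> where "\<mu> = (\<nu> + \<nu>') / 2"
  have \<mu>: "\<nu> < \<mu>" "\<mu> < \<nu>'" "\<nu>' - \<nu> = 2 * (\<mu> - \<nu>)" using \<nu> by (auto simp: \<mu>_def field_simps)
  define \<phi> where "\<phi> y = f (Complex (- \<mu>) y)" for y
  have \<phi>c: "continuous_on UNIV \<phi>" unfolding \<phi>_def
    by (intro continuous_on_compose2[OF holomorphic_on_imp_continuous_on[OF f]])
      (use \<mu> in \<open>auto simp: Complex_eq intro!: continuous_intros\<close>)
  then have [measurable]: "\<phi> \<in> borel_fun" by (rule borel_measurable_continuous_onI)
  have \<phi>b: "norm (\<phi> y) \<le> b * (1 / (1 + y\<^sup>2))" for y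
  proof -
    have "norm (\<phi> y) \<le> b / (1 + (norm (Complex (- \<mu>) y))\<^sup>2)" unfolding \<phi>_def using \<mu> by (intro b) simp
    also have "\<dots> \<le> b / (1 + y\<^sup>2)" using b0 by (intro divide_left_mono mult_pos_pos add_pos_nonneg) (auto simp: cmod_power2)
    finally show ?thesis by simp
  qed
  have \<phi>i: "integrable lborel (%y. b * (1 / (1 + y\<^sup>2)))" using integrable_Lorentz by (rule integrable_mult_right)
  define k where "k t = indicat_real {0..} t *\<^sub>R ((1 / (2 * pi)) *\<^sub>R (\<integral>y. \<phi> y * exp (Complex (- \<mu>) y * of_real t) \<partial>lborel))" for t :: real
  have [measurable]: "(%y. Complex (- \<mu>) y) \<in> borel_fun" 
    by (simp add: Complex_eq)
  have [measurable]: "k \<in> borel_fun" unfolding k_def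
    by (intro borel_measurable_scaleR borel_measurable_const lborel.borel_measurable_lebesgue_integral) measurable
  have kb: "norm (k t) \<le> indicat_real {0..} t * (b / 2 * exp (- \<mu> * t))" for t
  proof -
    have "norm (\<integral>y. \<phi> y * exp (Complex (- \<mu>) y * of_real t) \<partial>lborel) \<le> (\<integral>y. b * (1 / (1 + y\<^sup>2)) * exp (- \<mu> * t) \<partial>lborel)"
      by (rule Bochner_Integration.integral_norm_bound_integral)
        (use mult_right_mono[OF \<phi>b, of "exp (- (\<mu> * t))"] order_trans[OF mult_right_mono[OF \<phi>b, of "exp (- (\<mu> * t))"] abs_ge_self]
         in \<open>auto simp: norm_mult intro!: integrable_mult_left \<phi>i[simplified]
           Bochner_Integration.integrable_bound[OF integrable_mult_left[OF \<phi>i, of "exp (- \<mu> * t)"]]\<close>)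
    also have "\<dots> = b * pi * exp (- \<mu> * t)"
      using integral_Lorentz by (simp only: integral_mult_left_zero integral_mult_right_zero)
    finally show ?thesis unfolding k_def by (auto simp: indicator_def field_simps)
  qed
  have "LS {0..} \<nu> (b / (\<nu>' - \<nu>)) (%z. \<integral>t. k t * exp (- (z * of_real t)) \<partial>lborel)"
  proof (rule LS_density)
    have "(\<integral>\<^sup>+t. ennreal (norm (k t) * exp (\<nu> * t)) \<partial>lborel) \<le> (\<integral>\<^sup>+t. ennreal (b / 2) * ennreal (indicat_real {0..} t * exp (- ((\<mu> - \<nu>) * t))) \<partial>lborel)"
    proof (rule nn_integral_mono)
      fix t :: real
      have "norm (k t) * exp (\<nu> * t) \<le> indicat_real {0..} t * (b / 2 * exp (- \<mu> * t)) * exp (\<nu> * t)"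
        by (intro mult_right_mono kb) auto
      also have "\<dots> = b / 2 * (indicat_real {0..} t * exp (- ((\<mu> - \<nu>) * t)))"
        by (simp add: mult_exp_exp algebra_simps)
      finally show "ennreal (norm (k t) * exp (\<nu> * t)) \<le> ennreal (b / 2) * ennreal (indicat_real {0..} t * exp (- ((\<mu> - \<nu>) * t)))"
        using b0 by (simp add: ennreal_mult[symmetric] ennreal_leI)
    qed
    also have "\<dots> = ennreal (b / 2) * ennreal (1 / (\<mu> - \<nu>))"
      using nn_integral_exp_half_line[of "\<mu> - \<nu>"] \<mu> by (subst nn_integral_cmult) auto
    also have "\<dots> = ennreal (b / (\<nu>' - \<nu>))"
      using b0 \<mu> by (simp add: ennreal_mult[symmetric])
    finally show "(\<integral>\<^sup>+t. ennreal (norm (k t) * exp (\<nu> * t)) \<partial>lborel) \<le> ennreal (b / (\<nu>' - \<nu>))" .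
  qed (use b0 \<nu> in \<open>auto simp: k_def\<close>)
  moreover have "f z = (\<integral>t. k t * exp (- (z * of_real t)) \<partial>lborel)" if z: "- \<nu> \<le> Re z" for z
  proof -
    have z': "- \<mu> < Re z" using z \<mu> by simp
    let ?F = "%(t, y). indicat_real {0..} t *\<^sub>R (\<phi> y * exp (- ((z - Complex (- \<mu>) y) * of_real t)))"
    have int: "integrable (lborel \<Otimes>\<^sub>M lborel) ?F"
    proof (rule lborel_pair.integrable_pair_product_bound)
      show "integrable lborel (%t. indicat_real {0..} t * exp (- ((Re z + \<mu>) * t)))" using z' by (intro integrable_exp_half_line) simp
      show "integrable lborel (%y. b * (1 / (1 + y\<^sup>2)))" by fact
      show "norm (?F (t, y)) \<le> indicat_real {0..} t * exp (- ((Re z + \<mu>) * t)) * (b * (1 / (1 + y\<^sup>2)))" for t y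
        using mult_right_mono[OF \<phi>b[of y], of "exp (- ((Re z + \<mu>) * t))"]
        by (auto simp: norm_mult indicator_def mult.commute)
    qed (use b0 in auto)
    have in1: "(\<integral>t. ?F (t, y) \<partial>lborel) = \<phi> y / (z - Complex (- \<mu>) y)" for y
    proof -
      have "(\<integral>t. ?F (t, y) \<partial>lborel) = (\<integral>t. \<phi> y * (indicat_real {0..} t *\<^sub>R exp (- ((z - Complex (- \<mu>) y) * of_real t))) \<partial>lborel)"
        by (intro Bochner_Integration.integral_cong) auto
      also have "\<dots> = \<phi> y / (z - Complex (- \<mu>) y)"
        using z' by (subst integral_mult_right_zero, subst integral_cexp_half_line) auto
      finally show ?thesis .
    qed
    have "(\<integral>t. k t * exp (- (z * of_real t)) \<partial>lborel) = (1 / (2 * pi)) *\<^sub>R (\<integral>t. \<integral>y. ?F (t, y) \<partial>lborel \<partial>lborel)"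
    proof (subst integral_scaleR_right[symmetric], rule Bochner_Integration.integral_cong[OF refl])
      fix t :: real
      have "(\<integral>y. ?F (t, y) \<partial>lborel) = indicat_real {0..} t *\<^sub>R ((\<integral>y. \<phi> y * exp (Complex (- \<mu>) y * of_real t) \<partial>lborel) * exp (- (z * of_real t)))"
      proof -
        have "exp (- ((z - Complex (- \<mu>) y) * of_real t)) = exp (Complex (- \<mu>) y * of_real t) * exp (- (z * of_real t))" for y
          unfolding mult_exp_exp by (simp add: algebra_simps)
        then show ?thesis unfolding integral_mult_left_zero[symmetric] by (simp add: mult.assoc)
      qed
      then show "k t * exp (- (z * of_real t)) = (1 / (2 * pi)) *\<^sub>R (\<integral>y. ?F (t, y) \<partial>lborel)"
        by (simp only: k_def) (simp add: scaleR_conv_of_real)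
    qed
    also have "(\<integral>t. \<integral>y. ?F (t, y) \<partial>lborel \<partial>lborel) = (\<integral>y. \<integral>t. ?F (t, y) \<partial>lborel \<partial>lborel)"
      using lborel_pair.Fubini_integral[OF int] by simp
    also have "\<dots> = (\<integral>y. \<phi> y / (z - Complex (- \<mu>) y) \<partial>lborel)"
      by (intro Bochner_Integration.integral_cong refl in1)
    also have "\<dots> = 2 * pi * f z"
      unfolding \<phi>_def by (rule half_plane_Cauchy[OF f b]) (use \<mu> z' in auto)
    finally show ?thesis by (simp add: scaleR_conv_of_real)
  qed
  ultimately show ?thesis by (rule LS_cong)
qed


text \<open>The mean over $[-R,R]$ of a character tends to $0$ unless the character is trivial.  This is how a single frequency is singled out.\<close>

lemma mean_exp_imaginary:
  fixes x :: real
  assumes R: "0 < R"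
  shows "norm (\<integral>y. indicat_real {- R..R} y *\<^sub>R exp (Complex 0 y * of_real x) \<partial>lborel) \<le> 2 * R"
    and "x \<noteq> 0 ==> norm (\<integral>y. indicat_real {- R..R} y *\<^sub>R exp (Complex 0 y * of_real x) \<partial>lborel) \<le> 2 / \<bar>x\<bar>"
proof -
  let ?I = "\<integral>y. indicat_real {- R..R} y *\<^sub>R exp (Complex 0 y * of_real x) \<partial>lborel"
  let ?p = "linepath (Complex 0 (- R)) (Complex 0 R)"
  have "contour_integral ?p (%z. exp (z * of_real x)) = \<i> * ?I"
    by (rule vertical_contour_integral[OF R]) (auto intro!: continuous_intros)
  then have n: "norm ?I = norm (contour_integral ?p (%z. exp (z * of_real x)))" by (simp add: norm_mult)
  have "norm (contour_integral ?p (%z. exp (z * of_real x))) \<le> 1 * norm (Complex 0 R - Complex 0 (- R))"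
    by (rule contour_integral_bound_linepath_continuous) (auto intro!: continuous_intros simp: closed_segment_same_Re)
  also have "norm (Complex 0 R - Complex 0 (- R)) = 2 * R" using R by (simp add: cmod_def real_sqrt_mult)
  finally show "norm ?I \<le> 2 * R" unfolding n by simp
  assume x: "x \<noteq> 0"
  have "((%z. exp (z * of_real x)) has_contour_integral (exp (pathfinish ?p * of_real x) / of_real x - exp (pathstart ?p * of_real x) / of_real x)) ?p"
    by (rule contour_integral_primitive[of UNIV "%z. exp (z * of_real x) / of_real x"]) (use x in \<open>auto intro!: derivative_eq_intros\<close>)
  then have "contour_integral ?p (%z. exp (z * of_real x)) = exp (Complex 0 R * of_real x) / of_real x - exp (Complex 0 (- R) * of_real x) / of_real x"
    by (simp add: contour_integral_unique)
  then have "norm ?I \<le> norm (exp (Complex 0 R * of_real x) / of_real x) + norm (exp (Complex 0 (- R) * of_real x) / of_real x)"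
    unfolding n by (simp only: norm_triangle_ineq4)
  then show "norm ?I \<le> 2 / \<bar>x\<bar>" by (simp add: norm_divide)
qed

text \<open>Bohr's formula: the mass that a measure puts on a point is the mean value of its transform times the conjugate character along a vertical line.
  Moving the line to the left, as far as \<open>f\<close> stays bounded, makes the mean value, hence the mass, exponentially small in the point.\<close>

lemma discrete_coefficient_bound:
  fixes f :: "complex => complex"
  assumes f: "f holomorphic_on {z. - \<nu>' < Re z}" and b: "\<And>z. - \<nu>' < Re z ==> norm (f z) \<le> b"
    and M: "law S M" and fin: "absint M (%t. ennreal (exp (- (\<sigma> * t)))) < \<infinity>"
    and eq: "\<And>z. \<sigma> \<le> Re z ==> f z = pairing M (lap z)"
    and \<mu>: "\<mu> < \<nu>'" "- \<mu> < \<sigma>"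
  shows "norm (pairing M (%t. of_bool (t = lam))) \<le> b * exp (- (\<mu> * lam))"
proof -
  interpret M: prob_space M using M by (simp add: law_def)
  interpret P: pair_sigma_finite M lborel ..
  have s[measurable_cong]: "sets M = sets borel" using M by (simp add: law_def)
  have int0: "integrable M (%x. norm (snd x) * exp (- (\<sigma> * fst x)))"
    using fin by (intro integrableI_nonneg) (auto simp: absint_def ennreal_mult')
  define g where "g z = f z * exp (z * of_real lam)" for z
  have gh: "g holomorphic_on {z. - \<nu>' < Re z}" unfolding g_def by (intro holomorphic_intros f)
  note gc = holomorphic_on_imp_continuous_on[OF gh]
  have b0: "0 \<le> b" using b[of "of_real \<sigma>"] \<mu> norm_ge_zero[of "f (of_real \<sigma>)"] by (simp del: norm_ge_zero)
  define J where "J \<beta> R = (\<integral>y. indicat_real {- R..R} y *\<^sub>R g (Complex \<beta> y) \<partial>lborel)" for \<beta> R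
  define E where "E R x = (\<integral>y. indicat_real {- R..R} y *\<^sub>R exp (Complex 0 y * of_real x) \<partial>lborel)" for R x :: real
  define H where "H = b * max (exp (- (\<mu> * lam))) (exp (\<sigma> * lam))"
  have gH: "norm (g z) \<le> H" if "- \<mu> \<le> Re z" "Re z \<le> \<sigma>" for z
  proof -
    have "exp (Re z * lam) \<le> max (exp (- (\<mu> * lam))) (exp (\<sigma> * lam))"
      using mult_right_mono[OF that(1), of lam] mult_right_mono[OF that(2), of lam] mult_right_mono_neg[OF that(1), of lam]
        mult_right_mono_neg[OF that(2), of lam]
      by (cases "0 \<le> lam") (auto simp: le_max_iff_disj)
    then show ?thesis unfolding g_def H_def norm_mult using b[of z] that \<mu> b0 by (intro mult_mono) auto
  qed
  have shift: "norm (J \<sigma> R) \<le> 2 * R * (b * exp (- (\<mu> * lam))) + 2 * H * (\<sigma> + \<mu>)" if R: "0 < R" for R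
  proof -
    let ?p = "rectpath (Complex (- \<mu>) (- R)) (Complex \<sigma> R)"
    have V: "contour_integral (linepath (Complex \<beta> (- R)) (Complex \<beta> R)) g = \<i> * J \<beta> R" if "- \<nu>' < \<beta>" for \<beta>
      unfolding J_def by (rule vertical_contour_integral[OF R continuous_on_subset[OF gc]]) (use that in auto)
    have "path_image ?p \<subseteq> cbox (Complex (- \<mu>) (- R)) (Complex \<sigma> R)"
      using R \<mu> by (intro path_image_rectpath_subset_cbox) auto
    then have pi: "path_image ?p \<subseteq> {w. - \<nu>' < Re w}" using \<mu> by (auto simp: in_cbox_complex_iff)
    have "(g has_contour_integral 0) ?p"
      by (rule Cauchy_theorem_convex_simple[OF gh convex_right_half_plane _ pi]) auto
    from rectangle_vertical_sides[OF _ _ continuous_on_subset[OF gc pi] this, of H]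
    have "norm (\<i> * J \<sigma> R - \<i> * J (- \<mu>) R) \<le> 2 * H * (\<sigma> + \<mu>)"
      using R \<mu> gH V[of \<sigma>] V[of "- \<mu>"] by simp
    then have 1: "norm (J \<sigma> R - J (- \<mu>) R) \<le> 2 * H * (\<sigma> + \<mu>)" 
      by (simp add: right_diff_distrib[symmetric] norm_mult del: right_diff_distrib)
    have "norm (\<i> * J (- \<mu>) R) \<le> b * exp (- (\<mu> * lam)) * norm (Complex (- \<mu>) R - Complex (- \<mu>) (- R))"
      unfolding V[of "- \<mu>", symmetric, simplified, OF \<mu>(1)]
    proof (rule contour_integral_bound_linepath_continuous)
      show "continuous_on (closed_segment (Complex (- \<mu>) (- R)) (Complex (- \<mu>) R)) g"
        by (rule continuous_on_subset[OF gc]) (use \<mu> in \<open>auto simp: closed_segment_same_Re\<close>)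
      show "norm (g z) \<le> b * exp (- (\<mu> * lam))" if "z \<in> closed_segment (Complex (- \<mu>) (- R)) (Complex (- \<mu>) R)" for z
        using that b[of z] \<mu> by (auto simp: g_def norm_mult closed_segment_same_Re intro!: mult_mono)
    qed
    moreover have "norm (Complex (- \<mu>) R - Complex (- \<mu>) (- R)) = 2 * R" using R by (simp add: cmod_def real_sqrt_mult)
    ultimately have "norm (J (- \<mu>) R) \<le> 2 * R * (b * exp (- (\<mu> * lam)))" by (simp add: norm_mult mult_ac)
    with 1 show ?thesis using norm_triangle_ineq2[of "J \<sigma> R" "J (- \<mu>) R"] by linarith
  qed
  have Jeq: "J \<sigma> R = pairing M (%t. exp (of_real (\<sigma> * (lam - t))) * E R (lam - t))" for R
  proof -
    let ?F = "%(x, y). indicat_real {- R..R} y *\<^sub>R (snd x * exp (Complex \<sigma> y * of_real (lam - fst x)))"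
    have [measurable]: "(%y. Complex \<sigma> y) \<in> borel_fun" by (simp add: Complex_eq)
    have int: "integrable (M \<Otimes>\<^sub>M lborel) ?F"
    proof (rule P.integrable_pair_product_bound)
      show "integrable M (%x. norm (snd x) * exp (- (\<sigma> * fst x)))" by fact
      show "integrable lborel (%y. indicat_real {- R..R} y * exp (\<sigma> * lam))"
        by (intro integrable_mult_left) (simp add: emeasure_lborel_Icc_eq)
      show "norm (?F (x, y)) \<le> norm (snd x) * exp (- (\<sigma> * fst x)) * (indicat_real {- R..R} y * exp (\<sigma> * lam))" for x y
        by (auto simp: indicator_def norm_mult algebra_simps mult_exp_exp)
    qed auto
    have "J \<sigma> R = (\<integral>y. \<integral>x. ?F (x, y) \<partial>M \<partial>lborel)"
      unfolding J_def
    proof (intro Bochner_Integration.integral_cong refl)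
      fix y
      have "g (Complex \<sigma> y) = (\<integral>x. snd x * exp (- (Complex \<sigma> y * of_real (fst x))) * exp (Complex \<sigma> y * of_real lam) \<partial>M)"
        unfolding g_def using eq[of "Complex \<sigma> y"] by (simp add: pairing_def)
      also have "\<dots> = (\<integral>x. snd x * exp (Complex \<sigma> y * of_real (lam - fst x)) \<partial>M)"
        by (simp add: mult.assoc mult_exp_exp right_diff_distrib)
      finally show "indicat_real {- R..R} y *\<^sub>R g (Complex \<sigma> y) = (\<integral>x. ?F (x, y) \<partial>M)" by simp
    qed
    also have "\<dots> = (\<integral>x. \<integral>y. ?F (x, y) \<partial>lborel \<partial>M)"
      using P.Fubini_integral[OF int] by simp
    also have "\<dots> = pairing M (%t. exp (of_real (\<sigma> * (lam - t))) * E R (lam - t))"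
      unfolding pairing_def
    proof (intro Bochner_Integration.integral_cong refl)
      fix x :: "real \<times> complex"
      have "exp (Complex \<sigma> y * of_real (lam - fst x)) = exp (of_real (\<sigma> * (lam - fst x))) * exp (Complex 0 y * of_real (lam - fst x))" for y
        unfolding exp_add[symmetric] by (rule arg_cong[where f = exp]) (simp add: complex_eq_iff)
      then have "?F (x, y) = (snd x * exp (of_real (\<sigma> * (lam - fst x)))) * (indicat_real {- R..R} y *\<^sub>R exp (Complex 0 y * of_real (lam - fst x)))" for y
        by (simp only: split scaleR_conv_of_real mult_ac)
      then have "(\<integral>y. ?F (x, y) \<partial>lborel) = (\<integral>y. (snd x * exp (of_real (\<sigma> * (lam - fst x)))) * (indicat_real {- R..R} y *\<^sub>R exp (Complex 0 y * of_real (lam - fst x))) \<partial>lborel)"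
        by (intro Bochner_Integration.integral_cong) auto
      then show "(\<integral>y. ?F (x, y) \<partial>lborel) = snd x * (exp (of_real (\<sigma> * (lam - fst x))) * E R (lam - fst x))"
        unfolding E_def integral_mult_right_zero by (simp only: mult.assoc)
    qed
    finally show ?thesis .
  qed
  have Emeas: "E R \<in> borel_fun" for R
    unfolding E_def by (intro lborel.borel_measurable_lebesgue_integral) (simp add: Complex_eq)
  have "((%R. \<integral>x. snd x * (exp (of_real (\<sigma> * (lam - fst x))) * E R (lam - fst x)) / (2 * R) \<partial>M) \<longlongrightarrow> 
     (\<integral>x. snd x * of_bool (fst x = lam) \<partial>M)) at_top"
  proof (rule integral_dominated_convergence_at_top[where w = "%x. norm (snd x) * exp (- (\<sigma> * fst x)) * exp (\<sigma> * lam)"])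
    show "integrable M (%x. norm (snd x) * exp (- (\<sigma> * fst x)) * exp (\<sigma> * lam))" using int0 by (rule integrable_mult_left)
    show "\<forall>\<^sub>F R in at_top. AE x in M. norm (snd x * (exp (of_real (\<sigma> * (lam - fst x))) * E R (lam - fst x)) / (2 * R)) \<le> norm (snd x) * exp (- (\<sigma> * fst x)) * exp (\<sigma> * lam)"
      using eventually_gt_at_top[of 0]
    proof eventually_elim
      case (elim R)
      show ?case
      proof (rule AE_I2)
        fix x
        have "norm (snd x * (exp (of_real (\<sigma> * (lam - fst x))) * E R (lam - fst x)) / (2 * R)) = 
          norm (snd x) * (exp (- (\<sigma> * fst x)) * exp (\<sigma> * lam)) * (norm (E R (lam - fst x)) / (2 * R))"
          using elim by (simp add: norm_mult norm_divide mult_exp_exp algebra_simps)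
        also have "\<dots> \<le> norm (snd x) * (exp (- (\<sigma> * fst x)) * exp (\<sigma> * lam)) * 1"
          using mean_exp_imaginary(1)[OF elim, of "lam - fst x", folded E_def] elim by (intro mult_left_mono) (auto simp del: of_real_diff)
        finally show "norm (snd x * (exp (of_real (\<sigma> * (lam - fst x))) * E R (lam - fst x)) / (2 * R)) \<le> norm (snd x) * exp (- (\<sigma> * fst x)) * exp (\<sigma> * lam)" 
          by (simp add: mult_ac)
      qed
    qed
    show "AE x in M. ((%R. snd x * (exp (of_real (\<sigma> * (lam - fst x))) * E R (lam - fst x)) / (2 * R)) \<longlongrightarrow> snd x * of_bool (fst x = lam)) at_top"
    proof (rule AE_I2)
      fix x :: "real \<times> complex"
      have "((%R. E R (lam - fst x) / (2 * R)) \<longlongrightarrow> of_bool (fst x = lam)) at_top"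
      proof (cases "fst x = lam")
        case True
        have "\<forall>\<^sub>F R in at_top. E R (lam - fst x) / (2 * R) = 1"
          using eventually_gt_at_top[of 0] by eventually_elim (simp add: True E_def scaleR_conv_of_real)
        then show ?thesis using True by (simp add: tendsto_eventually)
      next
        case False
        have "((%R. E R (lam - fst x) / (2 * R)) \<longlongrightarrow> 0) at_top"
        proof (rule Lim_null_comparison)
          show "\<forall>\<^sub>F R in at_top. norm (E R (lam - fst x) / (2 * R)) \<le> 2 / \<bar>lam - fst x\<bar> / (2 * R)"
            using eventually_gt_at_top[of 0]
          proof eventually_elim
            case (elim R)
            show ?case using mean_exp_imaginary(2)[OF elim, of "lam - fst x"] False elim
              unfolding E_def norm_divide by (intro frac_le) auto
          qed
          show "((%R. 2 / \<bar>lam - fst x\<bar> / (2 * R)) \<longlongrightarrow> 0) at_top" by real_asymp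
        qed
        then show ?thesis using False by simp
      qed
      from tendsto_mult[OF tendsto_const[of "snd x * exp (of_real (\<sigma> * (lam - fst x)))"] this]
      show "((%R. snd x * (exp (of_real (\<sigma> * (lam - fst x))) * E R (lam - fst x)) / (2 * R)) \<longlongrightarrow> snd x * of_bool (fst x = lam)) at_top"
        by (cases "fst x = lam") (simp_all add: mult.assoc)
    qed
  next
    note Emeas[measurable]
    show "(%x. snd x * of_bool (fst x = lam)) \<in> borel_measurable M" by measurable
    show "(%x. snd x * (exp (of_real (\<sigma> * (lam - fst x))) * E R (lam - fst x)) / (2 * R)) \<in> borel_measurable M" for R
      by measurable
  qed
  then have lim: "((%R. norm (J \<sigma> R / (2 * R))) \<longlongrightarrow> norm (pairing M (%t. of_bool (t = lam)))) at_top"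
    unfolding Jeq pairing_def by (intro tendsto_norm) simp
  have lim2: "((%R. b * exp (- (\<mu> * lam)) + 2 * H * (\<sigma> + \<mu>) / (2 * R)) \<longlongrightarrow> b * exp (- (\<mu> * lam))) at_top"
    by real_asymp
  show ?thesis
  proof (rule tendsto_le[OF _ lim2 lim])
    show "\<forall>\<^sub>F R in at_top. norm (J \<sigma> R / (2 * R)) \<le> b * exp (- (\<mu> * lam)) + 2 * H * (\<sigma> + \<mu>) / (2 * R)"
      using eventually_gt_at_top[of 0]
    proof eventually_elim
      case (elim R)
      show ?case using shift[OF elim] elim by (simp add: norm_divide field_simps)
    qed
  qed simp
qed


text \<open>For a purely atomic measure a sup bound on the transform in a larger half-plane controls each atom by the previous lemma.  When the exponents are so sparse that
  $\sum_x e^{-\eta x}$ converges, these bounds can be summed.  The constant is linear in the sup bound, which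
  is what makes the estimate useful for high powers.\<close>

lemma LS_discrete:
  fixes f :: "complex => complex"
  assumes f: "f holomorphic_on {z. - \<nu>' < Re z}" and b: "\<And>z. - \<nu>' < Re z ==> norm (f z) \<le> b"
    and L: "LS \<Lambda> (- \<sigma>) B f" and \<Lambda>: "\<Lambda> \<subseteq> {0..}" "countable \<Lambda>" and \<nu>: "\<nu> < \<nu>'"
    and K: "\<And>F. finite F ==> F \<subseteq> \<Lambda> ==> (\<Sum>x\<in>F. exp (- ((\<nu>' - \<nu>) / 3 * x))) \<le> K"
  shows "LS {0..} \<nu> (b * K) f"
proof -
  define \<eta> where "\<eta> = (\<nu>' - \<nu>) / 3"
  define \<mu> where "\<mu> = \<nu> + 2 * \<eta>"
  have \<eta>: "0 < \<eta>" "\<mu> < \<nu>'" using \<nu> by (auto simp: \<eta>_def \<mu>_def field_simps)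
  define \<sigma>' where "\<sigma>' = max \<sigma> (1 - \<mu>)"
  have \<sigma>': "- \<mu> < \<sigma>'" "\<sigma> \<le> \<sigma>'" by (auto simp: \<sigma>'_def)
  obtain M where M: "law \<Lambda> M" and MB: "absint M (%t. ennreal (exp (- \<sigma> * t))) \<le> ennreal B"
    and Meq: "\<And>z. \<sigma> \<le> Re z ==> f z = pairing M (lap z)" 
    using L by (auto simp: LS_def)
  have AES: "AE x in M. fst x \<in> \<Lambda>" using M by (simp add: law_def)
  have "absint M (%t. ennreal (exp (- (\<sigma>' * t)))) \<le> absint M (%t. ennreal (exp (- \<sigma> * t)))"
    by (rule absint_mono[OF M]) (use \<Lambda> \<sigma>' in \<open>auto intro!: ennreal_leI mult_right_mono\<close>)
  then have fin: "absint M (%t. ennreal (exp (- (\<sigma>' * t)))) < \<infinity>" using MB by (simp add: order.strict_trans1)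
  have [measurable_cong]: "sets M = sets borel" using M by (simp add: law_def)
  have int0: "integrable M (%x. norm (snd x) * exp (- (\<sigma>' * fst x)))"
    using fin by (intro integrableI_nonneg) (auto simp: absint_def ennreal_mult')
  have b0: "0 \<le> b" using b[of "of_real \<sigma>'"] \<sigma>' \<eta> norm_ge_zero[of "f (of_real \<sigma>')"] by (simp del: norm_ge_zero)
  define e where "e = from_nat_into \<Lambda>"
  define I where "I = to_nat_on \<Lambda> ` \<Lambda>"
  have eI: "e i \<in> \<Lambda>" if "i \<in> I" for i using that \<Lambda>(2) by (auto simp: e_def I_def)
  have inj: "inj_on e I" using \<Lambda>(2) by (auto simp: e_def I_def inj_on_def)
  have surj: "\<exists>i\<in>I. e i = t" if "t \<in> \<Lambda>" for t using that \<Lambda>(2) by (auto simp: e_def I_def)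
  define c where "c i = (if i \<in> I then pairing M (%t. of_bool (t = e i)) else 0)" for i
  define D where "D i = (if i \<in> I then b * exp (- (\<eta> * e i)) else 0)" for i
  have c: "norm (c i) * exp ((\<nu> + \<eta>) * e i) \<le> D i" for i
  proof (cases "i \<in> I")
    case True
    have "norm (c i) \<le> b * exp (- (\<mu> * e i))"
      using discrete_coefficient_bound[OF f b M fin _ \<eta>(2) \<sigma>'(1), of "e i"] Meq \<sigma>'(2) True by (simp add: c_def)
    then have "norm (c i) * exp ((\<nu> + \<eta>) * e i) \<le> b * exp (- (\<mu> * e i)) * exp ((\<nu> + \<eta>) * e i)"
      by (rule mult_right_mono) simp
    also have "\<dots> = b * exp (- (\<eta> * e i))" by (simp add: mult.assoc mult_exp_exp \<mu>_def algebra_simps)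
    finally show ?thesis using True by (simp add: D_def)
  qed (simp add: c_def D_def)
  have LSi: "LS {0..} (\<nu> + \<eta>) (D i) (%z. c i * exp (- (z * of_real (e i))))" for i
  proof (cases "i \<in> I")
    case True
    then show ?thesis using eI[OF True] \<Lambda>(1) by (intro LS_le[OF LS_exp c]) auto
  next
    case False
    then have "c i = 0" "D i = 0" by (simp_all add: c_def D_def)
    then show ?thesis by (simp add: LS_zero)
  qed
  have D0: "0 \<le> D i" for i using b0 by (simp add: D_def)
  have part: "(\<Sum>i<n. D i) \<le> b * K" for n
  proof -
    have "(\<Sum>i<n. D i) = (\<Sum>i\<in>{..<n} \<inter> I. b * exp (- (\<eta> * e i)))"
      by (simp add: D_def sum.If_cases)
    also have "\<dots> = b * (\<Sum>x\<in>e ` ({..<n} \<inter> I). exp (- (\<eta> * x)))"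
      by (subst sum.reindex) (auto intro: inj_on_subset[OF inj] simp: sum_distrib_left)
    also have "\<dots> \<le> b * K" using eI b0 by (intro mult_left_mono K[folded \<eta>_def]) auto
    finally show ?thesis .
  qed
  have sD: "summable D" by (rule summableI_nonneg_bounded[OF D0 part])
  have le: "(\<Sum>i. D i) \<le> b * K" by (rule suminf_le_const[OF sD part])
  define g where "g z = (\<Sum>i. c i * exp (- (z * complex_of_real (e i))))" for z
  have g: "LS {0..} (\<nu> + \<eta>) (\<Sum>i. D i) g" unfolding g_def by (rule LS_suminf[OF LSi _ sD]) simp
  have eq1: "f z = g z" if z: "\<sigma>' \<le> Re z" for z
  proof -
    define G where "G i x = snd x * (if i \<in> I \<and> fst x = e i then exp (- (z * complex_of_real (e i))) else 0)" for i and x :: "real \<times> complex"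
    have Gm[measurable]: "G i \<in> borel_measurable M" for i unfolding G_def by measurable
    have one: "\<exists>j\<in>I. fst x = e j \<and> (\<forall>i. i \<noteq> j --> G i x = 0) \<and> G j x = snd x * exp (- (z * complex_of_real (fst x)))" if x\<Lambda>: "fst x \<in> \<Lambda>" for x
    proof -
      obtain i where i: "i \<in> I" "e i = fst x" using surj[OF x\<Lambda>] by blast
      show ?thesis using i inj by (intro bexI[of _ i]) (auto simp: G_def inj_on_def)
    qed
    have bd: "(\<Sum>i<n. norm (G i x)) \<le> norm (snd x) * exp (- (\<sigma>' * fst x))" if x: "fst x \<in> \<Lambda>" for x n
    proof -
      obtain j where j: "\<forall>i. i \<noteq> j --> G i x = 0" "G j x = snd x * exp (- (z * complex_of_real (fst x)))" using one[OF x] by blast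
      have "(\<Sum>i<n. norm (G i x)) = (\<Sum>i\<in>{..<n} \<inter> {j}. norm (G i x))"
        using j(1) by (intro sum.mono_neutral_right) auto
      also have "\<dots> \<le> norm (G j x)" by (cases "j < n") auto
      also have "\<dots> \<le> norm (snd x) * exp (- (\<sigma>' * fst x))"
        unfolding j(2) using x \<Lambda>(1) z by (auto simp: norm_mult intro!: mult_left_mono mult_right_mono)
      finally show ?thesis .
    qed
    have int: "integrable M (G i)" for i
    proof (rule Bochner_Integration.integrable_bound[OF int0 Gm])
      show "AE x in M. norm (G i x) \<le> norm (norm (snd x) * exp (- (\<sigma>' * fst x)))"
        using AES
      proof eventually_elim
        case (elim x)
        have "norm (G i x) \<le> (\<Sum>k<Suc i. norm (G k x))" by (rule member_le_sum) auto
        also have "\<dots> \<le> norm (snd x) * exp (- (\<sigma>' * fst x))" by (rule bd[OF elim])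
        finally show ?case by simp
      qed
    qed
    have "(%i. \<integral>x. G i x \<partial>M) sums (\<integral>x. (\<Sum>i. G i x) \<partial>M)"
    proof (rule sums_integral[OF int])
      show "AE x in M. summable (%i. norm (G i x))"
        using AES by eventually_elim (rule summableI_nonneg_bounded[OF _ bd], auto)
      show "summable (%i. \<integral>x. norm (G i x) \<partial>M)"
      proof (rule summableI_nonneg_bounded)
        fix n
        have "(\<Sum>i<n. \<integral>x. norm (G i x) \<partial>M) = (\<integral>x. (\<Sum>i<n. norm (G i x)) \<partial>M)"
          using int by (subst Bochner_Integration.integral_sum) auto
        also have "\<dots> \<le> (\<integral>x. norm (snd x) * exp (- (\<sigma>' * fst x)) \<partial>M)"
          using AES bd int int0 by (intro integral_mono_AE) (auto elim!: eventually_mono)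
        finally show "(\<Sum>i<n. \<integral>x. norm (G i x) \<partial>M) \<le> (\<integral>x. norm (snd x) * exp (- (\<sigma>' * fst x)) \<partial>M)" .
      qed auto
    qed
    moreover have "(\<integral>x. G i x \<partial>M) = c i * exp (- (z * complex_of_real (e i)))" for i
    proof (cases "i \<in> I")
      case True
      then have "(\<integral>x. G i x \<partial>M) = (\<integral>x. snd x * of_bool (fst x = e i) * exp (- (z * complex_of_real (e i))) \<partial>M)"
        by (intro Bochner_Integration.integral_cong) (auto simp: G_def)
      then show ?thesis using True by (simp add: c_def pairing_def)
    qed (simp add: G_def c_def)
    moreover have "(\<integral>x. (\<Sum>i. G i x) \<partial>M) = f z"
    proof -
      have "AE x in M. (\<Sum>i. G i x) = snd x * exp (- (z * complex_of_real (fst x)))"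
        using AES
      proof eventually_elim
        case (elim x)
        then obtain j where j: "\<forall>i. i \<noteq> j --> G i x = 0" "G j x = snd x * exp (- (z * complex_of_real (fst x)))" using one by blast
        have "(%i. G i x) sums (\<Sum>i\<in>{j}. G i x)" using j(1) by (intro sums_finite) auto
        then show ?case using j(2) by (simp add: sums_iff)
      qed
      then have "(\<integral>x. (\<Sum>i. G i x) \<partial>M) = (\<integral>x. snd x * exp (- (z * complex_of_real (fst x))) \<partial>M)"
        by (intro integral_cong_AE) auto
      then show ?thesis using Meq[of z] z \<sigma>' by (simp add: pairing_def)
    qed
    ultimately show ?thesis unfolding g_def by (simp add: sums_iff)
  qed
  have sub: "{z. max \<sigma>' (- (\<nu> + \<eta>)) < Re z} \<subseteq> {z. - (\<nu> + \<eta>) < Re z}" by auto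
  have ne: "{z. max \<sigma>' (- (\<nu> + \<eta>)) < Re z} \<noteq> {}"
  proof -
    have "of_real (max \<sigma>' (- (\<nu> + \<eta>)) + 1) \<in> {z. max \<sigma>' (- (\<nu> + \<eta>)) < Re z}" by (simp del: max_less_iff_conj add: less_add_one)
    then show ?thesis by blast
  qed
  have "f z = g z" if "- (\<nu> + \<eta>) < Re z" for z
  proof (rule analytic_continuation_open[OF open_right_half_plane open_right_half_plane ne convex_connected[OF convex_right_half_plane] sub, where f = f and g = g])
    show "f holomorphic_on {z. - (\<nu> + \<eta>) < Re z}"
      by (rule holomorphic_on_subset[OF f]) (use \<eta> in \<open>auto simp: \<mu>_def\<close>)
    show "g holomorphic_on {z. - (\<nu> + \<eta>) < Re z}" using LS_holomorphic[OF g] by simp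
  qed (use that eq1 in auto)
  then show ?thesis using \<eta> by (intro LS_mono[OF g _ _ _ _ le]) auto
qed

section \<open>Approximating absolutely continuous kernels\<close>

definition Laplace :: "(real => real) => complex => complex" where
  "Laplace h z = (\<integral>t. of_real (h t) * exp (- (z * of_real t)) \<partial>lborel)"

lemma Laplace_integrable:
  assumes "integrable lborel h" "\<And>t. t \<notin> {0..T} ==> h t = 0"
  shows "integrable lborel (%t. complex_of_real (h t) * exp (- (z * of_real t)))"
proof (rule Bochner_Integration.integrable_bound[OF integrable_mult_right[OF assms(1), of "exp (norm z * T)"]])
  show "AE t in lborel. norm (complex_of_real (h t) * exp (- (z * of_real t))) \<le> norm (exp (norm z * T) * h t)"
  proof (rule AE_I2)
    fix t
    show "norm (complex_of_real (h t) * exp (- (z * of_real t))) \<le> norm (exp (norm z * T) * h t)"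
    proof (cases "t \<in> {0..T}")
      case True
      have "- (Re z * t) \<le> norm z * t" using abs_Re_le_cmod[of z] True mult_right_mono[of "- Re z" "norm z" t] by auto
      also have "\<dots> \<le> norm z * T" using True by (intro mult_left_mono) auto
      finally show ?thesis by (simp add: norm_mult abs_mult mult_left_mono mult.commute)
    qed (use assms(2) in auto)
  qed
qed (use assms in auto)

lemma LS_Laplace:
  assumes h: "integrable lborel h" "\<And>t. t \<notin> {0..T} ==> h t = 0" and "0 \<le> T"
  shows "LS {0..} \<nu> (exp (\<bar>\<nu>\<bar> * T) * (\<integral>t. \<bar>h t\<bar> \<partial>lborel)) (Laplace h)"
  unfolding Laplace_def
proof (rule LS_density)
  have "(\<integral>\<^sup>+t. ennreal (norm (complex_of_real (h t)) * exp (\<nu> * t)) \<partial>lborel) \<le> (\<integral>\<^sup>+t. ennreal (exp (\<bar>\<nu>\<bar> * T) * \<bar>h t\<bar>) \<partial>lborel)"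
  proof (rule nn_integral_mono, rule ennreal_leI)
    fix t
    show "norm (complex_of_real (h t)) * exp (\<nu> * t) \<le> exp (\<bar>\<nu>\<bar> * T) * \<bar>h t\<bar>"
    proof (cases "t \<in> {0..T}")
      case True
      have "\<nu> * t \<le> \<bar>\<nu>\<bar> * t" using True by (intro mult_right_mono) auto
      also have "\<dots> \<le> \<bar>\<nu>\<bar> * T" using True by (intro mult_left_mono) auto
      finally show ?thesis by (simp add: mult_left_mono mult.commute)
    qed (use h(2) in auto)
  qed
  also have "\<dots> = ennreal (exp (\<bar>\<nu>\<bar> * T) * (\<integral>t. \<bar>h t\<bar> \<partial>lborel))"
    using h by (subst nn_integral_eq_integral) auto
  finally show "(\<integral>\<^sup>+t. ennreal (norm (complex_of_real (h t)) * exp (\<nu> * t)) \<partial>lborel) \<le> ennreal (exp (\<bar>\<nu>\<bar> * T) * (\<integral>t. \<bar>h t\<bar> \<partial>lborel))" .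
  show "complex_of_real (h t) = 0" if "t \<notin> {0..}" for t using h(2)[of t] that by auto
qed (use h in auto)

interpretation half_line: delay_semigroup "{0..}"
  by unfold_locales auto

text \<open>The densities whose transform is, up to an arbitrarily small measure, a transform with quadratic decay along vertical lines.\<close>

definition decay_approx :: "real => real => (real => real) => bool" where
  "decay_approx \<nu> T h \<longleftrightarrow> integrable lborel h \<and> (\<forall>t. t \<notin> {0..T} --> h t = 0) \<and>
     (\<forall>\<epsilon>>0. \<exists>g C B. LS {0..} \<nu> \<epsilon> (%z. Laplace h z - g z) \<and> LS {0..} \<nu> B g \<and>
        (\<forall>z. - \<nu> \<le> Re z --> norm (g z) \<le> C / (1 + (norm z)\<^sup>2)))"

lemma Laplace_add:
  assumes "decay_approx \<nu> T h" "decay_approx \<nu> T k"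
  shows "Laplace (%t. h t + c * k t) z = Laplace h z + of_real c * Laplace k z"
  unfolding Laplace_def using assms unfolding decay_approx_def
  by (subst integral_mult_right_zero[symmetric], subst Bochner_Integration.integral_add[symmetric])
    (auto intro!: Laplace_integrable integrable_mult_right simp: algebra_simps)

lemma decay_approx_add:
  assumes h: "decay_approx \<nu> T h" and k: "decay_approx \<nu> T k"
  shows "decay_approx \<nu> T (%t. h t + c * k t)"
  unfolding decay_approx_def
proof (intro conjI allI impI)
  show "integrable lborel (%t. h t + c * k t)" using h k by (auto simp: decay_approx_def)
  show "t \<notin> {0..T} ==> h t + c * k t = 0" for t using h k by (auto simp: decay_approx_def)
  fix \<epsilon> :: real assume e: "0 < \<epsilon>"
  obtain g C B where g: "LS {0..} \<nu> (\<epsilon> / 2) (%z. Laplace h z - g z)" "LS {0..} \<nu> B g" 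
    "\<And>z. - \<nu> \<le> Re z ==> norm (g z) \<le> C / (1 + (norm z)\<^sup>2)"
    using h e unfolding decay_approx_def by (metis half_gt_zero)
  have "0 < \<epsilon> / 2 / (\<bar>c\<bar> + 1)" using e by simp
  then obtain g' C' B' where g': "LS {0..} \<nu> (\<epsilon> / 2 / (\<bar>c\<bar> + 1)) (%z. Laplace k z - g' z)" "LS {0..} \<nu> B' g'" 
    "\<And>z. - \<nu> \<le> Re z ==> norm (g' z) \<le> C' / (1 + (norm z)\<^sup>2)"
    using k unfolding decay_approx_def by metis
  have "LS {0..} \<nu> (\<epsilon> / 2 + norm (complex_of_real c) * (\<epsilon> / 2 / (\<bar>c\<bar> + 1))) (%z. (Laplace h z - g z) + of_real c * (Laplace k z - g' z))"
    by (intro LS_add half_line.LS_cmult g g') auto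
  moreover have "\<epsilon> / 2 + norm (complex_of_real c) * (\<epsilon> / 2 / (\<bar>c\<bar> + 1)) \<le> \<epsilon>" 
    using e by (simp add: field_simps)
  ultimately have 1: "LS {0..} \<nu> \<epsilon> (%z. Laplace (%t. h t + c * k t) z - (g z + of_real c * g' z))"
    using LS_le by (fastforce simp: Laplace_add[OF h k] algebra_simps)
  have 2: "LS {0..} \<nu> (B + norm (complex_of_real c) * B') (%z. g z + of_real c * g' z)"
    by (intro LS_add half_line.LS_cmult g g') auto
  have 3: "norm (g z + of_real c * g' z) \<le> (C + \<bar>c\<bar> * C') / (1 + (norm z)\<^sup>2)" if "- \<nu> \<le> Re z" for z
    using norm_triangle_ineq[of "g z" "of_real c * g' z"] g(3)[OF that] mult_left_mono[OF g'(3)[OF that], of "\<bar>c\<bar>"]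
    by (simp add: norm_mult add_divide_distrib)
  show "\<exists>g C B. LS {0..} \<nu> \<epsilon> (%z. Laplace (%t. h t + c * k t) z - g z) \<and> LS {0..} \<nu> B g \<and>
        (\<forall>z. - \<nu> \<le> Re z --> norm (g z) \<le> C / (1 + (norm z)\<^sup>2))"
    using 1 2 3 by (intro exI[of _ "%z. g z + of_real c * g' z"] exI[of _ "C + \<bar>c\<bar> * C'"] exI[of _ "B + norm (complex_of_real c) * B'"] conjI allI impI)
qed

lemma decay_approx_lim:
  assumes s: "\<And>i. decay_approx \<nu> T (s i)" and w: "integrable lborel w" "\<And>i t. \<bar>s i t\<bar> \<le> w t"
    and lim: "\<And>t. (%i. s i t) \<longlonglongrightarrow> h t" and T: "0 \<le> T" and hm[measurable]: "h \<in> borel_fun"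
  shows "decay_approx \<nu> T h"
  unfolding decay_approx_def
proof (intro conjI allI impI)
  have sm[measurable]: "s i \<in> borel_fun" for i using s[of i] by (auto simp: decay_approx_def)
  show ih: "integrable lborel h"
    by (rule integrable_dominated_convergence[OF _ _ w(1), of h s]) (use lim w(2) in auto)
  show h0: "h t = 0" if "t \<notin> {0..T}" for t
    using lim[of t] s that by (simp add: decay_approx_def LIMSEQ_const_iff)
  fix \<epsilon> :: real assume e: "0 < \<epsilon>"
  have "(%i. \<integral>t. \<bar>h t - s i t\<bar> \<partial>lborel) \<longlonglongrightarrow> (\<integral>t. 0 \<partial>(lborel :: real measure))"
  proof (rule integral_dominated_convergence[where w = "%t. w t + \<bar>h t\<bar>"])
    show "integrable lborel (%t. w t + \<bar>h t\<bar>)" using w ih by auto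
    show "AE t in lborel. (%i. \<bar>h t - s i t\<bar>) \<longlonglongrightarrow> 0"
    proof (rule AE_I2)
      fix t
      show "(%i. \<bar>h t - s i t\<bar>) \<longlonglongrightarrow> 0"
        using tendsto_rabs[OF tendsto_diff[OF tendsto_const[of "h t"] lim[of t]]] by simp
    qed
    show "AE t in lborel. norm \<bar>h t - s i t\<bar> \<le> w t + \<bar>h t\<bar>" for i
    proof (rule AE_I2)
      fix t
      show "norm \<bar>h t - s i t\<bar> \<le> w t + \<bar>h t\<bar>" using w(2)[of i t] abs_triangle_ineq4[of "h t" "s i t"] by simp
    qed
  qed auto
  from tendsto_mult[OF tendsto_const[of "exp (\<bar>\<nu>\<bar> * T)"] this]
  have "\<forall>\<^sub>F i in sequentially. exp (\<bar>\<nu>\<bar> * T) * (\<integral>t. \<bar>h t - s i t\<bar> \<partial>lborel) < \<epsilon> / 2"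
    by (rule order_tendstoD(2)) (use e in simp)
  then obtain i where i: "exp (\<bar>\<nu>\<bar> * T) * (\<integral>t. \<bar>h t - s i t\<bar> \<partial>lborel) < \<epsilon> / 2"
    by (auto simp: eventually_sequentially)
  have si: "integrable lborel (s i)" "\<And>t. t \<notin> {0..T} ==> s i t = 0" using s[of i] by (auto simp: decay_approx_def)
  have "LS {0..} \<nu> (\<epsilon> / 2) (Laplace (%t. h t - s i t))"
    by (rule LS_le[OF LS_Laplace]) (use i si ih h0 T in auto)
  moreover have "Laplace (%t. h t - s i t) z = Laplace h z - Laplace (s i) z" for z
    unfolding Laplace_def using Laplace_integrable[OF si] Laplace_integrable[OF ih h0]
    by (subst Bochner_Integration.integral_diff[symmetric]) (auto simp: algebra_simps)
  ultimately have 1: "LS {0..} \<nu> (\<epsilon> / 2) (%z. Laplace h z - Laplace (s i) z)" by (rule LS_cong[OF _ sym])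
  obtain g C B where g: "LS {0..} \<nu> (\<epsilon> / 2) (%z. Laplace (s i) z - g z)" "LS {0..} \<nu> B g" 
    "\<forall>z. - \<nu> \<le> Re z --> norm (g z) \<le> C / (1 + (norm z)\<^sup>2)"
    using s[of i] e unfolding decay_approx_def by (metis half_gt_zero)
  have "LS {0..} \<nu> \<epsilon> (%z. Laplace h z - g z)" using LS_add[OF 1 g(1)] by simp
  then show "\<exists>g C B. LS {0..} \<nu> \<epsilon> (%z. Laplace h z - g z) \<and> LS {0..} \<nu> B g \<and>
        (\<forall>z. - \<nu> \<le> Re z --> norm (g z) \<le> C / (1 + (norm z)\<^sup>2))"
    using g(2,3) by blast
qed

text \<open>Subtract from the indicator a narrow triangle and add its translate: the result is continuous and piecewise linear, and its transform is a
  product of two bounded factors divided by $\delta z^2$.  The triangles have small mass.\<close>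

lemma decay_approx_interval:
  assumes b: "0 \<le> b" "b \<le> T"
  shows "decay_approx \<nu> T (indicat_real {0..b})"
  unfolding decay_approx_def
proof (intro conjI allI impI)
  show "integrable lborel (indicat_real {0..b})" by (simp add: emeasure_lborel_Icc_eq)
  show "t \<notin> {0..T} ==> indicat_real {0..b} t = 0" for t using b by (auto simp: indicator_def)
  fix \<epsilon> :: real assume e: "0 < \<epsilon>"
  let ?h = "indicat_real {0..b}"
  define c where "c = 1 + exp (\<nu> * b)"
  have c0: "c > 0" by (simp add: c_def add_pos_pos)
  define \<delta> where "\<delta> = min 1 (\<epsilon> / (c * exp \<bar>\<nu>\<bar>))"
  have \<delta>: "0 < \<delta>" "\<delta> \<le> 1" using e c0 by (auto simp: \<delta>_def)
  have "\<delta> \<le> \<epsilon> / (c * exp \<bar>\<nu>\<bar>)" by (simp add: \<delta>_def)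
  then have \<delta>': "c * (exp \<bar>\<nu>\<bar> * \<delta>) \<le> \<epsilon>" using c0 by (simp add: field_simps)
  define v where "v t = indicat_real {0..\<delta>} t * (1 - t / \<delta>)" for t
  have vc: "continuous_on {0..\<delta>} (%t. 1 - t / \<delta>)" using \<delta> by (intro continuous_intros) auto
  have vi: "integrable lborel v"
    using borel_integrable_compact[OF _ vc] by (simp add: v_def[abs_def])
  have v01: "\<bar>v t\<bar> \<le> indicat_real {0..\<delta>} t" for t using \<delta> by (auto simp: v_def indicator_def field_simps)
  have "(\<integral>t. \<bar>v t\<bar> \<partial>lborel) \<le> (\<integral>t. indicat_real {0..\<delta>} t \<partial>lborel)"
    using vi v01 by (intro integral_mono) (auto simp: emeasure_lborel_Icc_eq)
  also have "\<dots> = \<delta>" using \<delta> by simp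
  finally have vI: "(\<integral>t. \<bar>v t\<bar> \<partial>lborel) \<le> \<delta>" .
  have "LS {0..} \<nu> (exp \<bar>\<nu>\<bar> * \<delta>) (Laplace v)"
    by (rule LS_le[OF LS_Laplace[of v \<delta>]]) (use vi \<delta> vI in \<open>auto simp: v_def intro!: mult_mono mult_left_le\<close>)
  moreover have c1: "LS {0..} \<nu> c (%z. 1 - exp (- (z * of_real b)))"
  proof -
    have "LS {0..} \<nu> (norm (1::complex) + norm (-1::complex) * exp (\<nu> * b)) (%z. 1 + -1 * exp (- (z * of_real b)))"
      using b by (intro LS_add LS_const LS_exp) auto
    then show ?thesis by (simp add: c_def)
  qed
  ultimately have 0: "LS {0..} \<nu> \<epsilon> (%z. (1 - exp (- (z * of_real b))) * Laplace v z)"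
    by (intro LS_le[OF LS_mult \<delta>']) auto
  define g where "g z = Laplace ?h z - (1 - exp (- (z * of_real b))) * Laplace v z" for z
  have 1: "LS {0..} \<nu> \<epsilon> (%z. Laplace ?h z - g z)" using 0 by (simp add: g_def)
  have 2: "LS {0..} \<nu> (exp (\<bar>\<nu>\<bar> * b) * (\<integral>t. \<bar>?h t\<bar> \<partial>lborel) + \<epsilon>) g"
    unfolding g_def using b by (intro half_line.LS_diff 0 LS_Laplace) (auto simp: emeasure_lborel_Icc_eq)
  define B where "B = exp (\<bar>\<nu>\<bar> * b) * (\<integral>t. \<bar>?h t\<bar> \<partial>lborel) + \<epsilon>"
  define C where "C = max (2 * B) (2 * (c * (1 + exp (\<nu> * \<delta>)) / \<delta>))"
  have B0: "0 \<le> B" using LS_nonneg[OF 2] by (simp add: B_def)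
  have 3: "norm (g z) \<le> C / (1 + (norm z)\<^sup>2)" if z: "- \<nu> \<le> Re z" for z
  proof (cases "norm z \<le> 1")
    case True
    have "norm (g z) \<le> B" using LS_bound[OF 2 _ z] by (simp add: B_def)
    moreover have "(norm z)\<^sup>2 \<le> 1" using True by (simp add: power_le_one)
    then have "B * (1 + (norm z)\<^sup>2) \<le> B * 2" using B0 by (intro mult_left_mono) auto
    then have "B \<le> 2 * B / (1 + (norm z)\<^sup>2)" by (simp add: field_simps add_pos_nonneg)
    moreover have "2 * B / (1 + (norm z)\<^sup>2) \<le> C / (1 + (norm z)\<^sup>2)" by (intro divide_right_mono) (auto simp: C_def)
    ultimately show ?thesis by linarith
  next
    case False
    then have z0: "z \<noteq> 0" by auto
    have L1: "Laplace ?h z = (1 - exp (- (z * of_real b))) / z"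
    proof -
      have "(\<integral>t. ?h t *\<^sub>R exp (- (z * of_real t)) \<partial>lborel) = (- exp (- (z * of_real b)) / z) - (- exp (- (z * of_real 0)) / z)"
        by (rule integral_FTC_Icc) (use b z0 in \<open>auto intro!: derivative_eq_intros has_vector_derivative_real_field continuous_intros\<close>)
      then show ?thesis by (simp add: Laplace_def scaleR_conv_of_real diff_divide_distrib)
    qed
    have L2: "Laplace v z = 1 / z - (1 - exp (- (z * of_real \<delta>))) / (of_real \<delta> * z\<^sup>2)"
    proof -
      let ?F = "%t. - ((1 - t / of_real \<delta>) * exp (- (z * t)) / z) + exp (- (z * t)) / (of_real \<delta> * z\<^sup>2)"
      have "(\<integral>t. indicat_real {0..\<delta>} t *\<^sub>R ((1 - of_real t / of_real \<delta>) * exp (- (z * of_real t))) \<partial>lborel) = ?F (of_real \<delta>) - ?F (of_real 0)"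
      proof (rule integral_FTC_Icc)
        fix x :: real assume "0 \<le> x" "x \<le> \<delta>"
        have "(?F has_field_derivative ((1 - of_real x / of_real \<delta>) * exp (- (z * of_real x)))) (at (of_real x))"
          using z0 \<delta> by (auto intro!: derivative_eq_intros simp: field_simps power2_eq_square)
        then show "((%t. ?F (of_real t)) has_vector_derivative ((1 - of_real x / of_real \<delta>) * exp (- (z * of_real x)))) (at x within {0..\<delta>})"
          by (rule has_vector_derivative_real_field)
      qed (use \<delta> in \<open>auto intro!: continuous_intros\<close>)
      moreover have "Laplace v z = (\<integral>t. indicat_real {0..\<delta>} t *\<^sub>R ((1 - of_real t / of_real \<delta>) * exp (- (z * of_real t))) \<partial>lborel)"
        by (simp add: Laplace_def v_def scaleR_conv_of_real mult.assoc)
      ultimately show ?thesis using \<delta> z0 by (simp add: field_simps)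
    qed
    have geq: "g z = (1 - exp (- (z * of_real b))) * (1 - exp (- (z * of_real \<delta>))) / (of_real \<delta> * z\<^sup>2)"
      unfolding g_def L1 L2 using z0 \<delta> by (simp add: field_simps)
    have n1: "norm (1 - exp (- (z * of_real b))) \<le> c" using LS_bound[OF c1 _ z] by simp
    have n2: "norm (1 - exp (- (z * of_real \<delta>))) \<le> 1 + exp (\<nu> * \<delta>)"
    proof -
      have "norm (1 - exp (- (z * of_real \<delta>))) \<le> norm (1::complex) + norm (exp (- (z * of_real \<delta>)))" by (rule norm_triangle_ineq4)
      also have "norm (exp (- (z * of_real \<delta>))) \<le> exp (\<nu> * \<delta>)" using neg_mult_le[OF z, of \<delta>] \<delta> by simp
      finally show ?thesis by simp
    qed
    have "norm (g z) \<le> c * (1 + exp (\<nu> * \<delta>)) / (\<delta> * (norm z)\<^sup>2)"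
      unfolding geq norm_divide norm_mult norm_power using \<delta> z0 c0 n1 n2
      by (auto intro!: divide_right_mono mult_mono)
    also have "\<dots> \<le> 2 * (c * (1 + exp (\<nu> * \<delta>)) / \<delta>) / (1 + (norm z)\<^sup>2)"
    proof -
      have "1 \<le> (norm z)\<^sup>2" using False by (simp add: one_le_power)
      then have "2 / (2 * (norm z)\<^sup>2) \<le> 2 / (1 + (norm z)\<^sup>2)" 
        by (intro divide_left_mono) (auto intro!: mult_pos_pos add_pos_nonneg intro: less_le_trans[OF zero_less_one])
      then have "1 / (norm z)\<^sup>2 \<le> 2 / (1 + (norm z)\<^sup>2)" by simp
      then have "(c * (1 + exp (\<nu> * \<delta>)) / \<delta>) * (1 / (norm z)\<^sup>2) \<le> (c * (1 + exp (\<nu> * \<delta>)) / \<delta>) * (2 / (1 + (norm z)\<^sup>2))"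
        using c0 \<delta> by (intro mult_left_mono) (auto intro!: divide_nonneg_pos mult_nonneg_nonneg add_nonneg_nonneg)
      then show ?thesis by (simp add: field_simps)
    qed
    also have "\<dots> \<le> C / (1 + (norm z)\<^sup>2)" by (intro divide_right_mono) (auto simp: C_def)
    finally show ?thesis .
  qed
  show "\<exists>g C B. LS {0..} \<nu> \<epsilon> (%z. Laplace ?h z - g z) \<and> LS {0..} \<nu> B g \<and>
        (\<forall>z. - \<nu> \<le> Re z --> norm (g z) \<le> C / (1 + (norm z)\<^sup>2))"
    using 1 2 3 by (intro exI[of _ g] exI conjI allI impI)
qed

lemma decay_approx_zero: "decay_approx \<nu> T (%t. 0)"
proof -
  have z: "LS {0..} \<nu> 0 (%z. 0)" by (rule LS_zero) auto
  have "Laplace (%t. 0) = (%z. 0)" by (simp add: Laplace_def fun_eq_iff)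
  then have "\<exists>g C B. LS {0..} \<nu> \<epsilon> (%z. Laplace (%t. 0) z - g z) \<and> LS {0..} \<nu> B g \<and>
        (\<forall>z. - \<nu> \<le> Re z --> norm (g z) \<le> C / (1 + (norm z)\<^sup>2))" if "0 < \<epsilon>" for \<epsilon>
    using that LS_le[OF z, of \<epsilon>] z by (intro exI[of _ "%z. 0"] exI[of _ 0]) simp
  then show ?thesis unfolding decay_approx_def by simp
qed

text \<open>Dynkin's lemma reduces Borel sets to half-lines, whose traces on $[0,T]$ are intervals.\<close>

lemma decay_approx_set:
  assumes A: "A \<in> sets borel" and T: "0 \<le> T"
  shows "decay_approx \<nu> T (indicat_real (A \<inter> {0..T}))"
proof -
  have sub: "sigma_sets UNIV (range (%a::real. {..a})) = sets borel" by (subst borel_eq_atMost) simp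
  have "Int_stable (range (%a::real. {..a}))" "range (%a::real. {..a}) \<subseteq> Pow UNIV" "A \<in> sigma_sets UNIV (range (%a::real. {..a}))"
    using A unfolding sub by (auto simp: Int_stable_def)
  then show ?thesis
  proof (induction A rule: sigma_sets_induct_disjoint)
    case (basic A)
    then obtain a where a: "A = {..a}" by auto
    show ?case
    proof (cases "0 \<le> a")
      case True
      have "A \<inter> {0..T} = {0..min a T}" using a by auto
      then show ?thesis using decay_approx_interval[of "min a T" T \<nu>] True T by simp
    next
      case False
      then have "A \<inter> {0..T} = {}" using a by auto
      then show ?thesis using decay_approx_zero by simp
    qed
  next
    case (compl A)
    have "indicat_real ((UNIV - A) \<inter> {0..T}) t = indicat_real {0..T} t + (-1) * indicat_real (A \<inter> {0..T}) t" for t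
      by (auto simp: indicator_def)
    then have eq: "indicat_real ((UNIV - A) \<inter> {0..T}) = (%t. indicat_real {0..T} t + (-1) * indicat_real (A \<inter> {0..T}) t)" by (rule ext)
    show ?case unfolding eq by (rule decay_approx_add[OF decay_approx_interval compl(2)]) (use T in auto)
  next
    case (union A)
    have fin: "decay_approx \<nu> T (indicat_real ((\<Union>i<n. A i) \<inter> {0..T}))" for n
    proof (induction n)
      case (Suc n)
      have dis: "A i \<inter> A n = {}" if "i < n" for i
        using union(1) that unfolding disjoint_family_on_def by (metis UNIV_I less_irrefl)
      have "((\<Union>i<n. A i) \<inter> {0..T}) \<inter> (A n \<inter> {0..T}) = {}" using dis by blast
      moreover have "(\<Union>i<Suc n. A i) \<inter> {0..T} = ((\<Union>i<n. A i) \<inter> {0..T}) \<union> (A n \<inter> {0..T})"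
        unfolding lessThan_Suc by blast
      ultimately have "indicat_real ((\<Union>i<Suc n. A i) \<inter> {0..T}) t = indicat_real ((\<Union>i<n. A i) \<inter> {0..T}) t + 1 * indicat_real (A n \<inter> {0..T}) t" for t
        unfolding indicator_def by auto
      then have eq: "indicat_real ((\<Union>i<Suc n. A i) \<inter> {0..T}) = (%t. indicat_real ((\<Union>i<n. A i) \<inter> {0..T}) t + 1 * indicat_real (A n \<inter> {0..T}) t)" by (rule ext)
      show ?case unfolding eq by (rule decay_approx_add[OF Suc union(3)])
    qed (simp add: decay_approx_zero)
    show ?case
    proof (rule decay_approx_lim[OF fin, where w = "indicat_real {0..T}"])
      show "(%n. indicat_real ((\<Union>i<n. A i) \<inter> {0..T}) t) \<longlonglongrightarrow> indicat_real (\<Union> (range A) \<inter> {0..T}) t" for t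
      proof (rule tendsto_eventually)
        show "\<forall>\<^sub>F n in sequentially. indicat_real ((\<Union>i<n. A i) \<inter> {0..T}) t = indicat_real (\<Union> (range A) \<inter> {0..T}) t"
        proof (cases "\<exists>i. t \<in> A i")
          case True
          then obtain i where "t \<in> A i" by auto
          then have i: "t \<in> \<Union> (range A)" "\<And>n. i < n ==> t \<in> (\<Union>i<n. A i)" by auto
          show ?thesis using eventually_gt_at_top[of i] by eventually_elim (use i in \<open>simp add: indicator_def\<close>)
        qed (auto simp: indicator_def)
      qed
      show "indicat_real (\<Union> (range A) \<inter> {0..T}) \<in> borel_fun"
        using union(2) sub by (auto intro!: borel_measurable_indicator)
    qed (use T in \<open>auto simp: emeasure_lborel_Icc_eq indicator_def\<close>)
  qed (use decay_approx_zero in auto)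
qed

lemma decay_approx_L1:
  assumes h: "integrable lborel h" and T: "0 \<le> T"
  shows "decay_approx \<nu> T (%t. indicat_real {0..T} t * h t)"
  using h
proof (induction rule: integrable_induct)
  case (base A c)
  have "(%t. indicat_real {0..T} t * indicat_real A t *\<^sub>R c) = (%t. 0 + c * indicat_real (A \<inter> {0..T}) t)"
    by (auto simp: indicator_def)
  then show ?case using decay_approx_add[OF decay_approx_zero decay_approx_set[of A T \<nu>]] base T by simp
next
  case (add f g)
  have "(%t. indicat_real {0..T} t * (f t + g t)) = (%t. indicat_real {0..T} t * f t + 1 * (indicat_real {0..T} t * g t))"
    by (auto simp: indicator_def)
  then show ?case using decay_approx_add[OF add(3,4)] by (simp only:)
next
  case (lim f s)
  show ?case
  proof (rule decay_approx_lim[OF lim(5), where w = "%t. 2 * \<bar>f t\<bar>"])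
    show "\<bar>indicat_real {0..T} t * s i t\<bar> \<le> 2 * \<bar>f t\<bar>" for i t using lim(3)[of t i] by (auto simp: indicator_def)
    show "(%i. indicat_real {0..T} t * s i t) \<longlonglongrightarrow> indicat_real {0..T} t * f t" for t
      using lim(2)[of t] by (intro tendsto_intros) auto
  qed (use lim T in auto)
qed

section \<open>Inverting a zero-free determinant\<close>

text \<open>Far to the right \<open>d\<close> is bounded below by hypothesis, so a sequence with $d(z_n) \to 0$ has bounded real parts.  By Montel's theorem the translates
  $d(\cdot + i\,\mathrm{Im}(z_n))$ subconverge to a holomorphic limit that has a zero and is not constant, contradicting Hurwitz' theorem.\<close>

lemma half_plane_lower_bound:
  fixes d :: "complex => complex"
  assumes d: "d holomorphic_on {z. - \<nu>0 < Re z}" and B: "\<And>z. - \<nu>0 < Re z ==> norm (d z) \<le> B"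
    and nz: "\<And>z. - \<nu>0 < Re z ==> d z \<noteq> 0" and \<sigma>: "\<And>z. \<sigma> \<le> Re z ==> 1 / 2 \<le> norm (d z)"
    and \<nu>: "\<nu> < \<nu>0"
  shows "\<exists>\<delta>>0. \<forall>z. - \<nu> \<le> Re z --> \<delta> \<le> norm (d z)"
proof (rule ccontr)
  assume "\<not> ?thesis"
  then have neg: "\<exists>z. - \<nu> \<le> Re z \<and> norm (d z) < \<delta>" if "0 < \<delta>" for \<delta> using that by (meson not_le)
  define e where "e n = min (1 / 2) (inverse (real (Suc n)))" for n
  have "\<exists>z. - \<nu> \<le> Re z \<and> norm (d z) < e n" for n by (rule neg) (simp add: e_def)
  then obtain z where z: "\<And>n. - \<nu> \<le> Re (z n)" "\<And>n. norm (d (z n)) < e n" by metis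
  have zs: "Re (z n) < \<sigma>" for n
    using \<sigma>[of "z n"] z(2)[of n] by (force simp: e_def)
  define S where "S = {z. - \<nu>0 < Re z}"
  define F where "F n w = d (w + Complex 0 (Im (z n)))" for n w
  have S: "open S" "connected S" unfolding S_def 
    by (auto simp: open_right_half_plane convex_connected convex_right_half_plane)
  have Fh: "F n holomorphic_on S" for n
  proof -
    have "d \<circ> (%w. w + Complex 0 (Im (z n))) holomorphic_on S"
      by (rule holomorphic_on_compose_gen[OF _ d]) (auto simp: S_def intro!: holomorphic_intros)
    then show ?thesis by (simp add: o_def F_def[abs_def])
  qed
  have bd: "\<exists>B. \<forall>h\<in>range F. \<forall>z\<in>K. norm (h z) \<le> B" if "K \<subseteq> S" for K
    using that by (intro exI[of _ B]) (auto simp: F_def S_def intro!: B)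
  obtain g r where g: "g holomorphic_on S" and r: "strict_mono (r :: nat => nat)" 
    and pt: "\<And>x. x \<in> S ==> (%n. F (r n) x) \<longlonglongrightarrow> g x"
    and ul: "\<And>K. compact K ==> K \<subseteq> S ==> uniform_limit K (F \<circ> r) g sequentially"
  proof (rule Montel[of S "range F" F])
    show "open S" by fact
    show "h holomorphic_on S" if "h \<in> range F" for h using that Fh by auto
    show "\<exists>B. \<forall>h\<in>range F. \<forall>z\<in>K. norm (h z) \<le> B" if "compact K" "K \<subseteq> S" for K using bd that by blast
    show "range F \<subseteq> range F" ..
  qed (rule that)
  have "seq_compact {- \<nu>..\<sigma>}" by (simp add: compact_imp_seq_compact)
  moreover have "\<forall>n. Re (z (r n)) \<in> {- \<nu>..\<sigma>}" using z(1) zs by (auto intro: less_imp_le)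
  ultimately obtain x k where x: "x \<in> {- \<nu>..\<sigma>}" and k: "strict_mono (k :: nat => nat)" and xk: "(%n. Re (z (r (k n)))) \<longlonglongrightarrow> x"
    unfolding seq_compact_def o_def by (auto dest!: spec[of _ "%n. Re (z (r n))"])
  define K where "K = complex_of_real ` {- \<nu>..\<sigma>}"
  have K: "compact K" "K \<subseteq> S" using \<nu> by (auto simp: K_def S_def intro!: compact_continuous_image continuous_intros)
  have gx: "g (of_real x) = 0"
  proof -
    have xS: "complex_of_real x \<in> S" using x \<nu> by (auto simp: S_def)
    have cg: "isCont g (of_real x)" using holomorphic_on_imp_continuous_on[OF g] S xS by (simp add: continuous_on_eq_continuous_at)
    have "(%n. g (of_real (Re (z (r (k n)))))) \<longlonglongrightarrow> g (of_real x)"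
      by (rule isCont_tendsto_compose[OF cg]) (intro tendsto_of_real xk)
    moreover have "(%n. g (of_real (Re (z (r (k n)))))) \<longlonglongrightarrow> 0"
    proof (rule LIMSEQ_I)
      fix \<epsilon> :: real assume \<epsilon>: "0 < \<epsilon>"
      have "\<forall>\<^sub>F n in sequentially. \<forall>w\<in>K. dist ((F \<circ> r) n w) (g w) < \<epsilon> / 2"
        using ul[OF K] \<epsilon> unfolding uniform_limit_iff by (meson half_gt_zero)
      then obtain N where N: "\<And>n w. n \<ge> N ==> w \<in> K ==> dist (F (r n) w) (g w) < \<epsilon> / 2"
        by (auto simp: eventually_sequentially)
      obtain N' where N': "inverse (real (Suc N')) < \<epsilon> / 2" using reals_Archimedean[of "\<epsilon> / 2"] \<epsilon> by auto
      have "norm (g (of_real (Re (z (r (k n)))))) < \<epsilon>" if n: "n \<ge> max N N'" for n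
      proof -
        let ?w = "complex_of_real (Re (z (r (k n))))"
        have kn: "n \<le> k n" "n \<le> r (k n)" using seq_suble[OF k] seq_suble[OF r] by (auto intro: order_trans)
        have "?w \<in> K" using z(1) zs by (auto simp: K_def intro!: less_imp_le[OF zs])
        then have 1: "dist (F (r (k n)) ?w) (g ?w) < \<epsilon> / 2" using N[of "k n" ?w] n kn by auto
        have "?w + Complex 0 (Im (z (r (k n)))) = z (r (k n))" by (simp add: complex_eq_iff)
        then have "norm (F (r (k n)) ?w) < e (r (k n))" unfolding F_def using z(2) by simp
        also have "\<dots> \<le> inverse (real (Suc (r (k n))))" by (simp add: e_def)
        also have "\<dots> \<le> inverse (real (Suc N'))" using n kn by (intro le_imp_inverse_le) auto
        also have "\<dots> < \<epsilon> / 2" by fact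
        finally show ?thesis using 1 norm_triangle_ineq2[of "g ?w" "F (r (k n)) ?w"] by (simp add: dist_norm norm_minus_commute)
      qed
      then show "\<exists>no. \<forall>n\<ge>no. norm (g (of_real (Re (z (r (k n))))) - 0) < \<epsilon>" by (intro exI[of _ "max N N'"]) simp
    qed
    ultimately show ?thesis by (rule LIMSEQ_unique)
  qed
  define y where "y = complex_of_real (max \<sigma> 0 + max (- \<nu>0) 0 + 1)"
  have yS: "y \<in> S" "\<sigma> \<le> Re y" by (auto simp: y_def S_def)
  have "1 / 2 \<le> norm (g y)"
    by (rule Lim_bounded2[OF tendsto_norm[OF pt[OF yS(1)]], of 0]) (use yS in \<open>auto simp: F_def intro!: \<sigma>[simplified]\<close>)
  then have "g y \<noteq> 0" by auto
  then have nc: "\<not> g constant_on S" 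
  proof -
    have "complex_of_real x \<in> S" using x \<nu> by (auto simp: S_def)
    then show ?thesis using gx yS(1) \<open>g y \<noteq> 0\<close> unfolding constant_on_def by metis
  qed
  have "g (of_real x) \<noteq> 0"
  proof (rule Hurwitz_no_zeros[OF S _ g _ nc])
    show "(F \<circ> r) n holomorphic_on S" for n using Fh by simp
    show "uniform_limit K (F \<circ> r) g sequentially" if "compact K" "K \<subseteq> S" for K by (rule ul[OF that])
    show "(F \<circ> r) n w \<noteq> 0" if "w \<in> S" for n w using nz that by (auto simp: F_def S_def)
    show "complex_of_real x \<in> S" using x \<nu> by (auto simp: S_def)
  qed
  with gx show False by simp
qed

text \<open>The additive semigroup generated by the first \<open>K\<close> delays: it contains all exponents that arise when exponential polynomials in these delays are multiplied and inverted.\<close>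

fun delay_span :: "(nat => real) => nat => real set" where
  "delay_span \<tau> 0 = {0}"
| "delay_span \<tau> (Suc K) = (%(x, m :: nat). x + real m * \<tau> K) ` (delay_span \<tau> K \<times> UNIV)"

lemma delay_span_props:
  assumes "\<And>k. 0 < \<tau> k"
  shows "countable (delay_span \<tau> K)" "0 \<in> delay_span \<tau> K" "delay_span \<tau> K \<subseteq> {0..}"
    "x \<in> delay_span \<tau> K ==> y \<in> delay_span \<tau> K ==> x + y \<in> delay_span \<tau> K"
    "k < K ==> \<tau> k \<in> delay_span \<tau> K"
proof -
  show "countable (delay_span \<tau> K)" by (induction K) auto
  show z: "0 \<in> delay_span \<tau> K" for K by (induction K) (auto intro!: image_eqI[of _ _ "(0, 0)"])
  show "delay_span \<tau> K \<subseteq> {0..}"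
  proof (induction K)
    case (Suc K)
    show ?case
    proof
      fix x assume "x \<in> delay_span \<tau> (Suc K)"
      then obtain a m where x: "a \<in> delay_span \<tau> K" "x = a + real m * \<tau> K" by auto
      have "0 \<le> a" "0 \<le> real m * \<tau> K" using Suc x(1) assms[of K] by auto
      then show "x \<in> {0..}" using x(2) by simp
    qed
  qed simp
  show "x \<in> delay_span \<tau> K ==> y \<in> delay_span \<tau> K ==> x + y \<in> delay_span \<tau> K"
  proof (induction K arbitrary: x y)
    case (Suc K)
    then obtain a m b n where "a \<in> delay_span \<tau> K" "b \<in> delay_span \<tau> K" "x = a + real m * \<tau> K" "y = b + real n * \<tau> K" by auto
    then have "x + y = (%(x, m). x + real m * \<tau> K) (a + b, m + n)" "(a + b, m + n) \<in> delay_span \<tau> K \<times> UNIV"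
      using Suc.IH[of a b] by (simp_all add: algebra_simps)
    then show ?case unfolding delay_span.simps by (rule image_eqI)
  qed simp
  show "k < K ==> \<tau> k \<in> delay_span \<tau> K"
  proof (induction K)
    case (Suc K)
    show ?case
    proof (cases "k = K")
      case True
      then show ?thesis using z[of K] by (force intro!: image_eqI[of _ _ "(0, 1)"])
    next
      case False
      then show ?thesis using Suc by (force intro!: image_eqI[of _ _ "(\<tau> k, 0)"])
    qed
  qed simp
qed

text \<open>The sum is dominated by a product of \<open>K\<close> geometric series.\<close>

lemma delay_span_exp_sum:
  assumes \<tau>: "\<And>k. 0 < \<tau> k" and \<eta>: "0 < \<eta>"
  shows "\<exists>C\<ge>0. \<forall>F. finite F --> F \<subseteq> delay_span \<tau> K --> (\<Sum>x\<in>F. exp (- (\<eta> * x))) \<le> C"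
proof (induction K)
  case 0
  have "(\<Sum>x\<in>F. exp (- (\<eta> * x))) \<le> 1" if "finite F" "F \<subseteq> {0}" for F
    using that by (cases "F = {}") (auto simp: subset_singleton_iff)
  then show ?case by (auto intro!: exI[of _ 1])
next
  case (Suc K)
  then obtain C where C: "0 \<le> C" "\<And>F. finite F ==> F \<subseteq> delay_span \<tau> K ==> (\<Sum>x\<in>F. exp (- (\<eta> * x))) \<le> C" by auto
  define q where "q = exp (- (\<eta> * \<tau> K))"
  have q: "0 < q" "q < 1" using \<eta> \<tau>[of K] by (auto simp: q_def)
  show ?case
  proof (intro exI[of _ "C * (1 / (1 - q))"] conjI allI impI)
    show "0 \<le> C * (1 / (1 - q))" using C q by simp
    fix F assume F: "finite F" "F \<subseteq> delay_span \<tau> (Suc K)"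
    let ?f = "%(x, m :: nat). x + real m * \<tau> K"
    obtain G where G: "G \<subseteq> delay_span \<tau> K \<times> UNIV" "finite G" "F = ?f ` G"
      using finite_subset_image[OF F[unfolded delay_span.simps]] by auto
    have "(\<Sum>x\<in>F. exp (- (\<eta> * x))) \<le> (\<Sum>p\<in>G. exp (- (\<eta> * ?f p)))"
      unfolding G(3) using sum_image_le[OF G(2), of "%x. exp (- (\<eta> * x))" ?f] by (simp add: o_def)
    also have "\<dots> \<le> (\<Sum>p\<in>fst ` G \<times> {..Max (snd ` G)}. exp (- (\<eta> * ?f p)))"
      using G by (intro sum_mono2) (force intro!: Max_ge)+
    also have "\<dots> = (\<Sum>x\<in>fst ` G. \<Sum>m\<in>{..Max (snd ` G)}. exp (- (\<eta> * x)) * q ^ m)"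
      unfolding sum.cartesian_product
      by (intro sum.cong refl) (auto simp: q_def exp_of_nat_mult[symmetric] mult_exp_exp algebra_simps)
    also have "\<dots> = (\<Sum>x\<in>fst ` G. exp (- (\<eta> * x))) * (\<Sum>m\<in>{..Max (snd ` G)}. q ^ m)"
      by (simp add: sum_product)
    also have "\<dots> \<le> C * (1 / (1 - q))"
    proof (rule mult_mono)
      show "(\<Sum>x\<in>fst ` G. exp (- (\<eta> * x))) \<le> C" using G by (intro C) auto
      have "(\<Sum>m\<in>{..Max (snd ` G)}. q ^ m) \<le> (\<Sum>m. q ^ m)"
        using q by (intro sum_le_suminf) (auto simp: summable_geometric)
      then show "(\<Sum>m\<in>{..Max (snd ` G)}. q ^ m) \<le> 1 / (1 - q)" using q by (simp add: suminf_geometric)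
    qed (use C q in \<open>auto intro!: sum_nonneg\<close>)
    finally show "(\<Sum>x\<in>F. exp (- (\<eta> * x))) \<le> C * (1 / (1 - q))" .
  qed
qed

text \<open>Dirichlet approximation: finitely many characters are simultaneously close to $1$ at arbitrarily large times.\<close>

lemma simultaneous_almost_period:
  fixes \<tau> :: "nat => real" and K :: nat
  assumes "0 < Y" "0 < \<epsilon>"
  shows "\<exists>y\<ge>Y. \<forall>k<K. norm (exp (- (\<i> * of_real (\<tau> k * y))) - 1) \<le> \<epsilon>"
proof -
  obtain N :: nat where N: "2 * pi / \<epsilon> < real N" using reals_Archimedean2 by blast
  then have N0: "0 < N" using assms(2) by (metis divide_pos_pos gr0I less_le_not_le mult_pos_pos of_nat_0 order.strict_trans pi_gt_zero zero_less_numeral)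
  obtain q p where q: "0 < q" and p: "\<And>k. k < K ==> \<bar>of_int q * (\<tau> k * Y / (2 * pi)) - of_int (p k)\<bar> < 1 / N"
    using Dirichlet_approx_simult[OF N0, of K "%k. \<tau> k * Y / (2 * pi)"] by metis
  show ?thesis
  proof (intro exI[of _ "of_int q * Y"] conjI allI impI)
    have "1 * Y \<le> of_int q * Y" using q assms by (intro mult_right_mono) auto
    then show "Y \<le> of_int q * Y" by simp
    fix k assume k: "k < K"
    define x where "x = \<tau> k * (of_int q * Y)"
    define u where "u = x - 2 * pi * of_int (p k)"
    have "u = 2 * pi * (of_int q * (\<tau> k * Y / (2 * pi)) - of_int (p k))" by (simp add: u_def x_def field_simps)
    then have "\<bar>u\<bar> \<le> 2 * pi * (1 / N)"
      using mult_left_mono[OF less_imp_le[OF p[OF k]], of "2 * pi"] by (simp only: abs_mult) simp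
    also have "\<dots> \<le> \<epsilon>" using N N0 assms by (simp add: field_simps)
    finally have u: "\<bar>u\<bar> \<le> \<epsilon>" .
    have "exp (- (\<i> * of_real x)) = exp (\<i> * of_real (- u)) * exp (\<i> * of_real (- (2 * pi * of_int (p k))))"
      by (simp add: mult_exp_exp u_def algebra_simps)
    also have "exp (\<i> * of_real (- (2 * pi * of_int (p k)))) = 1"
      using exp_integer_2pi[of "of_int (- p k)"] by (simp add: mult_ac)
    finally have "norm (exp (- (\<i> * of_real x)) - 1) = 2 * \<bar>sin (- u / 2)\<bar>"
      using dist_exp_i_1[of "- u"] by simp
    also have "\<dots> \<le> \<bar>u\<bar>" using abs_sin_x_le_abs_x[of "- u / 2"] by simp
    finally show "norm (exp (- (\<i> * of_real (\<tau> k * (of_int q * Y)))) - 1) \<le> \<epsilon>" using u by (simp add: x_def)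
  qed
qed

lemma tendsto_det:
  fixes F :: "nat => 'n::finite => 'n => complex"
  assumes "\<And>i j. (%m. F m i j) \<longlonglongrightarrow> G i j"
  shows "(%m. det (\<chi> i j. F m i j)) \<longlonglongrightarrow> det (\<chi> i j. G i j)"
  unfolding det_def by (auto intro!: tendsto_intros assms)

text \<open>Along almost periods \<open>D\<close> returns to its value at \<open>z\<close>, whereas the difference \<open>P - D\<close> dies out.  Hence $D(z)$ is a limit of values of \<open>P\<close>.\<close>

lemma discrete_part_lower_bound:
  fixes a :: "nat => 'n::finite => 'n => complex" and b :: "'n => 'n => complex" and \<tau> :: "nat => real" and K :: nat and P :: "complex => complex"
  defines "D \<equiv> %z. det (\<chi> i j. b i j + (\<Sum>k<K. a k i j * exp (- (z * of_real (\<tau> k)))))"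
  assumes P: "\<And>z. - \<nu> < Re z ==> \<delta> \<le> norm (P z)" 
    and PD: "\<And>z. - \<nu> < Re z ==> norm (P z - D z) \<le> C / (1 + (norm z)\<^sup>2)" and z: "- \<nu> < Re z"
  shows "\<delta> \<le> norm (D z)"
proof -
  have "\<exists>y\<ge>real (Suc m). \<forall>k<K. norm (exp (- (\<i> * of_real (\<tau> k * y))) - 1) \<le> inverse (real (Suc m))" for m
    by (rule simultaneous_almost_period) auto
  then obtain y where y: "\<And>m. real (Suc m) \<le> y m" 
    "\<And>m k. k < K ==> norm (exp (- (\<i> * of_real (\<tau> k * y m))) - 1) \<le> inverse (real (Suc m))" by metis
  have e1: "(%m. exp (- (\<i> * of_real (\<tau> k * y m)))) \<longlonglongrightarrow> 1" if "k < K" for k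
    by (rule LIM_zero_cancel, rule Lim_null_comparison[OF _ LIMSEQ_inverse_real_of_nat]) (use y(2)[OF that] in auto)
  have e2: "exp (- ((z + Complex 0 (y m)) * of_real (\<tau> k))) = exp (- (z * of_real (\<tau> k))) * exp (- (\<i> * of_real (\<tau> k * y m)))" for m k
    unfolding mult_exp_exp by (rule arg_cong[where f = exp]) (simp add: complex_eq_iff algebra_simps)
  have D: "(%m. D (z + Complex 0 (y m))) \<longlonglongrightarrow> D z"
    unfolding D_def e2
  proof (rule tendsto_det)
    fix i j
    have "(%m. b i j + (\<Sum>k<K. a k i j * (exp (- (z * of_real (\<tau> k))) * exp (- (\<i> * of_real (\<tau> k * y m)))))) \<longlonglongrightarrow> 
      b i j + (\<Sum>k<K. a k i j * (exp (- (z * of_real (\<tau> k))) * 1))"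
      by (intro tendsto_intros e1) auto
    then show "(%m. b i j + (\<Sum>k<K. a k i j * (exp (- (z * of_real (\<tau> k))) * exp (- (\<i> * of_real (\<tau> k * y m)))))) \<longlonglongrightarrow> 
      b i j + (\<Sum>k<K. a k i j * exp (- (z * of_real (\<tau> k))))" by simp
  qed
  have w: "filterlim (%m. norm (z + Complex 0 (y m))) at_top sequentially"
  proof (rule filterlim_at_top_mono)
    show "filterlim (%m. real m - norm z) at_top sequentially" by real_asymp
    show "\<forall>\<^sub>F m in sequentially. real m - norm z \<le> norm (z + Complex 0 (y m))"
    proof (intro always_eventually allI)
      fix m
      have "norm (Complex 0 (y m)) \<le> norm (z + Complex 0 (y m)) + norm z" by (metis add_diff_cancel_left' norm_triangle_ineq4)
      moreover have "norm (Complex 0 (y m)) = \<bar>y m\<bar>" by (simp add: cmod_def)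
      ultimately show "real m - norm z \<le> norm (z + Complex 0 (y m))" using y(1)[of m] by simp
    qed
  qed
  have "((%r. C / (1 + r\<^sup>2)) \<longlongrightarrow> 0) at_top" by real_asymp
  from filterlim_compose[OF this w] have lim: "(%m. norm (D (z + Complex 0 (y m))) + C / (1 + (norm (z + Complex 0 (y m)))\<^sup>2)) \<longlonglongrightarrow> norm (D z) + 0"
    by (intro tendsto_add tendsto_norm D)
  have "\<delta> \<le> norm (D z) + 0"
  proof (rule Lim_bounded2[OF lim, of 0], intro allI impI)
    fix m
    have "- \<nu> < Re (z + Complex 0 (y m))" using z by simp
    from P[OF this] PD[OF this] 
    show "\<delta> \<le> norm (D (z + Complex 0 (y m))) + C / (1 + (norm (z + Complex 0 (y m)))\<^sup>2)"
      using norm_triangle_ineq2[of "P (z + Complex 0 (y m))" "D (z + Complex 0 (y m))"] by linarith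
  qed
  then show ?thesis by simp
qed


lemma norm_det_diff_le:
  fixes B \<epsilon> :: real and a b :: "'n::finite => 'n => complex"
  assumes "\<And>i j. norm (a i j) \<le> B" "\<And>i j. norm (b i j) \<le> B" "\<And>i j. norm (a i j - b i j) \<le> \<epsilon>" "1 \<le> B"
  shows "norm (det (\<chi> i j. a i j) - det (\<chi> i j. b i j)) \<le> fact CARD('n) * (CARD('n) * B ^ CARD('n) * \<epsilon>)"
proof -
  have c: "LS {0..} 0 C (%z. c)" if "norm c \<le> C" for c C
    using LS_le[OF LS_const[of "{0..}" 0 c] that] by simp
  have "LS {0..} 0 (fact CARD('n) * (CARD('n) * B ^ CARD('n) * \<epsilon>)) (%z. det (\<chi> i j. a i j) - det (\<chi> i j. b i j))"
    by (rule half_line.LS_det_diff) (use assms in \<open>auto intro!: c\<close>)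
  from LS_bound[OF this, of 0] show ?thesis by simp
qed

text \<open>The geometric series for $1/(1+u)$.\<close>

lemma (in delay_semigroup) LS_Neumann:
  assumes u: "LS S \<nu> q u" and q: "q < 1"
  shows "LS S \<nu> (1 / (1 - q)) (%z. 1 / (1 + u z))"
proof -
  have q0: "0 \<le> q" using LS_nonneg[OF u] .
  have "LS S \<nu> (\<Sum>k. q ^ k) (%z. \<Sum>k. (- u z) ^ k)"
    by (rule LS_suminf[OF LS_power[OF LS_uminus[OF u]] S_nonneg]) (use q q0 in \<open>simp add: summable_geometric\<close>)
  then have "LS S \<nu> (1 / (1 - q)) (%z. \<Sum>k. (- u z) ^ k)" using q q0 by (simp add: suminf_geometric)
  then show ?thesis
  proof (rule LS_cong)
    fix z assume "- \<nu> \<le> Re z"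
    then have "norm (- u z) < 1" using LS_bound[OF u S_nonneg, of z] q by simp
    then show "1 / (1 + u z) = (\<Sum>k. (- u z) ^ k)" by (subst suminf_geometric) auto
  qed
qed

lemma norm_power_diff_scaled:
  fixes x y :: complex
  assumes "norm x \<le> r" "norm y \<le> r" "0 < r"
  shows "norm (x ^ j - y ^ j) \<le> real j * r ^ j * (norm (x - y) / r)"
proof -
  have "norm ((x / of_real r) ^ j - (y / of_real r) ^ j) \<le> real j * norm (x / of_real r - y / of_real r)"
    by (rule norm_power_diff) (use assms in \<open>auto simp: norm_divide\<close>)
  then have "norm (x ^ j - y ^ j) / r ^ j \<le> real j * (norm (x - y) / r)"
    using assms by (simp add: power_divide diff_divide_distrib[symmetric] norm_divide norm_power)
  then show ?thesis using assms by (simp add: field_simps)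
qed

text \<open>The determinant \<open>P\<close> mixes a purely discrete part \<open>D\<close> with terms of quadratic decay.  The difference of
  the $j$-th powers of $1/P$ and $1/D$ decays quadratically and is handled by the inverse Laplace integral; the powers of $1/D$ are
  discrete and are handled by the bound on coefficients.  Both bounds come from sup norms, so they grow
  like $\delta^{-j}$ up to a factor linear in \<open>j\<close>.\<close>

lemma LS_inverse_power:
  fixes a :: "nat => 'n::finite => 'n => complex" and g :: "'n => 'n => complex => complex" and \<tau> :: "nat => real" and K :: nat
  defines "Q \<equiv> %i j z. of_bool (i = j) + (\<Sum>k<K. a k i j * exp (- (z * of_real (\<tau> k))))"
  defines "P \<equiv> %z. det (\<chi> i j. Q i j z + g i j z)"
  assumes \<tau>: "\<And>k. 0 < \<tau> k" and \<nu>: "\<nu> < \<nu>'" and \<delta>: "0 < \<delta>"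
    and g: "\<And>i j. \<exists>B. LS {0..} \<nu>' B (g i j)" "\<And>i j. \<exists>C. \<forall>z. - \<nu>' \<le> Re z --> norm (g i j z) \<le> C / (1 + (norm z)\<^sup>2)"
    and P: "\<And>z. - \<nu>' < Re z ==> \<delta> \<le> norm (P z)"
  shows "\<exists>C. \<forall>j. LS {0..} \<nu> (C * (1 + real j) * (1 / \<delta>) ^ j) (%z. (1 / P z) ^ j)"
proof -
  define \<Lambda> where "\<Lambda> = delay_span \<tau> K"
  note sp = delay_span_props[of \<tau>, OF \<tau>]
  interpret \<Lambda>: delay_semigroup \<Lambda>
    unfolding \<Lambda>_def using sp by unfold_locales (auto intro: sets.countable)
  define D where "D z = det (\<chi> i j. Q i j z)" for z
  have LSQ\<Lambda>: "LS \<Lambda> \<nu> (\<Sum>k<K. norm (a k i j) * exp (\<nu> * \<tau> k)) (%z. \<Sum>k<K. a k i j * exp (- (z * of_real (\<tau> k))))" for i j \<nu>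
    by (intro \<Lambda>.LS_sum LS_exp \<Lambda>.S_borel) (auto simp: \<Lambda>_def sp)
  have LSQ: "\<exists>B. LS {0..} \<nu>' B (Q i j)" for i j
  proof -
    have "LS {0..} \<nu>' (norm (of_bool (i = j) :: complex) + (\<Sum>k<K. norm (a k i j) * exp (\<nu>' * \<tau> k))) (Q i j)"
      unfolding Q_def using \<tau> by (intro LS_add LS_const half_line.LS_sum LS_exp) (auto intro: less_imp_le)
    then show ?thesis by blast
  qed
  obtain bQ bg C0 where b: "\<And>i j. LS {0..} \<nu>' (bQ i j) (Q i j)" "\<And>i j. LS {0..} \<nu>' (bg i j) (g i j)"
    "\<And>i j z. - \<nu>' \<le> Re z ==> norm (g i j z) \<le> C0 i j / (1 + (norm z)\<^sup>2)"
    using LSQ g by metis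
  define B where "B = 1 + (\<Sum>i\<in>UNIV. \<Sum>j\<in>UNIV. bQ i j + bg i j)"
  define C1 where "C1 = (\<Sum>i\<in>UNIV. \<Sum>j\<in>UNIV. max 0 (C0 i j))"
  have nn: "0 \<le> bQ i j" "0 \<le> bg i j" for i j using b LS_nonneg by blast+
  have mem: "f i j \<le> (\<Sum>i\<in>UNIV. \<Sum>j\<in>UNIV. f i j)" if "\<And>i j. 0 \<le> f i j" for f :: "'n => 'n => real" and i j
  proof -
    have "f i j \<le> (\<Sum>j\<in>UNIV. f i j)" using that by (intro member_le_sum) auto
    also have "\<dots> \<le> (\<Sum>i\<in>UNIV. \<Sum>j\<in>UNIV. f i j)" using that by (intro member_le_sum[of i UNIV "%i. \<Sum>j\<in>UNIV. f i j"]) (auto intro: sum_nonneg)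
    finally show ?thesis .
  qed
  have B: "bQ i j + bg i j \<le> B" for i j using mem[of "%i j. bQ i j + bg i j" i j] nn by (simp add: B_def)
  have B1: "1 \<le> B" unfolding B_def using nn by (auto intro!: sum_nonneg add_nonneg_nonneg)
  have LQ: "LS {0..} \<nu>' B (Q i j)" for i j by (rule LS_le[OF b(1)]) (use B[of i j] nn[of i j] in linarith)
  have LQg: "LS {0..} \<nu>' B (%z. Q i j z + g i j z)" for i j by (rule LS_le[OF LS_add[OF b(1,2)] B]) simp
  have holP: "P holomorphic_on {z. - \<nu>' < Re z}" unfolding P_def
    by (rule LS_holomorphic[OF half_line.LS_det[OF LQg]]) simp
  have holD: "D holomorphic_on {z. - \<nu>' < Re z}" unfolding D_def
    by (rule LS_holomorphic[OF half_line.LS_det[OF LQ]]) simp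
  define C where "C = fact CARD('n) * (CARD('n) * B ^ CARD('n) * C1)"
  have C0: "0 \<le> C" using B1 by (auto simp: C_def C1_def intro!: mult_nonneg_nonneg sum_nonneg)
  have PD: "norm (P z - D z) \<le> C / (1 + (norm z)\<^sup>2)" if z: "- \<nu>' < Re z" for z
  proof -
    have "norm (P z - D z) \<le> fact CARD('n) * (CARD('n) * B ^ CARD('n) * (C1 / (1 + (norm z)\<^sup>2)))"
      unfolding P_def D_def
    proof (rule norm_det_diff_le[OF _ _ _ B1])
      show "norm (Q i j z + g i j z) \<le> B" "norm (Q i j z) \<le> B" for i j
        using LS_bound[OF LQg _ less_imp_le[OF z], of i j] LS_bound[OF LQ _ less_imp_le[OF z], of i j] by auto
      have "C0 i j / (1 + (norm z)\<^sup>2) \<le> C1 / (1 + (norm z)\<^sup>2)" for i j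
        using mem[of "%i j. max 0 (C0 i j)" i j] by (intro divide_right_mono) (auto simp: C1_def add_nonneg_nonneg)
      then show "norm (Q i j z + g i j z - Q i j z) \<le> C1 / (1 + (norm z)\<^sup>2)" for i j
        using b(3)[OF less_imp_le[OF z], of i j] by (auto intro: order_trans)
    qed
    then show ?thesis by (simp add: C_def)
  qed
  have D: "\<delta> \<le> norm (D z)" if "- \<nu>' < Re z" for z
    using discrete_part_lower_bound[where P = P and \<nu> = \<nu>' and \<delta> = \<delta> and b = "%i j. of_bool (i = j)" and K = K and a = a and \<tau> = \<tau> and C = C and z = z]
      P PD that unfolding D_def Q_def by blast
  define r where "r = 1 / \<delta>"
  have r: "0 < r" using \<delta> by (simp add: r_def)
  have inv: "norm (1 / P z) \<le> r" "norm (1 / D z) \<le> r" "P z \<noteq> 0" "D z \<noteq> 0" if "- \<nu>' < Re z" for z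
    using P[OF that] D[OF that] \<delta> by (auto simp: r_def norm_divide intro!: divide_left_mono mult_pos_pos)
  \<comment> \<open>the part of the inverse with a density\<close>
  have 1: "LS {0..} \<nu> (real j * r ^ j * (r * C) / (\<nu>' - \<nu>)) (%z. (1 / P z) ^ j - (1 / D z) ^ j)" for j
  proof (rule LS_inverse_Laplace[OF _ _ \<nu>])
    show "(%z. (1 / P z) ^ j - (1 / D z) ^ j) holomorphic_on {z. - \<nu>' < Re z}"
      using inv by (intro holomorphic_intros holP holD) auto
    fix z assume z: "- \<nu>' < Re z"
    have "norm (1 / P z - 1 / D z) = norm (1 / P z) * norm (1 / D z) * norm (P z - D z)"
      using inv[OF z] by (simp add: norm_mult[symmetric] field_simps norm_minus_commute)
    also have "\<dots> \<le> r * r * (C / (1 + (norm z)\<^sup>2))"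
      using inv[OF z] PD[OF z] r by (intro mult_mono) auto
    finally have "norm (1 / P z - 1 / D z) / r \<le> r * C / (1 + (norm z)\<^sup>2)" using r by (simp add: field_simps)
    then have "real j * r ^ j * (norm (1 / P z - 1 / D z) / r) \<le> real j * r ^ j * (r * C / (1 + (norm z)\<^sup>2))"
      using r by (intro mult_left_mono) auto
    then show "norm ((1 / P z) ^ j - (1 / D z) ^ j) \<le> real j * r ^ j * (r * C) / (1 + (norm z)\<^sup>2)"
      using norm_power_diff_scaled[OF inv(1,2)[OF z] r, of j] by simp
  qed (use r C0 in auto)
  \<comment> \<open>the discrete part\<close>
  have "\<exists>\<sigma>. \<forall>i j. (\<Sum>k<K. norm (a k i j) * exp (- \<sigma> * \<tau> k)) \<le> 1 / (2 * (fact CARD('n) * (CARD('n) * (2::real) ^ CARD('n))))"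
  proof -
    have "((%\<sigma>. \<Sum>k<K. norm (a k i j) * exp (- \<sigma> * \<tau> k)) \<longlongrightarrow> 0) at_top" for i j
    proof (rule tendsto_null_sum)
      fix k
      show "((%\<sigma>. norm (a k i j) * exp (- \<sigma> * \<tau> k)) \<longlongrightarrow> 0) at_top" using \<tau>[of k] by real_asymp
    qed
    then have "\<forall>\<^sub>F \<sigma> in at_top. (\<Sum>k<K. norm (a k i j) * exp (- \<sigma> * \<tau> k)) < 1 / (2 * (fact CARD('n) * (CARD('n) * (2::real) ^ CARD('n))))" for i j
      by (rule order_tendstoD(2)) auto
    then have "\<forall>\<^sub>F \<sigma> in at_top. \<forall>i j. (\<Sum>k<K. norm (a k i j) * exp (- \<sigma> * \<tau> k)) < 1 / (2 * (fact CARD('n) * (CARD('n) * (2::real) ^ CARD('n))))"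
      by (intro eventually_all_finite) auto
    from eventually_happens'[OF trivial_limit_at_top_linorder this] show ?thesis by (meson less_imp_le)
  qed
  then obtain \<sigma> where \<sigma>: "\<And>i j. (\<Sum>k<K. norm (a k i j) * exp (- \<sigma> * \<tau> k)) \<le> 1 / (2 * (fact CARD('n) * (CARD('n) * (2::real) ^ CARD('n))))" by blast
  define \<epsilon> where "\<epsilon> = 1 / (2 * (fact CARD('n) * (CARD('n) * (2::real) ^ CARD('n))) :: real)"
  have \<epsilon>: "fact CARD('n) * (CARD('n) * (2::real) ^ CARD('n) * \<epsilon>) = 1 / 2" by (simp add: \<epsilon>_def)
  have \<epsilon>1: "\<epsilon> \<le> 1"
  proof -
    have "1 \<le> real CARD('n)" using zero_less_card_finite[where 'a = 'n] by linarith
    then have "1 \<le> real CARD('n) * 2 ^ CARD('n)" 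
      using mult_mono[of 1 "real CARD('n)" 1 "2 ^ CARD('n)"] by simp
    then have "(1::real) \<le> 2 * (fact CARD('n) * (CARD('n) * (2::real) ^ CARD('n)))"
      using mult_mono[of 1 "fact CARD('n)" 1 "real CARD('n) * 2 ^ CARD('n)"] fact_ge_1[of "CARD('n)", where 'a = real] by simp
    then show ?thesis by (simp add: \<epsilon>_def)
  qed
  have "LS \<Lambda> (- \<sigma>) (1 / 2) (%z. D z - det (\<chi> i j. of_bool (i = j) :: complex ^ 'n ^ 'n))"
    unfolding D_def \<epsilon>[symmetric]
  proof (rule \<Lambda>.LS_det_diff)
    show o: "LS \<Lambda> (- \<sigma>) 2 (%z. of_bool (i = j))" for i j :: 'n
      by (rule LS_le[OF LS_const]) (use \<Lambda>.S_0 \<Lambda>.S_borel in auto)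
    show d: "LS \<Lambda> (- \<sigma>) \<epsilon> (%z. Q i j z - of_bool (i = j))" for i j
      using LS_le[OF LSQ\<Lambda>[of "- \<sigma>" i j] \<sigma>[of i j, folded \<epsilon>_def]] by (simp add: Q_def)
    have "LS \<Lambda> (- \<sigma>) (norm (of_bool (i = j) :: complex) + \<epsilon>) (%z. of_bool (i = j) + (Q i j z - of_bool (i = j)))" for i j
      by (rule LS_add[OF LS_const d \<Lambda>.S_nonneg]) (use \<Lambda>.S_0 \<Lambda>.S_borel in auto)
    then have "LS \<Lambda> (- \<sigma>) (norm (of_bool (i = j) :: complex) + \<epsilon>) (Q i j)" for i j by simp
    then show "LS \<Lambda> (- \<sigma>) 2 (Q i j)" for i j
      by (rule LS_le) (use \<epsilon>1 in auto)
  qed simp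
  moreover have "det (\<chi> i j. of_bool (i = j) :: complex ^ 'n ^ 'n) = 1"
  proof -
    have "(\<chi> i j. of_bool (i = j)) = (mat 1 :: complex ^ 'n ^ 'n)" by (simp add: mat_def vec_eq_iff)
    then show ?thesis by (simp add: det_I)
  qed
  ultimately have "LS \<Lambda> (- \<sigma>) (1 / 2) (%z. D z - 1)" by simp
  from \<Lambda>.LS_Neumann[OF this] have LD: "LS \<Lambda> (- \<sigma>) 2 (%z. 1 / D z)" by simp
  obtain K1 where K1: "0 \<le> K1" "\<And>F. finite F ==> F \<subseteq> \<Lambda> ==> (\<Sum>x\<in>F. exp (- ((\<nu>' - \<nu>) / 3 * x))) \<le> K1"
    using delay_span_exp_sum[of \<tau> "(\<nu>' - \<nu>) / 3" K, OF \<tau>] \<nu> unfolding \<Lambda>_def by auto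
  have 2: "LS {0..} \<nu> (r ^ j * K1) (%z. (1 / D z) ^ j)" for j
  proof (rule LS_discrete[OF _ _ \<Lambda>.LS_power[OF LD] \<Lambda>.S_nonneg _ \<nu> K1(2)])
    show "(%z. (1 / D z) ^ j) holomorphic_on {z. - \<nu>' < Re z}" using inv by (intro holomorphic_intros holD) auto
    show "norm ((1 / D z) ^ j) \<le> r ^ j" if "- \<nu>' < Re z" for z
      unfolding norm_power using inv[OF that] by (intro power_mono) auto
    show "countable \<Lambda>" using sp by (simp add: \<Lambda>_def)
  qed
  define C2 where "C2 = r * C / (\<nu>' - \<nu>) + K1"
  have "LS {0..} \<nu> (C2 * (1 + real j) * (1 / \<delta>) ^ j) (%z. (1 / P z) ^ j)" for j
  proof -
    have "LS {0..} \<nu> (real j * r ^ j * (r * C) / (\<nu>' - \<nu>) + r ^ j * K1) (%z. (1 / P z) ^ j)"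
      using LS_add[OF 1[of j] 2[of j]] by simp
    moreover have "real j * r ^ j * (r * C) / (\<nu>' - \<nu>) + r ^ j * K1 \<le> C2 * (1 + real j) * (1 / \<delta>) ^ j"
    proof -
      have "0 \<le> r * C / (\<nu>' - \<nu>) * r ^ j" "0 \<le> K1 * real j * r ^ j" using r C0 \<nu> K1 by auto
      then show ?thesis unfolding C2_def r_def[symmetric] by (simp add: algebra_simps add_divide_distrib)
    qed
    ultimately show ?thesis by (rule LS_le)
  qed
  then show ?thesis by blast
qed


text \<open>Let \<open>P\<close> be the determinant after replacing the entries by approximations and expand
  $1/d = \sum_j (P-d)^j P^{-j-1}$.  The measure of $P - d$ has mass at most $\delta/2$ if the approximation is good, and $P^{-j-1}$ costs
  about $j\,\delta^{-j-1}$ by the previous lemma, where \<open>\<delta>\<close> is a lower bound of $|P|$.  The series converges because the factor $2^{-j}$ wins.\<close>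

theorem LS_inverse_det:
  fixes m :: "'n::finite => 'n => complex => complex" and \<tau> :: "nat => real"
  defines "d \<equiv> %z. det (\<chi> i j. of_bool (i = j) + m i j z)"
  assumes \<tau>: "\<And>k. 0 < \<tau> k"
    and m: "\<And>i j. \<exists>B. LS {0<..} \<nu>0 B (m i j)"
    and approx: "\<And>\<nu> \<epsilon>. 0 < \<epsilon> ==> \<exists>(K::nat) a g. \<forall>i j. 
       LS {0..} \<nu> \<epsilon> (%z. m i j z - ((\<Sum>k<K. a k i j * exp (- (z * of_real (\<tau> k)))) + g i j z)) \<and>
       (\<exists>B. LS {0..} \<nu> B (g i j)) \<and> (\<exists>C. \<forall>z. - \<nu> \<le> Re z --> norm (g i j z) \<le> C / (1 + (norm z)\<^sup>2))"
    and nz: "\<And>z. - \<nu>0 < Re z ==> d z \<noteq> 0" and \<nu>: "\<nu> < \<nu>0"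
  shows "\<exists>B. LS {0..} \<nu> B (%z. 1 / d z)"
proof -
  \<comment> \<open>An intermediate weight: turning sup bounds into bounds on masses costs a little of the exponent.\<close>
  define \<nu>' where "\<nu>' = (\<nu> + \<nu>0) / 2"
  have \<nu>': "\<nu> < \<nu>'" "\<nu>' < \<nu>0" using \<nu> by (auto simp: \<nu>'_def)
  obtain bm where bm: "\<And>i j. LS {0<..} \<nu>0 (bm i j) (m i j)" using m by metis
  have nn: "0 \<le> bm i j" for i j using bm LS_nonneg by blast
  \<comment> \<open>The slack beyond the masses leaves room for the entries of the identity and for the approximation error.\<close>
  define B where "B = 3 + (\<Sum>i\<in>UNIV. \<Sum>j\<in>UNIV. bm i j)"
  have mem: "bm i j \<le> (\<Sum>i\<in>UNIV. \<Sum>j\<in>UNIV. bm i j)" for i j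
  proof -
    have "bm i j \<le> (\<Sum>j\<in>UNIV. bm i j)" using nn by (intro member_le_sum) auto
    also have "\<dots> \<le> (\<Sum>i\<in>UNIV. \<Sum>j\<in>UNIV. bm i j)" using nn by (intro member_le_sum[of i UNIV "%i. \<Sum>j\<in>UNIV. bm i j"]) (auto intro: sum_nonneg)
    finally show ?thesis .
  qed
  have B1: "1 \<le> B" unfolding B_def using nn by (auto intro!: sum_nonneg add_nonneg_nonneg)
  have one: "LS {0..} \<nu> 1 (%z. of_bool (i = j))" for i j :: 'n and \<nu>
    by (rule LS_le[OF LS_const]) auto
  have m0: "LS {0..} \<nu>0 (bm i j) (m i j)" for i j by (rule LS_mono[OF bm]) auto
  have E: "LS {0..} \<nu>0 (B - 2) (%z. of_bool (i = j) + m i j z)" for i j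
    by (rule LS_le[OF LS_add[OF one m0]]) (use mem in \<open>auto simp: B_def\<close>)
  have d0: "LS {0..} \<nu>0 (fact CARD('n) * (B - 2) ^ CARD('n)) d"
    unfolding d_def by (rule half_line.LS_det[OF E])
  define C1 where "C1 = (fact CARD('n) * (CARD('n) * B ^ CARD('n)) :: real)"
  have C1: "0 < C1" using B1 by (simp add: C1_def)
  \<comment> \<open>far to the right the determinant is close to 1\<close>
  have "\<exists>\<sigma>. \<forall>z. \<sigma> \<le> Re z --> 1 / 2 \<le> norm (d z)"
  proof -
    define \<epsilon> where "\<epsilon> = min 1 (1 / (2 * C1))"
    have \<epsilon>: "0 < \<epsilon>" "\<epsilon> \<le> 1" "C1 * \<epsilon> \<le> 1 / 2"
    proof -
      have "C1 * \<epsilon> \<le> C1 * (1 / (2 * C1))" using C1 by (intro mult_left_mono) (auto simp: \<epsilon>_def)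
      then show "C1 * \<epsilon> \<le> 1 / 2" using C1 by simp
    qed (use C1 in \<open>auto simp: \<epsilon>_def\<close>)
    have "\<exists>\<sigma>0. \<forall>\<sigma>\<ge>\<sigma>0. LS {0<..} (- \<sigma>) \<epsilon> (m i j)" for i j
      using LS_decay[OF bm _ _ \<epsilon>(1)] by auto
    then obtain s where s: "\<And>i j \<sigma>. s i j \<le> \<sigma> ==> LS {0<..} (- \<sigma>) \<epsilon> (m i j)" by metis
    define \<sigma> where "\<sigma> = (\<Sum>i\<in>UNIV. \<Sum>j\<in>UNIV. \<bar>s i j\<bar>)"
    have "s i j \<le> \<sigma>" for i j
    proof -
      have "\<bar>s i j\<bar> \<le> (\<Sum>j\<in>UNIV. \<bar>s i j\<bar>)" by (intro member_le_sum) auto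
      also have "\<dots> \<le> \<sigma>" unfolding \<sigma>_def by (intro member_le_sum[of i UNIV "%i. \<Sum>j\<in>UNIV. \<bar>s i j\<bar>"]) (auto intro: sum_nonneg)
      finally show ?thesis by simp
    qed
    then have small: "LS {0..} (- \<sigma>) \<epsilon> (m i j)" for i j by (intro LS_mono[OF s]) auto
    show ?thesis
    proof (intro exI[of _ \<sigma>] allI impI)
      fix z assume z: "\<sigma> \<le> Re z"
      have mz: "norm (m i j z) \<le> \<epsilon>" for i j using LS_bound[OF small, of z i j] z by simp
      have "norm (d z - det (\<chi> i j. of_bool (i = j) :: complex ^ 'n ^ 'n)) \<le> fact CARD('n) * (CARD('n) * B ^ CARD('n) * \<epsilon>)"
        unfolding d_def
      proof (rule norm_det_diff_le[OF _ _ _ B1])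
        have "3 \<le> B" unfolding B_def using nn by (auto intro!: sum_nonneg)
        then show "norm (of_bool (i = j) + m i j z) \<le> B" for i j
          using norm_triangle_ineq[of "of_bool (i = j)" "m i j z"] mz[of i j] \<epsilon> by (cases "i = j") auto
        show "norm (of_bool (i = j) :: complex) \<le> B" for i j :: 'n using B1 by (cases "i = j") auto
      qed (use mz in auto)
      moreover have "det (\<chi> i j. of_bool (i = j) :: complex ^ 'n ^ 'n) = 1"
      proof -
        have "(\<chi> i j. of_bool (i = j)) = (mat 1 :: complex ^ 'n ^ 'n)" by (simp add: mat_def vec_eq_iff)
        then show ?thesis by (simp add: det_I)
      qed
      ultimately have "norm (d z - 1) \<le> 1 / 2" using \<epsilon>(3) by (simp add: C1_def mult.assoc)
      then show "1 / 2 \<le> norm (d z)" using norm_triangle_ineq2[of 1 "1 - d z"] by (simp add: norm_minus_commute)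
    qed
  qed
  then obtain \<sigma> where \<sigma>: "\<And>z. \<sigma> \<le> Re z ==> 1 / 2 \<le> norm (d z)" by blast
  obtain \<delta>2 where \<delta>2: "0 < \<delta>2" "\<And>z. - \<nu>' \<le> Re z ==> \<delta>2 \<le> norm (d z)"
    using half_plane_lower_bound[OF LS_holomorphic[OF d0] LS_bound[OF d0 _ less_imp_le] nz \<sigma> \<nu>'(2)] by auto
  define \<delta> where "\<delta> = \<delta>2 / 2"
  have \<delta>: "0 < \<delta>" "\<delta>2 = 2 * \<delta>" using \<delta>2 by (auto simp: \<delta>_def)
  define \<epsilon> where "\<epsilon> = min 1 (\<delta> / (2 * C1))"
  have \<epsilon>: "0 < \<epsilon>" "\<epsilon> \<le> 1" "C1 * \<epsilon> \<le> \<delta> / 2"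
  proof -
    have "C1 * \<epsilon> \<le> C1 * (\<delta> / (2 * C1))" using C1 by (intro mult_left_mono) (auto simp: \<epsilon>_def)
    then show "C1 * \<epsilon> \<le> \<delta> / 2" using C1 by simp
  qed (use C1 \<delta> in \<open>auto simp: \<epsilon>_def\<close>)
  obtain K :: nat and a g where ag: 
    "\<And>i j. LS {0..} \<nu>' \<epsilon> (%z. m i j z - ((\<Sum>k<K. a k i j * exp (- (z * of_real (\<tau> k)))) + g i j z))"
    "\<And>i j. \<exists>B. LS {0..} \<nu>' B (g i j)" "\<And>i j. \<exists>C. \<forall>z. - \<nu>' \<le> Re z --> norm (g i j z) \<le> C / (1 + (norm z)\<^sup>2)"
    using approx[OF \<epsilon>(1), of \<nu>'] by blast
  define Q where "Q i j z = of_bool (i = j) + (\<Sum>k<K. a k i j * exp (- (z * of_real (\<tau> k)))) + g i j z" for i j z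
  define P where "P z = det (\<chi> i j. Q i j z)" for z
  have E': "LS {0..} \<nu>' B (%z. of_bool (i = j) + m i j z)" for i j
    by (rule LS_mono[OF E]) (use \<nu>' in auto)
  have diff: "LS {0..} \<nu>' \<epsilon> (%z. (of_bool (i = j) + m i j z) - Q i j z)" for i j
    using ag(1)[of i j] by (simp add: Q_def algebra_simps)
  have Q: "LS {0..} \<nu>' B (Q i j)" for i j
  proof -
    have "LS {0..} \<nu>' (B - 2 + \<epsilon>) (%z. (of_bool (i = j) + m i j z) - ((of_bool (i = j) + m i j z) - Q i j z))"
      by (rule half_line.LS_diff[OF LS_mono[OF E] diff]) (use \<nu>' in auto)
    then have "LS {0..} \<nu>' (B - 2 + \<epsilon>) (Q i j)" by simp
    then show ?thesis by (rule LS_le) (use \<epsilon> in auto)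
  qed
  have e: "LS {0..} \<nu>' (\<delta> / 2) (%z. d z - P z)"
  proof (rule LS_le)
    show "LS {0..} \<nu>' (fact CARD('n) * (CARD('n) * B ^ CARD('n) * \<epsilon>)) (%z. d z - P z)"
      unfolding d_def P_def by (rule half_line.LS_det_diff[OF E' Q diff B1])
  qed (use \<epsilon>(3) in \<open>simp add: C1_def mult.assoc\<close>)
  have P: "\<delta> \<le> norm (P z)" if "- \<nu>' < Re z" for z
    using LS_bound[OF e _ less_imp_le[OF that]] \<delta>2(2)[of z] \<delta> that norm_triangle_ineq2[of "d z" "d z - P z"] by simp
  obtain C where C: "\<And>j. LS {0..} \<nu> (C * (1 + real j) * (1 / \<delta>) ^ j) (%z. (1 / P z) ^ j)"
    using LS_inverse_power[OF \<tau> \<nu>'(1) \<delta>(1) ag(2,3) P[unfolded P_def Q_def]] unfolding P_def Q_def by blast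
  have e': "LS {0..} \<nu> (\<delta> / 2) (%z. - (d z - P z))"
    by (rule half_line.LS_uminus, rule LS_mono[OF e]) (use \<nu>' in auto)
  have summand: "LS {0..} \<nu> ((\<delta> / 2) ^ j * (C * (1 + real (Suc j)) * (1 / \<delta>) ^ Suc j)) (%z. (- (d z - P z)) ^ j * (1 / P z) ^ Suc j)" for j
    by (intro LS_mult half_line.LS_power e' C) auto
  have geq: "(\<delta> / 2) ^ j * (C * (1 + real (Suc j)) * (1 / \<delta>) ^ Suc j) = C / \<delta> * ((1 + real (Suc j)) * (1 / 2) ^ j)" for j
    using \<delta> by (simp add: power_divide field_simps)
  have sm: "summable (%j. (\<delta> / 2) ^ j * (C * (1 + real (Suc j)) * (1 / \<delta>) ^ Suc j))"
  proof -
    have "summable (%j. (1 + real (Suc j)) * (1 / 2) ^ j)"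
    proof (rule summable_comparison_test_bigo)
      show "summable (%j. norm ((3 / 4 :: real) ^ j))" by (simp add: summable_geometric)
      show "(%j. (1 + real (Suc j)) * (1 / 2) ^ j) \<in> O(%j. (3 / 4) ^ j)" by real_asymp
    qed
    then have "summable (%j. C / \<delta> * ((1 + real (Suc j)) * (1 / 2) ^ j))" by (rule summable_mult)
    then show ?thesis unfolding geq .
  qed
  have "LS {0..} \<nu> (\<Sum>j. (\<delta> / 2) ^ j * (C * (1 + real (Suc j)) * (1 / \<delta>) ^ Suc j)) (%z. \<Sum>j. (- (d z - P z)) ^ j * (1 / P z) ^ Suc j)"
    by (rule LS_suminf[OF summand _ sm]) simp
  then have "LS {0..} \<nu> (\<Sum>j. (\<delta> / 2) ^ j * (C * (1 + real (Suc j)) * (1 / \<delta>) ^ Suc j)) (%z. 1 / d z)"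
  proof (rule LS_cong)
    fix z assume "- \<nu> \<le> Re z"
    then have z: "- \<nu>' < Re z" using \<nu>' by simp
    have P0: "P z \<noteq> 0" "d z \<noteq> 0" using P[OF z] \<delta> nz[of z] z \<nu>' by auto
    have "norm (d z - P z) \<le> \<delta> / 2" using LS_bound[OF e _ less_imp_le[OF z]] by simp
    also have "\<delta> / 2 < norm (P z)" using P[OF z] \<delta> by simp
    finally have q: "norm (- (d z - P z) / P z) < 1" using P0 by (simp add: norm_divide divide_less_eq norm_minus_commute)
    have "(\<Sum>j. (- (d z - P z)) ^ j * (1 / P z) ^ Suc j) = (\<Sum>j. 1 / P z * (- (d z - P z) / P z) ^ j)"
      by (simp add: power_divide field_simps)
    also have "\<dots> = 1 / P z * (1 / (1 - (- (d z - P z) / P z)))"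
      using q by (simp only: suminf_mult[OF summable_geometric[OF q]] suminf_geometric[OF q])
    also have "\<dots> = 1 / d z" using P0 by (simp add: field_simps)
    finally show "1 / d z = (\<Sum>j. (- (d z - P z)) ^ j * (1 / P z) ^ Suc j)" by simp
  qed
  then show ?thesis by blast
qed

section \<open>Uniqueness of transforms and the resolvent formula\<close>

lemma law_zero:
  assumes "law S M"
  obtains Z where "law S Z" "\<And>\<phi>. \<phi> \<in> borel_fun ==> absint Z \<phi> = 0"
    "\<And>\<phi>. \<phi> \<in> borel_fun ==> pairing Z \<phi> = 0"
proof -
  have "S \<in> sets borel" "S \<noteq> {}" 
    using assms unfolding law_def using prob_space.AE_False[of M] by auto
  then obtain s where "s \<in> S" "S \<in> sets borel" by auto
  then obtain Z where Z: "law S Z" "\<And>\<phi>. \<phi> \<in> borel_fun ==> absint Z \<phi> = enorm (0::complex) * \<phi> s"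
    "\<And>\<phi>. \<phi> \<in> borel_fun ==> pairing Z \<phi> = 0 * \<phi> s" by (rule law_dirac[where c = 0]) (rule that, assumption, blast, blast)
  show thesis by (rule that[of Z]) (simp_all add: Z)
qed

lemma law_add:
  assumes M: "law S M" and N: "law S N"
  obtains L where "law S L" "\<And>\<phi>. \<phi> \<in> borel_fun ==> absint L \<phi> = absint M \<phi> + absint N \<phi>"
    "\<And>\<phi>. \<phi> \<in> borel_fun ==> absint M (%t. enorm (\<phi> t)) < \<infinity> ==> absint N (%t. enorm (\<phi> t)) < \<infinity> ==>
      pairing L \<phi> = pairing M \<phi> + pairing N \<phi>"
proof -
  obtain Z where Z: "law S Z" "\<And>\<phi>. \<phi> \<in> borel_fun ==> absint Z \<phi> = 0"
    "\<And>\<phi>. \<phi> \<in> borel_fun ==> pairing Z \<phi> = 0" using law_zero[OF M] by blast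
  define F where "F i = (if i = 0 then M else if i = 1 then N else Z)" for i :: nat
  have F: "law S (F i)" for i using M N Z by (simp add: F_def)
  obtain L where L: "law S L"
    "\<And>\<phi>. \<phi> \<in> borel_fun ==> absint L \<phi> = (\<Sum>i. absint (F i) \<phi>)"
    "\<And>\<phi>. \<phi> \<in> borel_fun ==> (\<Sum>i. absint (F i) (%t. enorm (\<phi> t))) < \<infinity> ==>
       (%i. pairing (F i) \<phi>) sums pairing L \<phi>"
    by (rule law_mixture[where M = F, OF F]) (rule that, assumption, blast, blast)
  have a: "(\<Sum>i. absint (F i) \<phi>) = absint M \<phi> + absint N \<phi>" if "\<phi> \<in> borel_fun" for \<phi>
  proof -
    have "(%i. absint (F i) \<phi>) sums (\<Sum>i\<in>{0, 1}. absint (F i) \<phi>)"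
      by (rule sums_finite) (auto simp: F_def Z(2) that)
    then show ?thesis by (simp add: sums_iff F_def)
  qed
  show thesis
  proof (rule that[OF L(1)])
    show "absint L \<phi> = absint M \<phi> + absint N \<phi>" if "\<phi> \<in> borel_fun" for \<phi>
      using a[OF that] L(2)[OF that] by simp
    fix \<phi> :: "real => complex" assume m[measurable]: "\<phi> \<in> borel_fun" and fin: "absint M (%t. enorm (\<phi> t)) < \<infinity>" "absint N (%t. enorm (\<phi> t)) < \<infinity>"
    have "(%i. pairing (F i) \<phi>) sums (\<Sum>i\<in>{0, 1}. pairing (F i) \<phi>)"
      by (rule sums_finite) (auto simp: F_def Z(3) m)
    moreover have "(\<Sum>i. absint (F i) (%t. enorm (\<phi> t))) < \<infinity>"
      by (subst a) (use fin in \<open>auto simp: less_top[symmetric]\<close>)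
    then have "(%i. pairing (F i) \<phi>) sums pairing L \<phi>" by (rule L(3)[OF m])
    ultimately show "pairing L \<phi> = pairing M \<phi> + pairing N \<phi>" by (simp add: sums_iff F_def)
  qed
qed

lemma law_sum:
  assumes "finite I" "I \<noteq> {}" "\<And>i. i \<in> I ==> law S (M i)"
  shows "\<exists>L. law S L \<and> (\<forall>\<phi>. \<phi> \<in> borel_fun --> absint L \<phi> = (\<Sum>i\<in>I. absint (M i) \<phi>)) \<and>
    (\<forall>\<phi>. \<phi> \<in> borel_fun --> (\<forall>i\<in>I. absint (M i) (%t. enorm (\<phi> t)) < \<infinity>) -->
      pairing L \<phi> = (\<Sum>i\<in>I. pairing (M i) \<phi>))"
  using assms
proof (induction I rule: finite_ne_induct)
  case (singleton x)
  then show ?case by (intro exI[of _ "M x"]) simp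
next
  case (insert x I)
  then obtain L where L: "law S L" "\<And>\<phi>. \<phi> \<in> borel_fun ==> absint L \<phi> = (\<Sum>i\<in>I. absint (M i) \<phi>)"
    "\<And>\<phi>. \<phi> \<in> borel_fun ==> (\<forall>i\<in>I. absint (M i) (%t. enorm (\<phi> t)) < \<infinity>) ==>
      pairing L \<phi> = (\<Sum>i\<in>I. pairing (M i) \<phi>)" by auto
  have x: "law S (M x)" using insert by simp
  obtain L' where L': "law S L'" "\<And>\<phi>. \<phi> \<in> borel_fun ==> absint L' \<phi> = absint (M x) \<phi> + absint L \<phi>"
    "\<And>\<phi>. \<phi> \<in> borel_fun ==> absint (M x) (%t. enorm (\<phi> t)) < \<infinity> ==> absint L (%t. enorm (\<phi> t)) < \<infinity> ==>
      pairing L' \<phi> = pairing (M x) \<phi> + pairing L \<phi>" using law_add[OF x L(1)] by blast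
  show ?case
  proof (intro exI[of _ L'] conjI allI impI)
    show "absint L' \<phi> = (\<Sum>i\<in>insert x I. absint (M i) \<phi>)" if "\<phi> \<in> borel_fun" for \<phi>
      using insert.hyps by (simp add: L'(2)[OF that] L(2)[OF that])
    fix \<phi> :: "real => complex" assume m: "\<phi> \<in> borel_fun" and fin: "\<forall>i\<in>insert x I. absint (M i) (%t. enorm (\<phi> t)) < \<infinity>"
    have "absint L (%t. enorm (\<phi> t)) < \<infinity>" 
      using m fin insert.hyps(1) by (subst L(2)) (auto simp: less_top[symmetric])
    then show "pairing L' \<phi> = (\<Sum>i\<in>insert x I. pairing (M i) \<phi>)"
      using insert.hyps fin L(3)[OF m] L'(3)[OF m] by simp
  qed (rule L')
qed

text \<open>The positive and the negative part of the weight have the same total mass and, normalised, the same characteristic function.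
  By Levy's uniqueness theorem they give the time the same distribution.\<close>

lemma signed_law_unique:
  fixes U T :: "'a => real"
  assumes "prob_space M" and U: "integrable M U" and T[measurable]: "T \<in> borel_measurable M"
    and ch: "\<And>y. (\<integral>x. of_real (U x) * iexp (y * T x) \<partial>M) = 0"
    and \<psi>[measurable]: "\<psi> \<in> borel_fun" and int: "integrable M (%x. U x * \<psi> (T x))"
  shows "(\<integral>x. U x * \<psi> (T x) \<partial>M) = 0"
proof -
  interpret prob_space M by fact
  have [measurable]: "U \<in> borel_measurable M" using U by auto
  define p where "p x = max (U x) 0" for x
  define n where "n x = max (- U x) 0" for x
  have pn: "U x = p x - n x" "0 \<le> p x" "0 \<le> n x" "p x \<le> \<bar>U x\<bar>" "n x \<le> \<bar>U x\<bar>" for x by (auto simp: p_def n_def)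
  have [measurable]: "p \<in> borel_measurable M" "n \<in> borel_measurable M" unfolding p_def[abs_def] n_def[abs_def] by measurable
  have pi: "integrable M (%x. p x * f x)" and ni: "integrable M (%x. n x * f x)" if "integrable M (%x. U x * f x)" "f \<in> borel_measurable M" for f
    by (rule Bochner_Integration.integrable_bound[OF that(1)]; use that(2) pn in \<open>auto simp: abs_mult intro!: mult_right_mono\<close>)+
  have p1: "integrable M p" "integrable M n" using pi[of "%_. 1"] ni[of "%_. 1"] U by auto
  have "(\<integral>x. complex_of_real (U x) \<partial>M) = 0" using ch[of 0] by simp
  then have "(\<integral>x. U x \<partial>M) = 0" by (simp only: integral_complex_of_real of_real_eq_0_iff)
  then have eqk: "(\<integral>x. p x \<partial>M) = (\<integral>x. n x \<partial>M)" unfolding pn(1) using p1 by simp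
  define k where "k = (\<integral>x. p x \<partial>M)"
  have k0: "0 \<le> k" unfolding k_def by (rule integral_nonneg_AE) (use pn in auto)
  show ?thesis
  proof (cases "k = 0")
    case True
    have "AE x in M. p x = 0" "AE x in M. n x = 0"
      using True eqk p1 pn integral_nonneg_eq_0_iff_AE[of M p] integral_nonneg_eq_0_iff_AE[of M n] by (auto simp: k_def)
    then have "AE x in M. U x * \<psi> (T x) = 0" by eventually_elim (simp add: pn(1))
    then show ?thesis by (simp add: integral_eq_zero_AE)
  next
    case False
    then have k: "0 < k" using k0 by simp
    define D where "D f = distr (density M (%x. ennreal (f x / k))) borel T" for f
    have D: "real_distribution (D f)" if f: "integrable M f" "\<And>x. 0 \<le> f x" "(\<integral>x. f x \<partial>M) = k" for f
    proof -
      have [measurable]: "f \<in> borel_measurable M" using f by auto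
      have "(\<integral>\<^sup>+x. ennreal (f x / k) \<partial>M) = ennreal (\<integral>x. f x / k \<partial>M)"
        using f k by (intro nn_integral_eq_integral) auto
      also have "\<dots> = 1" using f k by simp
      finally have "prob_space (density M (%x. ennreal (f x / k)))"
        by (intro prob_spaceI) (simp add: emeasure_density nn_integral_set_ennreal[symmetric] cong: nn_integral_cong_simp)
      then have "prob_space (D f)" unfolding D_def by (rule prob_space.prob_space_distr) simp
      then show ?thesis by (auto simp: real_distribution_def real_distribution_axioms_def D_def)
    qed
    have DI: "(\<integral>t. g t \<partial>D f) = (\<integral>x. (f x / k) *\<^sub>R g (T x) \<partial>M)" if [measurable]: "f \<in> borel_measurable M" "g \<in> borel_fun" and f: "\<And>x. 0 \<le> f x" 
      for f and g :: "real => 'b::{banach, second_countable_topology}"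
      unfolding D_def using f k by (subst integral_distr) (auto simp: integral_density)
    have "char (D p) = char (D n)"
    proof
      fix y
      have i: "integrable M (%x. complex_of_real (f x) * iexp (y * T x))" if "integrable M f" for f
        by (rule Bochner_Integration.integrable_bound[OF that]) (use that in \<open>auto simp: norm_mult\<close>)
      have "char (D p) y - char (D n) y = (\<integral>x. (p x / k) *\<^sub>R iexp (y * T x) \<partial>M) - (\<integral>x. (n x / k) *\<^sub>R iexp (y * T x) \<partial>M)"
        unfolding char_def using pn by (subst (1 2) DI) auto
      also have "\<dots> = ((\<integral>x. of_real (p x) * iexp (y * T x) \<partial>M) - (\<integral>x. of_real (n x) * iexp (y * T x) \<partial>M)) / k"
        by (simp add: scaleR_conv_of_real diff_divide_distrib)
      also have "(\<integral>x. of_real (p x) * iexp (y * T x) \<partial>M) - (\<integral>x. of_real (n x) * iexp (y * T x) \<partial>M) = (\<integral>x. of_real (U x) * iexp (y * T x) \<partial>M)"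
        by (subst Bochner_Integration.integral_diff[symmetric]) (use i p1 in \<open>auto simp: pn(1) algebra_simps\<close>)
      finally show "char (D p) y = char (D n) y" using ch by simp
    qed
    then have "D p = D n" using p1 pn eqk by (intro Levy_uniqueness D) (auto simp: k_def)
    then have "integral\<^sup>L (D p) \<psi> = integral\<^sup>L (D n) \<psi>" by (rule arg_cong)
    then have "(\<integral>x. (p x / k) *\<^sub>R \<psi> (T x) \<partial>M) = (\<integral>x. (n x / k) *\<^sub>R \<psi> (T x) \<partial>M)"
      unfolding DI[of p \<psi>, OF \<open>p \<in> _\<close> \<psi> pn(2)] DI[of n \<psi>, OF \<open>n \<in> _\<close> \<psi> pn(3)] .
    then have "(\<integral>x. p x * \<psi> (T x) \<partial>M) / k = (\<integral>x. n x * \<psi> (T x) \<partial>M) / k" 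
      by (simp only: real_scaleR_def times_divide_eq_left integral_divide_zero)
    then have "(\<integral>x. p x * \<psi> (T x) \<partial>M) = (\<integral>x. n x * \<psi> (T x) \<partial>M)" using k by (metis divide_cancel_right less_irrefl)
    then show ?thesis unfolding pn(1) left_diff_distrib 
      using pi[OF int] ni[OF int] by (subst Bochner_Integration.integral_diff) auto
  qed
qed

text \<open>Weighting by $e^{\nu t}$ turns the transform on the line $\mathrm{Re} = -\nu$ into a characteristic function; real and imaginary parts are signed measures.\<close>

lemma pairing_eq_0:
  assumes M: "law S M" and fin: "absint M (eexp \<nu>) < \<infinity>"
    and z: "\<And>z. Re z = - \<nu> ==> pairing M (lap z) = 0"
    and \<phi>[measurable]: "\<phi> \<in> borel_fun" and f\<phi>: "absint M (%t. enorm (\<phi> t)) < \<infinity>"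
  shows "pairing M \<phi> = 0"
proof -
  interpret prob_space M using M by (simp add: law_def)
  have s[measurable_cong]: "sets M = sets borel" using M by (simp add: law_def)
  define W where "W x = snd x * of_real (exp (\<nu> * fst x))" for x :: "real \<times> complex"
  have [measurable]: "W \<in> borel_measurable M" unfolding W_def by measurable
  have Wi: "integrable M W"
    using fin by (intro integrableI_bounded) (auto simp: absint_def ennreal_mult' W_def norm_mult)
  have Wz: "(\<integral>x. W x * iexp (y * fst x) \<partial>M) = 0" for y
  proof -
    have "exp (- (Complex (- \<nu>) (- y) * complex_of_real t)) = of_real (exp (\<nu> * t)) * iexp (y * t)" for t
      unfolding exp_of_real[symmetric] mult_exp_exp by (rule arg_cong[where f = exp]) (simp add: complex_eq_iff)
    then show ?thesis using z[of "Complex (- \<nu>) (- y)"] by (simp add: pairing_def W_def mult.assoc)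
  qed
  have Wi': "integrable M (%x. W x * iexp (y * fst x))" for y
    by (rule Bochner_Integration.integrable_bound[OF Wi]) (auto simp: norm_mult)
  define \<psi> where "\<psi> t = \<phi> t * of_real (exp (- (\<nu> * t)))" for t
  have [measurable]: "\<psi> \<in> borel_fun" unfolding \<psi>_def by measurable
  have W\<psi>: "W x * \<psi> (fst x) = snd x * \<phi> (fst x)" for x
    by (simp add: W_def \<psi>_def exp_minus field_simps flip: exp_of_real)
  have i\<phi>: "integrable M (%x. W x * \<psi> (fst x))" unfolding W\<psi> by (rule pairing_integrable[OF M \<phi> f\<phi>])
  have key: "(\<integral>x. Re (c * W x) * g (fst x) \<partial>M) = 0" "integrable M (%x. Re (c * W x) * g (fst x))"
    if c: "norm c = 1" and g[measurable]: "g \<in> borel_fun" and gl: "\<And>t. \<bar>g t\<bar> \<le> norm (\<psi> t)" for c g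
  proof -
    show i: "integrable M (%x. Re (c * W x) * g (fst x))"
    proof (rule Bochner_Integration.integrable_bound[OF i\<phi>])
      have "\<bar>Re (c * W x)\<bar> \<le> norm (W x)" for x using abs_Re_le_cmod[of "c * W x"] c by (simp add: norm_mult)
      then show "AE x in M. norm (Re (c * W x) * g (fst x)) \<le> norm (W x * \<psi> (fst x))"
        unfolding norm_mult real_norm_def abs_mult using gl by (intro AE_I2 mult_mono) (auto simp del: times_complex.sel)
    qed measurable
    show "(\<integral>x. Re (c * W x) * g (fst x) \<partial>M) = 0"
    proof (rule signed_law_unique[OF prob_space_axioms _ _ _ g i])
      show "integrable M (%x. Re (c * W x))" using Wi by (intro integrable_Re integrable_mult_right)
      fix y
      have e: "of_real (Re (c * W x)) * iexp (y * fst x) = (c * (W x * iexp (y * fst x)) + cnj (c * (W x * iexp (- y * fst x)))) / 2" for x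
      proof -
        have "cnj (iexp (- y * fst x)) = iexp (y * fst x)" by (simp add: exp_cnj)
        then have "c * (W x * iexp (y * fst x)) + cnj (c * (W x * iexp (- y * fst x))) = (c * W x + cnj (c * W x)) * iexp (y * fst x)"
          by (simp add: algebra_simps)
        also have "c * W x + cnj (c * W x) = of_real (2 * Re (c * W x))" by (rule complex_add_cnj)
        finally show ?thesis by simp
      qed
      have "(\<integral>x. of_real (Re (c * W x)) * iexp (y * fst x) \<partial>M) = 
        ((\<integral>x. c * (W x * iexp (y * fst x)) \<partial>M) + (\<integral>x. cnj (c * (W x * iexp (- y * fst x))) \<partial>M)) / 2"
        unfolding e using Wi'[of y] Wi'[of "- y"] by (simp del: complex_cnj_mult of_real_mult mult_minus_left)
      also have "\<dots> = 0" using Wz[of y] Wz[of "- y"] by (simp del: complex_cnj_mult of_real_mult mult_minus_left)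
      finally show "(\<integral>x. of_real (Re (c * W x)) * iexp (y * fst x) \<partial>M) = 0" .
    qed measurable
  qed
  have r1: "\<bar>Re (\<psi> t)\<bar> \<le> norm (\<psi> t)" "\<bar>Im (\<psi> t)\<bar> \<le> norm (\<psi> t)" for t by (auto simp: abs_Re_le_cmod abs_Im_le_cmod)
  have mm: "(%t. Re (\<psi> t)) \<in> borel_fun" "(%t. Im (\<psi> t)) \<in> borel_fun" by measurable
  note k1 = key[of 1, OF _ mm(1) r1(1)] and k2 = key[of 1, OF _ mm(2) r1(2)] and k3 = key[of "- \<i>", OF _ mm(1) r1(1)] and k4 = key[of "- \<i>", OF _ mm(2) r1(2)]
  have "Re (\<integral>x. W x * \<psi> (fst x) \<partial>M) = (\<integral>x. Re (1 * W x) * Re (\<psi> (fst x)) - Re (- \<i> * W x) * Im (\<psi> (fst x)) \<partial>M)"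
    using i\<phi> by (subst integral_Re[symmetric]) auto
  also have "\<dots> = 0" using k1 k4 by (subst Bochner_Integration.integral_diff) auto
  finally have re: "Re (\<integral>x. W x * \<psi> (fst x) \<partial>M) = 0" .
  have "Im (\<integral>x. W x * \<psi> (fst x) \<partial>M) = (\<integral>x. Re (1 * W x) * Im (\<psi> (fst x)) + Re (- \<i> * W x) * Re (\<psi> (fst x)) \<partial>M)"
    using i\<phi> by (subst integral_Im[symmetric]) auto
  also have "\<dots> = 0" using k2 k3 by (subst Bochner_Integration.integral_add) auto
  finally have "(\<integral>x. W x * \<psi> (fst x) \<partial>M) = 0" using re by (simp add: complex_eq_iff)
  then show ?thesis unfolding W\<psi> pairing_def .
qed


lemma borel_measurable_pairing_shift:
  assumes M: "law S M" and [measurable]: "\<phi> \<in> borel_fun"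
  shows "(%s. pairing M (%r. \<phi> (c - s - r))) \<in> borel_fun"
    and "(%s. absint M (%r. enorm (\<phi> (c - s - r)))) \<in> borel_fun"
proof -
  interpret prob_space M using M by (simp add: law_def)
  have [measurable_cong]: "sets M = sets borel" using M by (simp add: law_def)
  show "(%s. pairing M (%r. \<phi> (c - s - r))) \<in> borel_fun"
    unfolding pairing_def by (intro borel_measurable_lebesgue_integral) measurable
  show "(%s. absint M (%r. enorm (\<phi> (c - s - r)))) \<in> borel_fun"
    unfolding absint_def by (intro borel_measurable_nn_integral) measurable
qed

text \<open>The convolution identity $\kappa + \kappa * \mu = \delta_0 I$ is known only on the level of transforms.  By uniqueness it can be tested
  against any integrable function, and here it is tested against $s \mapsto y(t-s)$, at one fixed time \<open>t\<close>.
  Working pointwise lets the same lemma serve equations that hold everywhere and equations that hold almost everywhere.\<close>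

lemma resolvent_representation:
  fixes \<kappa> \<mu> :: "'n::finite => 'n => (real \<times> complex) measure" and y F :: "'n => real => complex"
  assumes \<kappa>: "\<And>i j. law {0..} (\<kappa> i j)" "\<And>i j. absint (\<kappa> i j) (eexp \<nu>) < \<infinity>"
    and \<mu>: "\<And>i j. law {0..} (\<mu> i j)" "\<And>i j. absint (\<mu> i j) (eexp \<nu>) < \<infinity>"
    and inv: "\<And>z l k. Re z = - \<nu> ==> pairing (\<kappa> l k) (lap z) + 
       (\<Sum>i\<in>UNIV. pairing (\<kappa> l i) (lap z) * pairing (\<mu> i k) (lap z)) = of_bool (l = k)"
    and y[measurable]: "\<And>k. y k \<in> borel_fun" and F[measurable]: "\<And>k. F k \<in> borel_fun"
    and h1: "\<And>i. absint (\<kappa> l i) (%s. enorm (y i (t - s))) < \<infinity>"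
    and h2: "\<And>i k. absint (\<kappa> l i) (%s. absint (\<mu> i k) (%r. enorm (y k (t - s - r)))) < \<infinity>"
    and h3: "\<And>i. AE x in \<kappa> l i. y i (t - fst x) + (\<Sum>k\<in>UNIV. pairing (\<mu> i k) (%r. y k (t - fst x - r))) = F i (t - fst x)"
  shows "y l t = (\<Sum>i\<in>UNIV. pairing (\<kappa> l i) (%s. F i (t - s)))"
proof -
  have s: "sets (\<kappa> i j) = sets borel" for i j using \<kappa> by (simp add: law_def)
  note [measurable_cong] = s
  have ne: "absint M (%t. enorm (exp (- (z * complex_of_real t)))) < \<infinity>" 
    if "law {0..} M" "absint M (eexp \<nu>) < \<infinity>" "Re z = - \<nu>" for M z
    using absint_exp_le[OF that(1) _, of \<nu> z] that(2,3) by (simp add: order.strict_trans1)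
  have step: "pairing (\<kappa> l k) (%s. y k (t - s)) + (\<Sum>i\<in>UNIV. pairing (\<kappa> l i) (%s. pairing (\<mu> i k) (%r. y k (t - s - r)))) = of_bool (l = k) * y k t" for k
  proof -
    have "\<exists>L. law {0..} L \<and> (\<forall>\<phi>. \<phi> \<in> borel_fun --> absint L \<phi> = absint (\<kappa> l i) (%s. absint (\<mu> i k) (%t. \<phi> (s + t)))) \<and>
     (\<forall>\<phi>. \<phi> \<in> borel_fun --> absint L (%t. enorm (\<phi> t)) < \<infinity> -->
       pairing L \<phi> = pairing (\<kappa> l i) (%s. pairing (\<mu> i k) (%t. \<phi> (s + t))))" for i
      by (rule law_prod[OF \<kappa>(1)[of l i] \<mu>(1)[of i k], of "{0..}"]) auto
    then obtain C where C: "\<And>i. law {0..} (C i)" "\<And>i \<phi>. \<phi> \<in> borel_fun ==> absint (C i) \<phi> = absint (\<kappa> l i) (%s. absint (\<mu> i k) (%t. \<phi> (s + t)))"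
       "\<And>i \<phi>. \<phi> \<in> borel_fun ==> absint (C i) (%t. enorm (\<phi> t)) < \<infinity> ==>
       pairing (C i) \<phi> = pairing (\<kappa> l i) (%s. pairing (\<mu> i k) (%t. \<phi> (s + t)))"
      by metis
    obtain Z where Z: "law {0..} Z" "\<And>\<phi>. \<phi> \<in> borel_fun ==> absint Z \<phi> = enorm (- of_bool (l = k) :: complex) * \<phi> 0"
      "\<And>\<phi>. \<phi> \<in> borel_fun ==> pairing Z \<phi> = - of_bool (l = k) * \<phi> 0" 
      by (rule law_dirac[of 0 "{0..}" "- of_bool (l = k)"]) auto
    define I where "I = insert None (insert (Some None) ((%i::'n. Some (Some i)) ` UNIV))"
    define G where "G q = (case q of None => \<kappa> l k | Some None => Z | Some (Some i) => C i)" for q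
    have I: "finite I" "I \<noteq> {}" by (auto simp: I_def)
    have G: "law {0..} (G q)" for q using \<kappa> Z C by (auto simp: G_def split: option.split)
    have sumI: "(\<Sum>q\<in>I. f q) = f None + f (Some None) + (\<Sum>i\<in>UNIV. f (Some (Some i)))" for f :: "'n option option => 'c::comm_monoid_add"
      unfolding I_def by (subst sum.insert; (subst sum.insert)?; auto simp: sum.reindex inj_on_def ac_simps)
    obtain L where L: "law {0..} L" "\<And>\<phi>. \<phi> \<in> borel_fun ==> absint L \<phi> = (\<Sum>q\<in>I. absint (G q) \<phi>)"
      "\<And>\<phi>. \<phi> \<in> borel_fun ==> (\<And>q. q \<in> I ==> absint (G q) (%t. enorm (\<phi> t)) < \<infinity>) ==>
      pairing L \<phi> = (\<Sum>q\<in>I. pairing (G q) \<phi>)" using law_sum[where M = G, OF I G] by auto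
    have Cexp: "absint (C i) (eexp \<nu>) < \<infinity>" for i
    proof -
      have mm: "(eexp \<nu>) \<in> borel_fun" by measurable
      have "absint (\<mu> i k) (%t. ennreal (exp (\<nu> * (s + t)))) = ennreal (exp (\<nu> * s)) * absint (\<mu> i k) (eexp \<nu>)" for s
        unfolding absint_def by (subst nn_integral_cmult[symmetric], auto intro!: law_meas[OF \<mu>(1)] nn_integral_cong simp: ring_distribs exp_add ennreal_mult' ac_simps)
      then have "absint (C i) (eexp \<nu>) = absint (\<kappa> l i) (%s. ennreal (exp (\<nu> * s)) * absint (\<mu> i k) (eexp \<nu>))"
        by (simp add: C(2)[OF mm])
      also have "\<dots> = absint (\<kappa> l i) (%s. ennreal (exp (\<nu> * s))) * absint (\<mu> i k) (eexp \<nu>)"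
        unfolding absint_def[of "\<kappa> l i"] by (subst nn_integral_multc[symmetric], auto intro!: law_meas[OF \<kappa>(1)] simp: mult.assoc)
      also have "\<dots> < \<infinity>" using \<kappa>(2)[of l i] \<mu>(2)[of i k] by (simp add: ennreal_mult_less_top)
      finally show ?thesis .
    qed
    have Gexp: "absint (G q) (eexp \<nu>) < \<infinity>" for q
      using \<kappa>(2)[of l k] Cexp Z(2)[of "%t. ennreal (exp (\<nu> * t))"] by (auto simp: G_def split: option.split)
    have "pairing L (%s. y k (t - s)) = 0"
    proof (rule pairing_eq_0[OF L(1), where \<nu> = \<nu>])
      show "absint L (eexp \<nu>) < \<infinity>"
        using Gexp I by (subst L(2)) (auto simp: less_top[symmetric])
      show "pairing L (lap z) = 0" if z: "Re z = - \<nu>" for z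
      proof -
        have mm: "(lap z) \<in> borel_fun" by measurable
        have cz: "pairing (C i) (lap z) = pairing (\<kappa> l i) (lap z) * pairing (\<mu> i k) (lap z)" for i
        proof -
          have "pairing (\<mu> i k) (%t. exp (- (z * of_real (s + t)))) = exp (- (z * of_real s)) * pairing (\<mu> i k) (lap z)" for s
            unfolding pairing_def by (subst integral_mult_right_zero[symmetric]) (auto intro!: Bochner_Integration.integral_cong simp: mult_exp_exp algebra_simps)
          then have "pairing (C i) (lap z) = pairing (\<kappa> l i) (%s. exp (- (z * of_real s)) * pairing (\<mu> i k) (lap z))"
            using C(3)[OF mm ne[OF C(1) Cexp z]] by simp
          also have "\<dots> = pairing (\<kappa> l i) (%s. exp (- (z * of_real s))) * pairing (\<mu> i k) (lap z)"
            unfolding pairing_def[of "\<kappa> l i"] by (subst integral_mult_left_zero[symmetric]) (simp add: mult.assoc)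
          finally show ?thesis .
        qed
        have "pairing L (lap z) = (\<Sum>q\<in>I. pairing (G q) (lap z))"
          by (rule L(3)[OF mm ne[OF G Gexp z]])
        also have "\<dots> = 0" unfolding sumI using inv[OF z, of l k] by (cases "l = k") (simp_all add: G_def cz Z(3)[OF mm] algebra_simps)
        finally show ?thesis .
      qed
      show "(%s. y k (t - s)) \<in> borel_fun" by measurable
    next
      have mm: "(%s. enorm (y k (t - s))) \<in> borel_fun" by measurable
      show "absint L (%s. enorm (y k (t - s))) < \<infinity>"
        unfolding L(2)[OF mm] sumI using h1[of k] h2[of _ k]
        by (auto simp: G_def C(2)[OF mm] Z(2)[OF mm] less_top[symmetric] diff_diff_eq ennreal_mult_eq_top_iff)
    qed
    moreover have "pairing L (%s. y k (t - s)) = (\<Sum>q\<in>I. pairing (G q) (%s. y k (t - s)))"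
    proof (rule L(3))
      have mm: "(%s. enorm (y k (t - s))) \<in> borel_fun" by measurable
      show "absint (G q) (%s. enorm (y k (t - s))) < \<infinity>" for q
        using h1[of k] h2[of _ k]
        by (auto simp: G_def C(2)[OF mm] Z(2)[OF mm] less_top[symmetric] diff_diff_eq ennreal_mult_eq_top_iff split: option.split)
    qed measurable
    moreover have "pairing (C i) (%s. y k (t - s)) = pairing (\<kappa> l i) (%s. pairing (\<mu> i k) (%r. y k (t - s - r)))" for i
    proof -
      have mm: "(%s. enorm (y k (t - s))) \<in> borel_fun" by measurable
      show ?thesis using h2[of i k] by (subst C(3)) (auto simp: C(2)[OF mm] diff_diff_eq)
    qed
    moreover have "pairing Z (%s. y k (t - s)) = - of_bool (l = k) * y k t" by (subst Z(3)) auto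
    ultimately show ?thesis unfolding sumI by (simp add: G_def add.commute add.left_commute eq_neg_iff_add_eq_0 algebra_simps)
  qed
  have i1: "integrable (\<kappa> l i) (%x. snd x * y i (t - fst x))" for i
    by (rule pairing_integrable[OF \<kappa>(1)]) (use h1 in auto)
  have i2: "integrable (\<kappa> l i) (%x. snd x * pairing (\<mu> i k) (%r. y k (t - fst x - r)))" for i k
  proof (rule pairing_integrable[OF \<kappa>(1)])
    show "(%s. pairing (\<mu> i k) (%r. y k (t - s - r))) \<in> borel_fun"
      by (rule borel_measurable_pairing_shift[OF \<mu>(1) y])
    have "absint (\<kappa> l i) (%s. enorm (pairing (\<mu> i k) (%r. y k (t - s - r)))) \<le> absint (\<kappa> l i) (%s. absint (\<mu> i k) (%r. enorm (y k (t - s - r))))"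
      by (rule absint_mono[OF \<kappa>(1)]) (rule norm_pairing_le[OF \<mu>(1)], measurable)
    then show "absint (\<kappa> l i) (%s. enorm (pairing (\<mu> i k) (%r. y k (t - s - r)))) < \<infinity>"
      using h2[of i k] by (rule order.strict_trans1)
  qed
  have "y l t = (\<Sum>k\<in>UNIV. of_bool (l = k) * y k t)" by simp
  also have "\<dots> = (\<Sum>k\<in>UNIV. pairing (\<kappa> l k) (%s. y k (t - s))) + (\<Sum>i\<in>UNIV. \<Sum>k\<in>UNIV. pairing (\<kappa> l i) (%s. pairing (\<mu> i k) (%r. y k (t - s - r))))"
    unfolding step[symmetric] sum.distrib by (subst (2) sum.swap) simp
  also have "\<dots> = (\<Sum>i\<in>UNIV. pairing (\<kappa> l i) (%s. y i (t - s) + (\<Sum>k\<in>UNIV. pairing (\<mu> i k) (%r. y k (t - s - r)))))"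
    unfolding sum.distrib[symmetric] using i1 i2
    by (intro sum.cong refl) (simp add: pairing_def[of "\<kappa> l _"] ring_distribs sum_distrib_left)
  also have "\<dots> = (\<Sum>i\<in>UNIV. pairing (\<kappa> l i) (%s. F i (t - s)))"
  proof (intro sum.cong refl)
    fix i
    have [measurable]: "(%s. pairing (\<mu> i k) (%r. y k (t - s - r))) \<in> borel_fun" for k
      by (rule borel_measurable_pairing_shift[OF \<mu>(1) y])
    have m: "(%s. y i (t - s) + (\<Sum>k\<in>UNIV. pairing (\<mu> i k) (%r. y k (t - s - r)))) \<in> borel_fun" by measurable
    show "pairing (\<kappa> l i) (%s. y i (t - s) + (\<Sum>k\<in>UNIV. pairing (\<mu> i k) (%r. y k (t - s - r)))) = pairing (\<kappa> l i) (%s. F i (t - s))"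
      unfolding pairing_def[of "\<kappa> l i"]
    proof (rule integral_cong_AE)
      show "(%x. snd x * (y i (t - fst x) + (\<Sum>k\<in>UNIV. pairing (\<mu> i k) (%r. y k (t - fst x - r))))) \<in> borel_measurable (\<kappa> l i)"
        using measurable_compose[OF meas_snd_fst(1) m] by (intro law_meas[OF \<kappa>(1)] borel_measurable_times) (auto simp: o_def)
      show "(%x. snd x * F i (t - fst x)) \<in> borel_measurable (\<kappa> l i)" by measurable
      show "AE x in \<kappa> l i. snd x * (y i (t - fst x) + (\<Sum>k\<in>UNIV. pairing (\<mu> i k) (%r. y k (t - fst x - r)))) = snd x * F i (t - fst x)"
        using h3[of i] by eventually_elim simp
    qed
  qed
  finally show ?thesis .
qed

section \<open>The resolvent of the delay kernel\<close>

text \<open>One law for the sum of the point masses and the absolutely continuous part of an entry of the kernel.\<close>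

lemma kernel_law:
  fixes a \<tau> :: "nat => real" and h :: "real => real"
  assumes a: "summable (%k::nat. \<bar>a k\<bar>)" and \<tau>: "\<And>k. \<tau> k \<in> {0<..T}"
    and h: "integrable lborel h" "\<And>t. t \<notin> {0<..T} ==> h t = 0"
  obtains M where "law {0<..T} M"
    "\<And>\<phi>. \<phi> \<in> borel_fun ==> absint M \<phi> = (\<Sum>k. ennreal \<bar>a k\<bar> * \<phi> (\<tau> k)) + (\<integral>\<^sup>+t. ennreal \<bar>h t\<bar> * \<phi> t \<partial>lborel)"
    "\<And>\<phi>. \<phi> \<in> borel_fun ==> absint M (%t. enorm (\<phi> t)) < \<infinity> ==>
      summable (%k. of_real (a k) * \<phi> (\<tau> k)) \<and> integrable lborel (%t. of_real (h t) * \<phi> t) \<and>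
      pairing M \<phi> = (\<Sum>k. of_real (a k) * \<phi> (\<tau> k)) + (\<integral>t. of_real (h t) * \<phi> t \<partial>lborel)"
proof -
  let ?S = "{0<..T}"
  have [measurable]: "h \<in> borel_fun" using h by auto
  have ne: "?S \<noteq> {}" "?S \<in> sets borel" using \<tau>[of 0] by auto
  obtain D where D: "law ?S D"
    "\<And>\<phi>. \<phi> \<in> borel_fun ==> absint D \<phi> = (\<integral>\<^sup>+t. enorm (complex_of_real (h t)) * \<phi> t \<partial>lborel)"
    "\<And>\<phi>. \<phi> \<in> borel_fun ==> pairing D \<phi> = (\<integral>t. complex_of_real (h t) * \<phi> t \<partial>lborel)"
    by (rule law_density[of "%t. complex_of_real (h t)" ?S]) (use h ne in \<open>auto simp del: greaterThanAtMost_iff\<close>)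
  define ok where "ok k Z \<longleftrightarrow> law ?S Z \<and> (\<forall>\<phi>. \<phi> \<in> borel_fun --> absint Z \<phi> = enorm (complex_of_real (a k)) * \<phi> (\<tau> k)) \<and>
    (\<forall>\<phi>. \<phi> \<in> borel_fun --> pairing Z \<phi> = complex_of_real (a k) * \<phi> (\<tau> k))" for k Z
  have "\<exists>Z. ok k Z" for k
    by (rule law_dirac[OF \<tau>[of k] ne(2), where c = "complex_of_real (a k)"]) (auto simp: ok_def)
  then have "\<forall>k. \<exists>Z. ok k Z" by blast
  from choice[OF this] obtain Z where "\<And>k. ok k (Z k)" by blast
  then have Z: "\<And>k. law ?S (Z k)" "\<And>k \<phi>. \<phi> \<in> borel_fun ==> absint (Z k) \<phi> = ennreal \<bar>a k\<bar> * \<phi> (\<tau> k)"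
    "\<And>k \<phi>. \<phi> \<in> borel_fun ==> pairing (Z k) \<phi> = complex_of_real (a k) * \<phi> (\<tau> k)"
    by (simp_all add: ok_def)
  obtain E where E: "law ?S E"
    "\<And>\<phi>. \<phi> \<in> borel_fun ==> absint E \<phi> = (\<Sum>i. absint (Z i) \<phi>)"
    "\<And>\<phi>. \<phi> \<in> borel_fun ==> (\<Sum>i. absint (Z i) (%t. enorm (\<phi> t))) < \<infinity> ==>
       (%i. pairing (Z i) \<phi>) sums pairing E \<phi>"
    by (rule law_mixture[where M = Z, OF Z(1)]) (rule that, assumption, blast, blast)
  obtain L where L: "law ?S L" "\<And>\<phi>. \<phi> \<in> borel_fun ==> absint L \<phi> = absint E \<phi> + absint D \<phi>"
    "\<And>\<phi>. \<phi> \<in> borel_fun ==> absint E (%t. enorm (\<phi> t)) < \<infinity> ==> absint D (%t. enorm (\<phi> t)) < \<infinity> ==>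
      pairing L \<phi> = pairing E \<phi> + pairing D \<phi>" by (rule law_add[OF E(1) D(1)]) (rule that, assumption, blast, blast)
  show thesis
  proof (rule that[OF L(1)])
    show "absint L \<phi> = (\<Sum>k. ennreal \<bar>a k\<bar> * \<phi> (\<tau> k)) + (\<integral>\<^sup>+t. ennreal \<bar>h t\<bar> * \<phi> t \<partial>lborel)" if "\<phi> \<in> borel_fun" for \<phi>
      by (simp add: L(2)[OF that] E(2)[OF that] Z(2)[OF that] D(2)[OF that])
    fix \<phi> :: "real => complex" assume m[measurable]: "\<phi> \<in> borel_fun" and fin: "absint L (%t. enorm (\<phi> t)) < \<infinity>"
    have mm: "(%t. enorm (\<phi> t)) \<in> borel_fun" by measurable
    have fE: "absint E (%t. enorm (\<phi> t)) < \<infinity>" and fD: "absint D (%t. enorm (\<phi> t)) < \<infinity>"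
      using fin unfolding L(2)[OF mm] by (auto simp: less_top[symmetric])
    have "(%i. complex_of_real (a i) * \<phi> (\<tau> i)) sums pairing E \<phi>"
      using E(3)[OF m] fE by (simp add: E(2)[OF mm] Z(3)[OF m])
    moreover have "integrable lborel (%t. complex_of_real (h t) * \<phi> t)"
      using fD by (intro integrableI_bounded) (auto simp: D(2)[OF mm] norm_mult ennreal_mult')
    ultimately show "summable (%k. of_real (a k) * \<phi> (\<tau> k)) \<and> integrable lborel (%t. of_real (h t) * \<phi> t) \<and>
      pairing L \<phi> = (\<Sum>k. of_real (a k) * \<phi> (\<tau> k)) + (\<integral>t. of_real (h t) * \<phi> t \<partial>lborel)"
      using L(3)[OF m fE fD] by (simp add: sums_iff D(3)[OF m])
  qed
qed

lemma absint_exp_bounded: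
  assumes M: "law {0<..T} M" and fin: "absint M (%t. 1) < \<infinity>" and T: "0 < T"
  shows "absint M (eexp \<nu>) < \<infinity>"
proof -
  have "\<nu> * t \<le> \<bar>\<nu>\<bar> * T" if "0 < t" "t \<le> T" for t
  proof -
    have "\<nu> * t \<le> \<bar>\<nu>\<bar> * t" using that by (intro mult_right_mono) auto
    also have "\<dots> \<le> \<bar>\<nu>\<bar> * T" using that by (intro mult_left_mono) auto
    finally show ?thesis .
  qed
  then have "absint M (eexp \<nu>) \<le> absint M (%t. ennreal (exp (\<bar>\<nu>\<bar> * T)) * 1)"
    by (intro absint_mono[OF M]) (auto intro!: ennreal_leI)
  also have "\<dots> = ennreal (exp (\<bar>\<nu>\<bar> * T)) * absint M (%t. 1)"
    unfolding absint_def by (subst nn_integral_cmult[symmetric]) (auto intro!: law_meas[OF M] nn_integral_cong simp: ac_simps)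
  also have "\<dots> < \<infinity>" using fin by (simp add: ennreal_mult_less_top)
  finally show ?thesis .
qed

lemma law_superset: "law S M ==> S \<subseteq> S' ==> S' \<in> sets borel ==> law S' M"
  unfolding law_def by (auto elim!: eventually_mono)

lemma LS_of_law:
  assumes M: "law S M" and fin: "absint M (eexp \<nu>) < \<infinity>"
  shows "\<exists>B. LS S \<nu> B (%z. pairing M (lap z))"
  unfolding LS_def using M fin
  by (intro exI[of _ "enn2real (absint M (eexp \<nu>))"] exI[of _ M]) simp

text \<open>Cutting off the tail of the series of point masses costs little mass; the density is approximated as above.\<close>

lemma kernel_approx:
  fixes a \<tau> :: "nat => real" and h :: "real => real"
  assumes a: "summable (%k::nat. \<bar>a k\<bar>)" and \<tau>: "\<And>k. \<tau> k \<in> {0<..T}"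
    and h: "integrable lborel h" "\<And>t. t \<notin> {0<..T} ==> h t = 0" and \<epsilon>: "0 < \<epsilon>"
  shows "\<exists>K0. \<forall>K\<ge>K0. \<exists>g. LS {0..} \<nu> \<epsilon> (%z. ((\<Sum>k. of_real (a k) * exp (- (z * of_real (\<tau> k)))) + Laplace h z)
       - ((\<Sum>k<K. of_real (a k) * exp (- (z * of_real (\<tau> k)))) + g z)) \<and>
     (\<exists>B. LS {0..} \<nu> B g) \<and> (\<exists>C. \<forall>z. - \<nu> \<le> Re z --> norm (g z) \<le> C / (1 + (norm z)\<^sup>2))"
proof -
  have T: "0 < T" using \<tau>[of 0] by auto
  have ind: "indicat_real {0..T} t * h t = h t" for t using h(2)[of t] by (cases "t \<in> {0<..T}") auto
  have "decay_approx \<nu> T h" using decay_approx_L1[OF h(1), of T \<nu>] T unfolding ind by simp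
  then obtain g where g: "LS {0..} \<nu> (\<epsilon> / 2) (%z. Laplace h z - g z)" "\<exists>B. LS {0..} \<nu> B g"
    "\<exists>C. \<forall>z. - \<nu> \<le> Re z --> norm (g z) \<le> C / (1 + (norm z)\<^sup>2)"
    unfolding decay_approx_def using \<epsilon> by (meson half_gt_zero)
  define c where "c = exp (\<bar>\<nu>\<bar> * T)"
  have c: "0 < c" by (simp add: c_def)
  have ec: "exp (\<nu> * \<tau> k) \<le> c" for k
  proof -
    have "\<nu> * \<tau> k \<le> \<bar>\<nu>\<bar> * \<tau> k" using \<tau>[of k] by (intro mult_right_mono) auto
    also have "\<dots> \<le> \<bar>\<nu>\<bar> * T" using \<tau>[of k] by (intro mult_left_mono) auto
    finally show ?thesis by (simp add: c_def)
  qed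
  have "\<exists>K0. \<forall>K\<ge>K0. norm (\<Sum>k. \<bar>a (k + K)\<bar>) < \<epsilon> / 2 / c"
    by (rule suminf_exist_split[OF _ a]) (use \<epsilon> c in simp)
  then obtain K0 where K0: "\<And>K. K0 \<le> K ==> norm (\<Sum>k. \<bar>a (k + K)\<bar>) < \<epsilon> / 2 / c" by blast
  show ?thesis
  proof (intro exI[of _ K0] allI impI exI[of _ g] conjI g(2,3))
    fix K assume K: "K0 \<le> K"
    have sK: "summable (%k. \<bar>a (k + K)\<bar>)" using a by (subst summable_iff_shift)
    have "LS {0..} \<nu> (\<bar>a (k + K)\<bar> * c) (%z. of_real (a (k + K)) * exp (- (z * of_real (\<tau> (k + K)))))" for k
      by (rule LS_le[OF LS_exp]) (use \<tau>[of "k + K"] ec[of "k + K"] in \<open>auto intro!: mult_left_mono\<close>)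
    from LS_suminf[OF this _ summable_mult2[OF sK]]
    have "LS {0..} \<nu> (\<Sum>k. \<bar>a (k + K)\<bar> * c) (%z. \<Sum>k. of_real (a (k + K)) * exp (- (z * of_real (\<tau> (k + K)))))" by simp
    moreover have "(\<Sum>k. \<bar>a (k + K)\<bar> * c) \<le> \<epsilon> / 2"
    proof -
      have "(\<Sum>k. \<bar>a (k + K)\<bar> * c) = (\<Sum>k. \<bar>a (k + K)\<bar>) * c" by (rule suminf_mult2[OF sK, symmetric])
      also have "\<dots> \<le> \<epsilon> / 2 / c * c" using K0[OF K] c by (intro mult_right_mono) auto
      finally show ?thesis using c by simp
    qed
    ultimately have 1: "LS {0..} \<nu> (\<epsilon> / 2) (%z. \<Sum>k. of_real (a (k + K)) * exp (- (z * of_real (\<tau> (k + K)))))" by (rule LS_le)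
    have "LS {0..} \<nu> \<epsilon> (%z. (\<Sum>k. of_real (a (k + K)) * exp (- (z * of_real (\<tau> (k + K))))) + (Laplace h z - g z))"
      using LS_add[OF 1 g(1)] by simp
    then show "LS {0..} \<nu> \<epsilon> (%z. ((\<Sum>k. of_real (a k) * exp (- (z * of_real (\<tau> k)))) + Laplace h z)
       - ((\<Sum>k<K. of_real (a k) * exp (- (z * of_real (\<tau> k)))) + g z))"
    proof (rule LS_cong)
      fix z assume z: "- \<nu> \<le> Re z"
      have "summable (%k. of_real (a k) * exp (- (z * of_real (\<tau> k))))"
      proof (rule summable_comparison_test'[OF summable_mult2[OF a, of c], of 0])
        fix k
        have "norm (exp (- (z * of_real (\<tau> k)))) \<le> exp (\<nu> * \<tau> k)" using neg_mult_le[OF z, of "\<tau> k"] \<tau>[of k] by simp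
        then have "norm (exp (- (z * of_real (\<tau> k)))) \<le> c" using ec[of k] by (rule order_trans)
        then show "norm (of_real (a k) * exp (- (z * of_real (\<tau> k)))) \<le> \<bar>a k\<bar> * c" 
          unfolding norm_mult norm_of_real by (rule mult_left_mono) simp
      qed
      from suminf_split_initial_segment[OF this, of K]
      show "((\<Sum>k. of_real (a k) * exp (- (z * of_real (\<tau> k)))) + Laplace h z) - ((\<Sum>k<K. of_real (a k) * exp (- (z * of_real (\<tau> k)))) + g z)
        = (\<Sum>k. of_real (a (k + K)) * exp (- (z * of_real (\<tau> (k + K))))) + (Laplace h z - g z)" by simp
    qed
  qed
qed

text \<open>Cramer's rule: the entries of the inverse are minors divided by the determinant, and all of them lie in the algebra.\<close>

lemma resolvent_exists:
  fixes a :: "nat => 'n::finite => 'n => real" and h :: "'n => 'n => real => real" and \<mu> :: "'n => 'n => (real \<times> complex) measure"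
  assumes a: "\<And>i j. summable (%k. \<bar>a k i j\<bar>)" and \<tau>: "\<And>k. \<tau> k \<in> {0<..T}"
    and h: "\<And>i j. integrable lborel (h i j)" "\<And>i j t. t \<notin> {0<..T} ==> h i j t = 0"
    and \<mu>: "\<And>i j. law {0<..T} (\<mu> i j)" "\<And>i j. absint (\<mu> i j) (%t. 1) < \<infinity>"
    and \<mu>eq: "\<And>i j z. pairing (\<mu> i j) (lap z) = (\<Sum>k. of_real (a k i j) * exp (- (z * of_real (\<tau> k)))) + Laplace (h i j) z"
    and nz: "\<And>z. - \<nu>0 < Re z ==> det (\<chi> i j. of_bool (i = j) + pairing (\<mu> i j) (lap z)) \<noteq> 0"
    and \<nu>: "\<nu> < \<nu>0"
  shows "\<exists>\<kappa>. (\<forall>i j. law {0..} (\<kappa> i j) \<and> absint (\<kappa> i j) (eexp \<nu>) < \<infinity>) \<and>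
    (\<forall>z l k. - \<nu> \<le> Re z --> pairing (\<kappa> l k) (lap z) + 
       (\<Sum>i\<in>UNIV. pairing (\<kappa> l i) (lap z) * pairing (\<mu> i k) (lap z)) = of_bool (l = k))"
proof -
  have T: "0 < T" using \<tau>[of 0] by auto
  define m where "m i j z = pairing (\<mu> i j) (lap z)" for i j z
  define d where "d z = det (\<chi> i j. of_bool (i = j) + m i j z)" for z
  have LSm: "\<exists>B. LS {0<..} \<nu> B (m i j)" for i j \<nu>
    unfolding m_def by (rule LS_of_law[OF law_superset[OF \<mu>(1)] absint_exp_bounded[OF \<mu> T]]) auto
  have "\<exists>B. LS {0..} \<nu> B (%z. 1 / det (\<chi> i j. of_bool (i = j) + m i j z))"
  proof (rule LS_inverse_det)
    show "\<exists>B. LS {0<..} \<nu>0 B (m i j)" for i j by (rule LSm)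
    show "0 < \<tau> k" for k using \<tau> by auto
    show "det (\<chi> i j. of_bool (i = j) + m i j z) \<noteq> 0" if "- \<nu>0 < Re z" for z using nz[OF that] by (simp add: m_def)
    fix \<nu> \<epsilon> :: real assume \<epsilon>: "0 < \<epsilon>"
    define good where "good i j K g \<longleftrightarrow> LS {0..} \<nu> \<epsilon> (%z. m i j z
         - ((\<Sum>k<K. of_real (a k i j) * exp (- (z * of_real (\<tau> k)))) + g z)) \<and>
       (\<exists>B. LS {0..} \<nu> B g) \<and> (\<exists>C. \<forall>z. - \<nu> \<le> Re z --> norm (g z) \<le> C / (1 + (norm z)\<^sup>2))" for i j and K :: nat and g
    have "\<exists>K0. \<forall>K\<ge>K0. \<exists>g. good i j K g" for i j
      unfolding good_def m_def \<mu>eq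
      by (rule kernel_approx[where a = "%k. a k i j" and h = "h i j" and \<tau> = \<tau> and T = T]) (rule a, rule \<tau>, rule h(1), rule h(2), assumption, rule \<epsilon>)
    then obtain K0 where K0: "\<And>i j K. K0 i j \<le> K ==> \<exists>g. good i j K g" by metis
    define K where "K = (\<Sum>i\<in>UNIV. \<Sum>j\<in>UNIV. K0 i j)"
    have "K0 i j \<le> K" for i j
    proof -
      have "K0 i j \<le> (\<Sum>j\<in>UNIV. K0 i j)" by (intro member_le_sum) auto
      also have "\<dots> \<le> K" unfolding K_def by (intro member_le_sum[of i UNIV "%i. \<Sum>j\<in>UNIV. K0 i j"]) auto
      finally show ?thesis .
    qed
    from K0[OF this] obtain g where "\<And>i j. good i j K (g i j)" by metis
    then show "\<exists>(K::nat) a g. \<forall>i j. 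
       LS {0..} \<nu> \<epsilon> (%z. m i j z - ((\<Sum>k<K. a k i j * exp (- (z * of_real (\<tau> k)))) + g i j z)) \<and>
       (\<exists>B. LS {0..} \<nu> B (g i j)) \<and> (\<exists>C. \<forall>z. - \<nu> \<le> Re z --> norm (g i j z) \<le> C / (1 + (norm z)\<^sup>2))"
      by (intro exI[of _ K] exI[of _ "%k i j. complex_of_real (a k i j)"] exI[of _ g]) (simp add: good_def)
  qed (use \<nu> in auto)
  then obtain Bd where Bd: "LS {0..} \<nu> Bd (%z. 1 / d z)" unfolding d_def by blast
  obtain bm where bm: "\<And>i j. LS {0<..} \<nu> (bm i j) (m i j)" using LSm by metis
  have nn: "0 \<le> bm i j" for i j using bm LS_nonneg by blast
  define B where "B = 1 + (\<Sum>i\<in>UNIV. \<Sum>j\<in>UNIV. bm i j)"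
  have mem: "bm i j \<le> (\<Sum>i\<in>UNIV. \<Sum>j\<in>UNIV. bm i j)" for i j
  proof -
    have "bm i j \<le> (\<Sum>j\<in>UNIV. bm i j)" using nn by (intro member_le_sum) auto
    also have "\<dots> \<le> (\<Sum>i\<in>UNIV. \<Sum>j\<in>UNIV. bm i j)" using nn by (intro member_le_sum[of i UNIV "%i. \<Sum>j\<in>UNIV. bm i j"]) (auto intro: sum_nonneg)
    finally show ?thesis .
  qed
  have m0: "LS {0..} \<nu> (bm i j) (m i j)" for i j by (rule LS_mono[OF bm]) auto
  have o: "LS {0..} \<nu> 1 (%z. of_bool b)" for b by (rule LS_le[OF LS_const]) auto
  have E: "LS {0..} \<nu> B (%z. of_bool (i = j) + m i j z)" for i j
    by (rule LS_le[OF LS_add[OF o m0]]) (use mem in \<open>auto simp: B_def\<close>)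
  have B1: "1 \<le> B" unfolding B_def using nn by (auto intro!: sum_nonneg)
  \<comment> \<open>the entries of the inverse by Cramer's rule\<close>
  define f where "f l k r s z = (if s = l then of_bool (r = k) else of_bool (r = s) + m r s z)" for l k r s z
  have fLS: "LS {0..} \<nu> B (f l k r s)" for l k r s
  proof (cases "s = l")
    case True
    then show ?thesis using LS_le[OF o B1] by (simp add: f_def[abs_def])
  qed (use E in \<open>simp add: f_def[abs_def]\<close>)
  define k where "k l j z = 1 / d z * det (\<chi> r s. f l j r s z)" for l j z
  have "\<exists>B. LS {0..} \<nu> B (k l j)" for l j
  proof -
    have "LS {0..} \<nu> (fact CARD('n) * B ^ CARD('n)) (%z. det (\<chi> r s. f l j r s z))"
      by (rule half_line.LS_det) (rule fLS)
    from LS_mult[OF Bd this] show ?thesis unfolding k_def by auto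
  qed
  then obtain \<kappa> where \<kappa>: "\<And>l j. law {0..} (\<kappa> l j)" "\<And>l j. absint (\<kappa> l j) (eexp \<nu>) < \<infinity>"
    "\<And>l j z. - \<nu> \<le> Re z ==> k l j z = pairing (\<kappa> l j) (lap z)"
  proof -
    assume a: "\<And>l j. \<exists>B. LS {0..} \<nu> B (k l j)" and
      t: "\<And>\<kappa>. (\<And>l j. law {0..} (\<kappa> l j)) ==> (\<And>l j. absint (\<kappa> l j) (eexp \<nu>) < \<infinity>) ==>
       (\<And>l j z. - \<nu> \<le> Re z ==> k l j z = pairing (\<kappa> l j) (lap z)) ==> thesis"
    define ok where "ok l j M \<longleftrightarrow> law {0..} M \<and> absint M (eexp \<nu>) < \<infinity> \<and> (\<forall>z. - \<nu> \<le> Re z --> k l j z = pairing M (lap z))" for l j M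
    have "\<exists>M. ok l j M" for l j
      using a[of l j] unfolding LS_def ok_def by (auto simp: order.strict_trans1)
    then obtain \<kappa> where "\<And>l j. ok l j (\<kappa> l j)" by metis
    then show thesis by (intro t[of \<kappa>]) (auto simp: ok_def)
  qed
  show ?thesis
  proof (intro exI[of _ \<kappa>] conjI allI impI)
    show "law {0..} (\<kappa> i j)" "absint (\<kappa> i j) (eexp \<nu>) < \<infinity>" for i j by (rule \<kappa>)+
    fix z :: complex and l j
    assume z: "- \<nu> \<le> Re z"
    define D where "D = (\<chi> r s. of_bool (r = s) + m r s z)"
    define Ki where "Ki = (\<chi> l j. k l j z)"
    have d0: "det D \<noteq> 0" using nz[of z] z \<nu> by (simp add: D_def m_def)
    have "D *v (\<chi> l. k l j z) = axis j 1" for j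
    proof (rule cramer[OF d0, THEN iffD2])
      show "(\<chi> l. k l j z) = (\<chi> l. det (\<chi> r s. if s = l then axis j 1 $ r else D $ r $ s) / det D)"
        by (simp add: k_def f_def d_def D_def axis_def vec_eq_iff of_bool_def eq_commute cong: if_cong)
    qed
    then have "D ** Ki = mat 1"
      by (simp add: vec_eq_iff matrix_matrix_mult_def matrix_vector_mult_def Ki_def axis_def mat_def)
    then have "Ki ** D = mat 1" by (simp add: matrix_left_right_inverse)
    then have "(Ki ** D) $ l $ j = of_bool (l = j)" by (simp add: mat_def)
    then have "(\<Sum>i\<in>UNIV. k l i z * (of_bool (i = j) + m i j z)) = of_bool (l = j)"
      by (simp add: matrix_matrix_mult_def Ki_def D_def)
    then have "k l j z + (\<Sum>i\<in>UNIV. k l i z * m i j z) = of_bool (l = j)"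
      by (simp add: ring_distribs sum.distrib)
    then show "pairing (\<kappa> l j) (lap z) + 
       (\<Sum>i\<in>UNIV. pairing (\<kappa> l i) (lap z) * pairing (\<mu> i j) (lap z)) = of_bool (l = j)"
      using \<kappa>(3)[OF z] by (simp add: m_def)
  qed
qed

section \<open>Representation of solutions by their initial data\<close>

lemma bounded_linear_axis: "bounded_linear (axis i :: 'b::euclidean_space => 'b ^ 'n)"
  by (auto simp: linear_conv_bounded_linear[symmetric] linear_iff axis_def vec_eq_iff)

lemma vec_as_axis_sum: "(x :: 'b::euclidean_space ^ 'n::finite) = (\<Sum>i\<in>UNIV. axis i (x $ i))"
  by (simp add: vec_eq_iff axis_def sum.delta' cong: if_cong)

lemma integrable_vec:
  fixes f :: "'a => 'b::euclidean_space ^ 'n::finite"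
  assumes "\<And>i. integrable M (%x. f x $ i)"
  shows "integrable M f" and "(\<integral>x. f x \<partial>M) $ i = (\<integral>x. f x $ i \<partial>M)"
proof -
  have "integrable M (%x. \<Sum>i\<in>UNIV. axis i (f x $ i))"
    by (intro Bochner_Integration.integrable_sum integrable_bounded_linear[OF bounded_linear_axis] assms)
  then show i: "integrable M f" by (subst (asm) vec_as_axis_sum[symmetric]) simp
  show "(\<integral>x. f x \<partial>M) $ i = (\<integral>x. f x $ i \<partial>M)"
    by (rule integral_bounded_linear[OF bounded_linear_vec_nth i, symmetric])
qed

lemma sums_vec:
  fixes f :: "nat => 'b::real_normed_vector ^ 'n::finite"
  assumes "\<And>i. (%k. f k $ i) sums (s $ i)"
  shows "f sums s"
  using assms unfolding sums_def by (intro vec_tendstoI) simp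

lemma borel_measurable_vec_nth: "(%x :: real ^ 'n. x $ i) \<in> borel_fun"
  by (intro borel_measurable_continuous_onI continuous_intros)

lemma norm_le_sum_components: "norm (x :: real ^ 'n) \<le> (\<Sum>i\<in>UNIV. \<bar>x $ i\<bar>)"
  by (rule norm_le_l1_cart)

locale delay_equation =
  fixes \<tau>max :: real and A :: "nat => real ^ 'n::finite ^ 'n" and \<tau> :: "nat => real" and N :: "real => real ^ 'n ^ 'n"
  assumes \<tau>max: "0 < \<tau>max" and A: "summable (%k. norm (A k))" and \<tau>: "\<And>k. \<tau> k \<in> {0<..\<tau>max}"
    and N: "N absolutely_integrable_on {0<..<\<tau>max}"
begin

lemma A_entry: "summable (%k. \<bar>A k $ i $ j\<bar>)"
proof (rule summable_comparison_test'[OF A, of 0])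
  show "norm \<bar>A k $ i $ j\<bar> \<le> norm (A k)" for k
    using component_le_norm_cart[of "A k $ i" j] Finite_Cartesian_Product.norm_nth_le[of "A k" i] by simp
qed

lemma density_exists:
  "\<exists>h. \<forall>i j. integrable lborel (h i j) \<and> (\<forall>t. t \<notin> {0<..<\<tau>max} --> h i j t = 0) \<and>
     (AE s in lborel. s \<in> {0<..<\<tau>max} --> h i j s = N s $ i $ j)"
proof -
  have "\<exists>h. integrable lborel h \<and> (\<forall>t. t \<notin> {0<..<\<tau>max} --> h t = 0) \<and>
     (AE s in lborel. s \<in> {0<..<\<tau>max} --> h s = N s $ i $ j)" for i j
  proof -
    have N': "integrable lebesgue (%s. indicat_real {0<..<\<tau>max} s *\<^sub>R N s)" using N by (simp add: set_integrable_def)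
    have "bounded_linear (%M :: real ^ 'n ^ 'n. M $ i $ j)"
      by (intro bounded_linear_compose[OF bounded_linear_vec_nth bounded_linear_vec_nth])
    from integrable_bounded_linear[OF this N'] have i: "integrable lebesgue (%s. indicat_real {0<..<\<tau>max} s * N s $ i $ j)" by simp
    then have "(%s. indicat_real {0<..<\<tau>max} s * N s $ i $ j) \<in> borel_measurable lebesgue" by auto
    from completion_ex_borel_measurable_real[OF this] obtain g where g: "g \<in> borel_measurable lborel"
      "AE s in lborel. indicat_real {0<..<\<tau>max} s * N s $ i $ j = g s" by blast
    have [measurable]: "g \<in> borel_fun" using g(1) by simp
    define h where "h s = indicat_real {0<..<\<tau>max} s * g s" for s
    have [measurable]: "h \<in> borel_fun" unfolding h_def by measurable
    have ae: "AE s in lborel. h s = indicat_real {0<..<\<tau>max} s * N s $ i $ j"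
      using g(2)
    proof eventually_elim
      case (elim s)
      then show ?case by (cases "s \<in> {0<..<\<tau>max}") (simp_all add: h_def)
    qed
    have "integrable lebesgue h"
      by (rule integrable_cong_AE_imp[OF i]) (use ae in \<open>auto intro: AE_completion measurable_completion simp: eq_commute\<close>)
    then have "integrable lborel h" by (simp add: integrable_completion)
    moreover have "AE s in lborel. s \<in> {0<..<\<tau>max} --> h s = N s $ i $ j" using ae by eventually_elim auto
    ultimately show ?thesis by (intro exI[of _ h]) (auto simp: h_def)
  qed
  then have "\<forall>p. \<exists>h. integrable lborel h \<and> (\<forall>t. t \<notin> {0<..<\<tau>max} --> h t = 0) \<and>
     (AE s in lborel. s \<in> {0<..<\<tau>max} --> h s = N s $ fst p $ snd p)" by blast
  from choice[OF this] obtain H where "\<forall>p. integrable lborel (H p) \<and> (\<forall>t. t \<notin> {0<..<\<tau>max} --> H p t = 0) \<and>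
     (AE s in lborel. s \<in> {0<..<\<tau>max} --> H p s = N s $ fst p $ snd p)" by blast
  then show ?thesis by (intro exI[of _ "%i j. H (i, j)"]) simp
qed

text \<open>A Borel function supported in the open interval that agrees almost everywhere with the entry of $N$; the law of the kernel requires a Borel density.\<close>

definition dens :: "'n => 'n => real => real" where
  "dens = (SOME h. \<forall>i j. integrable lborel (h i j) \<and> (\<forall>t. t \<notin> {0<..<\<tau>max} --> h i j t = 0) \<and>
     (AE s in lborel. s \<in> {0<..<\<tau>max} --> h i j s = N s $ i $ j))"

lemma dens: "integrable lborel (dens i j)" "t \<notin> {0<..<\<tau>max} ==> dens i j t = 0"
  "AE s in lborel. s \<in> {0<..<\<tau>max} --> dens i j s = N s $ i $ j"
  using someI_ex[OF density_exists] unfolding dens_def[symmetric] by auto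

lemma dens_meas[measurable]: "dens i j \<in> borel_fun"
  using dens(1)[of i j] by auto

definition kern_spec :: "'n => 'n => (real \<times> complex) measure => bool" where
  "kern_spec i j M \<longleftrightarrow> law {0<..\<tau>max} M \<and>
    (\<forall>\<phi>. \<phi> \<in> borel_fun --> absint M \<phi> = (\<Sum>k. ennreal \<bar>A k $ i $ j\<bar> * \<phi> (\<tau> k)) + (\<integral>\<^sup>+t. ennreal \<bar>dens i j t\<bar> * \<phi> t \<partial>lborel)) \<and>
    (\<forall>\<phi>. \<phi> \<in> borel_fun --> absint M (%t. enorm (\<phi> t)) < \<infinity> -->
      summable (%k. of_real (A k $ i $ j) * \<phi> (\<tau> k)) \<and> integrable lborel (%t. of_real (dens i j t) * \<phi> t) \<and>
      pairing M \<phi> = (\<Sum>k. of_real (A k $ i $ j) * \<phi> (\<tau> k)) + (\<integral>t. of_real (dens i j t) * \<phi> t \<partial>lborel))"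

definition kern :: "'n => 'n => (real \<times> complex) measure" where
  "kern i j = (SOME M. kern_spec i j M)"

lemma kern_spec: "kern_spec i j (kern i j)"
proof -
  have "\<exists>M. kern_spec i j M"
    by (rule kernel_law[where a = "%k. A k $ i $ j" and \<tau> = \<tau> and T = \<tau>max and h = "dens i j"])
      (use A_entry \<tau> dens in \<open>auto simp: kern_spec_def\<close>)
  then show ?thesis unfolding kern_def by (rule someI_ex)
qed

lemma kern: "law {0<..\<tau>max} (kern i j)"
  "\<phi> \<in> borel_fun ==> absint (kern i j) \<phi> = (\<Sum>k. ennreal \<bar>A k $ i $ j\<bar> * \<phi> (\<tau> k)) + (\<integral>\<^sup>+t. ennreal \<bar>dens i j t\<bar> * \<phi> t \<partial>lborel)"
  "\<psi> \<in> borel_fun ==> absint (kern i j) (%t. enorm (\<psi> t)) < \<infinity> ==> summable (%k. of_real (A k $ i $ j) * \<psi> (\<tau> k))"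
  "\<psi> \<in> borel_fun ==> absint (kern i j) (%t. enorm (\<psi> t)) < \<infinity> ==> integrable lborel (%t. of_real (dens i j t) * \<psi> t)"
  "\<psi> \<in> borel_fun ==> absint (kern i j) (%t. enorm (\<psi> t)) < \<infinity> ==> 
     pairing (kern i j) \<psi> = (\<Sum>k. of_real (A k $ i $ j) * \<psi> (\<tau> k)) + (\<integral>t. of_real (dens i j t) * \<psi> t \<partial>lborel)"
  using kern_spec[of i j] unfolding kern_spec_def by blast+

lemma kern0: "law {0..} (kern i j)"
  by (rule law_superset[OF kern(1)]) auto

lemma kern_mass: "absint (kern i j) (%t. 1) < \<infinity>"
proof -
  have "(\<Sum>k. ennreal \<bar>A k $ i $ j\<bar>) = ennreal (\<Sum>k. \<bar>A k $ i $ j\<bar>)" using A_entry by (intro suminf_ennreal2) auto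
  moreover have "(\<integral>\<^sup>+t. ennreal \<bar>dens i j t\<bar> \<partial>lborel) < \<infinity>" using dens(1)[of i j] by (simp add: integrable_iff_bounded)
  ultimately show ?thesis by (simp add: kern(2))
qed

lemma kern_exp: "absint (kern i j) (eexp \<nu>) < \<infinity>"
  by (rule absint_exp_bounded[OF kern(1) kern_mass \<tau>max])

lemma kern_transform_fin: "absint (kern i j) (%t. enorm (exp (- (z * complex_of_real t)))) < \<infinity>"
  by (rule order.strict_trans1[OF absint_exp_le[OF kern0, of "- Re z"] kern_exp]) auto

lemma kern_transform:
  "pairing (kern i j) (lap z) = (\<Sum>k. of_real (A k $ i $ j) * exp (- (z * of_real (\<tau> k)))) + Laplace (dens i j) z"
  unfolding Laplace_def by (rule kern(5)[OF exp_meas(1) kern_transform_fin])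

lemma AE_dens: "AE s in lebesgue. \<forall>i j. indicat_real {0<..<\<tau>max} s * N s $ i $ j = dens i j s"
proof -
  have "AE s in lborel. indicat_real {0<..<\<tau>max} s * N s $ i $ j = dens i j s" for i j
    using dens(3)[of i j] by eventually_elim (use dens(2)[of _ i j] in \<open>auto simp: indicator_def\<close>)
  then have "AE s in lborel. \<forall>i j. indicat_real {0<..<\<tau>max} s * N s $ i $ j = dens i j s"
    by (simp add: AE_all_countable)
  then show ?thesis by (rule AE_completion)
qed

lemma N_measurable: "(%s. indicat_real {0<..<\<tau>max} s *\<^sub>R N s) \<in> borel_measurable lebesgue"
  using N by (auto simp: set_integrable_def)

lemma char_matrix_entry:
  "char_matrix \<tau>max A \<tau> N z $ i $ j = of_bool (i = j) + pairing (kern i j) (lap z)"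
proof -
  let ?e = "%t. exp (- (z * complex_of_real t))"
  have e: "exp (- complex_of_real t * z) = ?e t" for t by (simp add: mult.commute)
  have "(%k. cscale (?e (\<tau> k)) (A k) $ i $ j) sums (\<Sum>k. of_real (A k $ i $ j) * ?e (\<tau> k))" for i j
    using kern(3)[OF exp_meas(1) kern_transform_fin, of i j z] by (simp add: cscale_def summable_sums mult.commute)
  then have "(%k. cscale (?e (\<tau> k)) (A k)) sums (\<chi> i j. \<Sum>k. of_real (A k $ i $ j) * ?e (\<tau> k))"
    by (intro sums_vec) simp
  then have 1: "(\<Sum>k. cscale (?e (\<tau> k)) (A k)) $ i $ j = (\<Sum>k. of_real (A k $ i $ j) * ?e (\<tau> k))"
    by (simp add: sums_iff)
  let ?F = "%s. indicat_real {0<..<\<tau>max} s *\<^sub>R cscale (?e s) (N s)"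
  have eq: "AE s in lebesgue. ?F s $ i $ j = of_real (dens i j s) * ?e s" for i j
    using AE_dens
  proof eventually_elim
    case (elim s)
    have "complex_of_real (dens i j s) = indicat_real {0<..<\<tau>max} s *\<^sub>R of_real (N s $ i $ j)"
      unfolding elim[rule_format, symmetric] by (simp add: scaleR_conv_of_real)
    then show ?case by (simp add: cscale_def mult.commute)
  qed
  have m: "(%s. ?F s $ i $ j) \<in> borel_measurable lebesgue" for i j
  proof -
    have "bounded_linear (%M :: real ^ 'n ^ 'n. M $ i $ j)"
      by (intro bounded_linear_compose[OF bounded_linear_vec_nth bounded_linear_vec_nth])
    from bounded_linear.continuous_on[OF this continuous_on_id, of UNIV]
    have "(%M :: real ^ 'n ^ 'n. M $ i $ j) \<in> borel_fun" by (intro borel_measurable_continuous_onI) (simp add: id_def)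
    from measurable_compose[OF N_measurable this]
    have "(%s. indicat_real {0<..<\<tau>max} s * N s $ i $ j) \<in> borel_measurable lebesgue" by simp
    moreover have "?e \<in> borel_measurable lebesgue" by (rule measurable_completion) simp
    ultimately have "(%s. ?e s * of_real (indicat_real {0<..<\<tau>max} s * N s $ i $ j)) \<in> borel_measurable lebesgue"
      using measurable_compose[of _ lebesgue borel complex_of_real borel] by (intro borel_measurable_times) (auto simp del: of_real_mult)
    then show ?thesis 
      by (rule measurable_cong[THEN iffD1, rotated])
        (simp only: cscale_def vector_scaleR_component vec_lambda_beta, simp add: scaleR_conv_of_real)
  qed
  have il: "integrable lebesgue (%s. of_real (dens i j s) * ?e s)" for i j
    using kern(4)[OF exp_meas(1) kern_transform_fin, of i j z] by (simp add: integrable_completion)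
  have ii: "integrable lebesgue (%s. ?F s $ i $ j)" for i j
    by (rule integrable_cong_AE_imp[OF il m]) (use eq in \<open>simp add: eq_commute\<close>)
  have ii': "integrable lebesgue (%s. ?F s $ i)" for i by (rule integrable_vec(1)) (rule ii)
  have "(\<integral>s. ?F s \<partial>lebesgue) $ i $ j = (\<integral>s. ?F s $ i $ j \<partial>lebesgue)"
    by (simp only: integrable_vec(2)[OF ii'] integrable_vec(2)[OF ii])
  also have "\<dots> = (\<integral>s. of_real (dens i j s) * ?e s \<partial>lebesgue)"
    by (rule integral_cong_AE[OF m _ eq]) (use il in auto)
  also have "\<dots> = Laplace (dens i j) z"
    unfolding Laplace_def by (subst integral_completion) auto
  finally have 2: "(LINT s:{0<..<\<tau>max}|lebesgue. cscale (?e s) (N s)) $ i $ j = Laplace (dens i j) z"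
    by (simp add: set_lebesgue_integral_def)
  show ?thesis unfolding char_matrix_def e kern_transform by (simp add: 1 2 mat_def)
qed

text \<open>The terms of the equation at one time \<open>t\<close>, written as a pairing with the kernel.  \<open>X\<close> is only known to agree with a Borel function
  \<open>X'\<close> at the delayed points and almost everywhere on the window, which is all that the series and the integral see.\<close>

lemma equation_as_pairing:
  fixes X X' :: "real => real ^ 'n"
  assumes X'[measurable]: "X' \<in> borel_fun" and fin: "\<And>i j. absint (kern i j) (%s. enorm (X' (t - s))) < \<infinity>"
    and eqd: "\<And>k. X (t - \<tau> k) = X' (t - \<tau> k)" and eqi: "AE s in lebesgue. s \<in> {0<..<\<tau>max} --> X (t - s) = X' (t - s)"
  shows "complex_of_real (((\<Sum>k. A k *v X (t - \<tau> k)) + (LINT s:{0<..<\<tau>max}|lebesgue. N s *v X (t - s))) $ i) =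
    (\<Sum>j\<in>UNIV. pairing (kern i j) (%s. of_real (X' (t - s) $ j)))"
proof -
  let ?\<psi> = "%j s. complex_of_real (X' (t - s) $ j)"
  have cm: "(%s. X' (t - s) $ j) \<in> borel_fun" for j
    by (rule measurable_compose[OF _ borel_measurable_vec_nth]) measurable
  note cm[measurable]
  have pm: "?\<psi> j \<in> borel_fun" for j by measurable
  have pf: "absint (kern i j) (%s. enorm (?\<psi> l s)) < \<infinity>" for i j l
    by (rule order.strict_trans1[OF absint_mono[OF kern(1)] fin[of i j]]) (auto intro!: ennreal_leI component_le_norm_cart)
  have s1: "(%k. A k $ i $ j * X' (t - \<tau> k) $ j) sums (\<Sum>k. A k $ i $ j * X' (t - \<tau> k) $ j)" for i j
    using kern(3)[OF pm pf, of i j j] by (simp add: summable_sums summable_of_real_iff flip: of_real_mult)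
  have "(%k. (A k *v X (t - \<tau> k)) $ i) sums (\<Sum>j\<in>UNIV. \<Sum>k. A k $ i $ j * X' (t - \<tau> k) $ j)" for i
    unfolding eqd matrix_vector_mult_def using sums_sum[OF s1] by simp
  then have "(%k. A k *v X (t - \<tau> k)) sums (\<chi> i. \<Sum>j\<in>UNIV. \<Sum>k. A k $ i $ j * X' (t - \<tau> k) $ j)"
    by (intro sums_vec) simp
  then have 1: "(\<Sum>k. A k *v X (t - \<tau> k)) $ i = (\<Sum>j\<in>UNIV. \<Sum>k. A k $ i $ j * X' (t - \<tau> k) $ j)"
    by (simp add: sums_iff)
  have i1: "integrable lborel (%s. dens i j s * X' (t - s) $ j)" for i j
    using integrable_Re[OF kern(4)[OF pm pf, of i j j]] by simp
  define G where "G s = (\<chi> i. \<Sum>j\<in>UNIV. dens i j s * X' (t - s) $ j)" for s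
  have Gi: "integrable lborel (%s. G s $ i)" for i using i1 by (simp add: G_def)
  have ae: "AE s in lebesgue. indicat_real {0<..<\<tau>max} s *\<^sub>R (N s *v X (t - s)) = G s"
    using AE_dens eqi
  proof eventually_elim
    case (elim s)
    have "indicat_real {0<..<\<tau>max} s * N s $ i $ j * X (t - s) $ j = dens i j s * X' (t - s) $ j" for i j
      using elim(1)[rule_format, of i j] elim(2) by (cases "s \<in> {0<..<\<tau>max}") auto
    then show ?case by (simp add: G_def vec_eq_iff matrix_vector_mult_def sum_distrib_left mult.assoc[symmetric])
  qed
  have GM: "G \<in> borel_measurable lebesgue" using integrable_vec(1)[OF Gi] by (intro measurable_completion) auto
  have "(\<integral>s. indicat_real {0<..<\<tau>max} s *\<^sub>R (N s *v X (t - s)) \<partial>lebesgue) = (\<integral>s. G s \<partial>lebesgue)"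
  proof (rule integral_cong_AE[OF _ GM ae])
    show "(%s. indicat_real {0<..<\<tau>max} s *\<^sub>R (N s *v X (t - s))) \<in> borel_measurable lebesgue"
      by (rule borel_measurable_AE[OF GM]) (use ae in \<open>simp add: eq_commute\<close>)
  qed
  also have "\<dots> = (\<integral>s. G s \<partial>lborel)" using integrable_vec(1)[OF Gi] by (intro integral_completion) auto
  also have "\<dots> $ i = (\<Sum>j\<in>UNIV. \<integral>s. dens i j s * X' (t - s) $ j \<partial>lborel)"
    unfolding integrable_vec(2)[OF Gi] using i1 by (simp add: G_def)
  finally have 2: "(LINT s:{0<..<\<tau>max}|lebesgue. N s *v X (t - s)) $ i = (\<Sum>j\<in>UNIV. \<integral>s. dens i j s * X' (t - s) $ j \<partial>lborel)"
    by (simp add: set_lebesgue_integral_def)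
  have "pairing (kern i j) (?\<psi> j) = of_real ((\<Sum>k. A k $ i $ j * X' (t - \<tau> k) $ j) + (\<integral>s. dens i j s * X' (t - s) $ j \<partial>lborel))" for j
    unfolding kern(5)[OF pm pf] using s1[of i j] 
    by (simp add: suminf_of_real sums_iff flip: integral_complex_of_real)
  then show ?thesis by (simp add: 1 2 sum.distrib)
qed

end

lemma AE_shift:
  fixes c :: real
  assumes "AE x in lborel. P x"
  shows "AE t in lborel. P (t - c)"
proof -
  obtain Z where Z: "{x \<in> space lborel. \<not> P x} \<subseteq> Z" "emeasure lborel Z = 0" "Z \<in> sets lborel"
    using assms by (rule AE_E)
  have "AE x in (lborel :: real measure). x \<notin> Z" using Z by (intro AE_not_in) (simp add: null_sets_def)
  then have "AE x in distr lborel borel ((+) (- c)). x \<notin> Z" unfolding lborel_distr_plus .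
  then have "AE t in lborel. - c + t \<notin> Z" using Z(3) by (subst (asm) AE_distr_iff) auto
  then show ?thesis by eventually_elim (use Z(1) in auto)
qed

text \<open>A null set is missed by almost every translate of almost every sample, by Fubini's theorem.\<close>

lemma AE_convolution:
  assumes M: "law S M" and P: "AE x in lborel. P x"
  shows "AE t in lborel. AE x in M. P (t - fst x)"
proof -
  interpret prob_space M using M by (simp add: law_def)
  interpret pair_sigma_finite M "lborel :: real measure" ..
  have [measurable_cong]: "sets M = sets borel" using M by (simp add: law_def)
  obtain Z where Z: "{x \<in> space lborel. \<not> P x} \<subseteq> Z" "emeasure lborel Z = 0" and [measurable]: "Z \<in> sets lborel"
    using P by (rule AE_E)
  have [measurable]: "Z \<in> sets borel" using \<open>Z \<in> sets lborel\<close> by simp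
  have "AE x in (lborel :: real measure). x \<notin> Z" using Z by (intro AE_not_in) (simp add: null_sets_def)
  then have "AE x in M. AE t in lborel. t - fst x \<notin> Z" by (rule AE_I2[OF AE_shift])
  then have "AE t in lborel. AE x in M. t - fst x \<notin> Z"
    by (subst AE_commute[symmetric]) measurable
  then show ?thesis by eventually_elim (use Z(1) in \<open>auto elim!: eventually_mono\<close>)
qed

lemma borel_measurable_absint_shift:
  assumes M: "law S M" and [measurable]: "f \<in> borel_fun"
  shows "(%t. absint M (%s. f (t - s))) \<in> borel_fun"
proof -
  interpret prob_space M using M by (simp add: law_def)
  have [measurable_cong]: "sets M = sets borel" using M by (simp add: law_def)
  show ?thesis unfolding absint_def by (intro borel_measurable_nn_integral) measurable
qed

text \<open>Young's inequality in $L^1$, restricted to a left half-line: convolution with a measure on $[0,\infty)$ does not look into the future.\<close>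

lemma nn_integral_convolution_le:
  assumes M: "law {0..} M" and f[measurable]: "f \<in> borel_fun"
  shows "(\<integral>\<^sup>+t. absint M (%s. f (t - s)) * indicator {..R} t \<partial>lborel) \<le> absint M (%s. 1) * (\<integral>\<^sup>+t. f t * indicator {..R} t \<partial>lborel)"
proof -
  interpret prob_space M using M by (simp add: law_def)
  interpret pair_sigma_finite M "lborel :: real measure" ..
  have [measurable_cong]: "sets M = sets borel" using M by (simp add: law_def)
  have "(\<integral>\<^sup>+t. absint M (%s. f (t - s)) * indicator {..R} t \<partial>lborel) = 
    (\<integral>\<^sup>+t. \<integral>\<^sup>+x. enorm (snd x) * f (t - fst x) * indicator {..R} t \<partial>M \<partial>lborel)"
    unfolding absint_def by (intro nn_integral_cong nn_integral_multc[symmetric]) measurable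
  also have "\<dots> = (\<integral>\<^sup>+x. \<integral>\<^sup>+t. enorm (snd x) * f (t - fst x) * indicator {..R} t \<partial>lborel \<partial>M)"
    by (rule Fubini'[of "%x t. enorm (snd x) * f (t - fst x) * indicator {..R} t"]) measurable
  also have "\<dots> \<le> (\<integral>\<^sup>+x. enorm (snd x) * (\<integral>\<^sup>+t. f t * indicator {..R} t \<partial>lborel) \<partial>M)"
  proof (rule nn_integral_mono_AE)
    have "AE x in M. fst x \<in> {0..}" using M by (simp add: law_def)
    then show "AE x in M. (\<integral>\<^sup>+t. enorm (snd x) * f (t - fst x) * indicator {..R} t \<partial>lborel) \<le> enorm (snd x) * (\<integral>\<^sup>+t. f t * indicator {..R} t \<partial>lborel)"
    proof eventually_elim
      case (elim x)
      have "(\<integral>\<^sup>+t. enorm (snd x) * f (t - fst x) * indicator {..R} t \<partial>lborel) \<le> (\<integral>\<^sup>+t. enorm (snd x) * f (t - fst x) * indicator {..R} (t - fst x) \<partial>lborel)"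
        using elim by (intro nn_integral_mono) (auto simp: indicator_def)
      also have "\<dots> = enorm (snd x) * (\<integral>\<^sup>+t. f (t - fst x) * indicator {..R} (t - fst x) \<partial>lborel)"
        by (subst nn_integral_cmult[symmetric]) (auto simp: mult.assoc)
      also have "(\<integral>\<^sup>+t. f (t - fst x) * indicator {..R} (t - fst x) \<partial>lborel) = (\<integral>\<^sup>+t. f t * indicator {..R} t \<partial>lborel)"
        using nn_integral_real_affine[of "%t. f t * indicator {..R} t" 1 "- fst x"] by (simp add: add.commute)
      finally show ?case .
    qed
  qed
  also have "\<dots> = absint M (%s. 1) * (\<integral>\<^sup>+t. f t * indicator {..R} t \<partial>lborel)"
    unfolding absint_def by (subst nn_integral_multc) auto
  finally show ?thesis .
qed

text \<open>Functions that are integrable on every left half-line; for such functions all convolutions below are finite almost everywhere.\<close>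

definition loc_fin :: "(real => ennreal) => bool" where
  "loc_fin f \<longleftrightarrow> f \<in> borel_fun \<and> (\<forall>R. (\<integral>\<^sup>+t. f t * indicator {..R} t \<partial>lborel) < \<infinity>)"

lemma loc_fin_convolution:
  assumes M: "law {0..} M" "absint M (%s. 1) < \<infinity>" and f: "loc_fin f"
  shows "loc_fin (%t. absint M (%s. f (t - s)))"
  unfolding loc_fin_def
proof (intro conjI allI)
  show "(%t. absint M (%s. f (t - s))) \<in> borel_fun"
    using f by (intro borel_measurable_absint_shift[OF M(1)]) (simp add: loc_fin_def)
  show "(\<integral>\<^sup>+t. absint M (%s. f (t - s)) * indicator {..R} t \<partial>lborel) < \<infinity>" for R
    using nn_integral_convolution_le[OF M(1), of f R] f M(2) unfolding loc_fin_def
    by (auto simp: ennreal_mult_less_top intro: order.strict_trans1)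
qed

lemma loc_fin_AE:
  assumes "loc_fin f"
  shows "AE t in lborel. f t < \<infinity>"
proof -
  have [measurable]: "f \<in> borel_fun" using assms by (simp add: loc_fin_def)
  have "AE t in lborel. f t * indicator {..real n} t \<noteq> \<infinity>" for n
    using assms by (intro nn_integral_PInf_AE) (auto simp: loc_fin_def less_top[symmetric])
  then have "AE t in lborel. \<forall>n. f t * indicator {..real n} t \<noteq> \<infinity>" by (simp add: AE_all_countable)
  then show ?thesis
  proof eventually_elim
    case (elim t)
    obtain n where "t \<le> real n" using real_arch_simple by blast
    then show ?case using elim[rule_format, of n] by (simp add: less_top)
  qed
qed

lemma absint_1_le_exp:
  assumes "law {0..} M" "0 \<le> \<nu>"
  shows "absint M (%t. 1) \<le> absint M (eexp \<nu>)"
  by (rule absint_mono[OF assms(1)]) (use assms(2) in \<open>auto simp flip: ennreal_1 intro!: ennreal_leI\<close>)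

text \<open>The situation after the algebraic part: a resolvent \<open>\<kappa>\<close> with weight \<open>\<nu>\<close> is at hand, and \<open>inv\<close>
  says that its transform inverts $I + \hat\mu$ in the closed half-plane.\<close>

locale stable_delay = delay_equation \<tau>max A \<tau> N
  for \<tau>max :: real and A :: "nat => real ^ 'b::finite ^ 'b" and \<tau> :: "nat => real" and N :: "real => real ^ 'b ^ 'b" +
  fixes \<kappa> :: "'b => 'b => (real \<times> complex) measure" and \<nu> :: real
  assumes \<nu>: "0 \<le> \<nu>" and \<kappa>: "\<And>i j. law {0..} (\<kappa> i j)" "\<And>i j. absint (\<kappa> i j) (eexp \<nu>) < \<infinity>"
    and inv: "\<And>z l k. - \<nu> \<le> Re z ==> pairing (\<kappa> l k) (lap z) + 
       (\<Sum>i\<in>UNIV. pairing (\<kappa> l i) (lap z) * pairing (kern i k) (lap z)) = of_bool (l = k)"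
begin

lemma \<kappa>_mass: "absint (\<kappa> i j) (%t. 1) < \<infinity>"
  by (rule order.strict_trans1[OF absint_1_le_exp[OF \<kappa>(1) \<nu>] \<kappa>(2)])

text \<open>The history enters the equation at positive times as an inhomogeneity: moving the terms that involve times $\le 0$ to the right-hand side leaves an equation for the part of the solution at positive times.\<close>

definition forcing :: "(real => real ^ 'b) => 'b => real => complex" where
  "forcing f i x = (if 0 < x then - (\<Sum>k\<in>UNIV. pairing (kern i k) (%s. of_real (f (x - s) $ k))) else 0)"

definition past :: "(real => real ^ 'b) => real => real ^ 'b" where
  "past X s = (if s \<le> 0 then X s else 0)"

text \<open>The equation holds at \<open>x\<close>, with absolute convergence of the terms.\<close>

definition good :: "(real => real ^ 'b) => real => bool" where
  "good X x \<longleftrightarrow> (\<forall>i. of_real (X x $ i) + (\<Sum>k\<in>UNIV. pairing (kern i k) (%s. of_real (X (x - s) $ k))) = 0) \<and>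
     (\<forall>i k. absint (kern i k) (%s. enorm (X (x - s))) < \<infinity>)"

lemma component_meas:
  fixes f :: "real => real ^ 'b"
  assumes "f \<in> borel_measurable (borel :: real measure)"
  shows "(%x. complex_of_real (f x $ i)) \<in> borel_measurable (borel :: real measure)"
  using measurable_compose[OF measurable_compose[OF assms borel_measurable_vec_nth], of complex_of_real borel i] by simp

lemma past_meas:
  assumes [measurable]: "f \<in> borel_fun"
  shows "past f \<in> borel_fun"
  unfolding past_def[abs_def] by measurable

lemma forcing_meas:
  fixes f :: "real => real ^ 'b"
  assumes f: "f \<in> borel_fun"
  shows "forcing f i \<in> borel_fun"
proof -
  have "(%x. pairing (kern i k) (%s. of_real (f (x - s) $ k))) \<in> borel_fun" for k
  proof -
    have "(%x. pairing (kern i k) (%s. of_real (f (0 - (- x) - s) $ k))) \<in> borel_fun"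
      by (rule measurable_compose[OF _ borel_measurable_pairing_shift(1)[OF kern0 component_meas[OF f], of i k 0 k]]) simp
    then show ?thesis by simp
  qed
  note this[measurable]
  show ?thesis unfolding forcing_def[abs_def] by measurable
qed

text \<open>Cut \<open>X\<close> off at time $0$.  The truncated function satisfies the equation with inhomogeneity \<open>forcing\<close> on the whole line, trivially so at times $\le 0$,
  and the resolvent formula applies.\<close>

lemma representation_at:
  fixes X :: "real => real ^ 'b"
  assumes X: "X \<in> borel_fun" and t: "0 < t"
    and h1: "\<And>i. absint (\<kappa> l i) (%s. enorm (X (t - s))) < \<infinity>"
    and h2: "\<And>i k. absint (\<kappa> l i) (%s. absint (kern i k) (%r. enorm (X (t - s - r)))) < \<infinity>"
    and h3: "\<And>i. AE x in \<kappa> l i. 0 < t - fst x --> good X (t - fst x)"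
  shows "of_real (X t $ l) = (\<Sum>i\<in>UNIV. pairing (\<kappa> l i) (%s. forcing (past X) i (t - s)))"
proof -
  define y where "y k s = complex_of_real ((if 0 < s then X s else 0) $ k)" for k s
  have [measurable]: "X \<in> borel_fun" by fact
  have ym: "y k \<in> borel_fun" for k unfolding y_def[abs_def] by (rule component_meas) measurable
  have yle: "norm (y k s) \<le> norm (X s)" for k s by (auto simp: y_def component_le_norm_cart)
  have "y l t = (\<Sum>i\<in>UNIV. pairing (\<kappa> l i) (%s. forcing (past X) i (t - s)))"
  proof (rule resolvent_representation[OF \<kappa> kern0 kern_exp _ ym forcing_meas[OF past_meas[OF X]]])
    show "pairing (\<kappa> l k) (lap z) + 
       (\<Sum>i\<in>UNIV. pairing (\<kappa> l i) (lap z) * pairing (kern i k) (lap z)) = of_bool (l = k)"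
      if "Re z = - \<nu>" for z l k using inv that by simp
    show "absint (\<kappa> l i) (%s. enorm (y i (t - s))) < \<infinity>" for i
      by (rule order.strict_trans1[OF absint_mono[OF \<kappa>(1)] h1[of i]]) (rule ennreal_leI[OF yle])
    show "absint (\<kappa> l i) (%s. absint (kern i k) (%r. enorm (y k (t - s - r)))) < \<infinity>" for i k
      by (rule order.strict_trans1[OF absint_mono[OF \<kappa>(1)] h2[of i k]]) (rule absint_mono[OF kern0], rule ennreal_leI[OF yle])
    have eq: "y i x + (\<Sum>k\<in>UNIV. pairing (kern i k) (%r. y k (x - r))) = forcing (past X) i x" if g: "0 < x --> good X x" for x i
    proof (cases "0 < x")
      case True
      have g: "good X x" using g True by simp
      have pk: "pairing (kern i k) (%s. of_real (X (x - s) $ k)) = pairing (kern i k) (%r. y k (x - r)) + pairing (kern i k) (%r. of_real (past X (x - r) $ k))" for k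
      proof -
        have fin: "absint (kern i k) (%s. enorm (X (x - s))) < \<infinity>" using g by (simp add: good_def)
        have "integrable (kern i k) (%p. snd p * y k (x - fst p))"
          by (rule pairing_integrable[OF kern0])
            (use ym in measurable, rule order.strict_trans1[OF absint_mono[OF kern0] fin], rule ennreal_leI[OF yle])
        moreover have "integrable (kern i k) (%p. snd p * of_real (past X (x - fst p) $ k))"
        proof (rule pairing_integrable[OF kern0])
          show "(%s. complex_of_real (past X (x - s) $ k)) \<in> borel_fun"
            by (rule component_meas, rule measurable_compose[OF _ past_meas[OF X]]) simp
          show "absint (kern i k) (%s. enorm (complex_of_real (past X (x - s) $ k))) < \<infinity>"
            by (rule order.strict_trans1[OF absint_mono[OF kern0] fin], rule ennreal_leI) (auto simp: past_def component_le_norm_cart)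
        qed
        ultimately have "pairing (kern i k) (%r. y k (x - r)) + pairing (kern i k) (%r. of_real (past X (x - r) $ k)) = 
            (\<integral>p. snd p * y k (x - fst p) + snd p * of_real (past X (x - fst p) $ k) \<partial>kern i k)"
          unfolding pairing_def by (rule Bochner_Integration.integral_add[symmetric])
        also have "\<dots> = (\<integral>p. snd p * of_real (X (x - fst p) $ k) \<partial>kern i k)"
          by (intro Bochner_Integration.integral_cong refl) (auto simp: y_def past_def)
        finally show ?thesis by (simp add: pairing_def)
      qed
      have "of_real (X x $ i) + (\<Sum>k\<in>UNIV. pairing (kern i k) (%s. of_real (X (x - s) $ k))) = 0" using g by (simp add: good_def)
      then show ?thesis using True unfolding pk by (simp add: forcing_def y_def sum.distrib eq_neg_iff_add_eq_0 ac_simps)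
    next
      case False
      have "pairing (kern i k) (%r. y k (x - r)) = 0" for k
        unfolding pairing_def
      proof (rule integral_eq_zero_AE)
        have "AE p in kern i k. fst p \<in> {0..}" using kern0 by (simp add: law_def)
        then show "AE p in kern i k. snd p * y k (x - fst p) = 0" by eventually_elim (use False in \<open>auto simp: y_def\<close>)
      qed
      then show ?thesis using False by (simp add: forcing_def y_def)
    qed
    show "AE x in \<kappa> l i. y i (t - fst x) + (\<Sum>k\<in>UNIV. pairing (kern i k) (%r. y k (t - fst x - r))) = forcing (past X) i (t - fst x)" for i
      using h3[of i] by eventually_elim (rule eq)
  qed
  then show ?thesis using t by (simp add: y_def)
qed

lemma tot_law:
  "\<exists>M. law {0..} M \<and> absint M (eexp \<nu>) < \<infinity> \<and>
    (\<forall>\<phi>. \<phi> \<in> borel_fun --> absint M \<phi> = \<phi> 0 + (\<Sum>l\<in>UNIV. \<Sum>i\<in>UNIV. \<Sum>k\<in>UNIV. absint (\<kappa> l i) (%s. absint (kern i k) (%r. \<phi> (s + r)))))"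
proof -
  have "\<exists>L. law {0..} L \<and> (\<forall>\<phi>. \<phi> \<in> borel_fun --> absint L \<phi> = absint (\<kappa> l i) (%s. absint (kern i k) (%t. \<phi> (s + t))))" for l i k
    by (rule law_prod[OF \<kappa>(1)[of l i] kern0[of i k], of "{0..}"]) auto
  then obtain C where C: "\<And>l i k. law {0..} (C l i k)" "\<And>l i k \<phi>. \<phi> \<in> borel_fun ==> absint (C l i k) \<phi> = absint (\<kappa> l i) (%s. absint (kern i k) (%t. \<phi> (s + t)))"
    by metis
  obtain Z where Z: "law {0..} Z" "\<And>\<phi>. \<phi> \<in> borel_fun ==> absint Z \<phi> = enorm (1::complex) * \<phi> 0"
    by (rule law_dirac[of 0 "{0..}" 1]) auto
  have I: "finite (UNIV :: ('b \<times> 'b \<times> 'b) set)" "(UNIV :: ('b \<times> 'b \<times> 'b) set) \<noteq> {}" by auto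
  obtain D where D: "law {0..} D" "\<And>\<phi>. \<phi> \<in> borel_fun ==> absint D \<phi> = (\<Sum>p\<in>UNIV. absint (case p of (l, i, k) => C l i k) \<phi>)"
    using law_sum[where M = "%(l, i, k). C l i k", OF I, of "{0..}"] C(1) by auto
  obtain L where L: "law {0..} L" "\<And>\<phi>. \<phi> \<in> borel_fun ==> absint L \<phi> = absint Z \<phi> + absint D \<phi>"
    using law_add[OF Z(1) D(1)] by metis
  have s: "(\<Sum>p\<in>UNIV. f p) = (\<Sum>l\<in>UNIV. \<Sum>i\<in>UNIV. \<Sum>k\<in>UNIV. f (l, i, k))" for f :: "'b \<times> 'b \<times> 'b => ennreal"
    unfolding UNIV_Times_UNIV[symmetric] sum.cartesian_product' ..
  have eq: "absint L \<phi> = \<phi> 0 + (\<Sum>l\<in>UNIV. \<Sum>i\<in>UNIV. \<Sum>k\<in>UNIV. absint (\<kappa> l i) (%s. absint (kern i k) (%r. \<phi> (s + r))))" if "\<phi> \<in> borel_fun" for \<phi>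
    using L(2)[OF that] Z(2)[OF that] D(2)[OF that] unfolding s by (simp add: C(2)[OF that])
  have "absint (\<kappa> l i) (%s. absint (kern i k) (%r. ennreal (exp (\<nu> * (s + r))))) < \<infinity>" for l i k
  proof -
    have "absint (kern i k) (%t. ennreal (exp (\<nu> * (s + t)))) = ennreal (exp (\<nu> * s)) * absint (kern i k) (eexp \<nu>)" for s
      unfolding absint_def by (subst nn_integral_cmult[symmetric], auto intro!: law_meas[OF kern0] nn_integral_cong simp: ring_distribs exp_add ennreal_mult' ac_simps)
    then have "absint (\<kappa> l i) (%s. absint (kern i k) (%r. ennreal (exp (\<nu> * (s + r))))) = absint (\<kappa> l i) (%s. ennreal (exp (\<nu> * s)) * absint (kern i k) (eexp \<nu>))"
      by simp
    also have "\<dots> = absint (\<kappa> l i) (%s. ennreal (exp (\<nu> * s))) * absint (kern i k) (eexp \<nu>)"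
      unfolding absint_def[of "\<kappa> l i"] by (subst nn_integral_multc[symmetric], auto intro!: law_meas[OF \<kappa>(1)] simp: mult.assoc)
    also have "\<dots> < \<infinity>" using \<kappa>(2)[of l i] kern_exp[of i k] by (simp add: ennreal_mult_less_top)
    finally show ?thesis .
  qed
  then have "absint L (eexp \<nu>) < \<infinity>"
    by (subst eq) (auto simp: less_top[symmetric])
  then show ?thesis using L(1) eq by blast
qed

text \<open>A positive majorant of all the measures through which the history acts: the unit mass at $0$ together with the convolutions of resolvent and kernel.\<close>

definition tot :: "(real \<times> complex) measure" where
  "tot = (SOME M. law {0..} M \<and> absint M (eexp \<nu>) < \<infinity> \<and>
    (\<forall>\<phi>. \<phi> \<in> borel_fun --> absint M \<phi> = \<phi> 0 + (\<Sum>l\<in>UNIV. \<Sum>i\<in>UNIV. \<Sum>k\<in>UNIV. absint (\<kappa> l i) (%s. absint (kern i k) (%r. \<phi> (s + r))))))"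

lemma tot: "law {0..} tot" "absint tot (eexp \<nu>) < \<infinity>"
  "\<phi> \<in> borel_fun ==> absint tot \<phi> = \<phi> 0 + (\<Sum>l\<in>UNIV. \<Sum>i\<in>UNIV. \<Sum>k\<in>UNIV. absint (\<kappa> l i) (%s. absint (kern i k) (%r. \<phi> (s + r))))"
  using someI_ex[OF tot_law] unfolding tot_def[symmetric] by auto

lemma absint_sum:
  assumes "law S M" "\<And>i. i \<in> I ==> f i \<in> borel_fun"
  shows "absint M (%t. \<Sum>i\<in>I. f i t) = (\<Sum>i\<in>I. absint M (f i))"
  unfolding absint_def using assms(2)
  by (subst nn_integral_sum[symmetric]) (auto simp: sum_distrib_left intro!: law_meas[OF assms(1)] measurable_compose[OF meas_snd_fst(1)])

lemma forcing_bound: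
  fixes f :: "real => real ^ 'b"
  assumes "f \<in> borel_fun"
  shows "enorm (forcing f i x) \<le> (\<Sum>k\<in>UNIV. absint (kern i k) (%r. enorm (f (x - r))))"
proof (cases "0 < x")
  case True
  have "enorm (forcing f i x) \<le> ennreal (\<Sum>k\<in>UNIV. norm (pairing (kern i k) (%s. of_real (f (x - s) $ k))))"
    using True by (simp add: forcing_def norm_sum ennreal_leI)
  also have "\<dots> = (\<Sum>k\<in>UNIV. enorm (pairing (kern i k) (%s. of_real (f (x - s) $ k))))" by (simp add: sum_ennreal)
  also have "\<dots> \<le> (\<Sum>k\<in>UNIV. absint (kern i k) (%r. enorm (f (x - r))))"
  proof (rule sum_mono)
    fix k
    have "enorm (pairing (kern i k) (%s. of_real (f (x - s) $ k))) \<le> absint (kern i k) (%r. enorm (complex_of_real (f (x - r) $ k)))"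
      by (rule norm_pairing_le[OF kern0], rule component_meas, rule measurable_compose[OF _ assms]) simp
    also have "\<dots> \<le> absint (kern i k) (%r. enorm (f (x - r)))"
      by (rule absint_mono[OF kern0], rule ennreal_leI) (simp add: component_le_norm_cart)
    finally show "enorm (pairing (kern i k) (%s. of_real (f (x - s) $ k))) \<le> absint (kern i k) (%r. enorm (f (x - r)))" .
  qed
  finally show ?thesis .
qed (simp add: forcing_def)

text \<open>The representation formula estimated by absolute values.  The unit mass at $0$ makes it true at times $\le 0$ as well, so that a window may straddle $0$.\<close>

lemma domination_at:
  fixes X :: "real => real ^ 'b"
  assumes X: "X \<in> borel_fun" 
    and rep: "0 < t ==> (\<And>l. of_real (X t $ l) = (\<Sum>i\<in>UNIV. pairing (\<kappa> l i) (%s. forcing (past X) i (t - s))))"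
  shows "enorm (X t) \<le> absint tot (%s. enorm (past X (t - s)))"
proof -
  have pm: "past X \<in> borel_fun" by (rule past_meas[OF X])
  have m: "(%s. enorm (past X (t - s))) \<in> borel_fun"
    using measurable_compose[OF _ pm, of "%s. t - s" borel] by simp
  have "enorm (X t) \<le> enorm (past X (t - 0)) + (\<Sum>l\<in>UNIV. \<Sum>i\<in>UNIV. \<Sum>k\<in>UNIV. absint (\<kappa> l i) (%s. absint (kern i k) (%r. enorm (past X (t - (s + r))))))"
  proof (cases "0 < t")
    case True
    have km: "(%s. absint (kern i k) (%r. enorm (past X (t - s - r)))) \<in> borel_fun" for i k
      by (rule measurable_compose[OF _ borel_measurable_absint_shift[OF kern0]]) (use pm in measurable)
    have "enorm (X t) \<le> ennreal (\<Sum>l\<in>UNIV. \<bar>X t $ l\<bar>)" by (intro ennreal_leI norm_le_sum_components)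
    also have "\<dots> = (\<Sum>l\<in>UNIV. enorm (complex_of_real (X t $ l)))" by (simp add: sum_ennreal)
    also have "\<dots> \<le> (\<Sum>l\<in>UNIV. \<Sum>i\<in>UNIV. \<Sum>k\<in>UNIV. absint (\<kappa> l i) (%s. absint (kern i k) (%r. enorm (past X (t - (s + r))))))"
    proof (rule sum_mono)
      fix l
      have "enorm (complex_of_real (X t $ l)) \<le> ennreal (\<Sum>i\<in>UNIV. norm (pairing (\<kappa> l i) (%s. forcing (past X) i (t - s))))"
        unfolding rep[OF True, of l] by (intro ennreal_leI norm_sum)
      also have "\<dots> = (\<Sum>i\<in>UNIV. enorm (pairing (\<kappa> l i) (%s. forcing (past X) i (t - s))))" by (simp add: sum_ennreal)
      also have "\<dots> \<le> (\<Sum>i\<in>UNIV. \<Sum>k\<in>UNIV. absint (\<kappa> l i) (%s. absint (kern i k) (%r. enorm (past X (t - (s + r))))))"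
      proof (rule sum_mono)
        fix i
        have "enorm (pairing (\<kappa> l i) (%s. forcing (past X) i (t - s))) \<le> absint (\<kappa> l i) (%s. enorm (forcing (past X) i (t - s)))"
          by (rule norm_pairing_le[OF \<kappa>(1)], rule measurable_compose[OF _ forcing_meas[OF pm]]) simp
        also have "\<dots> \<le> absint (\<kappa> l i) (%s. \<Sum>k\<in>UNIV. absint (kern i k) (%r. enorm (past X (t - s - r))))"
          by (rule absint_mono[OF \<kappa>(1)], rule forcing_bound[OF pm])
        also have "\<dots> = (\<Sum>k\<in>UNIV. absint (\<kappa> l i) (%s. absint (kern i k) (%r. enorm (past X (t - s - r)))))"
          by (rule absint_sum[OF \<kappa>(1) km])
        finally show "enorm (pairing (\<kappa> l i) (%s. forcing (past X) i (t - s))) \<le> (\<Sum>k\<in>UNIV. absint (\<kappa> l i) (%s. absint (kern i k) (%r. enorm (past X (t - (s + r))))))"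
          by (simp add: diff_diff_eq)
      qed
      finally show "enorm (complex_of_real (X t $ l)) \<le> (\<Sum>i\<in>UNIV. \<Sum>k\<in>UNIV. absint (\<kappa> l i) (%s. absint (kern i k) (%r. enorm (past X (t - (s + r))))))" .
    qed
    finally show ?thesis by (rule order_trans) simp
  next
    case False
    then show ?thesis by (simp add: past_def)
  qed
  then show ?thesis unfolding tot(3)[OF m] .
qed

lemma representation_AE:
  fixes X :: "real => real ^ 'b"
  assumes X: "X \<in> borel_fun" and lf: "loc_fin (%t. enorm (X t))"
    and good: "AE x in lborel. 0 < x --> good X x"
  shows "AE t in lborel. 0 < t --> (\<forall>l. of_real (X t $ l) = (\<Sum>i\<in>UNIV. pairing (\<kappa> l i) (%s. forcing (past X) i (t - s))))"
proof -
  have 1: "AE t in lborel. absint (\<kappa> l i) (%s. enorm (X (t - s))) < \<infinity>" for l i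
    by (rule loc_fin_AE[OF loc_fin_convolution[OF \<kappa>(1) \<kappa>_mass lf]])
  have 2: "AE t in lborel. absint (\<kappa> l i) (%s. absint (kern i k) (%r. enorm (X (t - s - r)))) < \<infinity>" for l i k
    by (rule loc_fin_AE[OF loc_fin_convolution[OF \<kappa>(1) \<kappa>_mass loc_fin_convolution[OF kern0 kern_mass lf]]])
  have 3: "AE t in lborel. AE x in \<kappa> l i. 0 < t - fst x --> good X (t - fst x)" for l i
    by (rule AE_convolution[OF \<kappa>(1) good])
  have "AE t in lborel. \<forall>l i. absint (\<kappa> l i) (%s. enorm (X (t - s))) < \<infinity>"
    "AE t in lborel. \<forall>l i k. absint (\<kappa> l i) (%s. absint (kern i k) (%r. enorm (X (t - s - r)))) < \<infinity>"
    "AE t in lborel. \<forall>l i. AE x in \<kappa> l i. 0 < t - fst x --> good X (t - fst x)"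
    using 1 2 3 by (simp_all add: AE_all_countable)
  then show ?thesis
    by eventually_elim (auto intro!: representation_at[OF X])
qed

end

section \<open>Trajectories given by windows and almost everywhere equations\<close>

lemma AE_lebesgue_on_iff:
  assumes "S \<in> sets borel"
  shows "(AE x in lebesgue_on S. P x) \<longleftrightarrow> (AE x in lborel. x \<in> S --> P x)"
  using assms by (subst AE_restrict_space_iff) (auto simp: AE_completion_iff)

lemma borel_representative:
  fixes f :: "real => real ^ 'n::finite"
  assumes f: "f \<in> borel_measurable (lebesgue_on S)" and S: "S \<in> sets borel"
  shows "\<exists>g\<in>borel_fun. AE x in lborel. x \<in> S --> f x = g x"
proof -
  have Sl: "S \<inter> space lebesgue \<in> sets lebesgue" using S by simp
  have fm: "(%x. indicat_real S x *\<^sub>R f x) \<in> borel_measurable lebesgue"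
    using f unfolding borel_measurable_restrict_space_iff[OF Sl] .
  have "\<forall>i. \<exists>g. g \<in> borel_measurable lborel \<and> (AE x in lborel. (indicat_real S x *\<^sub>R f x) $ i = g x)"
  proof
    fix i
    have "(%x. (indicat_real S x *\<^sub>R f x) $ i) \<in> borel_measurable lebesgue"
      by (rule measurable_compose[OF fm borel_measurable_vec_nth])
    from completion_ex_borel_measurable_real[OF this]
    show "\<exists>g. g \<in> borel_measurable lborel \<and> (AE x in lborel. (indicat_real S x *\<^sub>R f x) $ i = g x)" by blast
  qed
  from choice[OF this] obtain g where g0: "\<forall>i. g i \<in> borel_measurable lborel \<and> (AE x in lborel. (indicat_real S x *\<^sub>R f x) $ i = g i x)" ..
  then have g: "g i \<in> borel_fun" "AE x in lborel. (indicat_real S x *\<^sub>R f x) $ i = g i x" for i by simp_all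
  have "AE x in lborel. \<forall>i. (indicat_real S x *\<^sub>R f x) $ i = g i x" unfolding AE_all_countable using g(2) by blast
  then have ae: "AE x in lborel. x \<in> S --> f x = (\<Sum>i\<in>UNIV. axis i (g i x))"
  proof (rule eventually_mono, intro impI)
    fix x assume x: "\<forall>i. (indicat_real S x *\<^sub>R f x) $ i = g i x" "x \<in> S"
    have "f x = (\<Sum>i\<in>UNIV. axis i (f x $ i))" by (rule vec_as_axis_sum)
    also have "\<dots> = (\<Sum>i\<in>UNIV. axis i (g i x))" 
    proof (rule sum.cong[OF refl])
      show "axis i (f x $ i) = axis i (g i x)" for i using x(1)[rule_format, of i] x(2) by simp
    qed
    finally show "f x = (\<Sum>i\<in>UNIV. axis i (g i x))" .
  qed
  have cm: "(axis i :: real => real ^ 'n) \<in> borel_fun" for i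
    by (rule borel_measurable_continuous_onI[OF linear_continuous_on[OF bounded_linear_axis]])
  have "(%x. \<Sum>i\<in>UNIV. axis i (g i x) :: real ^ 'n) \<in> borel_fun"
    by (rule borel_measurable_sum) (rule measurable_compose[OF g(1) cm])
  then show ?thesis by (rule bexI[rotated]) (rule ae)
qed

text \<open>The windows $[-T,0] + nT$ cover $[-T,\infty)$; the index selects one that contains the given time.\<close>

definition window_index :: "real => real => nat" where
  "window_index T x = nat \<lceil>x / T\<rceil>"

lemma window_index:
  fixes T x :: real
  assumes "0 < T" "- T \<le> x"
  shows "x - window_index T x * T \<in> {- T..0}"
proof (cases "x \<le> 0")
  case True
  then have "x / T \<le> 0" using assms by (simp add: divide_nonpos_pos)
  then have "\<lceil>x / T\<rceil> \<le> 0" by (simp add: ceiling_le_iff)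
  then show ?thesis using assms True by (simp add: window_index_def)
next
  case False
  then have "0 \<le> x / T" using assms by simp
  then have "0 \<le> \<lceil>x / T\<rceil>" by (simp add: zero_le_ceiling)
  then have n: "real (window_index T x) = of_int \<lceil>x / T\<rceil>" by (simp add: window_index_def)
  have "x / T \<le> real (window_index T x)" "real (window_index T x) < x / T + 1" unfolding n using ceiling_correct[of "x / T"] by linarith+
  then show ?thesis using assms by (simp add: field_simps)
qed

lemma glue_windows_measurable:
  fixes g :: "nat => real => 'a :: real_normed_vector" and T :: real
  assumes [measurable]: "\<And>n. g n \<in> borel_fun"
  shows "(%x. if x < - T then 0 else g (window_index T x) (x - window_index T x * T)) \<in> borel_fun"
proof -
  have [measurable]: "window_index T \<in> borel \<rightarrow>\<^sub>M count_space UNIV"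
  proof -
    have "(%x. \<lceil>x / T\<rceil>) \<in> borel \<rightarrow>\<^sub>M count_space UNIV"
      by (rule measurable_compose[OF _ measurable_real_ceiling]) simp
    from measurable_compose[OF this, of nat "count_space UNIV"] show ?thesis
      by (simp add: window_index_def[abs_def])
  qed
  have "(%x. g (window_index T x) (x - real (window_index T x) * T)) \<in> borel_fun"
    by (rule measurable_compose_countable[where f = "%n x. g n (x - real n * T)" and g = "window_index T"]) measurable
  then show ?thesis by measurable
qed

text \<open>Membership in the state space is only known window by window, and only up to null sets.  Gluing Borel representatives of countably many windows yields one
  Borel function on the line.\<close>

lemma trajectory_borel_representative:
  fixes X :: "real => real ^ 'n::finite" and T :: real
  assumes T: "0 < T" and X: "\<And>t. 0 \<le> t ==> (%s. X (t + s)) \<in> borel_measurable (lebesgue_on {- T..0})"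
    and fin: "\<And>t. 0 \<le> t ==> (\<integral>\<^sup>+s. enorm (X (t + s)) \<partial>lebesgue_on {- T..0}) < \<infinity>"
  obtains X' where "X' \<in> borel_fun" "\<And>s. s < - T ==> X' s = 0" 
    "AE s in lborel. - T \<le> s --> X s = X' s" "loc_fin (%s. enorm (X' s))"
proof -
  have "\<forall>n. \<exists>g. g \<in> borel_fun \<and> (AE s in lborel. s \<in> {- T..0} --> X (real n * T + s) = g s)"
  proof
    fix n
    show "\<exists>g. g \<in> borel_fun \<and> (AE s in lborel. s \<in> {- T..0} --> X (real n * T + s) = g s)"
      using borel_representative[OF X[of "real n * T"]] T by auto
  qed
  from choice[OF this] obtain g where g[measurable]: "\<And>n. g n \<in> borel_fun" 
    and ge: "\<And>n. AE s in lborel. s \<in> {- T..0} --> X (real n * T + s) = g n s" by auto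
  define X' where "X' x = (if x < - T then 0 else g (window_index T x) (x - window_index T x * T))" for x
  have m[measurable]: "X' \<in> borel_fun" unfolding X'_def by (rule glue_windows_measurable) (rule g)
  have "AE x in lborel. \<forall>n. x - real n * T \<in> {- T..0} --> X (real n * T + (x - real n * T)) = g n (x - real n * T)"
    unfolding AE_all_countable by (rule allI, rule AE_shift[OF ge])
  then have ae: "AE s in lborel. - T \<le> s --> X s = X' s"
  proof eventually_elim
    case (elim x)
    show ?case
    proof
      assume x: "- T \<le> x"
      have "X x = g (window_index T x) (x - real (window_index T x) * T)"
        using elim[rule_format, OF window_index[OF T x]] by simp
      then show "X x = X' x" using x by (simp add: X'_def)
    qed
  qed
  have gf: "(\<integral>\<^sup>+s. enorm (g n s) * indicator {- T..0} s \<partial>lborel) < \<infinity>" for n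
  proof -
    have "(\<integral>\<^sup>+s. enorm (g n s) * indicator {- T..0} s \<partial>lborel) = (\<integral>\<^sup>+s. enorm (g n s) * indicator {- T..0} s \<partial>lebesgue)"
      by (rule nn_integral_completion[symmetric])
    also have "\<dots> = (\<integral>\<^sup>+s. enorm (X (real n * T + s)) * indicator {- T..0} s \<partial>lebesgue)"
      by (rule nn_integral_cong_AE) (use AE_completion[OF ge[of n]] in \<open>auto simp: indicator_def elim!: eventually_mono\<close>)
    also have "\<dots> = (\<integral>\<^sup>+s. enorm (X (real n * T + s)) \<partial>lebesgue_on {- T..0})"
      by (rule nn_integral_restrict_space[symmetric]) auto
    also have "\<dots> < \<infinity>" using T by (intro fin) simp
    finally show ?thesis .
  qed
  have "(\<integral>\<^sup>+x. enorm (X' x) * indicator {..R} x \<partial>lborel) < \<infinity>" for R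
  proof -
    obtain n where n: "R / T \<le> real n" using real_arch_simple by blast
    have wi: "window_index T x \<le> n" if "x \<le> R" for x
    proof -
      have "x / T \<le> real n" using that n T by (meson divide_right_mono less_imp_le order_trans)
      then show ?thesis unfolding window_index_def by (simp add: ceiling_le_iff nat_le_iff)
    qed
    have "(\<integral>\<^sup>+x. enorm (X' x) * indicator {..R} x \<partial>lborel) \<le> 
       (\<integral>\<^sup>+x. (\<Sum>k\<le>n. enorm (g k (x - real k * T)) * indicator {- T..0} (x - real k * T)) \<partial>lborel)"
    proof (rule nn_integral_mono)
      fix x
      show "enorm (X' x) * indicator {..R} x \<le> (\<Sum>k\<le>n. enorm (g k (x - real k * T)) * indicator {- T..0} (x - real k * T))"
      proof (cases "x \<le> R \<and> - T \<le> x")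
        case True
        then have "enorm (X' x) * indicator {..R} x = 
          enorm (g (window_index T x) (x - real (window_index T x) * T)) * indicator {- T..0} (x - real (window_index T x) * T)"
          using window_index[OF T, of x] by (simp add: X'_def)
        also have "\<dots> \<le> (\<Sum>k\<le>n. enorm (g k (x - real k * T)) * indicator {- T..0} (x - real k * T))"
          using wi[of x] True by (intro member_le_sum[of "window_index T x" "{..n}" "%k. enorm (g k (x - real k * T)) * indicator {- T..0} (x - real k * T)"]) auto
        finally show ?thesis .
      qed (auto simp: X'_def)
    qed
    also have "\<dots> = (\<Sum>k\<le>n. \<integral>\<^sup>+x. enorm (g k (x - real k * T)) * indicator {- T..0} (x - real k * T) \<partial>lborel)"
      by (rule nn_integral_sum) measurable
    also have "\<dots> = (\<Sum>k\<le>n. \<integral>\<^sup>+x. enorm (g k x) * indicator {- T..0} x \<partial>lborel)"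
    proof (rule sum.cong[OF refl])
      fix k
      show "(\<integral>\<^sup>+x. enorm (g k (x - real k * T)) * indicator {- T..0} (x - real k * T) \<partial>lborel) = (\<integral>\<^sup>+x. enorm (g k x) * indicator {- T..0} x \<partial>lborel)"
        using nn_integral_real_affine[of "%x. enorm (g k x) * indicator {- T..0} x" 1 "- real k * T"] by (simp add: add.commute)
    qed
    also have "\<dots> < \<infinity>" using gf by (simp add: less_top[symmetric])
    finally show ?thesis .
  qed
  then have "loc_fin (%s. enorm (X' s))" by (simp add: loc_fin_def)
  then show thesis using that[OF m _ ae] by (simp add: X'_def)
qed

lemma AE_reflect:
  fixes t :: real
  assumes "AE x in lborel. P x"
  shows "AE x in lborel. P (t - x)"
proof -
  obtain Z where Z: "{x \<in> space lborel. \<not> P x} \<subseteq> Z" "emeasure lborel Z = 0" "Z \<in> sets lborel"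
    using assms by (rule AE_E)
  have [measurable]: "Z \<in> sets borel" using Z(3) by simp
  have "(\<integral>\<^sup>+x. indicator Z x \<partial>lborel) = 0" using Z by simp
  then have "(\<integral>\<^sup>+x. indicator Z (t - x) \<partial>lborel) = 0"
    using nn_integral_real_affine[of "indicator Z" "- 1" t] by simp
  then have "AE x in lborel. indicator Z (t - x) = (0 :: ennreal)"
    by (subst (asm) nn_integral_0_iff_AE) simp_all
  then show ?thesis by (rule eventually_mono) (use Z(1) in \<open>auto simp: indicator_def split: if_splits\<close>)
qed

lemma law_weight:
  assumes M: "law S M"
  obtains L where "law S L" "\<And>\<phi>. \<phi> \<in> borel_fun ==> absint L \<phi> = absint M (%s. ennreal (exp (\<nu> * s)) * \<phi> s)"
proof -
  have p: "prob_space M" "S \<in> sets borel" "AE x in M. fst x \<in> S" using M by (auto simp: law_def)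
  have m: "(%x. fst x) \<in> borel_measurable M" "(%x. snd x * of_real (exp (\<nu> * fst x))) \<in> borel_measurable M"
    by (auto intro!: law_meas[OF M])
  obtain L where L: "law S L" "\<And>\<phi>. \<phi> \<in> borel_fun ==> absint L \<phi> = (\<integral>\<^sup>+x. enorm (snd x * complex_of_real (exp (\<nu> * fst x))) * \<phi> (fst x) \<partial>M)"
    by (rule law_from_rv[OF p(1) m p(2,3)]) (rule that)
  show thesis
    by (rule that[OF L(1)], subst L(2), assumption) (simp add: absint_def norm_mult ennreal_mult' mult.assoc)
qed

context stable_delay
begin

text \<open>The majorant with the exponential weight built in; its mass \<open>gain\<close> is the factor by which the norms are amplified.\<close>

definition totw :: "(real \<times> complex) measure" where
  "totw = (SOME L. law {0..} L \<and> (\<forall>\<phi>. \<phi> \<in> borel_fun --> absint L \<phi> = absint tot (%s. ennreal (exp (\<nu> * s)) * \<phi> s)))"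

lemma totw: "law {0..} totw" "\<phi> \<in> borel_fun ==> absint totw \<phi> = absint tot (%s. ennreal (exp (\<nu> * s)) * \<phi> s)"
proof -
  have "\<exists>L. law {0..} L \<and> (\<forall>\<phi>. \<phi> \<in> borel_fun --> absint L \<phi> = absint tot (%s. ennreal (exp (\<nu> * s)) * \<phi> s))"
    using law_weight[OF tot(1), of \<nu>] by metis
  from someI_ex[OF this] show "law {0..} totw" "\<phi> \<in> borel_fun ==> absint totw \<phi> = absint tot (%s. ennreal (exp (\<nu> * s)) * \<phi> s)"
    unfolding totw_def by auto
qed

definition gain :: real where "gain = enn2real (absint totw (%s. 1))"

lemma gain: "0 \<le> gain" "absint totw (%s. 1) = ennreal gain"
proof -
  have "absint totw (%s. 1) = absint tot (%s. ennreal (exp (\<nu> * s)) * 1)" by (rule totw(2)) simp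
  also have "\<dots> < \<infinity>" using tot(2) by simp
  finally show "absint totw (%s. 1) = ennreal gain" unfolding gain_def by simp
qed (simp add: gain_def)

text \<open>For a time \<open>x\<close> in the window at \<open>t\<close> only masses at $s \ge x \ge t - \tau_*$ reach back to nonpositive times, and there $e^{\nu s} \ge e^{\nu(t-\tau_*)}$.
  This is the source of the exponential decay.\<close>

lemma weighted_domination:
  fixes X :: "real => real ^ 'b"
  assumes X: "X \<in> borel_fun" and x: "t - \<tau>max \<le> x"
    and rep: "0 < x --> (\<forall>l. of_real (X x $ l) = (\<Sum>i\<in>UNIV. pairing (\<kappa> l i) (%s. forcing (past X) i (x - s))))"
  shows "ennreal (exp (\<nu> * (t - \<tau>max)) * norm (X x)) \<le> absint totw (%s. enorm (past X (x - s)))"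
proof -
  have pm: "past X \<in> borel_fun" by (rule past_meas[OF X])
  have m: "(%s. enorm (past X (x - s))) \<in> borel_fun"
    using measurable_compose[OF _ pm, of "%s. x - s" borel] by simp
  have "ennreal (exp (\<nu> * (t - \<tau>max)) * norm (X x)) = ennreal (exp (\<nu> * (t - \<tau>max))) * enorm (X x)" by (simp add: ennreal_mult')
  also have "\<dots> \<le> ennreal (exp (\<nu> * (t - \<tau>max))) * absint tot (%s. enorm (past X (x - s)))"
    by (intro mult_left_mono domination_at[OF X]) (use rep in auto)
  also have "\<dots> = absint tot (%s. ennreal (exp (\<nu> * (t - \<tau>max))) * enorm (past X (x - s)))"
  proof -
    note pm[measurable]
    have "(%p. enorm (snd p) * enorm (past X (x - fst p))) \<in> borel_measurable tot"
      by (rule law_meas[OF tot(1)]) measurable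
    from nn_integral_cmult[OF this, of "ennreal (exp (\<nu> * (t - \<tau>max)))"] show ?thesis
      unfolding absint_def by (simp add: mult.left_commute)
  qed
  also have "\<dots> \<le> absint tot (%s. ennreal (exp (\<nu> * s)) * enorm (past X (x - s)))"
  proof (rule absint_mono[OF tot(1)])
    fix s :: real
    show "ennreal (exp (\<nu> * (t - \<tau>max))) * enorm (past X (x - s)) \<le> ennreal (exp (\<nu> * s)) * enorm (past X (x - s))"
    proof (cases "x - s \<le> 0")
      case True
      then have "exp (\<nu> * (t - \<tau>max)) \<le> exp (\<nu> * s)" using x \<nu> by (auto intro!: mult_left_mono)
      then show ?thesis by (intro mult_right_mono ennreal_leI) auto
    qed (simp add: past_def)
  qed
  also have "\<dots> = absint totw (%s. enorm (past X (x - s)))" by (rule totw(2)[OF m, symmetric])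
  finally show ?thesis .
qed

lemma good_of_equation:
  fixes X X' :: "real => real ^ 'b"
  assumes X'[measurable]: "X' \<in> borel_fun" and fin: "\<And>i j. absint (kern i j) (%s. enorm (X' (t - s))) < \<infinity>"
    and eq0: "X t = X' t" and eqd: "\<And>k. X (t - \<tau> k) = X' (t - \<tau> k)" and eqi: "AE s in lebesgue. s \<in> {0<..<\<tau>max} --> X (t - s) = X' (t - s)"
    and eq: "X t + (\<Sum>k. A k *v X (t - \<tau> k)) + (LINT s:{0<..<\<tau>max}|lebesgue. N s *v X (t - s)) = 0"
  shows "good X' t"
  unfolding good_def
proof (intro conjI allI fin)
  fix i
  have "X t $ i + ((\<Sum>k. A k *v X (t - \<tau> k)) + (LINT s:{0<..<\<tau>max}|lebesgue. N s *v X (t - s))) $ i = 0"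
    using arg_cong[OF eq, of "%v. v $ i"] by (simp add: add.assoc)
  then have "complex_of_real (X t $ i) + complex_of_real (((\<Sum>k. A k *v X (t - \<tau> k)) + (LINT s:{0<..<\<tau>max}|lebesgue. N s *v X (t - s))) $ i) = 0"
    by (simp only: of_real_add[symmetric] of_real_0)
  then show "complex_of_real (X' t $ i) + (\<Sum>k\<in>UNIV. pairing (kern i k) (%s. complex_of_real (X' (t - s) $ k))) = 0"
    unfolding equation_as_pairing[OF X' fin eqd eqi] eq0 .
qed

text \<open>A solution in the almost everywhere sense has a Borel representative to which the resolvent formula applies almost everywhere.\<close>

lemma solution_representation:
  fixes X X0 :: "real => real ^ 'b"
  assumes meas: "\<And>t. 0 \<le> t ==> (%s. X (t + s)) \<in> borel_measurable (lebesgue_on {- \<tau>max..0})"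
    and fin: "\<And>t. 0 \<le> t ==> (\<integral>\<^sup>+s. enorm (X (t + s)) \<partial>lebesgue_on {- \<tau>max..0}) < \<infinity>"
    and eq: "AE t in lebesgue_on {-\<tau>max..}. equation_at \<tau>max A \<tau> N X0 X t"
  obtains X' where "X' \<in> borel_fun" "\<And>s. s < - \<tau>max ==> X' s = 0" "AE s in lborel. - \<tau>max \<le> s --> X s = X' s"
    "AE s in lborel. s \<in> {- \<tau>max..0} --> X' s = X0 s"
    "AE t in lborel. 0 < t --> (\<forall>l. of_real (X' t $ l) = (\<Sum>i\<in>UNIV. pairing (\<kappa> l i) (%s. forcing (past X') i (t - s))))"
proof -
  obtain X' where X': "X' \<in> borel_fun" "\<And>s. s < - \<tau>max ==> X' s = 0" 
    and ae: "AE s in lborel. - \<tau>max \<le> s --> X s = X' s" and lf: "loc_fin (%s. enorm (X' s))"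
    by (rule trajectory_borel_representative[OF \<tau>max meas fin]) (assumption | rule that)+
  have eq': "AE t in lborel. - \<tau>max \<le> t --> equation_at \<tau>max A \<tau> N X0 X t"
    using eq by (subst (asm) AE_lebesgue_on_iff) auto
  have i: "AE s in lborel. s \<in> {- \<tau>max..0} --> X' s = X0 s"
    using eq' ae
  proof eventually_elim
    case (elim s)
    then show ?case unfolding equation_at_def by simp
  qed
  have aed: "AE t in lborel. \<forall>k. - \<tau>max \<le> t - \<tau> k --> X (t - \<tau> k) = X' (t - \<tau> k)"
    unfolding AE_all_countable by (rule allI, rule AE_shift[OF ae])
  have aef: "AE t in lborel. \<forall>i j. absint (kern i j) (%s. enorm (X' (t - s))) < \<infinity>"
    unfolding AE_all_countable by (intro allI loc_fin_AE loc_fin_convolution kern0 kern_mass lf)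
  have "AE s in lborel. t - s \<in> {- \<tau>max..} --> X (t - s) = X' (t - s)" for t
  proof -
    have "AE s in lborel. s \<in> {- \<tau>max..} --> X s = X' s" using ae by simp
    from AE_reflect[OF this] show ?thesis .
  qed
  then have aei: "AE s in lebesgue. s \<in> {0<..<\<tau>max} --> X (t - s) = X' (t - s)" if "0 < t" for t
    by (rule AE_completion[OF eventually_mono]) (use that in auto)
  have "AE x in lborel. 0 < x --> good X' x"
    using aed aef ae ae eq'
  proof eventually_elim
    case (elim x)
    show ?case
    proof
      assume x: "0 < x"
      have tk: "- \<tau>max \<le> x - \<tau> k" for k using \<tau>[of k] x by simp
      have x0: "- \<tau>max \<le> x" using x \<tau>max by simp
      have e: "X x + (\<Sum>k. A k *v X (x - \<tau> k)) + (LINT s:{0<..<\<tau>max}|lebesgue. N s *v X (x - s)) = 0"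
        using elim(5)[rule_format, OF x0] x unfolding equation_at_def by blast
      show "good X' x"
        by (rule good_of_equation[OF X'(1) elim(2)[rule_format] elim(4)[rule_format, OF x0] elim(1)[rule_format, OF tk] aei[OF x] e])
    qed
  qed
  from that[OF X' ae i representation_AE[OF X'(1) lf this]] show thesis .
qed

end

text \<open>A property that holds almost everywhere on a nondegenerate interval holds somewhere on it.\<close>

lemma interval_not_null:
  fixes a b :: real
  assumes "a < b" and "AE x in lborel. x \<in> {a..b} --> P x"
  shows "\<exists>x\<in>{a..b}. P x"
proof (rule ccontr)
  assume "\<not> ?thesis"
  then have n: "\<forall>x\<in>{a..b}. \<not> P x" by blast
  have ae: "AE x in lborel. \<not> (x \<in> {a..b})" using assms(2) by (rule eventually_mono) (use n in blast)
  have eq: "{x \<in> space lborel. x \<in> {a..b}} = {a..b}" by auto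
  have "emeasure lborel {a..b} = 0" using emeasure_eq_0_AE[OF ae] unfolding eq .
  then show False using assms(1) by (simp add: emeasure_lborel_Icc)
qed

lemma absint_cmult:
  assumes M: "law S M" and f: "f \<in> borel_fun"
  shows "absint M (%s. c * f s) = c * absint M f"
proof -
  note f[measurable]
  have "(%p. enorm (snd p) * f (fst p)) \<in> borel_measurable M" by (rule law_meas[OF M]) measurable
  from nn_integral_cmult[OF this, of c] show ?thesis unfolding absint_def by (simp add: mult.left_commute)
qed

lemma absint_le_const:
  assumes M: "law S M" and f: "AE p in M. f (fst p) \<le> K"
  shows "absint M f \<le> K * absint M (%s. 1)"
proof -
  have "AE p in M. enorm (snd p) * f (fst p) \<le> enorm (snd p) * (K * 1)"
    using f by (rule eventually_mono) (simp add: mult_left_mono)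
  then have "absint M f \<le> absint M (%s. K * 1)" unfolding absint_def by (rule nn_integral_mono_AE)
  also have "\<dots> = K * absint M (%s. 1)" by (rule absint_cmult[OF M]) simp
  finally show ?thesis .
qed

lemma nn_integral_window:
  fixes f g :: "real => ennreal"
  assumes S: "S \<in> sets borel" and ae: "AE s in lborel. s \<in> S --> f s = g s"
  shows "(\<integral>\<^sup>+s. f s \<partial>lebesgue_on S) = (\<integral>\<^sup>+s. g s * indicator S s \<partial>lborel)"
proof -
  have Sl: "S \<inter> space lebesgue \<in> sets lebesgue" using S by simp
  have "(\<integral>\<^sup>+s. f s \<partial>lebesgue_on S) = (\<integral>\<^sup>+s. f s * indicator S s \<partial>lebesgue)" by (rule nn_integral_restrict_space[OF Sl])
  also have "\<dots> = (\<integral>\<^sup>+s. g s * indicator S s \<partial>lebesgue)"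
  proof (rule nn_integral_cong_AE)
    show "AE s in lebesgue. f s * indicator S s = g s * indicator S s"
      using AE_completion[OF ae] by (rule eventually_mono) (simp add: indicator_def)
  qed
  also have "\<dots> = (\<integral>\<^sup>+s. g s * indicator S s \<partial>lborel)" by (rule nn_integral_completion)
  finally show ?thesis .
qed

lemma measurable_window:
  fixes f g :: "real => real ^ 'n::finite"
  assumes g[measurable]: "g \<in> borel_fun" and S[measurable]: "S \<in> sets borel" and ae: "AE s in lborel. s \<in> S --> f s = g s"
  shows "f \<in> borel_measurable (lebesgue_on S)"
proof -
  have Sl: "S \<inter> space lebesgue \<in> sets lebesgue" using S by simp
  have "(%x. indicat_real S x *\<^sub>R g x) \<in> borel_measurable lebesgue" by (rule measurable_completion) measurable
  moreover have "AE x in lebesgue. indicat_real S x *\<^sub>R g x = indicat_real S x *\<^sub>R f x"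
    using AE_completion[OF ae] by (rule eventually_mono) (auto simp: indicator_def)
  ultimately have "(%x. indicat_real S x *\<^sub>R f x) \<in> borel_measurable lebesgue" by (rule borel_measurable_AE)
  then show ?thesis unfolding borel_measurable_restrict_space_iff[OF Sl] .
qed

lemma AE_window_shift:
  fixes X X' :: "real => real ^ 'n::finite" and T t :: real
  assumes ae: "AE s in lborel. - T \<le> s --> X s = X' s" and t: "0 \<le> t"
  shows "AE s in lborel. s \<in> {- T..0} --> X (t + s) = X' (t + s)"
proof -
  have "AE s in lborel. - T \<le> s - (- t) --> X (s - (- t)) = X' (s - (- t))" by (rule AE_shift[OF ae])
  then show ?thesis by (rule eventually_mono) (use t in \<open>simp add: add.commute\<close>)
qed

lemma AE_window_iff:
  fixes T :: real
  shows "(AE x in lebesgue_on {- T..0}. P x) \<longleftrightarrow> (AE x in lborel. x \<in> {- T..0} --> P x)"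
  by (rule AE_lebesgue_on_iff) simp

lemma borel_measurable_vecI:
  fixes f :: "real => real ^ 'n::finite"
  assumes "\<And>k. (%x. f x $ k) \<in> borel_fun"
  shows "f \<in> borel_fun"
proof -
  have cm: "(axis i :: real => real ^ 'n) \<in> borel_fun" for i
    by (rule borel_measurable_continuous_onI[OF linear_continuous_on[OF bounded_linear_axis]])
  have "(%x. \<Sum>i\<in>UNIV. axis i (f x $ i)) \<in> borel_fun"
    by (rule borel_measurable_sum) (rule measurable_compose[OF assms cm])
  then show ?thesis unfolding vec_as_axis_sum[symmetric] .
qed

section \<open>Decay in Lebesgue spaces and for bounded Borel functions\<close>

text \<open>The windows are bounded, so membership in $L^p$ implies integrability.\<close>

lemma in_Lp_window:
  fixes f :: "real => real ^ 'n::finite" and T :: real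
  assumes p: "1 \<le> p" and f: "in_Lp p {- T..0} f"
  shows "f \<in> borel_measurable (lebesgue_on {- T..0})" "(\<integral>\<^sup>+s. enorm (f s) \<partial>lebesgue_on {- T..0}) < \<infinity>"
proof -
  let ?W = "lebesgue_on {- T..0}"
  interpret finite_measure ?W by (rule finite_measure_lebesgue_on) simp
  show m: "f \<in> borel_measurable ?W" using f by (simp add: in_Lp_def)
  have nm: "(%s. norm (f s)) \<in> borel_measurable ?W" using m by measurable
  have "integrable ?W (%s. norm (f s))"
  proof (cases "p = \<infinity>")
    case True
    let ?E = "esssup ?W (%x. ereal (norm (f x)))"
    have fin: "?E < \<infinity>" using f True by (simp add: in_Lp_def)
    have b: "norm (norm (f x)) \<le> real_of_ereal ?E" if "ereal (norm (f x)) \<le> ?E" for x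
      using that fin by (cases ?E) auto
    have ae: "AE x in ?W. ereal (norm (f x)) \<le> ?E" by (rule esssup_AE)
    have "AE x in ?W. norm (norm (f x)) \<le> real_of_ereal ?E" using ae by (rule eventually_mono) (rule b)
    then show ?thesis by (rule integrable_const_bound) (rule nm)
  next
    case False
    then obtain r where r: "p = ereal r" "1 \<le> r" using p by (cases p) auto
    have i: "integrable ?W (%x. norm (f x) powr r)" using f r by (simp add: in_Lp_def)
    have i1: "integrable ?W (%x. 1 + norm (f x) powr r)" by (intro Bochner_Integration.integrable_add i) simp
    have b: "norm (norm (f x)) \<le> norm (1 + norm (f x) powr r)" for x
    proof (cases "norm (f x) \<le> 1")
      case False
      then have "norm (f x) powr 1 \<le> norm (f x) powr r" using r by (intro powr_mono) auto
      then show ?thesis using False by simp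
    next
      case True
      moreover have "0 \<le> norm (f x) powr r" by simp
      ultimately have "norm (f x) \<le> 1 + norm (f x) powr r" by linarith
      then show ?thesis by simp
    qed
    show ?thesis by (rule Bochner_Integration.integrable_bound[OF i1 nm]) (rule AE_I2, rule b)
  qed
  then show "(\<integral>\<^sup>+s. enorm (f s) \<partial>?W) < \<infinity>" by (simp add: integrable_iff_bounded)
qed

text \<open>The tangent of the convex function $y^r$ at $1$, an instance of Young's inequality.\<close>

lemma powr_tangent:
  fixes y r :: real
  assumes "0 \<le> y" "1 \<le> r"
  shows "r * y \<le> y powr r + (r - 1)"
proof (cases "y = 0")
  case False
  then have y: "0 < y" using assms by simp
  have "(y powr r) powr (1 / r) * 1 powr (1 - 1 / r) \<le> 1 / r * y powr r + (1 - 1 / r) * 1"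
    by (rule Youngs_inequality_0) (use assms y in auto)
  then have "y \<le> y powr r / r + (1 - 1 / r)" using assms y by (simp add: powr_powr)
  then have "r * y \<le> r * (y powr r / r + (1 - 1 / r))" using assms by (intro mult_left_mono) auto
  also have "\<dots> = y powr r + (r - 1)" using assms by (simp add: field_simps)
  finally show ?thesis .
qed (use assms in simp)

text \<open>Jensen's inequality for a positive measure of mass at most \<open>B\<close>.  Integrating the tangent inequality at the point \<open>c = a / B\<close>
  avoids normalising the measure.\<close>

lemma absint_Jensen:
  fixes f :: "real => real"
  assumes M: "law S M" and f[measurable]: "f \<in> borel_fun" and f0: "\<And>s. 0 \<le> f s" and r: "1 \<le> r"
    and B: "0 < B" "absint M (%s. 1) \<le> ennreal B" and a: "0 \<le> a" "ennreal a \<le> absint M (%s. ennreal (f s))"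
  shows "ennreal (a powr r) \<le> ennreal (B powr (r - 1)) * absint M (%s. ennreal (f s powr r))"
proof (cases "a = 0")
  case False
  let ?J = "absint M (%s. ennreal (f s powr r))"
  define c where "c = a / B"
  have c: "0 < c" using False a(1) B by (simp add: c_def)
  show ?thesis
  proof (cases ?J)
    case top
    then show ?thesis using B by (simp add: ennreal_mult_top)
  next
    case (real j)
    have pt: "r / c * f s \<le> c powr - r * f s powr r + (r - 1)" for s
    proof -
      have "r * (f s / c) \<le> (f s / c) powr r + (r - 1)" by (rule powr_tangent) (use f0 c r in auto)
      also have "(f s / c) powr r = c powr - r * f s powr r" using f0 c by (simp add: powr_divide powr_minus_divide)
      finally show ?thesis by simp
    qed
    have "ennreal (r * B) = ennreal (r / c) * ennreal a"
      using r c a(1) B False by (subst ennreal_mult[symmetric]) (auto simp: c_def)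
    also have "\<dots> \<le> ennreal (r / c) * absint M (%s. ennreal (f s))" by (intro mult_left_mono a(2)) simp
    also have "\<dots> = absint M (%s. ennreal (r / c) * ennreal (f s))" by (rule absint_cmult[OF M, symmetric]) measurable
    also have "\<dots> \<le> absint M (%s. ennreal (c powr - r) * ennreal (f s powr r) + ennreal (r - 1) * 1)"
    proof (rule absint_mono[OF M])
      fix s
      have "ennreal (r / c) * ennreal (f s) = ennreal (r / c * f s)" by (rule ennreal_mult[symmetric]) (use r c f0 in auto)
      also have "\<dots> \<le> ennreal (c powr - r * f s powr r + (r - 1))" by (rule ennreal_leI[OF pt])
      also have "\<dots> = ennreal (c powr - r) * ennreal (f s powr r) + ennreal (r - 1) * 1"
        using r by (simp add: ennreal_plus ennreal_mult)
      finally show "ennreal (r / c) * ennreal (f s) \<le> ennreal (c powr - r) * ennreal (f s powr r) + ennreal (r - 1) * 1" .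
    qed
    also have "\<dots> = absint M (%s. ennreal (c powr - r) * ennreal (f s powr r)) + absint M (%s. ennreal (r - 1) * 1)"
    proof -
      have "(%p. enorm (snd p) * (ennreal (c powr - r) * ennreal (f (fst p) powr r))) \<in> borel_measurable M"
        "(%p. enorm (snd p) * (ennreal (r - 1) * 1)) \<in> borel_measurable M"
        by (rule law_meas[OF M], measurable)+
      from nn_integral_add[OF this] show ?thesis unfolding absint_def by (simp add: distrib_left)
    qed
    also have "\<dots> = ennreal (c powr - r) * ?J + ennreal (r - 1) * absint M (%s. 1)"
    proof -
      have "absint M (%s. ennreal (c powr - r) * ennreal (f s powr r)) = ennreal (c powr - r) * ?J"
        by (rule absint_cmult[OF M]) measurable
      moreover have "absint M (%s. ennreal (r - 1) * 1) = ennreal (r - 1) * absint M (%s. 1)"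
        by (rule absint_cmult[OF M]) simp
      ultimately show ?thesis by simp
    qed
    also have "\<dots> \<le> ennreal (c powr - r) * ennreal j + ennreal (r - 1) * ennreal B"
      unfolding real by (intro add_mono mult_left_mono B(2)) auto
    also have "\<dots> = ennreal (c powr - r * j + (r - 1) * B)" using r real B by (simp add: ennreal_plus ennreal_mult)
    finally have "r * B \<le> c powr - r * j + (r - 1) * B"
      by (subst (asm) ennreal_le_iff) (use r real B in auto)
    then have "B \<le> c powr - r * j" by (simp add: algebra_simps)
    then have "c powr r * B \<le> c powr r * (c powr - r * j)" by (intro mult_left_mono) auto
    also have "\<dots> = j" using c by (simp add: powr_minus_divide)
    finally have cB: "c powr r * B \<le> j" .
    have "a powr r = (c * B) powr r" using B by (simp add: c_def)
    also have "\<dots> = c powr r * B powr r" using c B by (simp add: powr_mult)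
    also have "B powr r = B powr (r - 1) * B" using B powr_add[of B "r - 1" 1] by simp
    finally have "a powr r = B powr (r - 1) * (c powr r * B)" by simp
    also have "\<dots> \<le> B powr (r - 1) * j" by (intro mult_left_mono cB) simp
    finally show ?thesis unfolding real using real by (simp add: ennreal_mult[symmetric] ennreal_leI)
  qed
qed simp

context stable_delay
begin

text \<open>Raise the pointwise domination to the power \<open>r\<close> by Jensen's inequality, then integrate over the window.  One is
  added to \<open>gain\<close> only to have a positive number.\<close>

lemma window_estimate_Lp:
  fixes X :: "real => real ^ 'b"
  assumes X: "X \<in> borel_fun" and zero: "\<And>s. s < - \<tau>max ==> X s = 0"
    and rep: "AE t in lborel. 0 < t --> (\<forall>l. of_real (X t $ l) = (\<Sum>i\<in>UNIV. pairing (\<kappa> l i) (%s. forcing (past X) i (t - s))))"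
    and r: "1 \<le> r"
  shows "ennreal (exp (\<nu> * (t - \<tau>max)) powr r) * (\<integral>\<^sup>+x. ennreal (norm (X x) powr r) * indicator {t - \<tau>max..t} x \<partial>lborel)
     \<le> ennreal ((gain + 1) powr r) * (\<integral>\<^sup>+x. ennreal (norm (X x) powr r) * indicator {- \<tau>max..0} x \<partial>lborel)"
proof -
  let ?e = "exp (\<nu> * (t - \<tau>max))" and ?G = "gain + 1"
  note X[measurable]
  have pm[measurable]: "past X \<in> borel_fun" by (rule past_meas[OF X])
  have G: "0 < ?G" "absint totw (%s. 1) \<le> ennreal ?G" using gain by (auto intro: ennreal_leI)
  have ae: "AE x in lborel. ennreal (?e powr r) * (ennreal (norm (X x) powr r) * indicator {t - \<tau>max..t} x)
     \<le> ennreal (?G powr (r - 1)) * (absint totw (%s. ennreal (norm (past X (x - s)) powr r)) * indicator {..t} x)"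
    using rep
  proof eventually_elim
    case (elim x)
    show ?case
    proof (cases "x \<in> {t - \<tau>max..t}")
      case True
      have m: "(%s. norm (past X (x - s))) \<in> borel_fun" by measurable
      have "ennreal (?e * norm (X x)) \<le> absint totw (%s. enorm (past X (x - s)))"
        by (rule weighted_domination[OF X _ elim]) (use True in simp)
      from absint_Jensen[OF totw(1) m _ r G _ this]
      have "ennreal ((?e * norm (X x)) powr r) \<le> ennreal (?G powr (r - 1)) * absint totw (%s. ennreal (norm (past X (x - s)) powr r))" by simp
      then show ?thesis using True by (simp add: powr_mult ennreal_mult)
    qed simp
  qed
  have am: "(%x. absint totw (%s. ennreal (norm (past X (x - s)) powr r))) \<in> borel_fun"
    by (rule borel_measurable_absint_shift[OF totw(1)]) measurable
  note am[measurable]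
  have "ennreal (?e powr r) * (\<integral>\<^sup>+x. ennreal (norm (X x) powr r) * indicator {t - \<tau>max..t} x \<partial>lborel) =
     (\<integral>\<^sup>+x. ennreal (?e powr r) * (ennreal (norm (X x) powr r) * indicator {t - \<tau>max..t} x) \<partial>lborel)"
    by (rule nn_integral_cmult[symmetric]) measurable
  also have "\<dots> \<le> (\<integral>\<^sup>+x. ennreal (?G powr (r - 1)) * (absint totw (%s. ennreal (norm (past X (x - s)) powr r)) * indicator {..t} x) \<partial>lborel)"
    by (rule nn_integral_mono_AE[OF ae])
  also have "\<dots> = ennreal (?G powr (r - 1)) * (\<integral>\<^sup>+x. absint totw (%s. ennreal (norm (past X (x - s)) powr r)) * indicator {..t} x \<partial>lborel)"
    by (rule nn_integral_cmult) measurable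
  also have "\<dots> \<le> ennreal (?G powr (r - 1)) * (ennreal ?G * (\<integral>\<^sup>+x. ennreal (norm (X x) powr r) * indicator {- \<tau>max..0} x \<partial>lborel))"
  proof (rule mult_left_mono)
    have "(\<integral>\<^sup>+x. absint totw (%s. ennreal (norm (past X (x - s)) powr r)) * indicator {..t} x \<partial>lborel)
      \<le> absint totw (%s. 1) * (\<integral>\<^sup>+x. ennreal (norm (past X x) powr r) * indicator {..t} x \<partial>lborel)"
      by (rule nn_integral_convolution_le[OF totw(1)]) measurable
    also have "\<dots> \<le> ennreal ?G * (\<integral>\<^sup>+x. ennreal (norm (X x) powr r) * indicator {- \<tau>max..0} x \<partial>lborel)"
    proof (rule mult_mono[OF G(2) nn_integral_mono])
      fix x
      show "ennreal (norm (past X x) powr r) * indicator {..t} x \<le> ennreal (norm (X x) powr r) * indicator {- \<tau>max..0} x"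
        using zero[of x] by (cases "x < - \<tau>max") (auto simp: past_def indicator_def)
    qed auto
    finally show "(\<integral>\<^sup>+x. absint totw (%s. ennreal (norm (past X (x - s)) powr r)) * indicator {..t} x \<partial>lborel)
      \<le> ennreal ?G * (\<integral>\<^sup>+x. ennreal (norm (X x) powr r) * indicator {- \<tau>max..0} x \<partial>lborel)" .
  qed simp
  also have "\<dots> = ennreal (?G powr r) * (\<integral>\<^sup>+x. ennreal (norm (X x) powr r) * indicator {- \<tau>max..0} x \<partial>lborel)"
  proof -
    have "?G powr r = ?G powr (r - 1) * ?G" using G powr_add[of ?G "r - 1" 1] by simp
    then have "ennreal (?G powr r) = ennreal (?G powr (r - 1)) * ennreal ?G" using G by (simp add: ennreal_mult)
    then show ?thesis by (simp add: mult.assoc)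
  qed
  finally show ?thesis .
qed

lemma exp_split: "exp (\<nu> * (t - c)) * (exp (\<nu> * c) * exp (- \<nu> * t)) = 1"
  by (simp add: exp_add[symmetric] algebra_simps)

lemma decay_Lp:
  assumes r: "1 \<le> r"
  shows "decay_estimate (Lp (ereal r)) \<tau>max A \<tau> N \<nu> ((gain + 1) * exp (\<nu> * \<tau>max))"
  unfolding decay_estimate_def
proof (intro allI impI)
  fix X0 X :: "real => real ^ 'b" and t :: real
  assume X0: "in_V (Lp (ereal r)) {- \<tau>max..0} X0" and sol: "is_solution (Lp (ereal r)) \<tau>max A \<tau> N X0 X" and t: "0 \<le> t"
  let ?W = "lebesgue_on {- \<tau>max..0}"
  have p: "1 \<le> ereal r" using r by simp
  have tr: "in_Lp (ereal r) {- \<tau>max..0} (%s. X (t + s))" if "0 \<le> t" for t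
    using sol that by (simp add: is_solution_def partial_trajectory_def[abs_def])
  have eq: "AE t in lebesgue_on {-\<tau>max..}. equation_at \<tau>max A \<tau> N X0 X t" using sol by (simp add: is_solution_def)
  obtain X' where X': "X' \<in> borel_fun" "\<And>s. s < - \<tau>max ==> X' s = 0" and ae: "AE s in lborel. - \<tau>max \<le> s --> X s = X' s"
    and ae0: "AE s in lborel. s \<in> {- \<tau>max..0} --> X' s = X0 s"
    and rep: "AE t in lborel. 0 < t --> (\<forall>l. of_real (X' t $ l) = (\<Sum>i\<in>UNIV. pairing (\<kappa> l i) (%s. forcing (past X') i (t - s))))"
    by (rule solution_representation[OF in_Lp_window(1)[OF p tr] in_Lp_window(2)[OF p tr] eq]) (assumption | rule that)+
  note X'(1)[measurable]
  define It where "It = (\<integral>\<^sup>+x. ennreal (norm (X' x) powr r) * indicator {t - \<tau>max..t} x \<partial>lborel)"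
  define I0 where "I0 = (\<integral>\<^sup>+x. ennreal (norm (X' x) powr r) * indicator {- \<tau>max..0} x \<partial>lborel)"
  have pm: "(%x. norm (f x) powr r) \<in> borel_measurable ?W" if "in_Lp (ereal r) {- \<tau>max..0} f" for f :: "real => real ^ 'b"
    using that by (auto simp: in_Lp_def)
  have It: "(\<integral>\<^sup>+s. ennreal (norm (X (t + s)) powr r) \<partial>?W) = It"
  proof -
    have "(\<integral>\<^sup>+s. ennreal (norm (X (t + s)) powr r) \<partial>?W) = (\<integral>\<^sup>+s. ennreal (norm (X' (t + s)) powr r) * indicator {- \<tau>max..0} s \<partial>lborel)"
      by (rule nn_integral_window, simp, rule eventually_mono[OF AE_window_shift[OF ae t]]) simp
    also have "\<dots> = (\<integral>\<^sup>+s. ennreal (norm (X' (t + 1 * s)) powr r) * indicator {t - \<tau>max..t} (t + 1 * s) \<partial>lborel)"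
      by (intro nn_integral_cong) (simp add: indicator_def)
    also have "\<dots> = It" unfolding It_def
      using nn_integral_real_affine[of "%x. ennreal (norm (X' x) powr r) * indicator {t - \<tau>max..t} x" 1 t] by simp
    finally show ?thesis .
  qed
  have I0: "(\<integral>\<^sup>+s. ennreal (norm (X0 s) powr r) \<partial>?W) = I0"
    unfolding I0_def by (rule nn_integral_window, simp, rule eventually_mono[OF ae0]) simp
  have Lt: "norm_Lp (ereal r) {- \<tau>max..0} (%s. X (t + s)) = enn2real It powr (1 / r)"
    unfolding norm_Lp_def using integral_eq_nn_integral[OF pm[OF tr[OF t]]] It by simp
  have X0': "in_Lp (ereal r) {- \<tau>max..0} X0" using X0 by simp
  have L0: "norm_Lp (ereal r) {- \<tau>max..0} X0 = enn2real I0 powr (1 / r)"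
    unfolding norm_Lp_def using integral_eq_nn_integral[OF pm[OF X0']] I0 by simp
  have f0: "I0 < \<infinity>" using X0' I0 by (simp add: in_Lp_def integrable_iff_bounded)
  let ?e = "exp (\<nu> * (t - \<tau>max))" and ?G = "gain + 1"
  have G: "0 < ?G" using gain by simp
  have main: "ennreal (?e powr r) * It \<le> ennreal (?G powr r) * I0"
    unfolding It_def I0_def by (rule window_estimate_Lp[OF X' rep r])
  have "ennreal (?G powr r) * I0 < \<infinity>" using f0 by (simp add: ennreal_mult_less_top)
  with main have "ennreal (?e powr r) * It < \<infinity>" by (rule order.strict_trans1)
  then have ft: "It < \<infinity>" by (auto simp: ennreal_mult_less_top)
  obtain jt where jt: "It = ennreal jt" "0 \<le> jt" using ft by (cases It) auto
  obtain j0 where j0: "I0 = ennreal j0" "0 \<le> j0" using f0 by (cases I0) auto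
  have "?e powr r * jt \<le> ?G powr r * j0"
    using main jt j0 by (simp add: ennreal_mult[symmetric])
  then have "(?e powr r * jt) powr (1 / r) \<le> (?G powr r * j0) powr (1 / r)"
    using r jt by (intro powr_mono2) auto
  then have "?e * jt powr (1 / r) \<le> ?G * j0 powr (1 / r)"
    using r G jt j0 by (simp add: powr_mult powr_powr)
  then have "(exp (\<nu> * \<tau>max) * exp (- \<nu> * t)) * (?e * jt powr (1 / r)) \<le> (exp (\<nu> * \<tau>max) * exp (- \<nu> * t)) * (?G * j0 powr (1 / r))"
    by (intro mult_left_mono) auto
  then have "(?e * (exp (\<nu> * \<tau>max) * exp (- \<nu> * t))) * jt powr (1 / r) \<le> ?G * exp (\<nu> * \<tau>max) * exp (- \<nu> * t) * j0 powr (1 / r)"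
    by (simp only: ac_simps)
  then have "jt powr (1 / r) \<le> ?G * exp (\<nu> * \<tau>max) * exp (- \<nu> * t) * j0 powr (1 / r)"
    unfolding exp_split by simp
  then show "norm_V (Lp (ereal r)) {- \<tau>max..0} (partial_trajectory X t) \<le> ?G * exp (\<nu> * \<tau>max) * exp (- \<nu> * t) * norm_V (Lp (ereal r)) {- \<tau>max..0} X0"
    unfolding partial_trajectory_def[abs_def] norm_V.simps Lt L0 using jt j0 by simp
qed

lemma bound_from_weighted:
  assumes "exp (\<nu> * (t - c)) * x \<le> y"
  shows "x \<le> exp (\<nu> * c) * exp (- \<nu> * t) * y"
proof -
  have "(exp (\<nu> * (t - c)) * (exp (\<nu> * c) * exp (- \<nu> * t))) * x = x" unfolding exp_split by simp
  then have "x = (exp (\<nu> * c) * exp (- \<nu> * t)) * (exp (\<nu> * (t - c)) * x)" by (simp only: ac_simps)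
  also have "\<dots> \<le> (exp (\<nu> * c) * exp (- \<nu> * t)) * y" using assms by (intro mult_left_mono) auto
  finally show ?thesis .
qed

lemma decay_Linf: "decay_estimate (Lp \<infinity>) \<tau>max A \<tau> N \<nu> ((gain + 1) * exp (\<nu> * \<tau>max))"
  unfolding decay_estimate_def
proof (intro allI impI)
  fix X0 X :: "real => real ^ 'b" and t :: real
  assume X0: "in_V (Lp \<infinity>) {- \<tau>max..0} X0" and sol: "is_solution (Lp \<infinity>) \<tau>max A \<tau> N X0 X" and t: "0 \<le> t"
  let ?W = "lebesgue_on {- \<tau>max..0}"
  have p: "1 \<le> (\<infinity> :: ereal)" by simp
  have tr: "in_Lp \<infinity> {- \<tau>max..0} (%s. X (t + s))" if "0 \<le> t" for t
    using sol that by (simp add: is_solution_def partial_trajectory_def[abs_def])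
  have eq: "AE t in lebesgue_on {-\<tau>max..}. equation_at \<tau>max A \<tau> N X0 X t" using sol by (simp add: is_solution_def)
  obtain X' where X': "X' \<in> borel_fun" "\<And>s. s < - \<tau>max ==> X' s = 0" and ae: "AE s in lborel. - \<tau>max \<le> s --> X s = X' s"
    and ae0: "AE s in lborel. s \<in> {- \<tau>max..0} --> X' s = X0 s"
    and rep: "AE t in lborel. 0 < t --> (\<forall>l. of_real (X' t $ l) = (\<Sum>i\<in>UNIV. pairing (\<kappa> l i) (%s. forcing (past X') i (t - s))))"
    by (rule solution_representation[OF in_Lp_window(1)[OF p tr] in_Lp_window(2)[OF p tr] eq]) (assumption | rule that)+
  define E where "E = esssup ?W (%x. ereal (norm (X0 x)))"
  have Efin: "E < \<infinity>" using X0 by (simp add: in_Lp_def E_def)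
  have Eae: "AE x in lborel. x \<in> {- \<tau>max..0} --> ereal (norm (X0 x)) \<le> E"
    unfolding AE_window_iff[symmetric] E_def by (rule esssup_AE)
  define m where "m = real_of_ereal E"
  \<comment> \<open>One point of the window shows that the essential supremum is not negative.\<close>
  obtain x0 where "ereal (norm (X0 x0)) \<le> E" using interval_not_null[OF _ Eae] \<tau>max by auto
  then have "0 \<le> E" by (rule order_trans[rotated]) simp
  then have m: "E = ereal m" "0 \<le> m" using Efin by (cases E; simp add: m_def)+
  have mae: "AE x in lborel. norm (past X' x) \<le> m"
    using Eae ae0
  proof eventually_elim
    case (elim x)
    then show ?case using X'(2)[of x] m by (cases "x < - \<tau>max") (auto simp: past_def)
  qed
  let ?e = "exp (\<nu> * (t - \<tau>max))" and ?G = "gain + 1"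
  have conv: "AE x in lborel. AE p in totw. norm (past X' (x - fst p)) \<le> m" by (rule AE_convolution[OF totw(1) mae])
  have b: "AE x in lborel. t - \<tau>max \<le> x --> norm (X' x) \<le> exp (\<nu> * \<tau>max) * exp (- \<nu> * t) * (?G * m)"
    using conv rep
  proof eventually_elim
    case (elim x)
    show ?case
    proof
      assume x: "t - \<tau>max \<le> x"
      have "ennreal (?e * norm (X' x)) \<le> absint totw (%s. enorm (past X' (x - s)))"
        by (rule weighted_domination[OF X'(1) x elim(2)])
      also have "\<dots> \<le> ennreal m * absint totw (%s. 1)"
        by (rule absint_le_const[OF totw(1)], rule eventually_mono[OF elim(1)]) (rule ennreal_leI)
      also have "\<dots> = ennreal (m * gain)" using gain m by (simp add: ennreal_mult)
      also have "\<dots> \<le> ennreal (?G * m)" using m by (intro ennreal_leI) (simp add: algebra_simps)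
      finally have "?e * norm (X' x) \<le> ?G * m" by (subst (asm) ennreal_le_iff) (use m gain in auto)
      then show "norm (X' x) \<le> exp (\<nu> * \<tau>max) * exp (- \<nu> * t) * (?G * m)" by (rule bound_from_weighted)
    qed
  qed
  let ?c = "exp (\<nu> * \<tau>max) * exp (- \<nu> * t) * (?G * m)"
  have "AE s in lborel. t - \<tau>max \<le> s - (- t) --> norm (X' (s - (- t))) \<le> ?c" by (rule AE_shift[OF b])
  then have "AE s in lborel. s \<in> {- \<tau>max..0} --> norm (X (t + s)) \<le> ?c"
    using AE_window_shift[OF ae t]
  proof eventually_elim
    case (elim s)
    then show ?case by (simp add: add.commute)
  qed
  then have ae_t: "AE s in ?W. ereal (norm (X (t + s))) \<le> ereal ?c" unfolding AE_window_iff by simp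
  have meas: "(%s. ereal (norm (X (t + s)))) \<in> borel_measurable ?W" using in_Lp_window(1)[OF p tr[OF t]] by measurable
  have le: "esssup ?W (%s. ereal (norm (X (t + s)))) \<le> ereal ?c" by (rule esssup_I[OF meas ae_t])
  have c0: "0 \<le> ?c" using gain m by simp
  have "real_of_ereal (esssup ?W (%s. ereal (norm (X (t + s))))) \<le> ?c"
    using le c0 by (cases "esssup ?W (%s. ereal (norm (X (t + s))))") auto
  then show "norm_V (Lp \<infinity>) {- \<tau>max..0} (partial_trajectory X t) \<le> ?G * exp (\<nu> * \<tau>max) * exp (- \<nu> * t) * norm_V (Lp \<infinity>) {- \<tau>max..0} X0"
    unfolding partial_trajectory_def[abs_def] norm_V.simps norm_Lp_def using m(1)[unfolded E_def] by (simp add: ac_simps)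
qed

text \<open>Nothing may be altered on a null set here.  Since solutions are bounded on every window, all convolutions are finite at every time and the
  pointwise lemmas apply without exceptional sets.\<close>

lemma decay_B_inf: "decay_estimate B_inf \<tau>max A \<tau> N \<nu> ((gain + 1) * exp (\<nu> * \<tau>max))"
  unfolding decay_estimate_def
proof (intro allI impI)
  fix X0 X :: "real => real ^ 'b" and t :: real
  assume X0: "in_V B_inf {- \<tau>max..0} X0" and sol: "is_solution B_inf \<tau>max A \<tau> N X0 X" and t: "0 \<le> t"
  have tr: "(%s. X (t + s)) \<in> borel_measurable (restrict_space borel {- \<tau>max..0})" "bounded ((%s. X (t + s)) ` {- \<tau>max..0})" if "0 \<le> t" for t
    using sol that by (simp_all add: is_solution_def partial_trajectory_def[abs_def] in_B_inf_def)
  have eq: "equation_at \<tau>max A \<tau> N X0 X t" if "- \<tau>max \<le> t" for t using sol that by (simp add: is_solution_def)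
  define X' where "X' x = (if x < - \<tau>max then 0 else X x)" for x
  define g where "g n s = indicat_real {- \<tau>max..0} s *\<^sub>R X (real n * \<tau>max + s)" for n :: nat and s
  have Wl: "{- \<tau>max..0} \<inter> space borel \<in> sets (borel :: real measure)" by simp
  have g: "g n \<in> borel_fun" for n
    using tr(1)[of "real n * \<tau>max"] \<tau>max unfolding g_def[abs_def] borel_measurable_restrict_space_iff[OF Wl] by simp
  have X'g: "X' x = (if x < - \<tau>max then 0 else g (window_index \<tau>max x) (x - real (window_index \<tau>max x) * \<tau>max))" for x
    using window_index[OF \<tau>max, of x] by (simp add: X'_def g_def)
  have X'm: "X' \<in> borel_fun"
    unfolding X'g[abs_def] by (rule glue_windows_measurable) (rule g)
  have bd: "\<exists>K\<ge>0. \<forall>x\<le>R. norm (X' x) \<le> K" for R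
  proof -
    obtain n :: nat where n: "R / \<tau>max \<le> real n" using real_arch_simple by blast
    have "\<forall>k. \<exists>K. \<forall>s\<in>{- \<tau>max..0}. norm (X (real k * \<tau>max + s)) \<le> K"
    proof
      fix k :: nat
      show "\<exists>K. \<forall>s\<in>{- \<tau>max..0}. norm (X (real k * \<tau>max + s)) \<le> K"
        using tr(2)[of "real k * \<tau>max"] \<tau>max unfolding bounded_iff by auto
    qed
    from choice[OF this] obtain K where K: "\<And>k s. s \<in> {- \<tau>max..0} ==> norm (X (real k * \<tau>max + s)) \<le> K k" by blast
    have "norm (X' x) \<le> (\<Sum>k\<le>n. \<bar>K k\<bar>)" if x: "x \<le> R" for x
    proof (cases "x < - \<tau>max")
      case False
      define w where "w = window_index \<tau>max x"
      have w: "x - real w * \<tau>max \<in> {- \<tau>max..0}" unfolding w_def by (rule window_index[OF \<tau>max]) (use False in simp)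
      have "x / \<tau>max \<le> real n" using x n \<tau>max by (meson divide_right_mono less_imp_le order_trans)
      then have wn: "w \<le> n" unfolding w_def window_index_def by (simp add: ceiling_le_iff nat_le_iff)
      have "norm (X' x) \<le> K w" using K[OF w, of w] False by (simp add: X'_def)
      also have "\<dots> \<le> \<bar>K w\<bar>" by simp
      also have "\<dots> \<le> (\<Sum>k\<le>n. \<bar>K k\<bar>)" by (rule member_le_sum) (use wn in auto)
      finally show ?thesis .
    qed (simp add: X'_def sum_nonneg)
    then show ?thesis by (intro exI[of _ "\<Sum>k\<le>n. \<bar>K k\<bar>"]) (simp add: sum_nonneg)
  qed
  have afin: "absint M f < \<infinity>" if M: "law {0..} M" "absint M (%s. 1) < \<infinity>" and f: "\<And>s. 0 \<le> s ==> f s \<le> ennreal K" for M f K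
  proof -
    have "AE p in M. fst p \<in> {0..}" using M(1) by (simp add: law_def)
    then have "AE p in M. f (fst p) \<le> ennreal K" by (rule eventually_mono) (use f in simp)
    then have "absint M f \<le> ennreal K * absint M (%s. 1)" by (rule absint_le_const[OF M(1)])
    also have "\<dots> < \<infinity>" using M(2) by (simp add: ennreal_mult_less_top)
    finally show ?thesis .
  qed
  have fink: "absint M (%s. enorm (X' (x - s))) < \<infinity>" if M: "law {0..} M" "absint M (%s. 1) < \<infinity>" for M x
  proof -
    obtain K where K: "\<forall>y\<le>x. norm (X' y) \<le> K" using bd[of x] by blast
    show ?thesis by (rule afin[OF M, of _ K]) (use K in \<open>auto intro: ennreal_leI\<close>)
  qed
  have good: "good X' x" if x: "0 < x" for x
  proof (rule good_of_equation[OF X'm fink[OF kern0 kern_mass], where X = X])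
    show "X x = X' x" using x \<tau>max by (simp add: X'_def)
    show "X (x - \<tau> k) = X' (x - \<tau> k)" for k using x \<tau>[of k] by (simp add: X'_def)
    show "AE s in lebesgue. s \<in> {0<..<\<tau>max} --> X (x - s) = X' (x - s)" using x by (intro AE_I2) (simp add: X'_def)
    have "- \<tau>max \<le> x" using x \<tau>max by simp
    from eq[OF this] show "X x + (\<Sum>k. A k *v X (x - \<tau> k)) + (LINT s:{0<..<\<tau>max}|lebesgue. N s *v X (x - s)) = 0"
      using x unfolding equation_at_def by blast
  qed
  have rep: "0 < x --> (\<forall>l. of_real (X' x $ l) = (\<Sum>i\<in>UNIV. pairing (\<kappa> l i) (%s. forcing (past X') i (x - s))))" for x
  proof (intro impI allI)
    fix l assume x: "0 < x"
    show "of_real (X' x $ l) = (\<Sum>i\<in>UNIV. pairing (\<kappa> l i) (%s. forcing (past X') i (x - s)))"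
    proof (rule representation_at[OF X'm x])
      show "absint (\<kappa> l i) (%s. enorm (X' (x - s))) < \<infinity>" for i by (rule fink[OF \<kappa>(1) \<kappa>_mass])
      show "absint (\<kappa> l i) (%s. absint (kern i k) (%r. enorm (X' (x - s - r)))) < \<infinity>" for i k
      proof -
        obtain K where K: "0 \<le> K" "\<forall>y\<le>x. norm (X' y) \<le> K" using bd[of x] by blast
        obtain q where q: "absint (kern i k) (%s. 1) = ennreal q" "0 \<le> q" using kern_mass[of i k] by (cases "absint (kern i k) (%s. 1)") auto
        have "absint (kern i k) (%r. enorm (X' (x - s - r))) \<le> ennreal (K * q)" if "0 \<le> s" for s
        proof -
          have "AE p in kern i k. fst p \<in> {0..}" using kern0 by (simp add: law_def)
          then have "AE p in kern i k. enorm (X' (x - s - fst p)) \<le> ennreal K"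
            by (rule eventually_mono) (use K that in \<open>auto intro: ennreal_leI\<close>)
          from absint_le_const[OF kern0 this] show ?thesis using q K by (simp add: ennreal_mult)
        qed
        then show ?thesis by (rule afin[OF \<kappa>(1) \<kappa>_mass])
      qed
      show "AE p in \<kappa> l i. 0 < x - fst p --> good X' (x - fst p)" for i by (rule AE_I2) (use good in blast)
    qed
  qed
  define m where "m = sup_norm {- \<tau>max..0} X0"
  have b0: "bdd_above ((%x. norm (X0 x)) ` {- \<tau>max..0})"
    using X0 unfolding in_V.simps in_B_inf_def bounded_iff bdd_above_def by auto
  have mu: "norm (X0 x) \<le> m" if "x \<in> {- \<tau>max..0}" for x
    unfolding m_def sup_norm_def by (rule cSUP_upper[OF that b0])
  have "0 \<le> norm (X0 0)" by simp
  also have "\<dots> \<le> m" by (rule mu) (use \<tau>max in simp)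
  finally have m0: "0 \<le> m" .
  have pm: "norm (past X' x) \<le> m" for x
  proof (cases "x \<in> {- \<tau>max..0}")
    case True
    then have "X x = X0 x" using eq[of x] by (simp add: equation_at_def)
    then show ?thesis using True mu[OF True] by (simp add: past_def X'_def)
  qed (auto simp: past_def X'_def m0)
  let ?e = "exp (\<nu> * (t - \<tau>max))" and ?G = "gain + 1"
  have b: "norm (X x) \<le> exp (\<nu> * \<tau>max) * exp (- \<nu> * t) * (?G * m)" if x: "t - \<tau>max \<le> x" for x
  proof -
    have "ennreal (?e * norm (X' x)) \<le> absint totw (%s. enorm (past X' (x - s)))"
      by (rule weighted_domination[OF X'm x rep])
    also have "\<dots> \<le> ennreal m * absint totw (%s. 1)"
      by (rule absint_le_const[OF totw(1)], rule AE_I2, rule ennreal_leI, rule pm)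
    also have "\<dots> = ennreal (m * gain)" using gain m0 by (simp add: ennreal_mult)
    also have "\<dots> \<le> ennreal (?G * m)" using m0 by (intro ennreal_leI) (simp add: algebra_simps)
    finally have "?e * norm (X' x) \<le> ?G * m" by (subst (asm) ennreal_le_iff) (use m0 gain in auto)
    then have "norm (X' x) \<le> exp (\<nu> * \<tau>max) * exp (- \<nu> * t) * (?G * m)" by (rule bound_from_weighted)
    then show ?thesis using x t by (simp add: X'_def)
  qed
  have "(SUP s\<in>{- \<tau>max..0}. norm (X (t + s))) \<le> exp (\<nu> * \<tau>max) * exp (- \<nu> * t) * (?G * m)"
  proof (rule cSUP_least)
    show "{- \<tau>max..0} \<noteq> {}" using \<tau>max by auto
  qed (rule b, simp)
  then show "norm_V B_inf {- \<tau>max..0} (partial_trajectory X t) \<le> ?G * exp (\<nu> * \<tau>max) * exp (- \<nu> * t) * norm_V B_inf {- \<tau>max..0} X0"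
    unfolding norm_V.simps m_def sup_norm_def partial_trajectory_def by (simp add: ac_simps)
qed

end

section \<open>Decay in the space of functions of bounded variation\<close>

text \<open>Variation bounded by \<open>K\<close> over the increasing sequences in \<open>Q\<close>, for functions into any normed space: it is applied to complex components as well as to vectors.\<close>

definition variation_le :: "real set => (real => 'a::real_normed_vector) => real => bool" where
  "variation_le Q f K \<longleftrightarrow> (\<forall>m t. (\<forall>i\<le>m. t i \<in> Q) --> (\<forall>i<m. t i \<le> t (Suc i)) -->
     (\<Sum>i<m. norm (f (t (Suc i)) - f (t i))) \<le> K)"

lemma variation_leD:
  "variation_le Q f K ==> (\<And>i. i \<le> m ==> t i \<in> Q) ==> (\<And>i. i < m ==> t i \<le> t (Suc i)) ==>
     (\<Sum>i<m. norm (f (t (Suc i)) - f (t i))) \<le> K"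
  unfolding variation_le_def by blast

lemma variation_le_two_points:
  assumes "variation_le Q f K" "x \<in> Q" "y \<in> Q" "x \<le> y"
  shows "norm (f y - f x) \<le> K"
  using variation_leD[OF assms(1), of 1 "%i. if i = 0 then x else y"] assms(2-) by simp

lemma variation_le_nonneg: "variation_le Q f K ==> x \<in> Q ==> 0 \<le> K"
  using variation_leD[of Q f K 0 "%_. x"] by simp

lemma variation_le_bounded:
  assumes "variation_le UNIV f K" "f a = 0"
  shows "norm (f x) \<le> K"
proof (cases "a \<le> x")
  case True
  from variation_le_two_points[OF assms(1) _ _ True] show ?thesis using assms(2) by simp
next
  case False
  then have "x \<le> a" by simp
  from variation_le_two_points[OF assms(1) _ _ this] show ?thesis using assms(2) by simp
qed

text \<open>A monotone function with values in $[0,1]$ has variation at most $1$.\<close>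

lemma sum_steps_monotone_cutoff:
  fixes c :: "real => real"
  assumes c: "mono c \<or> antimono c" "\<And>x. 0 \<le> c x" "\<And>x. c x \<le> 1" and t: "\<And>i. i < m ==> t i \<le> t (Suc i)"
  shows "(\<Sum>i<m. \<bar>c (t (Suc i)) - c (t i)\<bar>) \<le> 1"
  using c(1)
proof
  assume m: "mono c"
  have "(\<Sum>i<m. \<bar>c (t (Suc i)) - c (t i)\<bar>) = (\<Sum>i<m. c (t (Suc i)) - c (t i))"
    by (intro sum.cong refl abs_of_nonneg) (use monoD[OF m t] in auto)
  also have "\<dots> = c (t m) - c (t 0)" by (rule sum_lessThan_telescope)
  finally show ?thesis using c(2)[of "t 0"] c(3)[of "t m"] by simp
next
  assume m: "antimono c"
  have "(\<Sum>i<m. \<bar>c (t (Suc i)) - c (t i)\<bar>) = (\<Sum>i<m. - (c (t (Suc i)) - c (t i)))"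
    by (intro sum.cong refl abs_of_nonpos) (use antimonoD[OF m t] in auto)
  also have "\<dots> = - (\<Sum>i<m. c (t (Suc i)) - c (t i))" by (rule sum_negf)
  also have "(\<Sum>i<m. c (t (Suc i)) - c (t i)) = c (t m) - c (t 0)" by (rule sum_lessThan_telescope)
  finally show ?thesis using c(2)[of "t m"] c(3)[of "t 0"] by simp
qed

lemma variation_le_cutoff:
  fixes f :: "real => 'a::real_normed_vector" and c :: "real => real"
  assumes f: "variation_le UNIV f K" and S: "\<And>x. norm (f x) \<le> S"
    and c: "mono c \<or> antimono c" "\<And>x. 0 \<le> c x" "\<And>x. c x \<le> 1"
  shows "variation_le UNIV (%x. c x *\<^sub>R f x) (K + S)"
  unfolding variation_le_def
proof (intro allI impI)
  fix m and t :: "nat => real"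
  assume t: "\<forall>i<m. t i \<le> t (Suc i)"
  have S0: "0 \<le> S" using S[of 0] norm_ge_zero order_trans by blast
  have step: "norm (c y *\<^sub>R f y - c x *\<^sub>R f x) \<le> norm (f y - f x) + S * \<bar>c y - c x\<bar>" for x y
  proof -
    have "c y *\<^sub>R f y - c x *\<^sub>R f x = c y *\<^sub>R (f y - f x) + (c y - c x) *\<^sub>R f x" by (simp add: algebra_simps)
    also have "norm \<dots> \<le> norm (c y *\<^sub>R (f y - f x)) + norm ((c y - c x) *\<^sub>R f x)" by (rule norm_triangle_ineq)
    also have "\<dots> = c y * norm (f y - f x) + \<bar>c y - c x\<bar> * norm (f x)" using c(2)[of y] by simp
    also have "\<dots> \<le> 1 * norm (f y - f x) + \<bar>c y - c x\<bar> * S" by (intro add_mono mult_right_mono mult_left_mono c(3) S) auto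
    finally show ?thesis by (simp add: mult.commute)
  qed
  have "(\<Sum>i<m. norm (c (t (Suc i)) *\<^sub>R f (t (Suc i)) - c (t i) *\<^sub>R f (t i))) \<le>
     (\<Sum>i<m. norm (f (t (Suc i)) - f (t i)) + S * \<bar>c (t (Suc i)) - c (t i)\<bar>)" by (intro sum_mono step)
  also have "\<dots> = (\<Sum>i<m. norm (f (t (Suc i)) - f (t i))) + S * (\<Sum>i<m. \<bar>c (t (Suc i)) - c (t i)\<bar>)"
    by (simp add: sum.distrib sum_distrib_left)
  also have "\<dots> \<le> K + S * 1"
    by (intro add_mono mult_left_mono variation_leD[OF f] sum_steps_monotone_cutoff[OF c] S0) (use t in auto)
  finally show "(\<Sum>i<m. norm (c (t (Suc i)) *\<^sub>R f (t (Suc i)) - c (t i) *\<^sub>R f (t i))) \<le> K + S" by simp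
qed

lemma variation_sums_0: "C \<noteq> {} ==> 0 \<in> variation_sums C f"
  unfolding variation_sums_def by (auto intro!: exI[of _ 0])

lemma total_variation_nonneg:
  "C \<noteq> {} ==> bounded_variation_on C f ==> 0 \<le> total_variation C f"
  unfolding total_variation_def bounded_variation_on_def by (rule cSup_upper[OF variation_sums_0])

lemma variation_le_total_variation:
  fixes f :: "real => real ^ 'n::finite"
  assumes "bounded_variation_on C f"
  shows "variation_le C f (total_variation C f)"
  unfolding variation_le_def
proof (intro allI impI)
  fix m and t :: "nat => real"
  assume t: "\<forall>i\<le>m. t i \<in> C" "\<forall>i<m. t i \<le> t (Suc i)"
  then have "(\<Sum>i<m. norm (f (t (Suc i)) - f (t i))) \<in> variation_sums C f" unfolding variation_sums_def by blast
  then show "(\<Sum>i<m. norm (f (t (Suc i)) - f (t i))) \<le> total_variation C f"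
    using assms unfolding total_variation_def bounded_variation_on_def by (rule cSup_upper)
qed

lemma total_variation_le:
  fixes f :: "real => real ^ 'n::finite"
  assumes "variation_le C f K" "C \<noteq> {}"
  shows "bounded_variation_on C f" "total_variation C f \<le> K"
proof -
  have ub: "x \<le> K" if "x \<in> variation_sums C f" for x
    using that assms(1) unfolding variation_sums_def variation_le_def by blast
  then show "bounded_variation_on C f" unfolding bounded_variation_on_def bdd_above_def by blast
  have "variation_sums C f \<noteq> {}" using variation_sums_0[OF assms(2), of f] by blast
  then show "total_variation C f \<le> K" unfolding total_variation_def by (rule cSup_least) (rule ub)
qed

lemma bounded_variation_bdd:
  fixes f :: "real => real ^ 'n::finite" and T :: real
  assumes "bounded_variation_on {- T..0} f" "0 < T"
  shows "bdd_above ((%x. norm (f x)) ` {- T..0})"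
proof (rule bdd_aboveI2)
  fix x assume x: "x \<in> {- T..0}"
  have "norm (f 0 - f x) \<le> total_variation {- T..0} f"
    by (rule variation_le_two_points[OF variation_le_total_variation[OF assms(1)]]) (use x assms(2) in auto)
  moreover have "norm (f x) \<le> norm (f 0) + norm (f 0 - f x)" by (metis norm_minus_commute norm_triangle_sub)
  ultimately show "norm (f x) \<le> norm (f 0) + total_variation {- T..0} f" by simp
qed

lemma norm_le_sup_norm:
  fixes f :: "real => real ^ 'n::finite"
  assumes "bdd_above ((%x. norm (f x)) ` C)" "x \<in> C"
  shows "norm (f x) \<le> sup_norm C f"
  unfolding sup_norm_def by (rule cSUP_upper[OF assms(2,1)])

text \<open>Extend \<open>g\<close> constantly beyond the endpoints and cut off on both sides; each cutoff adds one sup norm.\<close>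

lemma variation_le_extension:
  fixes g :: "real => real ^ 'n::finite" and T :: real
  assumes g: "bounded_variation_on {- T..0} g" and T: "0 < T"
  shows "variation_le UNIV (%x. if x \<in> {- T..0} then g x else 0) (2 * (total_variation {- T..0} g + sup_norm {- T..0} g))"
proof -
  let ?V = "total_variation {- T..0} g" and ?S = "sup_norm {- T..0} g"
  define clamp where "clamp x = max (- T) (min x 0)" for x
  have cl: "clamp x \<in> {- T..0}" for x using T by (auto simp: clamp_def)
  have clm: "clamp x \<le> clamp y" if "x \<le> y" for x y using that by (auto simp: clamp_def)
  have S: "norm (g x) \<le> ?S" if "x \<in> {- T..0}" for x by (rule norm_le_sup_norm[OF bounded_variation_bdd[OF g T] that])
  have S0: "0 \<le> ?S" using S[OF cl[of 0]] norm_ge_zero order_trans by blast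
  have V0: "0 \<le> ?V" by (rule total_variation_nonneg[OF _ g]) (use T in auto)
  have v: "variation_le UNIV (%x. g (clamp x)) ?V"
    unfolding variation_le_def
  proof (intro allI impI)
    fix m and t :: "nat => real" assume t: "\<forall>i<m. t i \<le> t (Suc i)"
    show "(\<Sum>i<m. norm (g (clamp (t (Suc i))) - g (clamp (t i)))) \<le> ?V"
      by (rule variation_leD[OF variation_le_total_variation[OF g], of m "%i. clamp (t i)"]) (use t cl clm in auto)
  qed
  have v1: "variation_le UNIV (%x. indicat_real {- T..} x *\<^sub>R g (clamp x)) (?V + ?S)"
    by (rule variation_le_cutoff[OF v S[OF cl]]) (auto simp: mono_def indicator_def)
  have v2: "variation_le UNIV (%x. indicat_real {..0} x *\<^sub>R (indicat_real {- T..} x *\<^sub>R g (clamp x))) (?V + ?S + ?S)"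
  proof (rule variation_le_cutoff[OF v1])
    show "norm (indicat_real {- T..} x *\<^sub>R g (clamp x)) \<le> ?S" for x using S[OF cl[of x]] S0 by (simp add: indicator_def)
  qed (auto simp: antimono_def indicator_def)
  have eq: "indicat_real {..0} x *\<^sub>R (indicat_real {- T..} x *\<^sub>R g (clamp x)) = (if x \<in> {- T..0} then g x else 0)" for x
    by (auto simp: indicator_def clamp_def max_def min_def)
  have "variation_le UNIV (%x. if x \<in> {- T..0} then g x else 0) (?V + ?S + ?S)" using v2 unfolding eq .
  then show ?thesis using V0 unfolding variation_le_def by (smt (verit))
qed

text \<open>Jordan decomposition: with \<open>P\<close> the variation up to a point, \<open>P\<close> and the difference of \<open>P\<close> and a component are increasing.  A sum that ends at
  or before \<open>x\<close> can be prolonged by the points \<open>x\<close> and \<open>y\<close>, which shows that \<open>P\<close> increases at least as fast as the function varies.\<close>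

lemma variation_le_borel_component:
  fixes f :: "real => real ^ 'n::finite"
  assumes f: "variation_le UNIV f K"
  shows "(%x. f x $ k) \<in> borel_fun"
proof -
  define D where "D x = {\<Sum>i<m. norm (f (t (Suc i)) - f (t i)) | m t. (\<forall>i<m. t i \<le> t (Suc i)) \<and> t m \<le> x}" for x :: real
  define P where "P x = Sup (D x)" for x
  have ne: "D x \<noteq> {}" for x unfolding D_def by (auto intro!: exI[of _ 0] exI[of _ "%_. x"])
  have bdd: "bdd_above (D x)" for x unfolding bdd_above_def D_def using f unfolding variation_le_def by blast
  have key: "P x + norm (f y - f x) \<le> P y" if xy: "x \<le> y" for x y
  proof -
    have "d \<le> P y - norm (f y - f x)" if d: "d \<in> D x" for d
    proof -
      from d obtain m t where mt: "d = (\<Sum>i<m. norm (f (t (Suc i)) - f (t i)))" "\<forall>i<m. t i \<le> t (Suc i)" "t m \<le> x"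
        unfolding D_def by blast
      define t' where "t' i = (if i \<le> m then t i else if i = Suc m then x else y)" for i
      have "(\<Sum>i<Suc (Suc m). norm (f (t' (Suc i)) - f (t' i))) = d + norm (f x - f (t m)) + norm (f y - f x)"
        unfolding mt(1) by (simp add: t'_def)
      moreover have "(\<Sum>i<Suc (Suc m). norm (f (t' (Suc i)) - f (t' i))) \<le> P y"
        unfolding P_def
      proof (rule cSup_upper[OF _ bdd])
        have "\<forall>i<Suc (Suc m). t' i \<le> t' (Suc i)"
        proof (intro allI impI)
          fix i assume "i < Suc (Suc m)"
          then consider "i < m" | "i = m" | "i = Suc m" by linarith
          then show "t' i \<le> t' (Suc i)" by cases (use mt(2,3) xy in \<open>auto simp: t'_def\<close>)
        qed
        moreover have "t' (Suc (Suc m)) \<le> y" by (simp add: t'_def)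
        ultimately show "(\<Sum>i<Suc (Suc m). norm (f (t' (Suc i)) - f (t' i))) \<in> D y" unfolding D_def by blast
      qed
      ultimately show ?thesis using norm_ge_zero[of "f x - f (t m)"] by linarith
    qed
    then have "Sup (D x) \<le> P y - norm (f y - f x)" by (rule cSup_least[OF ne])
    then show ?thesis unfolding P_def by simp
  qed
  have ck: "\<bar>f y $ k - f x $ k\<bar> \<le> norm (f y - f x)" for x y using component_le_norm_cart[of "f y - f x" k] by simp
  have "mono P" by (rule monoI) (use key norm_ge_zero in \<open>smt (verit)\<close>)
  moreover have "mono (%x. P x - f x $ k)"
  proof (rule monoI)
    fix x y :: real assume "x \<le> y"
    from key[OF this] ck[of y x] show "P x - f x $ k \<le> P y - f y $ k" by linarith
  qed
  ultimately have "(%x. P x - (P x - f x $ k)) \<in> borel_fun"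
    by (intro borel_measurable_diff borel_measurable_mono)
  then show ?thesis by simp
qed

text \<open>Convolution with a measure multiplies variations by at most the mass.  The weights \<open>w\<close> and \<open>h\<close> allow for the exponential factor: it suffices to
  bound the weighted variation of each translate.\<close>

lemma variation_le_pairing:
  fixes f :: "real => complex"
  assumes M: "law S M" and f: "f \<in> borel_fun"
    and fin: "\<And>x. x \<in> Q ==> absint M (%s. enorm (f (x - s))) < \<infinity>"
    and w: "0 \<le> w" and h: "h \<in> borel_fun" and B: "absint M h = ennreal B" "0 \<le> B" and K: "0 \<le> K"
    and dom: "\<And>m t s. s \<in> S ==> (\<And>i. i \<le> m ==> t i \<in> Q) ==> (\<And>i. i < m ==> t i \<le> t (Suc i)) ==>
       ennreal (w * (\<Sum>i<m. norm (f (t (Suc i) - s) - f (t i - s)))) \<le> ennreal K * h s"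
  shows "variation_le Q (%x. w *\<^sub>R pairing M (%s. f (x - s))) (K * B)"
  unfolding variation_le_def
proof (intro allI impI)
  fix m and t :: "nat => real"
  assume t: "\<forall>i\<le>m. t i \<in> Q" "\<forall>i<m. t i \<le> t (Suc i)"
  let ?F = "%x. pairing M (%s. f (x - s))"
  note f[measurable]
  have fm: "(%s. f (x - s)) \<in> borel_fun" for x by measurable
  have dm: "(%s. f (x - s) - f (y - s)) \<in> borel_fun" for x y by measurable
  have diff: "enorm (?F x - ?F y) \<le> absint M (%s. enorm (f (x - s) - f (y - s)))" if "x \<in> Q" "y \<in> Q" for x y
  proof -
    have "?F x - ?F y = pairing M (%s. f (x - s) - f (y - s))"
      unfolding pairing_def
      using Bochner_Integration.integral_diff[OF pairing_integrable[OF M fm fin[OF that(1)]] pairing_integrable[OF M fm fin[OF that(2)]]]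
      by (simp add: right_diff_distrib)
    then show ?thesis using norm_pairing_le[OF M dm] by simp
  qed
  have "ennreal (\<Sum>i<m. norm (w *\<^sub>R ?F (t (Suc i)) - w *\<^sub>R ?F (t i))) = ennreal w * (\<Sum>i<m. enorm (?F (t (Suc i)) - ?F (t i)))"
    using w by (simp add: scaleR_diff_right[symmetric] sum_distrib_left[symmetric] ennreal_mult sum_nonneg sum_ennreal)
  also have "\<dots> \<le> ennreal w * (\<Sum>i<m. absint M (%s. enorm (f (t (Suc i) - s) - f (t i - s))))"
    by (intro mult_left_mono sum_mono diff) (use t in auto)
  also have "\<dots> = absint M (%s. ennreal w * (\<Sum>i<m. enorm (f (t (Suc i) - s) - f (t i - s))))"
  proof -
    have "(\<Sum>i<m. absint M (%s. enorm (f (t (Suc i) - s) - f (t i - s)))) = absint M (%s. \<Sum>i<m. enorm (f (t (Suc i) - s) - f (t i - s)))"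
    proof -
      have m: "(%p. enorm (snd p) * enorm (f (x - fst p) - f (y - fst p))) \<in> borel_measurable M" for x y
        by (rule law_meas[OF M]) measurable
      show ?thesis unfolding absint_def sum_distrib_left by (rule nn_integral_sum[symmetric]) (rule m)
    qed
    moreover have "absint M (%s. ennreal w * (\<Sum>i<m. enorm (f (t (Suc i) - s) - f (t i - s)))) =
        ennreal w * absint M (%s. \<Sum>i<m. enorm (f (t (Suc i) - s) - f (t i - s)))"
      by (rule absint_cmult[OF M]) measurable
    ultimately show ?thesis by simp
  qed
  also have "\<dots> \<le> absint M (%s. ennreal K * h s)"
  proof (rule absint_mono[OF M])
    fix s assume s: "s \<in> S"
    have "ennreal w * (\<Sum>i<m. enorm (f (t (Suc i) - s) - f (t i - s))) = ennreal (w * (\<Sum>i<m. norm (f (t (Suc i) - s) - f (t i - s))))"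
      using w by (simp add: ennreal_mult sum_nonneg sum_ennreal)
    also have "\<dots> \<le> ennreal K * h s" by (rule dom[OF s]) (use t in auto)
    finally show "ennreal w * (\<Sum>i<m. enorm (f (t (Suc i) - s) - f (t i - s))) \<le> ennreal K * h s" .
  qed
  also have "\<dots> = ennreal (K * B)" unfolding absint_cmult[OF M h] B(1) using K B(2) by (simp add: ennreal_mult)
  finally show "(\<Sum>i<m. norm (w *\<^sub>R ?F (t (Suc i)) - w *\<^sub>R ?F (t i))) \<le> K * B"
    by (subst (asm) ennreal_le_iff) (use K B in auto)
qed

lemma variation_le_sum:
  assumes "\<And>i. i \<in> I ==> variation_le Q (f i) (K i)"
  shows "variation_le Q (%x. \<Sum>i\<in>I. f i x) (\<Sum>i\<in>I. K i)"
  unfolding variation_le_def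
proof (intro allI impI)
  fix m and t :: "nat => real"
  assume t: "\<forall>i\<le>m. t i \<in> Q" "\<forall>i<m. t i \<le> t (Suc i)"
  have "(\<Sum>j<m. norm ((\<Sum>i\<in>I. f i (t (Suc j))) - (\<Sum>i\<in>I. f i (t j)))) \<le> (\<Sum>j<m. \<Sum>i\<in>I. norm (f i (t (Suc j)) - f i (t j)))"
    by (intro sum_mono) (simp only: sum_subtractf[symmetric] norm_sum)
  also have "\<dots> = (\<Sum>i\<in>I. \<Sum>j<m. norm (f i (t (Suc j)) - f i (t j)))" by (rule sum.swap)
  also have "\<dots> \<le> (\<Sum>i\<in>I. K i)" by (intro sum_mono variation_leD[OF assms]) (use t in auto)
  finally show "(\<Sum>j<m. norm ((\<Sum>i\<in>I. f i (t (Suc j))) - (\<Sum>i\<in>I. f i (t j)))) \<le> (\<Sum>i\<in>I. K i)" .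
qed

lemma variation_le_lipschitz_map:
  assumes "variation_le Q f K" "\<And>x y. norm (g x - g y) \<le> norm (f x - f y)"
  shows "variation_le Q g K"
  unfolding variation_le_def
proof (intro allI impI)
  fix m and t :: "nat => real"
  assume t: "\<forall>i\<le>m. t i \<in> Q" "\<forall>i<m. t i \<le> t (Suc i)"
  have "(\<Sum>j<m. norm (g (t (Suc j)) - g (t j))) \<le> (\<Sum>j<m. norm (f (t (Suc j)) - f (t j)))" by (intro sum_mono assms(2))
  also have "\<dots> \<le> K" by (rule variation_leD[OF assms(1)]) (use t in auto)
  finally show "(\<Sum>j<m. norm (g (t (Suc j)) - g (t j))) \<le> K" .
qed

lemma variation_le_add:
  assumes "variation_le Q f K" "variation_le Q g L"
  shows "variation_le Q (%x. f x + g x) (K + L)"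
proof -
  have "variation_le Q (%x. \<Sum>i\<in>(UNIV :: bool set). (if i then f else g) x) (\<Sum>i\<in>(UNIV :: bool set). if i then K else L)"
    by (rule variation_le_sum) (use assms in auto)
  then show ?thesis by (simp add: UNIV_bool add.commute)
qed

lemma in_BV_window:
  fixes f :: "real => real ^ 'n::finite" and T :: real
  assumes T: "0 < T" and f: "in_BV {- T..0} f"
  shows "f \<in> borel_measurable (lebesgue_on {- T..0})" "(\<integral>\<^sup>+s. enorm (f s) \<partial>lebesgue_on {- T..0}) < \<infinity>"
proof -
  obtain g where g: "bounded_variation_on {- T..0} g" "AE x in lebesgue_on {- T..0}. g x = f x"
    using f unfolding in_BV_def bv_representatives_def by blast
  let ?g = "%x. if x \<in> {- T..0} then g x else 0"
  let ?K = "2 * (total_variation {- T..0} g + sup_norm {- T..0} g)"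
  have v: "variation_le UNIV ?g ?K" by (rule variation_le_extension[OF g(1) T])
  have gm: "?g \<in> borel_fun" by (rule borel_measurable_vecI) (rule variation_le_borel_component[OF v])
  have ae: "AE x in lborel. x \<in> {- T..0} --> f x = ?g x"
    using g(2) unfolding AE_window_iff by (rule eventually_mono) simp
  show "f \<in> borel_measurable (lebesgue_on {- T..0})" by (rule measurable_window[OF gm _ ae]) simp
  have b: "norm (?g x) \<le> ?K" for x by (rule variation_le_bounded[OF v, of 1]) simp
  have "(\<integral>\<^sup>+s. enorm (f s) \<partial>lebesgue_on {- T..0}) = (\<integral>\<^sup>+s. enorm (?g s) * indicator {- T..0} s \<partial>lborel)"
    by (rule nn_integral_window, simp, rule eventually_mono[OF ae]) simp
  also have "\<dots> \<le> (\<integral>\<^sup>+s. ennreal ?K * indicator {- T..0} s \<partial>lborel)"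
    by (intro nn_integral_mono mult_right_mono ennreal_leI b) simp
  also have "\<dots> < \<infinity>" using T by (simp add: nn_integral_cmult_indicator ennreal_mult_less_top)
  finally show "(\<integral>\<^sup>+s. enorm (f s) \<partial>lebesgue_on {- T..0}) < \<infinity>" .
qed

context stable_delay
begin

definition mass :: "'b => 'b => real" where "mass i k = enn2real (absint (kern i k) (%s. 1))"
definition wmass :: "'b => 'b => real" where "wmass l i = enn2real (absint (\<kappa> l i) (%s. ennreal (exp (\<nu> * s))))"

lemma mass: "0 \<le> mass i k" "absint (kern i k) (%s. 1) = ennreal (mass i k)"
  using kern_mass[of i k] by (simp_all add: mass_def)
lemma wmass: "0 \<le> wmass l i" "absint (\<kappa> l i) (%s. ennreal (exp (\<nu> * s))) = ennreal (wmass l i)"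
  using \<kappa>(2)[of l i] by (simp_all add: wmass_def)

text \<open>The part of the solution at positive times, obtained from a history \<open>f\<close> by the resolvent formula.\<close>

definition corr :: "(real => real ^ 'b) => real => real ^ 'b" where
  "corr f x = (\<chi> l. Re (\<Sum>i\<in>UNIV. pairing (\<kappa> l i) (%s. forcing f i (x - s))))"

definition bv_gain :: real where
  "bv_gain = 1 + (\<Sum>l\<in>UNIV. \<Sum>i\<in>UNIV. 2 * (\<Sum>k\<in>UNIV. mass i k) * wmass l i)"

lemma bv_gain: "1 \<le> bv_gain"
  unfolding bv_gain_def using mass(1) wmass(1) by (simp add: sum_nonneg)

lemma pairing_outside_zero:
  assumes "law S M" "\<And>s. s \<in> S ==> f s = 0"
  shows "pairing M f = 0"
  unfolding pairing_def
proof (rule integral_eq_zero_AE)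
  have "AE p in M. fst p \<in> S" using assms(1) by (simp add: law_def)
  then show "AE p in M. snd p * f (fst p) = 0" by (rule eventually_mono) (simp add: assms(2))
qed

text \<open>A history supported in $[-\tau_*,0]$ is felt by the delays during $(0,\tau_*]$ only.\<close>

lemma forcing_support:
  fixes f :: "real => real ^ 'b"
  assumes f: "\<And>x. x \<notin> {- \<tau>max..0} ==> f x = 0" and x: "x \<notin> {0<..\<tau>max}"
  shows "forcing f i x = 0"
proof (cases "0 < x")
  case True
  then have "\<tau>max < x" using x by simp
  then have "pairing (kern i k) (%s. of_real (f (x - s) $ k)) = 0" for k
    by (intro pairing_outside_zero[OF kern(1)]) (simp add: f)
  then show ?thesis by (simp add: forcing_def)
qed (simp add: forcing_def)

lemma forcing_variation:
  fixes f :: "real => real ^ 'b"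
  assumes f: "\<And>x. x \<notin> {- \<tau>max..0} ==> f x = 0" and v: "variation_le UNIV f K" and m: "f \<in> borel_fun"
  shows "variation_le UNIV (forcing f i) (2 * (\<Sum>k\<in>UNIV. mass i k) * K)"
proof -
  define L where "L x = (\<Sum>k\<in>UNIV. 1 *\<^sub>R pairing (kern i k) (%s. complex_of_real (f (x - s) $ k)))" for x
  have K: "0 \<le> K" by (rule variation_le_nonneg[OF v]) simp
  have b: "norm (f x) \<le> K" for x by (rule variation_le_bounded[OF v, of 1]) (simp add: f)
  have vk: "variation_le UNIV (%x. complex_of_real (f x $ k)) K" for k
    by (rule variation_le_lipschitz_map[OF v])
      (metis component_le_norm_cart norm_of_real of_real_diff vector_minus_component)
  have "variation_le UNIV (%x. 1 *\<^sub>R pairing (kern i k) (%s. complex_of_real (f (x - s) $ k))) (K * mass i k)" for k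
  proof (rule variation_le_pairing[OF kern0 component_meas[OF m], where h = "%s. 1"])
    fix x
    have "absint (kern i k) (%s. enorm (complex_of_real (f (x - s) $ k))) \<le> ennreal K * absint (kern i k) (%s. 1)"
    proof (rule absint_le_const[OF kern0 AE_I2], rule ennreal_leI)
      show "norm (complex_of_real (f (x - fst p) $ k)) \<le> K" for p :: "real \<times> complex"
        using component_le_norm_cart[of "f (x - fst p)" k] b[of "x - fst p"] by simp
    qed
    also have "\<dots> < \<infinity>" using kern_mass[of i k] by (simp add: ennreal_mult_less_top)
    finally show "absint (kern i k) (%s. enorm (complex_of_real (f (x - s) $ k))) < \<infinity>" .
  next
    fix mm and t :: "nat => real" and s :: real
    assume t: "\<And>i. i < mm ==> t i \<le> t (Suc i)"
    have "(\<Sum>i<mm. norm (complex_of_real (f (t (Suc i) - s) $ k) - complex_of_real (f (t i - s) $ k))) \<le> K"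
      by (rule variation_leD[OF vk, of mm "%i. t i - s"]) (use t in auto)
    then show "ennreal (1 * (\<Sum>i<mm. norm (complex_of_real (f (t (Suc i) - s) $ k) - complex_of_real (f (t i - s) $ k)))) \<le> ennreal K * 1"
      by (simp add: ennreal_leI)
  qed (use K mass in auto)
  then have vL: "variation_le UNIV L (\<Sum>k\<in>UNIV. K * mass i k)" unfolding L_def[abs_def] by (rule variation_le_sum)
  have "L (- \<tau>max - 1) = 0"
    unfolding L_def using pairing_outside_zero[OF kern0] f by (intro sum.neutral) simp
  from variation_le_bounded[OF vL this] have bL: "norm (L x) \<le> (\<Sum>k\<in>UNIV. K * mass i k)" for x .
  have "variation_le UNIV (%x. indicat_real {0<..} x *\<^sub>R L x) ((\<Sum>k\<in>UNIV. K * mass i k) + (\<Sum>k\<in>UNIV. K * mass i k))"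
    by (rule variation_le_cutoff[OF vL bL]) (auto simp: mono_def indicator_def)
  moreover have "norm (forcing f i x - forcing f i y) \<le> norm (indicat_real {0<..} x *\<^sub>R L x - indicat_real {0<..} y *\<^sub>R L y)" for x y
  proof -
    have "forcing f i x = - (indicat_real {0<..} x *\<^sub>R L x)" for x by (simp add: forcing_def L_def)
    then show ?thesis by (simp add: norm_minus_commute)
  qed
  ultimately have "variation_le UNIV (forcing f i) ((\<Sum>k\<in>UNIV. K * mass i k) + (\<Sum>k\<in>UNIV. K * mass i k))"
    by (rule variation_le_lipschitz_map)
  moreover have "(\<Sum>k\<in>UNIV. K * mass i k) + (\<Sum>k\<in>UNIV. K * mass i k) = 2 * (\<Sum>k\<in>UNIV. mass i k) * K"
    by (simp add: sum_distrib_left[symmetric] mult.commute)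
  ultimately show ?thesis by simp
qed

text \<open>The points to the left of $-\tau_*$, where the function vanishes, are admitted besides the window because a bound for the sup norm then follows from the variation.  A translate of the
  forcing by \<open>s\<close> vanishes at all these points unless $s \ge t - 2\tau_*$, and in that case $e^{\nu(t-2\tau_*)} \le e^{\nu s}$.\<close>

lemma correction_variation:
  fixes f :: "real => real ^ 'b"
  assumes f: "\<And>x. x \<notin> {- \<tau>max..0} ==> f x = 0" and v: "variation_le UNIV f K" and m: "f \<in> borel_fun" and t: "0 \<le> t"
  shows "variation_le ({t - \<tau>max..t} \<union> {..< - \<tau>max}) (%x. exp (\<nu> * (t - 2 * \<tau>max)) *\<^sub>R (f x + corr f x)) (bv_gain * K)"
proof -
  let ?Q = "{t - \<tau>max..t} \<union> {..< - \<tau>max}" and ?w = "exp (\<nu> * (t - 2 * \<tau>max))"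
  have K: "0 \<le> K" by (rule variation_le_nonneg[OF v]) simp
  define F where "F i = 2 * (\<Sum>k\<in>UNIV. mass i k) * K" for i
  have F0: "0 \<le> F i" for i unfolding F_def using K mass(1) by (simp add: sum_nonneg)
  have vf: "variation_le UNIV (forcing f i) (F i)" for i unfolding F_def by (rule forcing_variation[OF f v m])
  have bf: "norm (forcing f i x) \<le> F i" for i x
    by (rule variation_le_bounded[OF vf, of _ 0]) (simp add: forcing_def)
  have p: "variation_le ?Q (%x. ?w *\<^sub>R pairing (\<kappa> l i) (%s. forcing f i (x - s))) (F i * wmass l i)" for l i
  proof (rule variation_le_pairing[OF \<kappa>(1) forcing_meas[OF m], where h = "%s. ennreal (exp (\<nu> * s))"])
    fix x
    have "absint (\<kappa> l i) (%s. enorm (forcing f i (x - s))) \<le> ennreal (F i) * absint (\<kappa> l i) (%s. 1)"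
      by (rule absint_le_const[OF \<kappa>(1) AE_I2], rule ennreal_leI, rule bf)
    also have "\<dots> < \<infinity>" using \<kappa>_mass[of l i] by (simp add: ennreal_mult_less_top)
    finally show "absint (\<kappa> l i) (%s. enorm (forcing f i (x - s))) < \<infinity>" .
  next
    fix mm and u :: "nat => real" and s :: real
    assume s: "s \<in> {0..}" and uQ: "\<And>i. i \<le> mm ==> u i \<in> ?Q" and u: "\<And>i. i < mm ==> u i \<le> u (Suc i)"
    let ?S = "\<Sum>j<mm. norm (forcing f i (u (Suc j) - s) - forcing f i (u j - s))"
    have "?w * ?S \<le> F i * exp (\<nu> * s)"
    \<comment> \<open>Earlier translates vanish at all the points considered.\<close>
    proof (cases "t - 2 * \<tau>max \<le> s")
      case True
      have "?S \<le> F i" by (rule variation_leD[OF vf, of mm "%j. u j - s"]) (use u in auto)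
      moreover have "?w \<le> exp (\<nu> * s)" using True \<nu> by (simp add: mult_left_mono)
      ultimately have "?w * ?S \<le> exp (\<nu> * s) * F i" by (intro mult_mono) (auto simp: sum_nonneg)
      then show ?thesis by (simp add: mult.commute)
    next
      case False
      have "forcing f i (u j - s) = 0" if "j \<le> mm" for j
        by (rule forcing_support[OF f]) (use uQ[OF that] s False \<tau>max in auto)
      then have "?S = 0" by (intro sum.neutral) simp
      then show ?thesis using F0[of i] by simp
    qed
    then show "ennreal (?w * ?S) \<le> ennreal (F i) * ennreal (exp (\<nu> * s))"
      using F0[of i] by (simp add: ennreal_mult[symmetric] ennreal_leI)
  qed (use F0 wmass in auto)
  have vc: "variation_le ?Q (%x. ?w *\<^sub>R corr f x) (\<Sum>l\<in>UNIV. \<Sum>i\<in>UNIV. F i * wmass l i)"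
  proof -
    have v1: "variation_le ?Q (%x. \<Sum>i\<in>UNIV. ?w *\<^sub>R pairing (\<kappa> l i) (%s. forcing f i (x - s))) (\<Sum>i\<in>UNIV. F i * wmass l i)" for l
      by (rule variation_le_sum) (rule p)
    have "variation_le ?Q (%x. axis l (?w * corr f x $ l) :: real ^ 'b) (\<Sum>i\<in>UNIV. F i * wmass l i)" for l
    proof (rule variation_le_lipschitz_map[OF v1[of l]])
      fix x y
      let ?P = "%x. \<Sum>i\<in>UNIV. ?w *\<^sub>R pairing (\<kappa> l i) (%s. forcing f i (x - s))"
      have c: "?w * corr f x $ l = Re (?P x)" for x
        by (simp add: corr_def scaleR_sum_right[symmetric])
      have "norm (axis l (?w * corr f x $ l) - axis l (?w * corr f y $ l) :: real ^ 'b) = norm (axis l (Re (?P x) - Re (?P y)) :: real ^ 'b)"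
        unfolding c by (rule arg_cong[of _ _ norm]) (simp add: vec_eq_iff axis_def)
      also have "\<dots> \<le> \<bar>Re (?P x - ?P y)\<bar>"
        using norm_le_sum_components[of "axis l (Re (?P x) - Re (?P y)) :: real ^ 'b"]
        by (simp add: axis_def if_distrib[of abs] cong: if_cong)
      also have "\<dots> \<le> norm (?P x - ?P y)" by (rule abs_Re_le_cmod)
      finally show "norm (axis l (?w * corr f x $ l) - axis l (?w * corr f y $ l) :: real ^ 'b) \<le> norm (?P x - ?P y)" .
    qed
    then have "variation_le ?Q (%x. \<Sum>l\<in>UNIV. axis l (?w * corr f x $ l)) (\<Sum>l\<in>UNIV. \<Sum>i\<in>UNIV. F i * wmass l i)"
      by (rule variation_le_sum)
    moreover have "(\<Sum>l\<in>UNIV. axis l (?w * corr f x $ l)) = ?w *\<^sub>R corr f x" for x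
      using vec_as_axis_sum[of "?w *\<^sub>R corr f x"] by simp
    ultimately show ?thesis by simp
  qed
  have vg: "variation_le ?Q (%x. ?w *\<^sub>R f x) K"
    unfolding variation_le_def
  proof (intro allI impI)
    fix mm and u :: "nat => real"
    assume uQ: "\<forall>i\<le>mm. u i \<in> ?Q" and u: "\<forall>i<mm. u i \<le> u (Suc i)"
    have vS: "(\<Sum>i<mm. norm (f (u (Suc i)) - f (u i))) \<le> K" by (rule variation_leD[OF v]) (use u in auto)
    show "(\<Sum>i<mm. norm (?w *\<^sub>R f (u (Suc i)) - ?w *\<^sub>R f (u i))) \<le> K"
    proof (cases "t \<le> 2 * \<tau>max")
      case True
      then have "?w \<le> 1" using \<nu> by (simp add: mult_nonneg_nonpos)
      then have "?w * (\<Sum>i<mm. norm (f (u (Suc i)) - f (u i))) \<le> 1 * K"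
        by (intro mult_mono vS) (auto simp: sum_nonneg)
      then show ?thesis by (simp add: scaleR_diff_right[symmetric] sum_distrib_left[symmetric])
    next
      case False
      have "f (u i) = 0" if "i \<le> mm" for i by (rule f) (use uQ[rule_format, OF that] False \<tau>max in auto)
      then have "(\<Sum>i<mm. norm (?w *\<^sub>R f (u (Suc i)) - ?w *\<^sub>R f (u i))) = 0" by (intro sum.neutral) simp
      then show ?thesis using K by simp
    qed
  qed
  have "variation_le ?Q (%x. ?w *\<^sub>R f x + ?w *\<^sub>R corr f x) (K + (\<Sum>l\<in>UNIV. \<Sum>i\<in>UNIV. F i * wmass l i))"
    by (rule variation_le_add[OF vg vc])
  moreover have "K + (\<Sum>l\<in>UNIV. \<Sum>i\<in>UNIV. F i * wmass l i) = bv_gain * K"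
  proof -
    have "(\<Sum>l\<in>UNIV. \<Sum>i\<in>UNIV. F i * wmass l i) = (\<Sum>l\<in>UNIV. \<Sum>i\<in>UNIV. 2 * (\<Sum>k\<in>UNIV. mass i k) * wmass l i) * K"
      unfolding sum_distrib_right F_def by (intro sum.cong refl) (simp add: ac_simps)
    then show ?thesis by (simp add: bv_gain_def distrib_right)
  qed
  ultimately show ?thesis by (simp add: scaleR_add_right)
qed

lemma correction_far_left:
  fixes f :: "real => real ^ 'b"
  assumes "x \<le> 0"
  shows "corr f x = 0"
proof -
  have "pairing (\<kappa> l i) (%s. forcing f i (x - s)) = 0" for l i
    by (rule pairing_outside_zero[OF \<kappa>(1)]) (use assms in \<open>simp add: forcing_def\<close>)
  then show ?thesis by (simp add: corr_def vec_eq_iff)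
qed

lemma pairing_cong_AE:
  assumes "AE p in M. f (fst p) = g (fst p)" "law S M" "f \<in> borel_fun" "g \<in> borel_fun"
  shows "pairing M f = pairing M g"
  unfolding pairing_def
proof (rule integral_cong_AE)
  note assms(3,4)[measurable]
  show "(%p. snd p * f (fst p)) \<in> borel_measurable M" "(%p. snd p * g (fst p)) \<in> borel_measurable M"
    by (rule law_meas[OF assms(2)], measurable)+
  show "AE p in M. snd p * f (fst p) = snd p * g (fst p)" using assms(1) by (rule eventually_mono) simp
qed

text \<open>Any representative \<open>g\<close> of the initial value with bounded variation, extended by zero, produces through the resolvent formula a function \<open>Z\<close> that agrees almost everywhere with the
  solution.  The windows of \<open>Z\<close> are representatives of the partial trajectories; finally the infimum over \<open>g\<close> is taken.\<close>

lemma decay_BV: "decay_estimate BV \<tau>max A \<tau> N \<nu> (4 * bv_gain * exp (\<nu> * (2 * \<tau>max)))"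
  unfolding decay_estimate_def
proof (intro allI impI)
  fix X0 X :: "real => real ^ 'b" and t :: real
  assume X0: "in_V BV {- \<tau>max..0} X0" and sol: "is_solution BV \<tau>max A \<tau> N X0 X" and t: "0 \<le> t"
  let ?W = "{- \<tau>max..0}"
  have tr: "in_BV ?W (%s. X (t + s))" if "0 \<le> t" for t
    using sol that by (simp add: is_solution_def partial_trajectory_def[abs_def])
  have eq: "AE t in lebesgue_on {-\<tau>max..}. equation_at \<tau>max A \<tau> N X0 X t" using sol by (simp add: is_solution_def)
  obtain X' where X': "X' \<in> borel_fun" "\<And>s. s < - \<tau>max ==> X' s = 0" and ae: "AE s in lborel. - \<tau>max \<le> s --> X s = X' s"
    and ae0: "AE s in lborel. s \<in> {- \<tau>max..0} --> X' s = X0 s"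
    and rep: "AE t in lborel. 0 < t --> (\<forall>l. of_real (X' t $ l) = (\<Sum>i\<in>UNIV. pairing (\<kappa> l i) (%s. forcing (past X') i (t - s))))"
    by (rule solution_representation[OF in_BV_window(1)[OF \<tau>max tr] in_BV_window(2)[OF \<tau>max tr] eq]) (assumption | rule that)+
  define c where "c = 4 * bv_gain * exp (\<nu> * (2 * \<tau>max)) * exp (- \<nu> * t)"
  have c: "0 < c" using bv_gain by (simp add: c_def)
  have main: "norm_BV ?W (%s. X (t + s)) \<le> c * (total_variation ?W g + sup_norm ?W g)" if "g \<in> bv_representatives ?W X0" for g
  proof -
    have g: "bounded_variation_on ?W g" "AE x in lebesgue_on ?W. g x = X0 x" using that by (auto simp: bv_representatives_def)
    define f where "f x = (if x \<in> ?W then g x else 0)" for x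
    define K where "K = 2 * (total_variation ?W g + sup_norm ?W g)"
    have v: "variation_le UNIV f K" unfolding f_def[abs_def] K_def by (rule variation_le_extension[OF g(1) \<tau>max])
    have f0: "f x = 0" if "x \<notin> ?W" for x unfolding f_def by (rule if_not_P[OF that])
    have fm: "f \<in> borel_fun" by (rule borel_measurable_vecI) (rule variation_le_borel_component[OF v])
    have pm: "past X' \<in> borel_fun" by (rule past_meas[OF X'(1)])
    have pf: "AE x in lborel. past X' x = f x"
      using g(2)[unfolded AE_window_iff] ae0
    proof eventually_elim
      case (elim x)
      show ?case
      proof (cases "x \<in> ?W")
        case True
        then show ?thesis using elim by (simp add: past_def f_def)
      next
        case False
        then show ?thesis using X'(2)[of x] by (auto simp: past_def f_def)
      qed
    qed
    have "AE x in lborel. \<forall>i k. AE p in kern i k. past X' (x - fst p) = f (x - fst p)"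
      unfolding AE_all_countable by (intro allI, rule AE_convolution[OF kern0 pf])
    then have ff: "AE x in lborel. \<forall>i. forcing (past X') i x = forcing f i x"
    proof (rule eventually_mono)
      fix x assume a: "\<forall>i k. AE p in kern i k. past X' (x - fst p) = f (x - fst p)"
      have "pairing (kern i k) (%s. of_real (past X' (x - s) $ k)) = pairing (kern i k) (%s. of_real (f (x - s) $ k))" for i k
      proof (rule pairing_cong_AE[OF _ kern0])
        show "AE p in kern i k. complex_of_real (past X' (x - fst p) $ k) = complex_of_real (f (x - fst p) $ k)"
          using a[rule_format, of i k] by (rule eventually_mono) simp
        show "(%s. complex_of_real (past X' (x - s) $ k)) \<in> borel_fun"
          by (rule component_meas, rule measurable_compose[OF _ pm]) simp
        show "(%s. complex_of_real (f (x - s) $ k)) \<in> borel_fun"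
          by (rule component_meas, rule measurable_compose[OF _ fm]) simp
      qed
      then show "\<forall>i. forcing (past X') i x = forcing f i x" by (simp add: forcing_def)
    qed
    have fi: "AE x in lborel. forcing (past X') i x = forcing f i x" for i using ff by (rule eventually_mono) blast
    have "AE x in lborel. \<forall>l i. AE p in \<kappa> l i. forcing (past X') i (x - fst p) = forcing f i (x - fst p)"
      unfolding AE_all_countable by (intro allI, rule AE_convolution[OF \<kappa>(1) fi])
    then have pe: "AE x in lborel. \<forall>l i. pairing (\<kappa> l i) (%s. forcing (past X') i (x - s)) = pairing (\<kappa> l i) (%s. forcing f i (x - s))"
    proof (rule eventually_mono)
      fix x assume a: "\<forall>l i. AE p in \<kappa> l i. forcing (past X') i (x - fst p) = forcing f i (x - fst p)"
      show "\<forall>l i. pairing (\<kappa> l i) (%s. forcing (past X') i (x - s)) = pairing (\<kappa> l i) (%s. forcing f i (x - s))"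
      proof (intro allI, rule pairing_cong_AE[OF _ \<kappa>(1)])
        fix l i
        show "AE p in \<kappa> l i. forcing (past X') i (x - fst p) = forcing f i (x - fst p)" using a by blast
        show "(%s. forcing (past X') i (x - s)) \<in> borel_fun" by (rule measurable_compose[OF _ forcing_meas[OF pm]]) simp
        show "(%s. forcing f i (x - s)) \<in> borel_fun" by (rule measurable_compose[OF _ forcing_meas[OF fm]]) simp
      qed
    qed
    define Z where "Z x = f x + corr f x" for x
    have ZX: "AE x in lborel. - \<tau>max \<le> x --> X x = Z x"
      using pe rep ae pf
    proof eventually_elim
      case (elim x)
      show ?case
      proof
        assume x: "- \<tau>max \<le> x"
        show "X x = Z x"
        proof (cases "0 < x")
          case True
          have "X' x $ l = corr f x $ l" for l
          proof -
            have "complex_of_real (X' x $ l) = (\<Sum>i\<in>UNIV. pairing (\<kappa> l i) (%s. forcing f i (x - s)))"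
              using elim(1,2) True by simp
            from arg_cong[OF this, of Re] show ?thesis by (simp only: corr_def vec_lambda_beta Re_complex_of_real)
          qed
          then have "X' x = corr f x" by (simp add: vec_eq_iff)
          moreover have "f x = 0" by (rule f0) (use True in simp)
          ultimately show ?thesis using elim(3) x by (simp add: Z_def)
        next
          case False
          then show ?thesis using elim(3,4) x correction_far_left[of x f] by (simp add: Z_def past_def)
        qed
      qed
    qed
    let ?w = "exp (\<nu> * (t - 2 * \<tau>max))" and ?Q = "{t - \<tau>max..t} \<union> {..< - \<tau>max}"
    have vZ: "variation_le ?Q (%x. ?w *\<^sub>R Z x) (bv_gain * K)"
      unfolding Z_def by (rule correction_variation[OF f0 v fm t])
    define D where "D = exp (\<nu> * (2 * \<tau>max)) * exp (- \<nu> * t) * (bv_gain * K)"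
    have vZw: "variation_le ?Q Z D"
      unfolding variation_le_def D_def
    proof (intro allI impI, rule bound_from_weighted)
      fix m and u :: "nat => real"
      assume u: "\<forall>i\<le>m. u i \<in> ?Q" "\<forall>i<m. u i \<le> u (Suc i)"
      have "(\<Sum>i<m. norm (?w *\<^sub>R Z (u (Suc i)) - ?w *\<^sub>R Z (u i))) \<le> bv_gain * K"
        by (rule variation_leD[OF vZ]) (use u in auto)
      then show "?w * (\<Sum>i<m. norm (Z (u (Suc i)) - Z (u i))) \<le> bv_gain * K"
        by (simp add: scaleR_diff_right[symmetric] sum_distrib_left[symmetric])
    qed
    let ?Zt = "%s. Z (t + s)"
    have vt: "variation_le ?W ?Zt D"
      unfolding variation_le_def
    proof (intro allI impI)
      fix m and u :: "nat => real"
      assume u: "\<forall>i\<le>m. u i \<in> ?W" "\<forall>i<m. u i \<le> u (Suc i)"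
      show "(\<Sum>i<m. norm (Z (t + u (Suc i)) - Z (t + u i))) \<le> D"
        by (rule variation_leD[OF vZw, of m "%i. t + u i"]) (use u in auto)
    qed
    have W: "?W \<noteq> {}" using \<tau>max by auto
    have Zl: "Z (- \<tau>max - 1) = 0" unfolding Z_def using correction_far_left[of "- \<tau>max - 1" f] f0[of "- \<tau>max - 1"] \<tau>max by simp
    have bZ: "norm (?Zt s) \<le> D" if "s \<in> ?W" for s
    proof -
      have "norm (Z (t + s) - Z (- \<tau>max - 1)) \<le> D" by (rule variation_le_two_points[OF vZw]) (use that t in auto)
      then show ?thesis unfolding Zl by simp
    qed
    have supZ: "sup_norm ?W ?Zt \<le> D" unfolding sup_norm_def by (rule cSUP_least[OF W bZ])
    have "AE s in lebesgue_on ?W. ?Zt s = X (t + s)"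
      unfolding AE_window_iff using AE_window_shift[OF ZX t] by (rule eventually_mono) simp
    then have repZ: "?Zt \<in> bv_representatives ?W (%s. X (t + s))"
      unfolding bv_representatives_def using total_variation_le(1)[OF vt W] by simp
    have bb: "bdd_below ((%g. total_variation ?W g + sup_norm ?W g) ` bv_representatives ?W (%s. X (t + s)))"
    proof (rule bdd_belowI2)
      fix g assume "g \<in> bv_representatives ?W (%s. X (t + s))"
      then have g: "bounded_variation_on ?W g" by (simp add: bv_representatives_def)
      have "norm (g 0) \<le> sup_norm ?W g" by (rule norm_le_sup_norm[OF bounded_variation_bdd[OF g \<tau>max]]) (use \<tau>max in simp)
      then have "0 \<le> sup_norm ?W g" by (rule order_trans[OF norm_ge_zero])
      then show "0 \<le> total_variation ?W g + sup_norm ?W g" using total_variation_nonneg[OF W g] by simp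
    qed
    have "norm_BV ?W (%s. X (t + s)) \<le> total_variation ?W ?Zt + sup_norm ?W ?Zt"
      unfolding norm_BV_def by (rule cINF_lower[OF bb repZ])
    also have "\<dots> \<le> D + D" by (intro add_mono supZ total_variation_le(2)[OF vt W])
    also have "\<dots> = c * (total_variation ?W g + sup_norm ?W g)" unfolding D_def K_def c_def by (simp add: algebra_simps)
    finally show ?thesis .
  qed
  have "bv_representatives ?W X0 \<noteq> {}" using X0 by (simp add: in_BV_def)
  then have "norm_BV ?W (%s. X (t + s)) / c \<le> norm_BV ?W X0"
    unfolding norm_BV_def[of ?W X0]
  proof (rule cINF_greatest)
    fix g assume "g \<in> bv_representatives ?W X0"
    from main[OF this] show "norm_BV ?W (%s. X (t + s)) / c \<le> total_variation ?W g + sup_norm ?W g"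
      using c by (simp add: divide_le_eq mult.commute)
  qed
  then show "norm_V BV ?W (partial_trajectory X t) \<le> 4 * bv_gain * exp (\<nu> * (2 * \<tau>max)) * exp (- \<nu> * t) * norm_V BV ?W X0"
    using c unfolding c_def[symmetric] partial_trajectory_def[abs_def] by (simp add: divide_le_eq mult.commute)
qed

end

section \<open>Exponential modes and the necessity of the spectral condition\<close>

text \<open>A function that is bounded below in norm on an interval cannot be small in any of the spaces.  Comparing with such a multiple of the bound replaces the homogeneity of the norms.\<close>

lemma norm_V_lower:
  fixes T :: real
  assumes V: "valid_state_space V" and \<delta>: "0 < \<delta>" "\<delta> \<le> T"
  shows "\<exists>q>0. \<forall>(f :: real => real ^ 'n::finite) b. in_V V {- T..0} f --> 0 \<le> b --> (\<forall>s\<in>{- \<delta>..0}. b \<le> norm (f s)) --> q * b \<le> norm_V V {- T..0} f"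
proof -
  let ?W = "lebesgue_on {- T..0}"
  have T: "0 < T" using \<delta> by simp
  have pick: "\<exists>x\<in>{- \<delta>..0}. P x" if "AE x in ?W. P x" for P
    using that \<delta> unfolding AE_window_iff by (intro interval_not_null) (auto elim!: eventually_mono)
  show ?thesis
  proof (cases V)
    case (Lp p)
    show ?thesis
    proof (cases "p = \<infinity>")
      case True
      have "1 * b \<le> norm_V V {- T..0} f" if f: "in_V V {- T..0} f" and b: "\<forall>s\<in>{- \<delta>..0}. b \<le> norm (f s)" for f :: "real => real ^ 'n" and b
      proof -
        let ?E = "esssup ?W (%x. ereal (norm (f x)))"
        have "AE x in ?W. ereal (norm (f x)) \<le> ?E" by (rule esssup_AE)
        from pick[OF this] obtain x where x: "x \<in> {- \<delta>..0}" "ereal (norm (f x)) \<le> ?E" by blast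
        have "ereal b \<le> ereal (norm (f x))" using b x by simp
        also note x(2)
        finally have "ereal b \<le> ?E" .
        moreover have "?E < \<infinity>" using f Lp True by (simp add: in_Lp_def)
        ultimately have "b \<le> real_of_ereal ?E" by (cases ?E) auto
        then show ?thesis using Lp True by (simp add: norm_Lp_def)
      qed
      then show ?thesis by (intro exI[of _ 1]) auto
    next
      case False
      then obtain r where r: "p = ereal r" "1 \<le> r" using V Lp by (cases p) (auto simp: valid_state_space_def)
      interpret finite_measure ?W by (rule finite_measure_lebesgue_on) simp
      have "\<delta> powr (1 / r) * b \<le> norm_V V {- T..0} f" if f: "in_V V {- T..0} f" and b0: "0 \<le> b" and b: "\<forall>s\<in>{- \<delta>..0}. b \<le> norm (f s)" for f :: "real => real ^ 'n" and b
      proof -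
        have i: "integrable ?W (%x. norm (f x) powr r)" using f Lp r by (simp add: in_Lp_def)
        have im: "indicat_real {- \<delta>..0} \<in> borel_measurable ?W" by (rule measurable_restrict_space1, rule measurable_completion) simp
        have ii: "integrable ?W (indicat_real {- \<delta>..0})"
          by (rule integrable_const_bound[of _ 1]) (use im in \<open>auto simp: indicator_def\<close>)
        have "(\<integral>x. b powr r * indicat_real {- \<delta>..0} x \<partial>?W) \<le> (\<integral>x. norm (f x) powr r \<partial>?W)"
        proof (rule integral_mono[OF _ i])
          show "integrable ?W (%x. b powr r * indicat_real {- \<delta>..0} x)" using ii by (rule integrable_mult_right)
          show "b powr r * indicat_real {- \<delta>..0} x \<le> norm (f x) powr r" for x
            using b b0 r by (cases "x \<in> {- \<delta>..0}") (auto intro!: powr_mono2)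
        qed
        also have "(\<integral>x. b powr r * indicat_real {- \<delta>..0} x \<partial>?W) = b powr r * measure ?W ({- \<delta>..0} \<inter> space ?W)" by simp
        also have "{- \<delta>..0} \<inter> space ?W = {- \<delta>..0}" using \<delta> by auto
        also have "measure ?W {- \<delta>..0} = measure lebesgue {- \<delta>..0}" using \<delta> by (intro measure_restrict_space) auto
        also have "\<dots> = \<delta>" using \<delta> by simp
        finally have "(b powr r * \<delta>) powr (1 / r) \<le> (\<integral>x. norm (f x) powr r \<partial>?W) powr (1 / r)"
          using r \<delta> by (intro powr_mono2) auto
        moreover have "(b powr r * \<delta>) powr (1 / r) = \<delta> powr (1 / r) * b" using r \<delta> b0 by (simp add: powr_mult powr_powr)
        ultimately show ?thesis using Lp r by (simp add: norm_Lp_def)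
      qed
      then show ?thesis using \<delta> by (intro exI[of _ "\<delta> powr (1 / r)"]) auto
    qed
  next
    case B_inf
    have "1 * b \<le> norm_V V {- T..0} f" if f: "in_V V {- T..0} f" and b: "\<forall>s\<in>{- \<delta>..0}. b \<le> norm (f s)" for f :: "real => real ^ 'n" and b
    proof -
      have "bdd_above ((%x. norm (f x)) ` {- T..0})" using f B_inf unfolding bdd_above_def by (auto simp: in_B_inf_def bounded_iff)
      then have "norm (f 0) \<le> sup_norm {- T..0} f" by (rule norm_le_sup_norm) (use T in simp)
      moreover have "b \<le> norm (f 0)" using b \<delta> by simp
      ultimately show ?thesis using B_inf by simp
    qed
    then show ?thesis by (intro exI[of _ 1]) auto
  next
    case BV
    have "1 * b \<le> norm_V V {- T..0} f" if f: "in_V V {- T..0} f" and b: "\<forall>s\<in>{- \<delta>..0}. b \<le> norm (f s)" for f :: "real => real ^ 'n" and b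
    proof -
      have "b \<le> norm_BV {- T..0} f"
        unfolding norm_BV_def
      proof (rule cINF_greatest)
        show "bv_representatives {- T..0} f \<noteq> {}" using f BV by (simp add: in_BV_def)
        fix h assume h: "h \<in> bv_representatives {- T..0} f"
        then have hb: "bounded_variation_on {- T..0} h" and "AE x in ?W. h x = f x" by (auto simp: bv_representatives_def)
        from pick[OF this(2)] obtain x where x: "x \<in> {- \<delta>..0}" "h x = f x" by blast
        have "norm (h x) \<le> sup_norm {- T..0} h" by (rule norm_le_sup_norm[OF bounded_variation_bdd[OF hb T]]) (use x \<delta> in auto)
        moreover have "b \<le> norm (h x)" using b x by simp
        moreover have "0 \<le> total_variation {- T..0} h" by (rule total_variation_nonneg[OF _ hb]) (use T in auto)
        ultimately show "b \<le> total_variation {- T..0} h + sup_norm {- T..0} h" by linarith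
      qed
      then show ?thesis using BV by simp
    qed
    then show ?thesis by (intro exI[of _ 1]) auto
  qed
qed

definition exp_mode :: "complex => complex ^ 'n::finite => real => real ^ 'n" where
  "exp_mode z v x = (\<chi> i. Re (exp (z * of_real x) * v $ i))"

lemma exp_mode_measurable: "exp_mode z (v :: complex ^ 'n::finite) \<in> borel_fun"
proof (rule borel_measurable_vecI)
  fix k
  have "continuous_on UNIV (%x. Re (exp (z * complex_of_real x) * v $ k))" by (intro continuous_intros)
  then have "(%x. Re (exp (z * complex_of_real x) * v $ k)) \<in> borel_fun" by (rule borel_measurable_continuous_onI)
  then show "(%x. exp_mode z v x $ k) \<in> borel_fun" by (simp add: exp_mode_def)
qed

lemma norm_exp_mult_le:
  assumes "\<bar>y\<bar> \<le> R"
  shows "norm (exp (z * complex_of_real y)) \<le> exp (norm z * R)"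
proof -
  have "norm (exp (z * complex_of_real y)) \<le> exp (norm (z * complex_of_real y))" by (rule norm_exp)
  also have "\<dots> \<le> exp (norm z * R)" using assms by (simp add: norm_mult mult_left_mono)
  finally show ?thesis .
qed

lemma exp_mode_bound:
  fixes v :: "complex ^ 'n::finite"
  assumes "\<bar>y\<bar> \<le> R"
  shows "norm (exp_mode z v y) \<le> (\<Sum>i\<in>UNIV. exp (norm z * R) * norm (v $ i))"
proof -
  have "norm (exp_mode z v y) \<le> (\<Sum>i\<in>UNIV. \<bar>exp_mode z v y $ i\<bar>)" by (rule norm_le_sum_components)
  also have "\<dots> \<le> (\<Sum>i\<in>UNIV. exp (norm z * R) * norm (v $ i))"
  proof (rule sum_mono)
    fix i
    have "\<bar>exp_mode z v y $ i\<bar> \<le> norm (exp (z * complex_of_real y) * v $ i)" by (simp only: exp_mode_def vec_lambda_beta abs_Re_le_cmod)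
    also have "\<dots> \<le> exp (norm z * R) * norm (v $ i)" unfolding norm_mult by (intro mult_right_mono norm_exp_mult_le assms) simp
    finally show "\<bar>exp_mode z v y $ i\<bar> \<le> exp (norm z * R) * norm (v $ i)" .
  qed
  finally show ?thesis .
qed

text \<open>The mean value inequality for the exponential function on a disc.\<close>

lemma exp_mode_lipschitz:
  fixes v :: "complex ^ 'n::finite"
  assumes "\<bar>x\<bar> \<le> R" "\<bar>y\<bar> \<le> R"
  shows "norm (exp_mode z v x - exp_mode z v y) \<le> (\<Sum>i\<in>UNIV. exp (norm z * R) * norm z * norm (v $ i)) * \<bar>x - y\<bar>"
proof -
  have R: "norm z * \<bar>x\<bar> \<le> norm z * R" "norm z * \<bar>y\<bar> \<le> norm z * R" using assms by (auto intro: mult_left_mono)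
  have "norm (exp (z * complex_of_real x) - exp (z * complex_of_real y)) \<le> exp (norm z * R) * norm (z * of_real x - z * of_real y)"
  proof (rule field_differentiable_bound[where S = "cball 0 (norm z * R)" and f' = exp])
    show "(exp has_field_derivative exp w) (at w within cball 0 (norm z * R))" for w :: complex by (rule DERIV_subset[OF DERIV_exp]) simp
    show "norm (exp w) \<le> exp (norm z * R)" if "w \<in> cball 0 (norm z * R)" for w :: complex
      using norm_exp[of w] that by (simp add: order_trans)
  qed (use R in \<open>auto simp: norm_mult\<close>)
  also have "norm (z * of_real x - z * of_real y) = norm z * \<bar>x - y\<bar>"
    by (simp add: right_diff_distrib[symmetric] norm_mult flip: of_real_diff)
  finally have e: "norm (exp (z * complex_of_real x) - exp (z * complex_of_real y)) \<le> exp (norm z * R) * (norm z * \<bar>x - y\<bar>)" .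
  have "norm (exp_mode z v x - exp_mode z v y) \<le> (\<Sum>i\<in>UNIV. \<bar>(exp_mode z v x - exp_mode z v y) $ i\<bar>)" by (rule norm_le_sum_components)
  also have "\<dots> \<le> (\<Sum>i\<in>UNIV. exp (norm z * R) * norm z * norm (v $ i) * \<bar>x - y\<bar>)"
  proof (rule sum_mono)
    fix i
    have "\<bar>(exp_mode z v x - exp_mode z v y) $ i\<bar> = \<bar>Re ((exp (z * complex_of_real x) - exp (z * complex_of_real y)) * v $ i)\<bar>"
      by (simp add: exp_mode_def left_diff_distrib)
    also have "\<dots> \<le> norm (exp (z * complex_of_real x) - exp (z * complex_of_real y)) * norm (v $ i)"
      unfolding norm_mult[symmetric] by (rule abs_Re_le_cmod)
    also have "\<dots> \<le> exp (norm z * R) * (norm z * \<bar>x - y\<bar>) * norm (v $ i)" by (intro mult_right_mono e) simp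
    finally show "\<bar>(exp_mode z v x - exp_mode z v y) $ i\<bar> \<le> exp (norm z * R) * norm z * norm (v $ i) * \<bar>x - y\<bar>" by (simp add: ac_simps)
  qed
  finally show ?thesis by (simp add: sum_distrib_right)
qed

lemma exp_mode_in_V:
  fixes v :: "complex ^ 'n::finite" and T :: real
  assumes V: "valid_state_space V" and T: "0 < T"
  shows "in_V V {- T..0} (%s. exp_mode z v (t + s))"
proof -
  let ?W = "lebesgue_on {- T..0}" and ?f = "%s. exp_mode z v (t + s)"
  interpret finite_measure ?W by (rule finite_measure_lebesgue_on) simp
  note exp_mode_measurable[measurable]
  have fm: "?f \<in> borel_fun" by measurable
  have fl: "?f \<in> borel_measurable ?W"
    by (rule measurable_restrict_space1, rule measurable_completion) (use fm in simp)
  define K where "K = (\<Sum>i\<in>UNIV. exp (norm z * (\<bar>t\<bar> + T)) * norm (v $ i))"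
  have b: "norm (?f s) \<le> K" if "s \<in> {- T..0}" for s unfolding K_def by (rule exp_mode_bound) (use that in auto)
  have K0: "0 \<le> K" unfolding K_def by (intro sum_nonneg) simp
  have sp: "AE s in ?W. s \<in> {- T..0}" unfolding AE_window_iff by simp
  show ?thesis
  proof (cases V)
    case (Lp p)
    show ?thesis
    proof (cases "p = \<infinity>")
      case True
      have "esssup ?W (%x. ereal (norm (?f x))) \<le> ereal K"
      proof (rule esssup_I)
        show "(%x. ereal (norm (?f x))) \<in> borel_measurable ?W" using fl by measurable
        show "AE x in ?W. ereal (norm (?f x)) \<le> ereal K" using sp by (rule eventually_mono) (use b in simp)
      qed
      then have "esssup ?W (%x. ereal (norm (?f x))) < \<infinity>" by (rule order.strict_trans1) simp
      then show ?thesis using Lp True fl by (simp add: in_Lp_def)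
    next
      case False
      then obtain r where r: "p = ereal r" "1 \<le> r" using V Lp by (cases p) (auto simp: valid_state_space_def)
      have "integrable ?W (%x. norm (?f x) powr r)"
      proof (rule integrable_const_bound[of _ "K powr r"])
        show "AE x in ?W. norm (norm (?f x) powr r) \<le> K powr r"
          using sp by (rule eventually_mono) (use b r in \<open>auto intro!: powr_mono2\<close>)
        show "(%x. norm (?f x) powr r) \<in> borel_measurable ?W" using fl by measurable
      qed
      then show ?thesis using Lp r fl by (simp add: in_Lp_def)
    qed
  next
    case B_inf
    have "?f \<in> borel_measurable (restrict_space borel {- T..0})" by (rule measurable_restrict_space1[OF fm])
    moreover have "bounded (?f ` {- T..0})" unfolding bounded_iff using b by blast
    ultimately show ?thesis using B_inf by (simp add: in_B_inf_def)
  next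
    case BV
    define L where "L = (\<Sum>i\<in>UNIV. exp (norm z * (\<bar>t\<bar> + T)) * norm z * norm (v $ i))"
    have L0: "0 \<le> L" unfolding L_def by (intro sum_nonneg) simp
    have "variation_le {- T..0} ?f (L * T)"
      unfolding variation_le_def
    proof (intro allI impI)
      fix m and u :: "nat => real"
      assume u: "\<forall>i\<le>m. u i \<in> {- T..0}" "\<forall>i<m. u i \<le> u (Suc i)"
      have "(\<Sum>i<m. norm (?f (u (Suc i)) - ?f (u i))) \<le> (\<Sum>i<m. L * (u (Suc i) - u i))"
      proof (rule sum_mono)
        fix i assume i: "i \<in> {..<m}"
        then have w: "u (Suc i) \<in> {- T..0}" "u i \<in> {- T..0}" "u i \<le> u (Suc i)" using u by auto
        have "norm (?f (u (Suc i)) - ?f (u i)) \<le> L * \<bar>(t + u (Suc i)) - (t + u i)\<bar>"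
          unfolding L_def by (rule exp_mode_lipschitz) (use w in auto)
        then show "norm (?f (u (Suc i)) - ?f (u i)) \<le> L * (u (Suc i) - u i)" using w(3) by simp
      qed
      also have "\<dots> = L * (\<Sum>i<m. u (Suc i) - u i)" by (rule sum_distrib_left[symmetric])
      also have "(\<Sum>i<m. u (Suc i) - u i) = u m - u 0" by (rule sum_lessThan_telescope)
      also have "L * (u m - u 0) \<le> L * T" using u(1)[rule_format, of m] u(1)[rule_format, of 0] by (intro mult_left_mono L0) auto
      finally show "(\<Sum>i<m. norm (?f (u (Suc i)) - ?f (u i))) \<le> L * T" .
    qed
    from total_variation_le(1)[OF this] have "bounded_variation_on {- T..0} ?f" using T by simp
    then have "?f \<in> bv_representatives {- T..0} ?f" by (simp add: bv_representatives_def)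
    then show ?thesis using BV by (auto simp: in_BV_def)
  qed
qed

context delay_equation
begin

text \<open>The kernel is real, so it commutes with taking real parts.\<close>

lemma kern_Re:
  assumes \<psi>: "\<psi> \<in> borel_fun" and fin: "absint (kern i j) (%s. enorm (\<psi> s)) < \<infinity>"
  shows "Re (pairing (kern i j) (%s. of_real (Re (\<psi> s)))) = Re (pairing (kern i j) \<psi>)"
proof -
  note \<psi>[measurable]
  let ?\<phi> = "%s. complex_of_real (Re (\<psi> s))"
  have m: "?\<phi> \<in> borel_fun" by measurable
  have f: "absint (kern i j) (%s. enorm (?\<phi> s)) < \<infinity>"
    by (rule order.strict_trans1[OF absint_mono[OF kern0] fin], rule ennreal_leI) (simp add: abs_Re_le_cmod)
  have "(%k. Re (of_real (A k $ i $ j) * \<psi> (\<tau> k))) sums Re (\<Sum>k. of_real (A k $ i $ j) * \<psi> (\<tau> k))"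
    using summable_sums[OF kern(3)[OF \<psi> fin]] unfolding sums_complex_iff by blast
  moreover have "(%k. Re (of_real (A k $ i $ j) * ?\<phi> (\<tau> k))) sums Re (\<Sum>k. of_real (A k $ i $ j) * ?\<phi> (\<tau> k))"
    using summable_sums[OF kern(3)[OF m f]] unfolding sums_complex_iff by blast
  ultimately have 1: "Re (\<Sum>k. of_real (A k $ i $ j) * ?\<phi> (\<tau> k)) = Re (\<Sum>k. of_real (A k $ i $ j) * \<psi> (\<tau> k))"
    by (simp add: sums_iff)
  have 2: "Re (\<integral>t. of_real (dens i j t) * ?\<phi> t \<partial>lborel) = Re (\<integral>t. of_real (dens i j t) * \<psi> t \<partial>lborel)"
    unfolding integral_Re[OF kern(4)[OF m f], symmetric] integral_Re[OF kern(4)[OF \<psi> fin], symmetric] by simp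
  show ?thesis unfolding kern(5)[OF \<psi> fin] kern(5)[OF m f] by (simp only: plus_complex.sel 1 2)
qed

text \<open>Pairing the kernel with $s \mapsto e^{z(t-s)}$ gives $e^{zt}\hat\mu(z)$, so the equation is the real part of $e^{zt}(I+\hat\mu(z))v = 0$.\<close>

lemma exp_mode_solves:
  fixes v :: "complex ^ 'n"
  assumes v: "char_matrix \<tau>max A \<tau> N z *v v = 0"
  shows "exp_mode z v t + (\<Sum>k. A k *v exp_mode z v (t - \<tau> k)) + (LINT s:{0<..<\<tau>max}|lebesgue. N s *v exp_mode z v (t - s)) = 0"
proof -
  let ?X = "exp_mode z v"
  define \<psi> where "\<psi> j s = exp (z * complex_of_real (t - s)) * v $ j" for j s
  have \<psi>m: "\<psi> j \<in> borel_fun" for j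
    unfolding \<psi>_def[abs_def] by (intro borel_measurable_continuous_onI continuous_intros)
  have lK: "absint (kern i j) f < \<infinity>" if "\<And>s. s \<in> {0<..\<tau>max} ==> f s \<le> ennreal K" for i j f K
  proof -
    have "AE p in kern i j. fst p \<in> {0<..\<tau>max}" using kern(1) by (simp add: law_def)
    then have "AE p in kern i j. f (fst p) \<le> ennreal K" by (rule eventually_mono) (rule that)
    then have "absint (kern i j) f \<le> ennreal K * absint (kern i j) (%s. 1)" by (rule absint_le_const[OF kern(1)])
    also have "\<dots> < \<infinity>" using kern_mass[of i j] by (simp add: ennreal_mult_less_top)
    finally show ?thesis .
  qed
  have R: "\<bar>t - s\<bar> \<le> \<bar>t\<bar> + \<tau>max" if "s \<in> {0<..\<tau>max}" for s using that by auto
  have Xf: "absint (kern i j) (%s. enorm (?X (t - s))) < \<infinity>" for i j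
    by (rule lK) (rule ennreal_leI, rule exp_mode_bound, rule R)
  have \<psi>f: "absint (kern i j) (%s. enorm (\<psi> l s)) < \<infinity>" for i j l
  proof (rule lK, rule ennreal_leI)
    fix s assume "s \<in> {0<..\<tau>max}"
    from norm_exp_mult_le[OF R[OF this], of z]
    show "norm (\<psi> l s) \<le> exp (norm z * (\<bar>t\<bar> + \<tau>max)) * norm (v $ l)"
      unfolding \<psi>_def norm_mult by (rule mult_right_mono) simp
  qed
  have comp: "((\<Sum>k. A k *v ?X (t - \<tau> k)) + (LINT s:{0<..<\<tau>max}|lebesgue. N s *v ?X (t - s))) $ i = - ?X t $ i" for i
  proof -
    let ?P = "%j. pairing (kern i j) (%s. exp (- (z * complex_of_real s)))"
    have pP: "pairing (kern i j) (\<psi> j) = exp (z * of_real t) * (?P j * v $ j)" for j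
    proof -
      have "\<psi> j s = (exp (z * of_real t) * v $ j) * exp (- (z * complex_of_real s))" for s
        by (simp add: \<psi>_def right_diff_distrib exp_diff exp_minus divide_inverse)
      then have "pairing (kern i j) (\<psi> j) = (\<integral>p. (exp (z * of_real t) * v $ j) * (snd p * exp (- (z * complex_of_real (fst p)))) \<partial>kern i j)"
        unfolding pairing_def by (intro Bochner_Integration.integral_cong refl) (simp add: ac_simps)
      also have "\<dots> = (exp (z * of_real t) * v $ j) * ?P j" unfolding pairing_def by (rule integral_mult_right_zero)
      finally show ?thesis by (simp add: ac_simps)
    qed
    have "0 = (char_matrix \<tau>max A \<tau> N z *v v) $ i" using v by simp
    also have "\<dots> = (\<Sum>j\<in>UNIV. (of_bool (i = j) + ?P j) * v $ j)"
      by (simp add: matrix_vector_mult_def char_matrix_entry)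
    also have "\<dots> = (\<Sum>j\<in>UNIV. of_bool (i = j) * v $ j) + (\<Sum>j\<in>UNIV. ?P j * v $ j)"
      by (simp add: distrib_right sum.distrib)
    also have "(\<Sum>j\<in>UNIV. of_bool (i = j) * v $ j) = v $ i"
      by (subst sum.mono_neutral_right[of UNIV "{i}"]) auto
    finally have e: "(\<Sum>j\<in>UNIV. ?P j * v $ j) = - v $ i" by (simp add: eq_neg_iff_add_eq_0 add.commute)
    have "((\<Sum>k. A k *v ?X (t - \<tau> k)) + (LINT s:{0<..<\<tau>max}|lebesgue. N s *v ?X (t - s))) $ i =
       Re (\<Sum>j\<in>UNIV. pairing (kern i j) (%s. of_real (?X (t - s) $ j)))"
      using arg_cong[OF equation_as_pairing[OF exp_mode_measurable Xf refl AE_I2], of Re] by simp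
    also have "\<dots> = (\<Sum>j\<in>UNIV. Re (pairing (kern i j) (%s. of_real (Re (\<psi> j s)))))"
      by (simp add: exp_mode_def \<psi>_def)
    also have "\<dots> = (\<Sum>j\<in>UNIV. Re (pairing (kern i j) (\<psi> j)))"
      by (rule sum.cong[OF refl]) (rule kern_Re[OF \<psi>m \<psi>f])
    also have "\<dots> = Re (exp (z * of_real t) * (\<Sum>j\<in>UNIV. ?P j * v $ j))" unfolding pP sum_distrib_left by simp
    also have "\<dots> = - ?X t $ i" unfolding e by (simp add: exp_mode_def)
    finally show ?thesis .
  qed
  have "(\<Sum>k. A k *v ?X (t - \<tau> k)) + (LINT s:{0<..<\<tau>max}|lebesgue. N s *v ?X (t - s)) = - ?X t"
    unfolding vec_eq_iff using comp by simp
  then show ?thesis by (simp add: add.assoc)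
qed

text \<open>The period of the oscillating factor of $e^{zt}$.\<close>

lemma real_period: "\<exists>p>0. exp (z * complex_of_real p) = of_real (exp (Re z * p))"
proof (cases "Im z = 0")
  case True
  then have "z * complex_of_real 1 = of_real (Re z * 1)" by (simp add: complex_eq_iff)
  then show ?thesis by (intro exI[of _ 1]) (simp only: exp_of_real, simp)
next
  case False
  define p where "p = 2 * pi / \<bar>Im z\<bar>"
  have p: "0 < p" using False by (simp add: p_def)
  have c: "Im z * p = 2 * pi \<or> Im z * p = - (2 * pi)" using False by (cases "0 < Im z") (auto simp: p_def)
  then have "cos (Im z * p) = 1" "sin (Im z * p) = 0" by auto
  then have "exp (z * complex_of_real p) = of_real (exp (Re z * p))"
    by (simp add: complex_eq_iff Re_exp Im_exp)
  with p show ?thesis by blast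
qed

text \<open>The kernel vector is rotated so that some component is real and positive; the mode then does not vanish near $0$.
  Over the times \<open>k p\<close> the mode reproduces its initial window up to the factor $e^{\mathrm{Re}(z) k p}$, and comparison with the decay estimate bounds
  the powers of $e^{(\mathrm{Re}(z)+\nu)p}$.\<close>

lemma decay_rate_bounds_zeros:
  assumes V: "valid_state_space V" and dec: "decay_estimate V \<tau>max A \<tau> N \<nu> C"
    and z: "det (char_matrix \<tau>max A \<tau> N z) = 0"
  shows "Re z \<le> - \<nu>"
proof (rule ccontr)
  assume neg: "\<not> Re z \<le> - \<nu>"
  let ?M = "char_matrix \<tau>max A \<tau> N z"
  have "\<not> invertible ?M" using z by (simp add: invertible_det_nz)
  then have "\<not> (\<exists>B. B ** ?M = mat 1)" unfolding invertible_def using matrix_left_right_inverse by blast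
  then obtain v0 where v0: "?M *v v0 = 0" "v0 \<noteq> 0" unfolding matrix_left_invertible_ker by blast
  then obtain j where j: "v0 $ j \<noteq> 0" by (auto simp: vec_eq_iff)
  \<comment> \<open>This makes the component \<open>j\<close> equal to $|v_{0,j}|^2 > 0$.\<close>
  define v where "v = (\<chi> i. cnj (v0 $ j) * v0 $ i)"
  have "(?M *v v) $ i = cnj (v0 $ j) * (?M *v v0) $ i" for i
    unfolding v_def matrix_vector_mult_def by (simp add: sum_distrib_left ac_simps)
  then have v: "?M *v v = 0" using v0 by (simp add: vec_eq_iff)
  define \<phi> where "\<phi> x = Re (exp (z * complex_of_real x) * v $ j)" for x
  have "v $ j = of_real ((norm (v0 $ j))\<^sup>2)" unfolding v_def vec_lambda_beta complex_norm_square by (rule mult.commute)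
  then have \<phi>0: "0 < \<phi> 0" using j by (simp add: \<phi>_def)
  have "continuous_on UNIV \<phi>" unfolding \<phi>_def[abs_def] by (intro continuous_intros)
  then have "isCont \<phi> 0" by (simp add: continuous_on_eq_continuous_at)
  then obtain d where d: "0 < d" "\<And>x. dist x 0 < d ==> dist (\<phi> x) (\<phi> 0) < \<phi> 0 / 2"
    unfolding continuous_at_eps_delta using \<phi>0 by (metis half_gt_zero)
  \<comment> \<open>Half of \<open>d\<close>, because the interval below is closed and \<open>d\<close> bounds distances strictly.\<close>
  define \<delta> where "\<delta> = min (d / 2) \<tau>max"
  have \<delta>: "0 < \<delta>" "\<delta> \<le> \<tau>max" "\<delta> < d" using d(1) \<tau>max by (auto simp: \<delta>_def min_def)
  let ?X = "exp_mode z v"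
  have low: "\<phi> 0 / 2 \<le> norm (?X s)" if s: "s \<in> {- \<delta>..0}" for s
  proof -
    have "dist (\<phi> s) (\<phi> 0) < \<phi> 0 / 2" by (rule d(2)) (use s \<delta> in \<open>auto simp: dist_real_def\<close>)
    then have "\<phi> 0 / 2 \<le> \<bar>\<phi> s\<bar>" unfolding dist_real_def by linarith
    also have "\<phi> s = ?X s $ j" unfolding \<phi>_def exp_mode_def by simp
    also have "\<bar>?X s $ j\<bar> \<le> norm (?X s)" by (rule component_le_norm_cart)
    finally show ?thesis .
  qed
  obtain q where q: "0 < q" and qd: "\<And>(f :: real => real ^ 'n) b. in_V V {- \<tau>max..0} f ==> 0 \<le> b ==> (\<forall>s\<in>{- \<delta>..0}. b \<le> norm (f s)) ==> q * b \<le> norm_V V {- \<tau>max..0} f"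
    using norm_V_lower[OF V \<delta>(1,2), where 'n = 'n] by blast
  obtain p where p: "0 < p" "exp (z * complex_of_real p) = of_real (exp (Re z * p))" using real_period by blast
  have inV: "in_V V {- \<tau>max..0} (partial_trajectory ?X t)" for t
    unfolding partial_trajectory_def by (rule exp_mode_in_V[OF V \<tau>max])
  have inV0: "in_V V {- \<tau>max..0} ?X" using exp_mode_in_V[OF V \<tau>max, of z v 0] by simp
  have eq: "equation_at \<tau>max A \<tau> N ?X ?X t" for t
    unfolding equation_at_def using exp_mode_solves[OF v] by simp
  have sol: "is_solution V \<tau>max A \<tau> N ?X ?X"
    unfolding is_solution_def using inV eq by simp
  let ?n = "norm_V V {- \<tau>max..0} ?X"
  have per: "?X (real k * p + s) = exp (Re z * p) ^ k *\<^sub>R ?X s" for k s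
  proof -
    have "exp (z * complex_of_real (real k * p + s)) = exp (of_nat k * (z * complex_of_real p)) * exp (z * of_real s)"
      by (simp add: exp_add[symmetric] algebra_simps)
    also have "\<dots> = of_real (exp (Re z * p) ^ k) * exp (z * of_real s)"
      unfolding exp_of_nat_mult p(2) by simp
    finally show ?thesis by (simp add: exp_mode_def vec_eq_iff mult.assoc)
  qed
  define \<rho> where "\<rho> = exp ((Re z + \<nu>) * p)"
  have \<rho>: "1 < \<rho>" using neg p(1) by (simp add: \<rho>_def)
  have bound: "\<rho> ^ k * (q * (\<phi> 0 / 2)) \<le> C * ?n" for k
  proof -
    have t: "0 \<le> real k * p" using p by simp
    have "q * (exp (Re z * p) ^ k * (\<phi> 0 / 2)) \<le> norm_V V {- \<tau>max..0} (partial_trajectory ?X (real k * p))"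
    proof (rule qd[OF inV])
      show "\<forall>s\<in>{- \<delta>..0}. exp (Re z * p) ^ k * (\<phi> 0 / 2) \<le> norm (partial_trajectory ?X (real k * p) s)"
      proof
        fix s assume s: "s \<in> {- \<delta>..0}"
        have "exp (Re z * p) ^ k * (\<phi> 0 / 2) \<le> exp (Re z * p) ^ k * norm (?X s)" by (intro mult_left_mono low s) simp
        then show "exp (Re z * p) ^ k * (\<phi> 0 / 2) \<le> norm (partial_trajectory ?X (real k * p) s)"
          unfolding partial_trajectory_def per by simp
      qed
    qed (use \<phi>0 in simp)
    also have "\<dots> \<le> C * exp (- \<nu> * (real k * p)) * ?n"
      using dec inV0 sol t unfolding decay_estimate_def by blast
    finally have le: "exp (\<nu> * (real k * p)) * (q * (exp (Re z * p) ^ k * (\<phi> 0 / 2))) \<le> exp (\<nu> * (real k * p)) * (C * exp (- \<nu> * (real k * p)) * ?n)"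
      by (intro mult_left_mono) auto
    have e1: "exp (\<nu> * (real k * p)) * (C * exp (- \<nu> * (real k * p)) * ?n) = C * ?n"
      by (simp add: exp_minus field_simps)
    have e2: "exp (\<nu> * (real k * p)) * (q * (exp (Re z * p) ^ k * (\<phi> 0 / 2))) = \<rho> ^ k * (q * (\<phi> 0 / 2))"
    proof -
      have "\<rho> ^ k = exp (\<nu> * (real k * p)) * exp (Re z * p) ^ k"
        unfolding \<rho>_def exp_of_nat_mult[symmetric] exp_add[symmetric] by (simp add: algebra_simps)
      then show ?thesis by (simp add: ac_simps)
    qed
    show ?thesis using le unfolding e1 e2 .
  qed
  obtain k where "C * ?n / (q * (\<phi> 0 / 2)) < \<rho> ^ k" using real_arch_pow[OF \<rho>] by blast
  then have "C * ?n < \<rho> ^ k * (q * (\<phi> 0 / 2))" using q \<phi>0 by (simp add: divide_less_eq)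
  with bound[of k] show False by simp
qed

end

section \<open>The characterisation of exponential stability\<close>

text \<open>The resolvent exists for every weight below \<open>\<nu>0\<close>; the estimates for the individual spaces then apply.\<close>

lemma (in delay_equation) zero_free_half_plane_imp_decay:
  assumes V: "valid_state_space V" and zeros: "\<And>z. det (char_matrix \<tau>max A \<tau> N z) = 0 ==> Re z < - \<nu>0"
    and \<nu>: "0 < \<nu>" "\<nu> < \<nu>0"
  shows "\<exists>C\<ge>1. decay_estimate V \<tau>max A \<tau> N \<nu> C"
proof -
  have char: "(\<chi> i j. of_bool (i = j) + pairing (kern i j) (lap z)) = char_matrix \<tau>max A \<tau> N z" for z
    by (simp add: vec_eq_iff char_matrix_entry)
  have "\<exists>\<kappa>. (\<forall>i j. law {0..} (\<kappa> i j) \<and> absint (\<kappa> i j) (eexp \<nu>) < \<infinity>) \<and>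
    (\<forall>z l k. - \<nu> \<le> Re z --> pairing (\<kappa> l k) (lap z) +
       (\<Sum>i\<in>UNIV. pairing (\<kappa> l i) (lap z) * pairing (kern i k) (lap z)) = of_bool (l = k))"
  proof -
    have h0: "dens i j t = 0" if "t \<notin> {0<..\<tau>max}" for i j t using that by (intro dens(2)) auto
    have nz: "det (\<chi> i j. of_bool (i = j) + pairing (kern i j) (lap z)) \<noteq> 0" if "- \<nu>0 < Re z" for z
      unfolding char using zeros[of z] that by force
    show ?thesis
      by (rule resolvent_exists[OF A_entry \<tau> dens(1) h0 kern(1) kern_mass kern_transform nz \<nu>(2)])
  qed
  then obtain \<kappa> where \<kappa>: "\<And>i j. law {0..} (\<kappa> i j)" "\<And>i j. absint (\<kappa> i j) (eexp \<nu>) < \<infinity>"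
    "\<And>z l k. - \<nu> \<le> Re z ==> pairing (\<kappa> l k) (lap z) +
       (\<Sum>i\<in>UNIV. pairing (\<kappa> l i) (lap z) * pairing (kern i k) (lap z)) = of_bool (l = k)"
    by blast
  interpret stable_delay \<tau>max A \<tau> N \<kappa> \<nu>
    by unfold_locales (use \<nu> \<kappa> in auto)
  have one: "1 \<le> exp (\<nu> * \<tau>max)" "1 \<le> exp (\<nu> * (2 * \<tau>max))" using \<nu> \<tau>max by simp_all
  have C: "1 \<le> (gain + 1) * exp (\<nu> * \<tau>max)" using mult_mono[of 1 "gain + 1" 1 "exp (\<nu> * \<tau>max)"] gain(1) one by simp
  have C': "1 \<le> 4 * bv_gain * exp (\<nu> * (2 * \<tau>max))" using mult_mono[of 1 "4 * bv_gain" 1 "exp (\<nu> * (2 * \<tau>max))"] bv_gain one by simp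
  show ?thesis
  proof (cases V)
    case (Lp p)
    show ?thesis
    proof (cases "p = \<infinity>")
      case True
      then show ?thesis using decay_Linf C Lp by blast
    next
      case False
      then obtain r where "p = ereal r" "1 \<le> r" using V Lp by (cases p) (auto simp: valid_state_space_def)
      then show ?thesis using decay_Lp[of r] C Lp by blast
    qed
  next
    case B_inf
    then show ?thesis using decay_B_inf C by blast
  next
    case BV
    then show ?thesis using decay_BV C' by blast
  qed
qed

theorem theorem6:
  fixes V :: state_space
    and \<tau>max :: real
    and A :: "nat \<Rightarrow> real ^ 'n ^ 'n"
    and \<tau> :: "nat \<Rightarrow> real"
    and N :: "real \<Rightarrow> real ^ 'n ^ 'n"
  assumes "valid_state_space V"
    and "0 < \<tau>max"
    and "summable (\<lambda>k. norm (A k))"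
    and "strict_mono \<tau>"
    and "\<And>k. \<tau> k \<in> {0<..\<tau>max}"
    and "N absolutely_integrable_on {0<..<\<tau>max}"
  shows "(exponentially_stable V \<tau>max A \<tau> N \<longleftrightarrow>
            (\<exists>\<nu>0>0. \<forall>z. det (char_matrix \<tau>max A \<tau> N z) = 0 \<longrightarrow> Re z < - \<nu>0)) \<and>
         (\<forall>\<nu>0>0. (\<forall>z. det (char_matrix \<tau>max A \<tau> N z) = 0 \<longrightarrow> Re z < - \<nu>0) \<longrightarrow>
            (\<forall>\<nu>. 0 < \<nu> \<and> \<nu> < \<nu>0 \<longrightarrow> (\<exists>C\<ge>1. decay_estimate V \<tau>max A \<tau> N \<nu> C)))"
proof -
  interpret delay_equation \<tau>max A \<tau> N
    using assms by unfold_locales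
  note V = assms(1)
  have decay: "\<exists>C\<ge>1. decay_estimate V \<tau>max A \<tau> N \<nu> C"
    if "\<forall>z. det (char_matrix \<tau>max A \<tau> N z) = 0 \<longrightarrow> Re z < - \<nu>0" "0 < \<nu>" "\<nu> < \<nu>0" for \<nu>0 \<nu>
    using zero_free_half_plane_imp_decay[OF V, of \<nu>0 \<nu>] that by blast
  have "exponentially_stable V \<tau>max A \<tau> N \<longleftrightarrow> (\<exists>\<nu>0>0. \<forall>z. det (char_matrix \<tau>max A \<tau> N z) = 0 \<longrightarrow> Re z < - \<nu>0)"
  proof
    assume "exponentially_stable V \<tau>max A \<tau> N"
    then obtain \<nu> C where \<nu>: "0 < \<nu>" "decay_estimate V \<tau>max A \<tau> N \<nu> C" unfolding exponentially_stable_def by blast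
    have "Re z < - (\<nu> / 2)" if "det (char_matrix \<tau>max A \<tau> N z) = 0" for z
      using decay_rate_bounds_zeros[OF V \<nu>(2) that] \<nu>(1) by linarith
    then show "\<exists>\<nu>0>0. \<forall>z. det (char_matrix \<tau>max A \<tau> N z) = 0 \<longrightarrow> Re z < - \<nu>0"
      using \<nu>(1) by (intro exI[of _ "\<nu> / 2"]) simp
  next
    assume "\<exists>\<nu>0>0. \<forall>z. det (char_matrix \<tau>max A \<tau> N z) = 0 \<longrightarrow> Re z < - \<nu>0"
    then obtain \<nu>0 where \<nu>0: "0 < \<nu>0" "\<forall>z. det (char_matrix \<tau>max A \<tau> N z) = 0 \<longrightarrow> Re z < - \<nu>0" by blast
    have "\<exists>C\<ge>1. decay_estimate V \<tau>max A \<tau> N (\<nu>0 / 2) C" by (rule decay[OF \<nu>0(2)]) (use \<nu>0(1) in auto)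
    moreover have "0 < \<nu>0 / 2" using \<nu>0(1) by simp
    ultimately show "exponentially_stable V \<tau>max A \<tau> N" unfolding exponentially_stable_def by blast
  qed
  then show ?thesis using decay by blast
qed

end
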